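(* Let $\dim V\le 2$ and let $K$ be a cone in $V$ with vertex at $0$ (a rational polyhedral cone with apex $0$). Let $\Psi$ be the complement map on $V^*$ induced by an inner product on $V^*$ or by a complete flag in $V^*$, let $\Psi^*$ be the corresponding complement map on $V$ (induced by the dual inner product, resp. the dual flag), and assume $K$ is $\Psi$-generic. Then $$\nu^{\Psi}(K)(0)=\mu^{\Psi^*}(K^{\vee})(0),$$ where $K^\vee=\{w\in V^*:\langle w,v\rangle\ge0\ \text{for all }v\in K\}$ is the dual cone.
   Context: Basic setting. $\Lambda\cong\mathbb Z^n$ is a lattice, $V=\Lambda\otimes_{\mathbb Z}\mathbb Q$, $V^*=\mathrm{Hom}_{\mathbb Q}(V,\mathbb Q)$ with pairing $\langle\cdot,\cdot\rangle$ and dual lattice $\Lambda^*=\{w:\langle w,v\rangle\in\mathbb Z\ \forall v\in\Lambda\}$. All notions below are applied both to $(V,\Lambda)$ and to $(V^*,\Lambda^* )$, with $V^{**}=V$. $\mathcal M(V^* )$ is the algebra of meromorphic functions on $V^*_{\mathbb C}=V^*\otimes\mathbb C$. A rational quotient $W$ of $V$ carries the image lattice, and $W^*$ is regarded as a subspace of $V^*$. Polyhedra are nonempty subsets of $V$ cut out by finitely many affine inequalities with rational coefficients; a cone is a polyhedron $s+C$ with $s\in V$ and $C$ a rational polyhedral convex cone with apex $0$. A lattice cone is a cone whose largest affine subspace contains a point of $\Lambda$; a lattice polyhedron is a polyhedron whose vertices lie in $\Lambda$ (if it has no vertices: whose minimal faces contain points of $\Lambda$). $\mathcal F(P)$ is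 the set of nonempty faces of $P$ (including $P$). $\mathrm{lin}(F)$ is the linear subspace parallel to the affine span $\mathrm{aff}(F)$. For a face $F$ of $P$ and $x$ in the relative interior of $F$, $\mathrm{Tan}(P,F)=\{v\in V: x+\epsilon v\in P\text{ for small }\epsilon>0\}$ and $\mathrm{Supp}(P,F)=x+\mathrm{Tan}(P,F)$. Integrals over $P$ are over the corresponding real polyhedron, with respect to Lebesgue measure on $\mathrm{aff}(P)$ normalized so that a basis of $\Lambda\cap \mathrm{lin}(P)$ spans a parallelepiped of volume $1$ (unit mass for a point). Exponential sums and integrals. For a polyhedron $P$, $S(P),I(P)\in\mathcal M(V^* )$ are the functions (which exist by a theorem of Lawrence) determined by: $S(P)=I(P)=0$ if $P$ contains a line; otherwise $S(P)(\xi)=\sum_{x\in P\cap\Lambda}e^{\langle\xi,x\rangle}$ and $I(P)(\xi)=\int_P e^{\langle\xi,x\rangle}dx$ for all $\xi$ for which the sum (resp. integral) converges absolutely. $S^0(P)=S(P^0)$ is the analogous function for the relative interior $P^0$; i.e. $S^0(P)=\sum_{F\in\mathcal F(P)}(-1)^{\dim P-\dim F}S(F)$. Rigid complement maps. A rigid complement map $\Psi$ on $V^*$ is a map from a collection $\mathcal L^\Psi$ of linear subspaces of $V^*$ to the set of linear subspaces of $V^*$ such that (a) $V^*=U\oplus\Psi(U)$ for $U\in\mathcal L^\Psi$; (b) if $U_1\subset U_2$ are in $\mathcal L^\Psi$ then $\Psi(U_2)\subset\Psi(U_1)$. An inner product $Q$ on $V^*$ induces $\Psi(U)=U^\perp$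 with $\mathcal L^\Psi$ all subspaces. A complete flag $L=(0=L_0\subset\dots\subset L_n=V^* )$ induces $\Psi(U)=L_{n-\dim U}$, with $\mathcal L^\Psi$ the subspaces $U$ complementary to $L_{n-\dim U}$. The dual flag in $V$ consists of the annihilators of the $L_i$. Genericity. A quotient $W$ of $V$ is $\Psi$-generic if $W^*\in\mathcal L^\Psi$; a subspace $U\subset V$ is $\Psi$-generic if $V/U$ is; a cone $K$ is $\Psi$-generic if $\mathrm{lin}(F)$ is $\Psi$-generic for every face $F$ of $K$; a polyhedron $P$ is $\Psi$-generic if every $\mathrm{Supp}(P,F)$ is. $\mathcal C^\Psi(V)$ is the set of $\Psi$-generic cones of $V$. If $W$ is a $\Psi$-generic quotient, $\bar\Psi$ denotes the induced complement map on $W^*$: $\bar\Psi(U)=\Psi(U)\cap W^*$ for $U\in\mathcal L^\Psi$, $U\subset W^*$ with $\Psi(U)\cap W^*$ complementary to $U$ in $W^*$; and $\pi_W:V^*\to W^*$ is the projection with kernel $\Psi(W^* )$. Compatible interpolators. $\mu^\Psi$ is the unique $\Psi$-compatible ($\mathrm{SI}$-)interpolator: the unique map $\mu:\mathcal C^\Psi(V)\to\mathcal M(V^* )$ such that (i) $S(P)=\sum_{F\in\mathcal F(P)}\mu(\mathrm{Supp}(P,F))\,I(F)$ for all $\Psi$-generic polyhedra $P$ in $V$; (ii) for every $\Psi$-generic quotient $q:V\to W$, the map $\bar\mu(K)=\mu(q^{-1}(K))|_{W^*}$, $K\in\mathcal C^{\bar\Psi}(W)$, satisfies the same identity for all $\bar\Psi$-generic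 polyhedra in $W$; (iii) $\mu(q^{-1}(K))=\bar\mu(K)\circ\pi_W$ for all such $W$, $K$. $\nu^\Psi$ is the unique $\Psi$-compatible $\mathrm{IS}^0$-interpolator: the unique map $\nu$ from $\Psi$-generic lattice cones of $V$ to $\mathcal M(V^* )$ satisfying (i)–(iii) with the identity replaced by $I(P)=\sum_{F\in\mathcal F(P)}\nu(\mathrm{Supp}(P,F))\,S^0(F)$, polyhedra replaced by lattice polyhedra, and cones by lattice cones. All values of $\mu^\Psi$ and $\nu^\Psi$ are analytic at $\xi=0$. *)

theory Defs
  imports "HOL-Analysis.Analysis" "Jordan_Normal_Form.VS_Connect"
begin

unbundle no inner_syntax
unbundle no vec_syntax

text \<open>
  After a choice of lattice basis, V is the space of rational vectors of dimension n, the lattice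
  is the set of integral vectors, and the dual space, with the dual lattice, is identified with
  the same data through the standard pairing. Every notion below therefore applies verbatim to
  V and to its dual. The dimension n may be 0.
\<close>

definition int_lattice :: "nat \<Rightarrow> 'a::ring_1 vec set" where
  "int_lattice n = {x \<in> carrier_vec n. \<forall>i<n. x $ i \<in> \<int>}"

abbreviation is_subspace :: "nat \<Rightarrow> rat vec set \<Rightarrow> bool" where
  "is_subspace n U \<equiv> VectorSpace.subspace class_ring U (module_vec TYPE(rat) n)"

definition sdim :: "nat \<Rightarrow> rat vec set \<Rightarrow> nat" where
  "sdim n U = vectorspace.dim class_ring ((module_vec TYPE(rat) n)\<lparr>carrier := U\<rparr>)"

definition annihilator :: "nat \<Rightarrow> rat vec set \<Rightarrow> rat vec set" where
  "annihilator n U = {w \<in> carrier_vec n. \<forall>u\<in>U. w \<bullet> u = 0}"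

definition direct_sum :: "nat \<Rightarrow> rat vec set \<Rightarrow> rat vec set \<Rightarrow> rat vec set \<Rightarrow> bool" where
  "direct_sum n X U W \<longleftrightarrow> X = {u + w | u w. u \<in> U \<and> w \<in> W} \<and> U \<inter> W = {0\<^sub>v n}"

definition lin :: "nat \<Rightarrow> rat vec set \<Rightarrow> rat vec set" where
  "lin n F = LinearCombinations.module.span class_ring (module_vec TYPE(rat) n)
               {x - y | x y. x \<in> F \<and> y \<in> F}"

definition aff :: "nat \<Rightarrow> rat vec set \<Rightarrow> rat vec set" where
  "aff n F = {x + u | x u. x \<in> F \<and> u \<in> lin n F}"

definition translate :: "rat vec \<Rightarrow> rat vec set \<Rightarrow> rat vec set" where
  "translate s C = (\<lambda>x. s + x) ` C"

definition polyhedron :: "nat \<Rightarrow> rat vec set \<Rightarrow> bool" where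
  "polyhedron n P \<longleftrightarrow> P \<noteq> {} \<and>
     (\<exists>k. \<exists>A\<in>carrier_mat k n. \<exists>b\<in>carrier_vec k. P = {x \<in> carrier_vec n. A *\<^sub>v x \<le> b})"

definition polyhedral_cone :: "nat \<Rightarrow> rat vec set \<Rightarrow> bool" where
  "polyhedral_cone n C \<longleftrightarrow>
     (\<exists>k. \<exists>A\<in>carrier_mat k n. C = {x \<in> carrier_vec n. A *\<^sub>v x \<le> 0\<^sub>v k})"

definition affine_cone :: "nat \<Rightarrow> rat vec set \<Rightarrow> bool" where
  "affine_cone n K \<longleftrightarrow>
     (\<exists>s\<in>carrier_vec n. \<exists>C. polyhedral_cone n C \<and> K = translate s C)"

definition dual_cone :: "nat \<Rightarrow> rat vec set \<Rightarrow> rat vec set" where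
  "dual_cone n K = {w \<in> carrier_vec n. \<forall>v\<in>K. 0 \<le> w \<bullet> v}"

definition faces :: "nat \<Rightarrow> rat vec set \<Rightarrow> rat vec set set" where
  "faces n P = {F. F \<noteq> {} \<and>
     (\<exists>a\<in>carrier_vec n. \<exists>b. (\<forall>x\<in>P. a \<bullet> x \<le> b) \<and> F = {x \<in> P. a \<bullet> x = b})}"

definition rel_interior_vec :: "nat \<Rightarrow> rat vec set \<Rightarrow> rat vec set" where
  "rel_interior_vec n F = {x \<in> F. \<exists>e>0. \<forall>y\<in>aff n F. (\<forall>i<n. \<bar>y $ i - x $ i\<bar> < e) \<longrightarrow> y \<in> F}"

text \<open>The two cones below do not depend on the chosen relative interior point of the face.\<close>

definition tangent_cone :: "nat \<Rightarrow> rat vec set \<Rightarrow> rat vec \<Rightarrow> rat vec set" where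
  "tangent_cone n P x = {v \<in> carrier_vec n. \<exists>d>0. \<forall>e. 0 < e \<and> e < d \<longrightarrow> x + e \<cdot>\<^sub>v v \<in> P}"

definition Supp :: "nat \<Rightarrow> rat vec set \<Rightarrow> rat vec set \<Rightarrow> rat vec set" where
  "Supp n P F = (let x = (SOME x. x \<in> rel_interior_vec n F) in translate x (tangent_cone n P x))"

text \<open>The largest affine subspace of the cone \<open>s + C\<close> is \<open>s + (C \<inter> -C)\<close>.\<close>

definition lattice_cone :: "nat \<Rightarrow> rat vec set \<Rightarrow> bool" where
  "lattice_cone n K \<longleftrightarrow>
     (\<exists>s\<in>carrier_vec n. \<exists>C. polyhedral_cone n C \<and> K = translate s C \<and>
        translate s {v \<in> C. - v \<in> C} \<inter> int_lattice n \<noteq> {})"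

text \<open>When a polyhedron has vertices, its minimal faces are exactly the vertices.\<close>

definition lattice_polyhedron :: "nat \<Rightarrow> rat vec set \<Rightarrow> bool" where
  "lattice_polyhedron n P \<longleftrightarrow> polyhedron n P \<and>
     (\<forall>F\<in>faces n P. (\<forall>G\<in>faces n P. G \<subseteq> F \<longrightarrow> G = F) \<longrightarrow> F \<inter> int_lattice n \<noteq> {})"

definition contains_line :: "nat \<Rightarrow> rat vec set \<Rightarrow> bool" where
  "contains_line n P \<longleftrightarrow>
     (\<exists>x\<in>P. \<exists>v\<in>carrier_vec n. v \<noteq> 0\<^sub>v n \<and> (\<forall>t. x + t \<cdot>\<^sub>v v \<in> P))"

definition polydisc :: "complex vec \<Rightarrow> real \<Rightarrow> complex vec set" where
  "polydisc z r = {w \<in> carrier_vec (dim_vec z). \<forall>i<dim_vec z. cmod (w $ i - z $ i) < r}"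

text \<open>Complex (Frechet) differentiability at every point; the set is meant to be open.\<close>

definition holomorphic_cn :: "nat \<Rightarrow> (complex vec \<Rightarrow> complex) \<Rightarrow> complex vec set \<Rightarrow> bool" where
  "holomorphic_cn n f U \<longleftrightarrow>
     (\<forall>z\<in>U. \<exists>a\<in>carrier_vec n. \<forall>e>0. \<exists>d>0. \<forall>w\<in>polydisc z d.
        cmod (f w - f z - a \<bullet> (w - z)) \<le> e * (\<Sum>i<n. cmod (w $ i - z $ i)))"

text \<open>
  A meromorphic function is represented by an honest function that is locally a quotient g / h
  wherever h does not vanish. Representatives may take arbitrary values on the remaining nowhere
  dense set, so equality in the algebra of meromorphic functions is the relation
  \<open>mero_eq\<close> (agreement on a dense open set), and the value at a point of
  analyticity is \<open>mero_value\<close>, the value of the holomorphic extension.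
\<close>

definition meromorphic_cn :: "nat \<Rightarrow> (complex vec \<Rightarrow> complex) set" where
  "meromorphic_cn n = {f. \<forall>z\<in>carrier_vec n. \<exists>r>0. \<exists>g h.
     holomorphic_cn n g (polydisc z r) \<and> holomorphic_cn n h (polydisc z r) \<and>
     (\<exists>w\<in>polydisc z r. h w \<noteq> 0) \<and>
     (\<forall>w\<in>polydisc z r. h w \<noteq> 0 \<longrightarrow> f w = g w / h w)}"

definition agree_generically ::
  "complex vec set \<Rightarrow> (complex vec \<Rightarrow> complex) \<Rightarrow> (complex vec \<Rightarrow> complex) \<Rightarrow> bool" where
  "agree_generically U f g \<longleftrightarrow>
     (\<forall>w\<in>U. \<forall>s>0. \<exists>u. \<exists>t>0. polydisc u t \<subseteq> polydisc w s \<inter> U \<and> (\<forall>v\<in>polydisc u t. f v = g v))"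

definition mero_eq ::
  "nat \<Rightarrow> (complex vec \<Rightarrow> complex) \<Rightarrow> (complex vec \<Rightarrow> complex) \<Rightarrow> bool" where
  "mero_eq n f g \<longleftrightarrow> agree_generically (carrier_vec n) f g"

definition has_value :: "nat \<Rightarrow> (complex vec \<Rightarrow> complex) \<Rightarrow> complex vec \<Rightarrow> complex \<Rightarrow> bool" where
  "has_value n f z c \<longleftrightarrow>
     (\<exists>r>0. \<exists>e. holomorphic_cn n e (polydisc z r) \<and>
        agree_generically (polydisc z r) f e \<and> e z = c)"

definition mero_analytic_at :: "nat \<Rightarrow> (complex vec \<Rightarrow> complex) \<Rightarrow> complex vec \<Rightarrow> bool" where
  "mero_analytic_at n f z \<longleftrightarrow> (\<exists>c. has_value n f z c)"

definition mero_value :: "nat \<Rightarrow> (complex vec \<Rightarrow> complex) \<Rightarrow> complex vec \<Rightarrow> complex" where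
  "mero_value n f z = (if mero_analytic_at n f z then THE c. has_value n f z c else 0)"

definition exp_pair :: "complex vec \<Rightarrow> complex vec \<Rightarrow> complex" where
  "exp_pair \<xi> x = exp (\<xi> \<bullet> x)"

definition is_exp_sum :: "nat \<Rightarrow> rat vec set \<Rightarrow> (complex vec \<Rightarrow> complex) \<Rightarrow> bool" where
  "is_exp_sum n A f \<longleftrightarrow> f \<in> meromorphic_cn n \<and>
     (if contains_line n A then mero_eq n f (\<lambda>_. 0)
      else \<forall>\<xi>\<in>carrier_vec n.
        (\<lambda>x. norm (exp_pair \<xi> (map_vec of_rat x))) summable_on (A \<inter> int_lattice n) \<longrightarrow>
        has_value n f \<xi> (\<Sum>\<^sub>\<infinity>x\<in>A \<inter> int_lattice n. exp_pair \<xi> (map_vec of_rat x)))"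

text \<open>By uniqueness of analytic continuation, \<open>is_exp_sum\<close> and \<open>is_exp_integral\<close> determine the
  function up to \<open>mero_eq\<close>; an arbitrary representative is chosen.\<close>

definition exp_sum :: "nat \<Rightarrow> rat vec set \<Rightarrow> complex vec \<Rightarrow> complex" where
  "exp_sum n A = (SOME f. is_exp_sum n A f)"

definition exp_sum0 :: "nat \<Rightarrow> rat vec set \<Rightarrow> complex vec \<Rightarrow> complex" where
  "exp_sum0 n P = exp_sum n (rel_interior_vec n P)"

text \<open>The real polyhedron cut out by all rational inequalities valid on P.\<close>

definition real_polyhedron :: "nat \<Rightarrow> rat vec set \<Rightarrow> real vec set" where
  "real_polyhedron n P = {x \<in> carrier_vec n. \<forall>a\<in>carrier_vec n. \<forall>b.
     (\<forall>y\<in>P. a \<bullet> y \<le> b) \<longrightarrow> map_vec of_rat a \<bullet> x \<le> of_rat b}"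

text \<open>The columns of B form a basis of the lattice points of the subspace U.\<close>

definition lattice_basis :: "nat \<Rightarrow> rat vec set \<Rightarrow> nat \<Rightarrow> rat mat \<Rightarrow> bool" where
  "lattice_basis n U d B \<longleftrightarrow> B \<in> carrier_mat n d \<and>
     bij_betw (\<lambda>c. B *\<^sub>v c) (int_lattice d) (U \<inter> int_lattice n)"

text \<open>
  The normalized Lebesgue measure on the affine span of P is the image of Lebesgue measure on
  real d-space under \<open>aff_param\<close>, for any point \<open>x\<^sub>0\<close> of P and any lattice basis B
  of \<open>lin n P\<close>. For d = 0 this is the unit point mass.
\<close>

definition aff_param :: "rat vec \<Rightarrow> rat mat \<Rightarrow> nat \<Rightarrow> (nat \<Rightarrow> real) \<Rightarrow> real vec" where
  "aff_param x\<^sub>0 B d t = map_vec of_rat x\<^sub>0 + map_mat of_rat B *\<^sub>v vec d t"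

definition is_exp_integral :: "nat \<Rightarrow> rat vec set \<Rightarrow> (complex vec \<Rightarrow> complex) \<Rightarrow> bool" where
  "is_exp_integral n P f \<longleftrightarrow> f \<in> meromorphic_cn n \<and>
     (if contains_line n P then mero_eq n f (\<lambda>_. 0)
      else \<forall>x\<^sub>0\<in>P. \<forall>d B. lattice_basis n (lin n P) d B \<longrightarrow>
        (let M = (\<Pi>\<^sub>M i\<in>{..<d}. (lborel :: real measure));
             D = {t \<in> space M. aff_param x\<^sub>0 B d t \<in> real_polyhedron n P};
             g = (\<lambda>\<xi> t. exp_pair \<xi> (map_vec complex_of_real (aff_param x\<^sub>0 B d t)))
         in \<forall>\<xi>\<in>carrier_vec n.
              set_integrable M D (g \<xi>) \<longrightarrow> has_value n f \<xi> (set_lebesgue_integral M D (g \<xi>))))"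

definition exp_integral :: "nat \<Rightarrow> rat vec set \<Rightarrow> complex vec \<Rightarrow> complex" where
  "exp_integral n P = (SOME f. is_exp_integral n P f)"

text \<open>A complement map is a partial map on sets of vectors; its domain is the collection of
  subspaces on which the map is defined.\<close>

type_synonym complement_map = "rat vec set \<rightharpoonup> rat vec set"

definition inner_product :: "nat \<Rightarrow> (rat vec \<Rightarrow> rat vec \<Rightarrow> rat) \<Rightarrow> bool" where
  "inner_product n Q \<longleftrightarrow>
     (\<forall>u\<in>carrier_vec n. \<forall>v\<in>carrier_vec n. Q u v = Q v u) \<and>
     (\<forall>u\<in>carrier_vec n. \<forall>v\<in>carrier_vec n. \<forall>w\<in>carrier_vec n. Q (u + v) w = Q u w + Q v w) \<and>
     (\<forall>c. \<forall>u\<in>carrier_vec n. \<forall>v\<in>carrier_vec n. Q (c \<cdot>\<^sub>v u) v = c * Q u v) \<and>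
     (\<forall>u\<in>carrier_vec n. u \<noteq> 0\<^sub>v n \<longrightarrow> 0 < Q u u)"

definition riesz :: "nat \<Rightarrow> (rat vec \<Rightarrow> rat vec \<Rightarrow> rat) \<Rightarrow> rat vec \<Rightarrow> rat vec" where
  "riesz n Q v = (THE w. w \<in> carrier_vec n \<and> (\<forall>u\<in>carrier_vec n. Q w u = u \<bullet> v))"

definition dual_inner_product ::
  "nat \<Rightarrow> (rat vec \<Rightarrow> rat vec \<Rightarrow> rat) \<Rightarrow> rat vec \<Rightarrow> rat vec \<Rightarrow> rat" where
  "dual_inner_product n Q v v' = Q (riesz n Q v) (riesz n Q v')"

definition orthogonal_map :: "nat \<Rightarrow> (rat vec \<Rightarrow> rat vec \<Rightarrow> rat) \<Rightarrow> complement_map" where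
  "orthogonal_map n Q U =
     (if is_subspace n U then Some {w \<in> carrier_vec n. \<forall>u\<in>U. Q u w = 0} else None)"

definition complete_flag :: "nat \<Rightarrow> (nat \<Rightarrow> rat vec set) \<Rightarrow> bool" where
  "complete_flag n L \<longleftrightarrow> (\<forall>i\<le>n. is_subspace n (L i) \<and> sdim n (L i) = i) \<and> (\<forall>i<n. L i \<subseteq> L (Suc i))"

definition dual_flag :: "nat \<Rightarrow> (nat \<Rightarrow> rat vec set) \<Rightarrow> nat \<Rightarrow> rat vec set" where
  "dual_flag n L i = annihilator n (L (n - i))"

definition flag_map :: "nat \<Rightarrow> (nat \<Rightarrow> rat vec set) \<Rightarrow> complement_map" where
  "flag_map n L U =
     (if is_subspace n U \<and> direct_sum n (carrier_vec n) U (L (n - sdim n U))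
      then Some (L (n - sdim n U)) else None)"

text \<open>The dual of the quotient by U is the annihilator of U.\<close>

definition generic_subspace :: "nat \<Rightarrow> complement_map \<Rightarrow> rat vec set \<Rightarrow> bool" where
  "generic_subspace n \<Psi> U \<longleftrightarrow> annihilator n U \<in> dom \<Psi>"

definition generic_cone :: "nat \<Rightarrow> complement_map \<Rightarrow> rat vec set \<Rightarrow> bool" where
  "generic_cone n \<Psi> K \<longleftrightarrow> (\<forall>F\<in>faces n K. generic_subspace n \<Psi> (lin n F))"

definition generic_polyhedron :: "nat \<Rightarrow> complement_map \<Rightarrow> rat vec set \<Rightarrow> bool" where
  "generic_polyhedron n \<Psi> P \<longleftrightarrow> (\<forall>F\<in>faces n P. generic_cone n \<Psi> (Supp n P F))"

text \<open>
  A rational quotient of dimension m, with its image lattice, is presented by a matrix that maps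
  the integral vectors onto the integral vectors; this makes the matrix integral and the map
  surjective. The transpose embeds the dual of the quotient.
\<close>

definition lattice_quotient :: "nat \<Rightarrow> nat \<Rightarrow> rat mat \<Rightarrow> bool" where
  "lattice_quotient n m q \<longleftrightarrow> q \<in> carrier_mat m n \<and> (\<lambda>x. q *\<^sub>v x) ` int_lattice n = int_lattice m"

definition preim :: "nat \<Rightarrow> rat mat \<Rightarrow> rat vec set \<Rightarrow> rat vec set" where
  "preim n q K = {x \<in> carrier_vec n. q *\<^sub>v x \<in> K}"

definition dual_image :: "rat mat \<Rightarrow> rat vec set \<Rightarrow> rat vec set" where
  "dual_image q U = (\<lambda>w. transpose_mat q *\<^sub>v w) ` U"

definition generic_quotient :: "nat \<Rightarrow> complement_map \<Rightarrow> nat \<Rightarrow> rat mat \<Rightarrow> bool" where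
  "generic_quotient n \<Psi> m q \<longleftrightarrow>
     lattice_quotient n m q \<and> dual_image q (carrier_vec m) \<in> dom \<Psi>"

definition induced_map :: "complement_map \<Rightarrow> nat \<Rightarrow> rat mat \<Rightarrow> complement_map" where
  "induced_map \<Psi> m q U =
     (let W = dual_image q (carrier_vec m) in
      if U \<subseteq> carrier_vec m then
        (case \<Psi> (dual_image q U) of
           None \<Rightarrow> None
         | Some X \<Rightarrow>
             if direct_sum (dim_col q) W (dual_image q U) (X \<inter> W)
             then Some {w \<in> carrier_vec m. transpose_mat q *\<^sub>v w \<in> X} else None)
      else None)"

text \<open>The matrix p of the projection onto the dual of the quotient with kernel its
  \<open>\<Psi>\<close>-complement.\<close>

definition is_projection :: "nat \<Rightarrow> complement_map \<Rightarrow> nat \<Rightarrow> rat mat \<Rightarrow> rat mat \<Rightarrow> bool" where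
  "is_projection n \<Psi> m q p \<longleftrightarrow> p \<in> carrier_mat m n \<and> p * transpose_mat q = 1\<^sub>m m \<and>
     {\<xi> \<in> carrier_vec n. p *\<^sub>v \<xi> = 0\<^sub>v m} = the (\<Psi> (dual_image q (carrier_vec m)))"

definition restriction ::
  "nat \<Rightarrow> rat mat \<Rightarrow> (complex vec \<Rightarrow> complex) \<Rightarrow> complex vec \<Rightarrow> complex" where
  "restriction n q f \<eta> = mero_value n f (map_mat of_rat (transpose_mat q) *\<^sub>v \<eta>)"

type_synonym interpolator = "rat vec set \<Rightarrow> complex vec \<Rightarrow> complex"

definition SI_identity :: "nat \<Rightarrow> complement_map \<Rightarrow> interpolator \<Rightarrow> bool" where
  "SI_identity n \<Psi> \<mu> \<longleftrightarrow> (\<forall>P. polyhedron n P \<and> generic_polyhedron n \<Psi> P \<longrightarrow>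
     mero_eq n (exp_sum n P) (\<lambda>\<xi>. \<Sum>F\<in>faces n P. \<mu> (Supp n P F) \<xi> * exp_integral n F \<xi>))"

definition IS0_identity :: "nat \<Rightarrow> complement_map \<Rightarrow> interpolator \<Rightarrow> bool" where
  "IS0_identity n \<Psi> \<nu> \<longleftrightarrow> (\<forall>P. lattice_polyhedron n P \<and> generic_polyhedron n \<Psi> P \<longrightarrow>
     mero_eq n (exp_integral n P) (\<lambda>\<xi>. \<Sum>F\<in>faces n P. \<nu> (Supp n P F) \<xi> * exp_sum0 n F \<xi>))"

text \<open>
  Compatibility with respect to a class of cones and an identity. If \<open>\<mu> (preim n q K)\<close>
  had poles along the whole dual of the quotient, its restriction would be 0 and the last clause
  would fail, so that clause also enforces that the restriction makes sense.
\<close>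

definition compatible_interpolator ::
  "(nat \<Rightarrow> rat vec set \<Rightarrow> bool) \<Rightarrow> (nat \<Rightarrow> complement_map \<Rightarrow> interpolator \<Rightarrow> bool) \<Rightarrow>
   nat \<Rightarrow> complement_map \<Rightarrow> interpolator \<Rightarrow> bool" where
  "compatible_interpolator cone_class identity n \<Psi> \<mu> \<longleftrightarrow>
     (\<forall>K. cone_class n K \<and> generic_cone n \<Psi> K \<longrightarrow> \<mu> K \<in> meromorphic_cn n) \<and>
     identity n \<Psi> \<mu> \<and>
     (\<forall>m q. generic_quotient n \<Psi> m q \<longrightarrow>
       (let \<Psi>' = induced_map \<Psi> m q; \<mu>' = (\<lambda>K. restriction n q (\<mu> (preim n q K))) in
         identity m \<Psi>' \<mu>' \<and>
         (\<forall>K. cone_class m K \<and> generic_cone m \<Psi>' K \<longrightarrow>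
            \<mu>' K \<in> meromorphic_cn m \<and>
            (\<forall>p. is_projection n \<Psi> m q p \<longrightarrow>
               mero_eq n (\<mu> (preim n q K)) (\<lambda>\<xi>. \<mu>' K (map_mat of_rat p *\<^sub>v \<xi>))))))"

definition SI_interpolator :: "nat \<Rightarrow> complement_map \<Rightarrow> interpolator \<Rightarrow> bool" where
  "SI_interpolator = compatible_interpolator affine_cone SI_identity"

definition IS0_interpolator :: "nat \<Rightarrow> complement_map \<Rightarrow> interpolator \<Rightarrow> bool" where
  "IS0_interpolator = compatible_interpolator lattice_cone IS0_identity"

end

theory Submission
  imports Defs "HOL-Complex_Analysis.Conformal_Mappings"
begin

unbundle no inner_syntax and no vec_syntax

text \<open>
  Every rational cone of dimension at most 2 is a coordinate cone of a pair of dual bases v, w with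
  primitive edges v. Near the origin an interpolator is computed recursively: its identity for a
  cone without lines expresses its value through its values at cones that contain lines, and
  compatibility pulls these back from quotients of smaller dimension. On a ray, the sum and the
  integral differ by a function \<open>\<rho>\<close> that is regular at 0, with value 1/2 there. At a cone of
  dimension 2, the poles cancel by the distribution relation for the generating function of the
  Bernoulli polynomials. What remains is a sum over the lattice points of the fundamental
  parallelogram, and a multiple of \<open>\<rho>'(0)\<close> that depends on the complement map.

  The rotation by a right angle identifies the plane with its dual. It takes the fundamental
  parallelogram of a cone to the one of the dual cone by mapping the coordinates (a, b) to
  (1 - b, a), it negates the contribution of the complement map, and \<open>\<rho>'(0)\<close> has opposite signs
  for the two kinds of interpolators. So the two values agree.
\<close>

subsection \<open>Polydiscs and generic statements\<close>

text \<open>Functions are known only up to agreement on a dense open set, and the series and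
  integrals converge only where all edges pair to negative real parts. The origin is merely a limit
  of that region, so each formula is proved generically there, carried to a polydisc about 0 by
  meromorphic continuation, and evaluated at 0 afterwards.

  A complement map enters only through functionals u with u . W = 1 whose kernel is the complement
  of the line through W. Inner products and flags become alike in this form, and duality replaces W
  and u by their rotations.

  One constant has to be balanced. In the identity for \<nu> the sums over the two open edges have a
  regular part of absolute value 1/2 at 0, and each multiplies a half-plane value 1/2; this adds 1/4
  twice. On the lattice side, the corner (1, 1) of the first parallelogram and the origin of the
  dual one have no partner under (a, b) to (1 - b, a). Each contributes 1/4 to its sum of (a - 1/2)
  (b - 1/2), while the matched points cancel.\<close>

lemma polydisc_iff:
  "w \<in> polydisc z r \<longleftrightarrow> dim_vec w = dim_vec z \<and> (\<forall>i<dim_vec z. cmod (w $ i - z $ i) < r)"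
  unfolding polydisc_def mem_Collect_eq carrier_dim_vec by (rule refl)

lemma polydisc_center [simp]: "0 < r \<Longrightarrow> z \<in> polydisc z r"
  by (simp add: polydisc_iff)

lemma polydisc_carrier: "w \<in> polydisc z r \<Longrightarrow> z \<in> carrier_vec n \<Longrightarrow> w \<in> carrier_vec n"
  unfolding polydisc_iff carrier_dim_vec by metis

lemma polydisc_mono: "r \<le> s \<Longrightarrow> polydisc z r \<subseteq> polydisc z s"
  by (fastforce simp: polydisc_iff)

definition open_cn :: "complex vec set \<Rightarrow> bool" where
  "open_cn U \<longleftrightarrow> (\<forall>w\<in>U. \<exists>s>0. polydisc w s \<subseteq> U)"

lemma open_cnE:
  assumes "open_cn U" "w \<in> U" "0 < r"
  obtains s where "0 < s" "s \<le> r" "polydisc w s \<subseteq> U"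
proof -
  from assms obtain s where s: "s > 0" "polydisc w s \<subseteq> U" by (auto simp: open_cn_def)
  show ?thesis
    by (rule that[of "min s r"]) (use s assms(3) polydisc_mono[of "min s r" s w] in auto)
qed

lemma open_cn_Int: "open_cn U \<Longrightarrow> open_cn V \<Longrightarrow> open_cn (U \<inter> V)"
proof (unfold open_cn_def, safe)
  fix w assume *: "\<forall>w\<in>U. \<exists>s>0. polydisc w s \<subseteq> U" "\<forall>w\<in>V. \<exists>s>0. polydisc w s \<subseteq> V" "w \<in> U" "w \<in> V"
  then obtain s t where "s > 0" "polydisc w s \<subseteq> U" "t > 0" "polydisc w t \<subseteq> V" by blast
  then have "min s t > 0" "polydisc w (min s t) \<subseteq> U \<inter> V"
    using polydisc_mono[of "min s t" s w] polydisc_mono[of "min s t" t w] by auto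
  then show "\<exists>s>0. polydisc w s \<subseteq> U \<inter> V" by blast
qed

lemma open_cn_polydisc: "open_cn (polydisc z r)"
proof (unfold open_cn_def, intro ballI)
  fix w assume w: "w \<in> polydisc z r"
  define D where "D = insert 1 ((\<lambda>i. r - cmod (w $ i - z $ i)) ` {..<dim_vec z})"
  have D: "finite D" "D \<noteq> {}" by (auto simp: D_def)
  have "Min D > 0" using D w by (auto simp: D_def polydisc_iff)
  moreover have "polydisc w (Min D) \<subseteq> polydisc z r"
  proof
    fix v assume v: "v \<in> polydisc w (Min D)"
    show "v \<in> polydisc z r"
      unfolding polydisc_iff
    proof (intro conjI allI impI)
      show "dim_vec v = dim_vec z" using v w by (simp add: polydisc_iff)
      fix i assume i: "i < dim_vec z"
      have "cmod (v $ i - w $ i) < Min D" using v w i by (simp add: polydisc_iff)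
      also have "Min D \<le> r - cmod (w $ i - z $ i)" using D i by (intro Min_le) (auto simp: D_def)
      finally show "cmod (v $ i - z $ i) < r"
        using norm_triangle_ineq[of "v $ i - w $ i" "w $ i - z $ i"] by simp
    qed
  qed
  ultimately show "\<exists>s>0. polydisc w s \<subseteq> polydisc z r" by blast
qed

lemma open_cn_carrier: "open_cn (carrier_vec n)"
  unfolding open_cn_def by (auto intro: exI[of _ 1] polydisc_carrier)

text \<open>Truth on a subset of U whose interior is dense in U. Density is phrased through small
  polydiscs; in this form the notion is stable under conjunction and under passing to open subsets,
  so identities between arbitrary representatives can be combined pointwise.\<close>

definition generically :: "complex vec set \<Rightarrow> (complex vec \<Rightarrow> bool) \<Rightarrow> bool" where
  "generically U P \<longleftrightarrow>
     (\<forall>w\<in>U. \<forall>s>0. \<exists>u. \<exists>t>0. polydisc u t \<subseteq> polydisc w s \<inter> U \<and> (\<forall>v\<in>polydisc u t. P v))"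

lemma agree_generically_iff: "agree_generically U f g \<longleftrightarrow> generically U (\<lambda>v. f v = g v)"
  by (simp add: agree_generically_def generically_def)

lemma genericallyE:
  assumes "generically U P" "w \<in> U" "0 < s"
  obtains u t where "0 < t" "polydisc u t \<subseteq> polydisc w s" "polydisc u t \<subseteq> U" "\<And>v. v \<in> polydisc u t \<Longrightarrow> P v"
  using assms unfolding generically_def by (metis Int_subset_iff)

lemma generically_conj:
  assumes "generically U P" "generically U Q"
  shows "generically U (\<lambda>v. P v \<and> Q v)"
  unfolding generically_def
proof (intro ballI allI impI)
  fix w and s :: real assume w: "w \<in> U" "s > 0"
  obtain u t where u: "t > 0" "polydisc u t \<subseteq> polydisc w s \<inter> U" "\<forall>v\<in>polydisc u t. P v"
    using assms(1) w unfolding generically_def by blast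
  have "u \<in> U" using u by force
  then obtain u' t' where "t' > 0" "polydisc u' t' \<subseteq> polydisc u t \<inter> U" "\<forall>v\<in>polydisc u' t'. Q v"
    using assms(2) u unfolding generically_def by blast
  then show "\<exists>u. \<exists>t>0. polydisc u t \<subseteq> polydisc w s \<inter> U \<and> (\<forall>v\<in>polydisc u t. P v \<and> Q v)"
    using u by (intro exI[of _ u'] exI[of _ t']) blast
qed

lemma generically_mono:
  assumes "generically U P" "\<And>v. v \<in> U \<Longrightarrow> P v \<Longrightarrow> Q v"
  shows "generically U Q"
  unfolding generically_def
proof (intro ballI allI impI)
  fix w and s :: real assume "w \<in> U" "s > 0"
  then obtain u t where u: "t > 0" "polydisc u t \<subseteq> polydisc w s \<inter> U" "\<forall>v\<in>polydisc u t. P v"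
    using assms(1) unfolding generically_def by blast
  then have "\<forall>v\<in>polydisc u t. Q v" using assms(2) by blast
  with u show "\<exists>u. \<exists>t>0. polydisc u t \<subseteq> polydisc w s \<inter> U \<and> (\<forall>v\<in>polydisc u t. Q v)" by blast
qed

lemma generically_all:
  assumes "open_cn U" "\<And>v. v \<in> U \<Longrightarrow> P v"
  shows "generically U P"
  unfolding generically_def
proof (intro ballI allI impI)
  fix w and s :: real assume w: "w \<in> U" "s > 0"
  obtain t where t: "0 < t" "t \<le> s" "polydisc w t \<subseteq> U" using open_cnE[OF assms(1) w] .
  have "polydisc w t \<subseteq> polydisc w s \<inter> U" "\<forall>v\<in>polydisc w t. P v"
    using polydisc_mono[OF t(2)] t(3) assms(2) by auto
  with t(1) show "\<exists>u. \<exists>t>0. polydisc u t \<subseteq> polydisc w s \<inter> U \<and> (\<forall>v\<in>polydisc u t. P v)" by blast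
qed

lemma generically_subset:
  assumes "generically U P" "V \<subseteq> U" "open_cn V"
  shows "generically V P"
  unfolding generically_def
proof (intro ballI allI impI)
  fix w and s :: real assume w: "w \<in> V" "s > 0"
  obtain s' where s': "0 < s'" "s' \<le> s" "polydisc w s' \<subseteq> V" using open_cnE[OF assms(3) w] .
  obtain u t where u: "t > 0" "polydisc u t \<subseteq> polydisc w s'" "polydisc u t \<subseteq> U" "\<And>v. v \<in> polydisc u t \<Longrightarrow> P v"
    using genericallyE[OF assms(1) subsetD[OF assms(2) w(1)] s'(1)] by metis
  then show "\<exists>u. \<exists>t>0. polydisc u t \<subseteq> polydisc w s \<inter> V \<and> (\<forall>v\<in>polydisc u t. P v)"
    using s' polydisc_mono[of s' s w] by (intro exI[of _ u] exI[of _ t]) blast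
qed

subsection \<open>Holomorphic functions of several variables\<close>

text \<open>The gradient is made explicit, whereas \<open>holomorphic_cn\<close> only asserts that
  one exists; sum and chain rules can then be proved for given gradients.\<close>

definition cn_deriv :: "nat \<Rightarrow> (complex vec \<Rightarrow> complex) \<Rightarrow> complex vec \<Rightarrow> complex vec \<Rightarrow> bool" where
  "cn_deriv n f a z \<longleftrightarrow> a \<in> carrier_vec n \<and> (\<forall>e>0. \<exists>d>0. \<forall>w\<in>polydisc z d.
        cmod (f w - f z - a \<bullet> (w - z)) \<le> e * (\<Sum>i<n. cmod (w $ i - z $ i)))"

lemma cn_derivE:
  assumes "cn_deriv n f a z" "0 < e"
  obtains d where "0 < d"
    "\<And>w. w \<in> polydisc z d \<Longrightarrow> cmod (f w - f z - a \<bullet> (w - z)) \<le> e * (\<Sum>i<n. cmod (w $ i - z $ i))"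
  using assms unfolding cn_deriv_def by blast

lemma holomorphic_cn_iff: "holomorphic_cn n f U \<longleftrightarrow> (\<forall>z\<in>U. \<exists>a. cn_deriv n f a z)"
  unfolding holomorphic_cn_def cn_deriv_def by (simp only: Bex_def)

lemma holomorphic_cn_subset: "holomorphic_cn n f U \<Longrightarrow> V \<subseteq> U \<Longrightarrow> holomorphic_cn n f V"
  by (auto simp: holomorphic_cn_def)

abbreviation l1dist :: "nat \<Rightarrow> complex vec \<Rightarrow> complex vec \<Rightarrow> real" where
  "l1dist n w z \<equiv> (\<Sum>i<n. cmod (w $ i - z $ i))"

lemma scalar_prod_l1_bound:
  fixes a :: "complex vec"
  assumes "a \<in> carrier_vec n" "w \<in> carrier_vec n" "z \<in> carrier_vec n"
  shows "cmod (a \<bullet> (w - z)) \<le> (\<Sum>i<n. cmod (a $ i)) * l1dist n w z"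
proof -
  have "a \<bullet> (w - z) = (\<Sum>i<n. a $ i * (w $ i - z $ i))"
    using assms by (auto simp: scalar_prod_def atLeast0LessThan intro!: sum.cong)
  also have "cmod \<dots> \<le> (\<Sum>i<n. cmod (a $ i) * cmod (w $ i - z $ i))"
    by (rule order_trans[OF norm_sum]) (simp add: norm_mult)
  also have "\<dots> \<le> (\<Sum>i<n. (\<Sum>j<n. cmod (a $ j)) * cmod (w $ i - z $ i))"
    by (intro sum_mono mult_right_mono member_le_sum) auto
  finally show ?thesis by (simp add: sum_distrib_left)
qed

lemma l1dist_small:
  assumes "e > 0"
  obtains d where "d > 0" "\<And>w. w \<in> polydisc z d \<Longrightarrow> z \<in> carrier_vec n \<Longrightarrow> l1dist n w z < e"
proof (rule that[of "e / (n + 1)"])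
  fix w assume w: "w \<in> polydisc z (e / (n + 1))" "z \<in> carrier_vec n"
  have "l1dist n w z \<le> (\<Sum>i<n. e / (n+1))"
    using w by (intro sum_mono less_imp_le) (auto simp: polydisc_iff)
  also have "\<dots> < e" using assms by (simp add: field_simps)
  finally show "l1dist n w z < e" .
qed (use assms in auto)

lemma cn_deriv_lipschitz:
  assumes "cn_deriv n f a z" "z \<in> carrier_vec n"
  obtains d L where "d > 0" "L > 0" "\<And>w. w \<in> polydisc z d \<Longrightarrow> cmod (f w - f z) \<le> L * l1dist n w z"
proof -
  obtain d where d: "d > 0"
    "\<And>w. w \<in> polydisc z d \<Longrightarrow> cmod (f w - f z - a \<bullet> (w - z)) \<le> 1 * l1dist n w z"
    by (rule cn_derivE[OF assms(1), of 1]) auto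
  have a: "a \<in> carrier_vec n" using assms by (simp add: cn_deriv_def)
  show thesis
  proof (rule that[of d "1 + (\<Sum>i<n. cmod (a $ i))"])
    fix w assume w: "w \<in> polydisc z d"
    have "cmod (f w - f z) \<le> cmod (f w - f z - a \<bullet> (w - z)) + cmod (a \<bullet> (w - z))"
      by (metis diff_add_cancel norm_triangle_ineq)
    also have "\<dots> \<le> 1 * l1dist n w z + (\<Sum>i<n. cmod (a $ i)) * l1dist n w z"
      using polydisc_carrier[OF w assms(2)] by (intro add_mono d w scalar_prod_l1_bound a assms(2))
    finally show "cmod (f w - f z) \<le> (1 + (\<Sum>i<n. cmod (a $ i))) * l1dist n w z"
      by (simp add: algebra_simps)
  qed (auto intro!: add_pos_nonneg sum_nonneg d)
qed

lemma cn_deriv_continuous: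
  assumes "cn_deriv n f a z" "z \<in> carrier_vec n" "e > 0"
  obtains d where "d > 0" "\<And>w. w \<in> polydisc z d \<Longrightarrow> cmod (f w - f z) < e"
proof -
  obtain d L where d: "d > 0" "L > 0" "\<And>w. w \<in> polydisc z d \<Longrightarrow> cmod (f w - f z) \<le> L * l1dist n w z"
    using cn_deriv_lipschitz[OF assms(1,2)] by metis
  obtain d' where d': "d' > 0" "\<And>w. w \<in> polydisc z d' \<Longrightarrow> l1dist n w z < e / L"
    using l1dist_small[of "e / L" z n] assms d by (metis divide_pos_pos)
  show thesis
  proof (rule that[of "min d d'"])
    fix w assume w: "w \<in> polydisc z (min d d')"
    then have "w \<in> polydisc z d" "w \<in> polydisc z d'"
      using polydisc_mono[of "min d d'"] by (meson min.cobounded1 min.cobounded2 subsetD)+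
    then have "cmod (f w - f z) \<le> L * l1dist n w z" "l1dist n w z < e / L" using d d' by auto
    then show "cmod (f w - f z) < e" using d by (auto simp: field_simps)
  qed (use d d' in auto)
qed

lemma cn_deriv_const: "cn_deriv n (\<lambda>_. c) (0\<^sub>v n) z" if "z \<in> carrier_vec n"
  unfolding cn_deriv_def
proof (intro conjI allI impI exI[of _ "1::real"])
  fix e :: real assume "e > 0"
  show "\<forall>w\<in>polydisc z 1. cmod (c - c - 0\<^sub>v n \<bullet> (w - z)) \<le> e * l1dist n w z"
    using polydisc_carrier[OF _ that] \<open>e > 0\<close> that by (auto intro!: mult_nonneg_nonneg sum_nonneg)
qed auto

lemma cn_deriv_linear:
  assumes "a \<in> carrier_vec n" "z \<in> carrier_vec n"
  shows "cn_deriv n (\<lambda>\<xi>. \<xi> \<bullet> a) a z"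
  unfolding cn_deriv_def
proof (intro conjI allI impI exI[of _ "1::real"] ballI assms)
  fix e :: real and w assume "e > 0" and w: "w \<in> polydisc z 1"
  have wc: "w \<in> carrier_vec n" using polydisc_carrier[OF w assms(2)] .
  have "w \<bullet> a - z \<bullet> a - a \<bullet> (w - z) = 0"
    using assms wc by (simp add: scalar_prod_minus_distrib comm_scalar_prod[of a n])
  then show "cmod (w \<bullet> a - z \<bullet> a - a \<bullet> (w - z)) \<le> e * l1dist n w z"
    using \<open>e > 0\<close> by (auto intro!: mult_nonneg_nonneg sum_nonneg)
qed auto

lemma cn_deriv_add:
  assumes "cn_deriv n f a z" "cn_deriv n g b z" "z \<in> carrier_vec n"
  shows "cn_deriv n (\<lambda>\<xi>. f \<xi> + g \<xi>) (a + b) z"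
  unfolding cn_deriv_def
proof (intro conjI allI impI)
  have ab: "a \<in> carrier_vec n" "b \<in> carrier_vec n" using assms by (auto simp: cn_deriv_def)
  then show "a + b \<in> carrier_vec n" by simp
  fix e :: real assume "e > 0"
  then have e2: "e / 2 > 0" by simp
  obtain d1 where d1: "d1 > 0" "\<And>w. w \<in> polydisc z d1 \<Longrightarrow> cmod (f w - f z - a \<bullet> (w - z)) \<le> e/2 * l1dist n w z"
    using assms(1) e2 unfolding cn_deriv_def by blast
  obtain d2 where d2: "d2 > 0" "\<And>w. w \<in> polydisc z d2 \<Longrightarrow> cmod (g w - g z - b \<bullet> (w - z)) \<le> e/2 * l1dist n w z"
    using assms(2) e2 unfolding cn_deriv_def by blast
  show "\<exists>d>0. \<forall>w\<in>polydisc z d. cmod (f w + g w - (f z + g z) - (a + b) \<bullet> (w - z)) \<le> e * l1dist n w z"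
  proof (intro exI[of _ "min d1 d2"] conjI ballI)
    fix w assume w: "w \<in> polydisc z (min d1 d2)"
    then have w12: "w \<in> polydisc z d1" "w \<in> polydisc z d2"
      using polydisc_mono[of "min d1 d2"] by (meson min.cobounded1 min.cobounded2 subsetD)+
    have wz: "w - z \<in> carrier_vec n" using polydisc_carrier[OF w assms(3)] assms(3) by simp
    have "f w + g w - (f z + g z) - (a + b) \<bullet> (w - z) = (f w - f z - a \<bullet> (w - z)) + (g w - g z - b \<bullet> (w - z))"
      using ab wz by (simp add: add_scalar_prod_distrib[of _ n])
    also have "cmod \<dots> \<le> e/2 * l1dist n w z + e/2 * l1dist n w z"
      by (rule order_trans[OF norm_triangle_ineq]) (intro add_mono d1 d2 w12)
    finally show "cmod (f w + g w - (f z + g z) - (a + b) \<bullet> (w - z)) \<le> e * l1dist n w z" by (simp add: field_simps)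
  qed (use d1 d2 in auto)
qed

lemma cn_deriv_compose:
  assumes f: "cn_deriv n f a z" and z: "z \<in> carrier_vec n"
    and \<phi>: "(\<phi> has_field_derivative c) (at (f z))"
  shows "cn_deriv n (\<lambda>\<xi>. \<phi> (f \<xi>)) (c \<cdot>\<^sub>v a) z"
  unfolding cn_deriv_def
proof (intro conjI allI impI)
  have a: "a \<in> carrier_vec n" using f by (simp add: cn_deriv_def)
  then show "c \<cdot>\<^sub>v a \<in> carrier_vec n" by simp
  fix e :: real assume e: "e > 0"
  obtain d0 L where L: "d0 > 0" "L > 0" "\<And>w. w \<in> polydisc z d0 \<Longrightarrow> cmod (f w - f z) \<le> L * l1dist n w z"
    using cn_deriv_lipschitz[OF f z] by metis
  \<comment> \<open>Each of the two error terms below may use half of e. The outer error is measured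
    by f w - f z, which costs a factor L; the inner one is multiplied by c, and the 1 in
    \<open>cmod c + 1\<close> covers c = 0.\<close>
  have "e / (2 * L) > 0" using e L by simp
  then obtain \<delta> where \<delta>: "\<delta> > 0"
    "\<And>y. cmod (y - f z) < \<delta> \<Longrightarrow> cmod (\<phi> y - \<phi> (f z) - c * (y - f z)) \<le> e / (2 * L) * cmod (y - f z)"
    using \<phi> unfolding has_field_derivative_def has_derivative_at_alt
    by (metis (no_types, lifting))
  obtain d1 where d1: "d1 > 0" "\<And>w. w \<in> polydisc z d1 \<Longrightarrow> cmod (f w - f z) < \<delta>"
    using cn_deriv_continuous[OF f z \<delta>(1)] by metis
  have "e / (2 * (cmod c + 1)) > 0" using e by (simp add: add_nonneg_pos)
  then obtain d2 where d2: "d2 > 0"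
    "\<And>w. w \<in> polydisc z d2 \<Longrightarrow> cmod (f w - f z - a \<bullet> (w - z)) \<le> e / (2 * (cmod c + 1)) * l1dist n w z"
    using f unfolding cn_deriv_def by blast
  define d where "d = min d0 (min d1 d2)"
  show "\<exists>d>0. \<forall>w\<in>polydisc z d. cmod (\<phi> (f w) - \<phi> (f z) - (c \<cdot>\<^sub>v a) \<bullet> (w - z)) \<le> e * l1dist n w z"
  proof (intro exI[of _ d] conjI ballI)
    fix w assume w: "w \<in> polydisc z d"
    then have w012: "w \<in> polydisc z d0" "w \<in> polydisc z d1" "w \<in> polydisc z d2"
      using polydisc_mono[of d d0 z] polydisc_mono[of d d1 z] polydisc_mono[of d d2 z]
      by (simp_all add: d_def subset_iff)
    have wz: "w - z \<in> carrier_vec n" using polydisc_carrier[OF w z] z by simp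
    have l0: "l1dist n w z \<ge> 0" by (intro sum_nonneg) auto
    have "\<phi> (f w) - \<phi> (f z) - (c \<cdot>\<^sub>v a) \<bullet> (w - z)
        = (\<phi> (f w) - \<phi> (f z) - c * (f w - f z)) + c * (f w - f z - a \<bullet> (w - z))"
      using a wz by (simp add: algebra_simps)
    also have "cmod \<dots> \<le> e / (2 * L) * cmod (f w - f z) + cmod c * cmod (f w - f z - a \<bullet> (w - z))"
      by (rule order_trans[OF norm_triangle_ineq]) (intro add_mono \<delta>(2) d1(2) w012, simp add: norm_mult)
    also have "\<dots> \<le> e / (2 * L) * (L * l1dist n w z) + cmod c * (e / (2 * (cmod c + 1)) * l1dist n w z)"
      using L e by (intro add_mono mult_left_mono L(3) d2(2) w012) auto
    also have "\<dots> \<le> e * l1dist n w z"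
    proof -
      have "cmod c * (e / (2 * (cmod c + 1))) \<le> e / 2"
      proof -
        have "cmod c * (e / (2 * (cmod c + 1))) = e / 2 * (cmod c / (cmod c + 1))" by simp
        also have "\<dots> \<le> e / 2 * 1" using e by (intro mult_left_mono) (auto simp: divide_le_eq_1 add_nonneg_pos)
        finally show ?thesis by simp
      qed
      then have "cmod c * (e / (2 * (cmod c + 1))) * l1dist n w z \<le> e / 2 * l1dist n w z"
        using l0 by (rule mult_right_mono)
      then show ?thesis using L by (simp add: field_simps)
    qed
    finally show "cmod (\<phi> (f w) - \<phi> (f z) - (c \<cdot>\<^sub>v a) \<bullet> (w - z)) \<le> e * l1dist n w z" .
  qed (use L d1 d2 in \<open>auto simp: d_def\<close>)
qed

lemma holomorphic_cn_const: "U \<subseteq> carrier_vec n \<Longrightarrow> holomorphic_cn n (\<lambda>_. c) U"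
  unfolding holomorphic_cn_iff using cn_deriv_const by blast

lemma holomorphic_cn_linear: "U \<subseteq> carrier_vec n \<Longrightarrow> a \<in> carrier_vec n \<Longrightarrow> holomorphic_cn n (\<lambda>\<xi>. \<xi> \<bullet> a) U"
  unfolding holomorphic_cn_iff using cn_deriv_linear by blast

lemma holomorphic_cn_add:
  "U \<subseteq> carrier_vec n \<Longrightarrow> holomorphic_cn n f U \<Longrightarrow> holomorphic_cn n g U \<Longrightarrow> holomorphic_cn n (\<lambda>\<xi>. f \<xi> + g \<xi>) U"
  unfolding holomorphic_cn_iff using cn_deriv_add by blast

lemma holomorphic_cn_compose:
  assumes "U \<subseteq> carrier_vec n" "holomorphic_cn n f U" "\<phi> holomorphic_on S" "open S" "\<And>\<xi>. \<xi> \<in> U \<Longrightarrow> f \<xi> \<in> S"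
  shows "holomorphic_cn n (\<lambda>\<xi>. \<phi> (f \<xi>)) U"
  unfolding holomorphic_cn_iff
proof
  fix z assume z: "z \<in> U"
  then obtain a where "cn_deriv n f a z" using assms by (auto simp: holomorphic_cn_iff)
  moreover obtain c where "(\<phi> has_field_derivative c) (at (f z))"
    using assms z by (metis DERIV_deriv_iff_field_differentiable holomorphic_on_imp_differentiable_at)
  ultimately show "\<exists>a. cn_deriv n (\<lambda>\<xi>. \<phi> (f \<xi>)) a z"
    using cn_deriv_compose assms(1) z by blast
qed

lemma holomorphic_cn_cmult:
  assumes "U \<subseteq> carrier_vec n" "holomorphic_cn n f U"
  shows "holomorphic_cn n (\<lambda>\<xi>. c * f \<xi>) U"
  by (rule holomorphic_cn_compose[OF assms, of "\<lambda>x. c * x" UNIV]) (auto intro: holomorphic_intros)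

text \<open>Products are reduced to squares by polarization.\<close>

lemma holomorphic_cn_mult:
  assumes "U \<subseteq> carrier_vec n" "holomorphic_cn n f U" "holomorphic_cn n g U"
  shows "holomorphic_cn n (\<lambda>\<xi>. f \<xi> * g \<xi>) U"
proof -
  have sq: "holomorphic_cn n (\<lambda>\<xi>. (h \<xi>)\<^sup>2) U" if "holomorphic_cn n h U" for h
    by (rule holomorphic_cn_compose[OF assms(1) that, of "\<lambda>x. x\<^sup>2" UNIV]) (auto intro: holomorphic_intros)
  have eq: "(\<lambda>\<xi>. f \<xi> * g \<xi>) = (\<lambda>\<xi>. 1/4 * ((f \<xi> + g \<xi>)\<^sup>2 + (-1) * (f \<xi> + (-1) * g \<xi>)\<^sup>2))"
    by (auto simp: power2_eq_square algebra_simps)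
  show ?thesis
    unfolding eq by (intro holomorphic_cn_cmult holomorphic_cn_add sq assms)
qed

lemma holomorphic_cn_diff:
  assumes "U \<subseteq> carrier_vec n" "holomorphic_cn n f U" "holomorphic_cn n g U"
  shows "holomorphic_cn n (\<lambda>\<xi>. f \<xi> - g \<xi>) U"
  using holomorphic_cn_add[OF assms(1,2) holomorphic_cn_cmult[OF assms(1,3), of "-1"]] by simp

lemma holomorphic_cn_sum:
  assumes "U \<subseteq> carrier_vec n" "\<And>i. i \<in> A \<Longrightarrow> holomorphic_cn n (f i) U"
  shows "holomorphic_cn n (\<lambda>\<xi>. \<Sum>i\<in>A. f i \<xi>) U"
  using assms(2)
  by (induction A rule: infinite_finite_induct) (auto intro!: holomorphic_cn_const holomorphic_cn_add assms(1))

lemma holomorphic_cn_prod: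
  assumes "U \<subseteq> carrier_vec n" "\<And>i. i \<in> A \<Longrightarrow> holomorphic_cn n (f i) U"
  shows "holomorphic_cn n (\<lambda>\<xi>. \<Prod>i\<in>A. f i \<xi>) U"
  using assms(2)
  by (induction A rule: infinite_finite_induct) (auto intro!: holomorphic_cn_const holomorphic_cn_mult assms(1))

lemma holomorphic_cn_divide:
  assumes "U \<subseteq> carrier_vec n" "holomorphic_cn n f U" "holomorphic_cn n g U" "\<And>\<xi>. \<xi> \<in> U \<Longrightarrow> g \<xi> \<noteq> 0"
  shows "holomorphic_cn n (\<lambda>\<xi>. f \<xi> / g \<xi>) U"
proof -
  have "holomorphic_cn n (\<lambda>\<xi>. inverse (g \<xi>)) U"
    by (rule holomorphic_cn_compose[OF assms(1,3), of inverse "-{0}"])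
       (use assms in \<open>auto intro!: holomorphic_intros\<close>)
  then show ?thesis
    using holomorphic_cn_mult[OF assms(1,2)] by (simp add: divide_inverse)
qed

lemma open_cn_linear_preimage:
  assumes "a \<in> carrier_vec n" "open S"
  shows "open_cn {\<xi> \<in> carrier_vec n. \<xi> \<bullet> a \<in> S}"
proof (unfold open_cn_def, safe)
  fix z assume z: "z \<in> carrier_vec n" "z \<bullet> a \<in> S"
  then obtain e where e: "e > 0" "ball (z \<bullet> a) e \<subseteq> S" using assms openE by blast
  obtain d where d: "d > 0" "\<And>w. w \<in> polydisc z d \<Longrightarrow> cmod (w \<bullet> a - z \<bullet> a) < e"
    using cn_deriv_continuous[OF cn_deriv_linear[OF assms(1) z(1)] z(1) e(1)] by metis
  have "w \<bullet> a \<in> S" if "w \<in> polydisc z d" for w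
    using d(2)[OF that] e(2) by (auto simp: dist_norm norm_minus_commute subset_iff)
  then show "\<exists>s>0. polydisc z s \<subseteq> {\<xi> \<in> carrier_vec n. \<xi> \<bullet> a \<in> S}"
    using d(1) polydisc_carrier[OF _ z(1)] by (intro exI[of _ d]) auto
qed

section \<open>Uniqueness of values, the identity theorem and meromorphic continuation\<close>

lemma holomorphic_cn_nonzero_nbhd:
  assumes "holomorphic_cn n h U" "w \<in> U" "w \<in> carrier_vec n" "h w \<noteq> 0"
  obtains s where "s > 0" "\<And>v. v \<in> polydisc w s \<Longrightarrow> h v \<noteq> 0"
proof -
  obtain a where a: "cn_deriv n h a w" using assms by (auto simp: holomorphic_cn_iff)
  obtain s where "s > 0" "\<And>v. v \<in> polydisc w s \<Longrightarrow> cmod (h v - h w) < cmod (h w)"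
    using cn_deriv_continuous[OF a assms(3)] assms(4) by (metis zero_less_norm_iff)
  then show thesis by (intro that[of s]) force+
qed

text \<open>By continuity f - g is nonzero near a point where it is nonzero, while agreement holds
  on some polydisc inside every neighbourhood.\<close>

lemma holomorphic_agree_eq:
  assumes "holomorphic_cn n f U" "holomorphic_cn n g U" "open_cn U" "U \<subseteq> carrier_vec n"
    and "generically U (\<lambda>v. f v = g v)" "z \<in> U"
  shows "f z = g z"
proof (rule ccontr)
  assume "f z \<noteq> g z"
  have zc: "z \<in> carrier_vec n" using assms by auto
  have "holomorphic_cn n (\<lambda>\<xi>. f \<xi> - g \<xi>) U" using assms by (intro holomorphic_cn_diff)
  then obtain s where s: "s > 0" "\<And>v. v \<in> polydisc z s \<Longrightarrow> f v - g v \<noteq> 0"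
    using holomorphic_cn_nonzero_nbhd[OF _ assms(6) zc] \<open>f z \<noteq> g z\<close>
    by (metis (no_types, lifting) right_minus_eq)
  obtain u t where "t > 0" "polydisc u t \<subseteq> polydisc z s \<inter> U" "\<forall>v\<in>polydisc u t. f v = g v"
    using assms(5,6) s(1) unfolding generically_def by blast
  then have "u \<in> polydisc z s" "f u = g u" by auto
  with s show False by auto
qed

lemma has_value_unique:
  assumes "has_value n f z c" "has_value n f z c'" "z \<in> carrier_vec n"
  shows "c = c'"
proof -
  obtain r e where e: "r > 0" "holomorphic_cn n e (polydisc z r)" "generically (polydisc z r) (\<lambda>v. f v = e v)" "e z = c"
    using assms(1) unfolding has_value_def agree_generically_iff by blast
  obtain r' e' where e': "r' > 0" "holomorphic_cn n e' (polydisc z r')" "generically (polydisc z r') (\<lambda>v. f v = e' v)" "e' z = c'"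
    using assms(2) unfolding has_value_def agree_generically_iff by blast
  define U where "U = polydisc z (min r r')"
  have U: "open_cn U" "U \<subseteq> polydisc z r" "U \<subseteq> polydisc z r'" "z \<in> U" "U \<subseteq> carrier_vec n"
    using e e' polydisc_mono[of "min r r'" r z] polydisc_mono[of "min r r'" r' z] polydisc_carrier[OF _ assms(3)]
    by (auto simp: U_def open_cn_polydisc)
  have "generically U (\<lambda>v. f v = e v \<and> f v = e' v)"
    by (intro generically_conj generically_subset[OF e(3)] generically_subset[OF e'(3)] U)
  then have "generically U (\<lambda>v. e v = e' v)" by (rule generically_mono) auto
  then show ?thesis
    using holomorphic_agree_eq[of n e U e' z] e e' U holomorphic_cn_subset by metis
qed

lemma mero_value_eq:
  assumes "has_value n f z c" "z \<in> carrier_vec n"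
  shows "mero_value n f z = c"
proof -
  have "(THE c. has_value n f z c) = c"
    by (rule the_equality) (use assms has_value_unique in auto)
  then show ?thesis using assms by (auto simp: mero_value_def mero_analytic_at_def)
qed

lemma has_valueI:
  assumes "open_cn U" "U \<subseteq> carrier_vec n" "z \<in> U" "holomorphic_cn n e U" "generically U (\<lambda>v. f v = e v)"
  shows "has_value n f z (e z)"
proof -
  obtain s where "0 < s" "polydisc z s \<subseteq> U" using assms by (auto simp: open_cn_def)
  then show ?thesis
    unfolding has_value_def agree_generically_iff using assms
    by (intro exI[of _ s] exI[of _ e] conjI) (auto intro: holomorphic_cn_subset generically_subset open_cn_polydisc)
qed

text \<open>A representative may differ from its values on a nowhere dense set, so only generic
  equality can be expected. Near each point f agrees with a holomorphic e on small polydiscs; there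
  e v is itself the value of f at v, and it equals g v by uniqueness of values.\<close>

lemma has_value_imp_generically:
  assumes "open_cn U" "U \<subseteq> carrier_vec n" "\<And>\<xi>. \<xi> \<in> U \<Longrightarrow> has_value n f \<xi> (g \<xi>)"
  shows "generically U (\<lambda>v. f v = g v)"
  unfolding generically_def
proof (intro ballI allI impI)
  fix w and s :: real assume w: "w \<in> U" "s > 0"
  obtain s' where s': "0 < s'" "s' \<le> s" "polydisc w s' \<subseteq> U" using open_cnE[OF assms(1) w] .
  obtain r e where e: "r > 0" "holomorphic_cn n e (polydisc w r)" "generically (polydisc w r) (\<lambda>v. f v = e v)"
    using assms(3)[OF w(1)] unfolding has_value_def agree_generically_iff by blast
  obtain u t where u: "t > 0" "polydisc u t \<subseteq> polydisc w s' \<inter> polydisc w r" "\<forall>v\<in>polydisc u t. f v = e v"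
    using e(1,3) s' unfolding generically_def by (meson polydisc_center)
  have "f v = g v" if v: "v \<in> polydisc u t" for v
  proof -
    have vc: "v \<in> carrier_vec n" "v \<in> U" using v u s' assms by auto
    have uc: "polydisc u t \<subseteq> carrier_vec n" using u s' assms by blast
    have "has_value n f v (e v)"
      by (rule has_valueI[OF open_cn_polydisc uc v])
         (use u in \<open>auto intro: holomorphic_cn_subset[OF e(2)] generically_all open_cn_polydisc\<close>)
    then show ?thesis using has_value_unique assms(3) vc u v by metis
  qed
  then show "\<exists>u. \<exists>t>0. polydisc u t \<subseteq> polydisc w s \<inter> U \<and> (\<forall>v\<in>polydisc u t. f v = g v)"
    using u s' polydisc_mono[of s' s w] by (intro exI[of _ u] exI[of _ t]) blast
qed

text \<open>The identity theorem is reduced to one variable by restricting to complex lines.\<close>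

lemma holomorphic_cn_identity:
  assumes f: "holomorphic_cn n f (polydisc z r)" and zc: "z \<in> carrier_vec n"
    and t: "t > 0" "polydisc u t \<subseteq> polydisc z r" "\<And>v. v \<in> polydisc u t \<Longrightarrow> f v = 0"
    and w: "w \<in> polydisc z r"
  shows "f w = 0"
proof -
  \<comment> \<open>The complex line through u and w, with p 0 = u and p 1 = w. Restricted to it, f
    vanishes near 0 and is to vanish at 1.\<close>
  define p where "p = (\<lambda>c::complex. u + c \<cdot>\<^sub>v (w - u))"
  have u: "u \<in> polydisc z r" using t by auto
  have uc: "u \<in> carrier_vec n" "w \<in> carrier_vec n" using u w zc polydisc_carrier by blast+
  have pc: "p c \<in> carrier_vec n" for c using uc by (simp add: p_def)
  have pi: "p c $ i = u $ i + c * (w $ i - u $ i)" if "i < n" for c i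
    using uc that by (simp add: p_def)
  define S where "S = {c. p c \<in> polydisc z r}"
  have S_eq: "S = (\<Inter>i\<in>{..<n}. (\<lambda>c. u $ i + c * (w $ i - u $ i)) -` ball (z $ i) r)"
    using pc zc by (auto simp: S_def polydisc_iff pi dist_norm norm_minus_commute)
  have "open S"
    unfolding S_eq by (intro open_INT ballI open_vimage continuous_intros) auto
  \<comment> \<open>Convexity yields the connectedness of S that analytic continuation in one
    variable requires.\<close>
  have "convex ((\<lambda>c. u $ i + c * (w $ i - u $ i)) -` ball (z $ i) r)" for i
  proof (rule convexI)
    fix x y :: complex and a b :: real
    assume *: "x \<in> (\<lambda>c. u $ i + c * (w $ i - u $ i)) -` ball (z $ i) r"
      "y \<in> (\<lambda>c. u $ i + c * (w $ i - u $ i)) -` ball (z $ i) r" "0 \<le> a" "0 \<le> b" "a + b = 1"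
    then have "a *\<^sub>R (u $ i + x * (w $ i - u $ i)) + b *\<^sub>R (u $ i + y * (w $ i - u $ i)) \<in> ball (z $ i) r"
      using convex_ball[of "z $ i" r] by (auto simp only: convex_def vimage_eq)
    also have "a *\<^sub>R (u $ i + x * (w $ i - u $ i)) + b *\<^sub>R (u $ i + y * (w $ i - u $ i))
        = (a + b) *\<^sub>R (u $ i) + (a *\<^sub>R x + b *\<^sub>R y) * (w $ i - u $ i)"
      by (simp add: algebra_simps scaleR_conv_of_real)
    finally show "a *\<^sub>R x + b *\<^sub>R y \<in> (\<lambda>c. u $ i + c * (w $ i - u $ i)) -` ball (z $ i) r"
      using * by simp
  qed
  then have "connected S"
    unfolding S_eq by (intro convex_connected convex_INT) auto
  have S01: "0 \<in> S" "1 \<in> S"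
  proof -
    have "p 0 = u" "p 1 = w" using uc by (auto simp: p_def)
    then show "0 \<in> S" "1 \<in> S" using u w by (auto simp: S_def)
  qed
  have hol: "(\<lambda>c. f (p c)) holomorphic_on S"
    unfolding holomorphic_on_open[OF \<open>open S\<close>]
  proof
    fix c assume c: "c \<in> S"
    then obtain a where a: "cn_deriv n f a (p c)" using f by (auto simp: S_def holomorphic_cn_iff)
    define m where "m = (\<Sum>i<n. cmod (w $ i - u $ i))"
    have m0: "m \<ge> 0" by (auto simp: m_def intro: sum_nonneg)
    have ld: "l1dist n (p y) (p c) = cmod (y - c) * m" for y
      unfolding m_def sum_distrib_left
      by (rule sum.cong) (auto simp: pi norm_mult[symmetric] algebra_simps)
    have ad: "a \<bullet> (p y - p c) = (a \<bullet> (w - u)) * (y - c)" for y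
    proof -
      have "p y - p c = (y - c) \<cdot>\<^sub>v (w - u)" using uc by (intro eq_vecI) (auto simp: p_def algebra_simps)
      then show ?thesis using a uc by (simp add: cn_deriv_def)
    qed
    have "((\<lambda>c. f (p c)) has_field_derivative (a \<bullet> (w - u))) (at c)"
      unfolding has_field_derivative_def has_derivative_at_alt
    proof (intro conjI allI impI bounded_linear_mult_right)
      fix e :: real assume e: "e > 0"
      then have "e / (m + 1) > 0" using m0 by simp
      then obtain d where d: "d > 0" "\<And>v. v \<in> polydisc (p c) d \<Longrightarrow>
          cmod (f v - f (p c) - a \<bullet> (v - p c)) \<le> e / (m + 1) * l1dist n v (p c)"
        using a unfolding cn_deriv_def by blast
      show "\<exists>d>0. \<forall>y. cmod (y - c) < d \<longrightarrow>
              cmod (f (p y) - f (p c) - a \<bullet> (w - u) * (y - c)) \<le> e * cmod (y - c)"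
      proof (intro exI[of _ "d / (m + 1)"] conjI allI impI)
        fix y assume y: "cmod (y - c) < d / (m + 1)"
        have "cmod (y - c) * m \<le> cmod (y - c) * (m + 1)" by (intro mult_left_mono) auto
        also have "\<dots> < d" using y m0 by (simp add: field_simps)
        finally have *: "cmod (y - c) * m < d" .
        have "p y \<in> polydisc (p c) d"
          unfolding polydisc_iff
        proof (intro conjI allI impI)
          show "dim_vec (p y) = dim_vec (p c)" using pc by (metis carrier_vecD)
          fix i assume "i < dim_vec (p c)"
          then have i: "i < n" using pc by (metis carrier_vecD)
          have "cmod (p y $ i - p c $ i) \<le> l1dist n (p y) (p c)"
            using i by (intro member_le_sum) auto
          then show "cmod (p y $ i - p c $ i) < d" using * ld by simp
        qed
        from d(2)[OF this] have "cmod (f (p y) - f (p c) - a \<bullet> (w - u) * (y - c)) \<le> e / (m + 1) * (cmod (y - c) * m)"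
          unfolding ad ld .
        also have "\<dots> = e * cmod (y - c) * (m / (m + 1))" by simp
        also have "\<dots> \<le> e * cmod (y - c) * 1"
          using m0 e by (intro mult_left_mono) (auto simp: field_simps)
        finally show "cmod (f (p y) - f (p c) - a \<bullet> (w - u) * (y - c)) \<le> e * cmod (y - c)" by simp
      qed (use d m0 in auto)
    qed
    then show "\<exists>f'. ((\<lambda>c. f (p c)) has_field_derivative f') (at c)" by blast
  qed
  \<comment> \<open>M bounds the speed of the line in each coordinate, with 1 added to keep it
    positive when u = w. Parameters below t / M stay in the polydisc where f vanishes.\<close>
  define M where "M = (\<Sum>i<n. cmod (w $ i - u $ i)) + 1"
  have M: "M > 0" unfolding M_def by (intro add_nonneg_pos sum_nonneg) auto
  define V where "V = ball (0::complex) (t / M)"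
  have Vz: "f (p c) = 0" if "c \<in> V" for c
  proof (rule t(3))
    show "p c \<in> polydisc u t"
      unfolding polydisc_iff
    proof (intro conjI allI impI)
      show "dim_vec (p c) = dim_vec u" using uc by (simp add: p_def)
      fix i assume "i < dim_vec u"
      then have i: "i < n" using uc by auto
      have "cmod (p c $ i - u $ i) = cmod c * cmod (w $ i - u $ i)" using i by (simp add: pi norm_mult)
      also have "\<dots> \<le> cmod c * M"
        unfolding M_def using i member_le_sum[of i "{..<n}" "\<lambda>i. cmod (w $ i - u $ i)"]
        by (intro mult_left_mono) auto
      also have "\<dots> < t" using that M by (simp add: V_def field_simps)
      finally show "cmod (p c $ i - u $ i) < t" .
    qed
  qed
  have "f (p 1) = 0"
  proof (rule analytic_continuation[OF hol \<open>open S\<close> \<open>connected S\<close>, of "V \<inter> S" 0])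
    show "0 islimpt (V \<inter> S)"
      using M t(1) S01 \<open>open S\<close> by (intro interior_limit_point) (auto simp: interior_Int interior_open V_def)
  qed (use S01 Vz in auto)
  moreover have "p 1 = w" using uc by (auto simp: p_def)
  ultimately show ?thesis by simp
qed

text \<open>If h vanished on a polydisc around some point, the identity theorem would make it vanish
  on the whole polydisc of radius r, including w.\<close>

lemma holomorphic_cn_nonzero_generic:
  assumes "holomorphic_cn n h (polydisc z r)" "z \<in> carrier_vec n" "w \<in> polydisc z r" "h w \<noteq> 0"
  shows "generically (polydisc z r) (\<lambda>v. h v \<noteq> 0)"
  unfolding generically_def
proof (intro ballI allI impI)
  fix x and s :: real assume x: "x \<in> polydisc z r" "s > 0"
  obtain s' where s': "0 < s'" "s' \<le> s" "polydisc x s' \<subseteq> polydisc z r"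
    using open_cnE[OF open_cn_polydisc x] .
  obtain u where u: "u \<in> polydisc x s'" "h u \<noteq> 0"
    using holomorphic_cn_identity[OF assms(1,2) s'(1,3)] assms(3,4) by blast
  have uc: "u \<in> carrier_vec n" "u \<in> polydisc z r" using u s' polydisc_carrier[OF _ assms(2)] by auto
  obtain t where t: "t > 0" "\<And>v. v \<in> polydisc u t \<Longrightarrow> h v \<noteq> 0"
    using holomorphic_cn_nonzero_nbhd[OF assms(1) uc(2,1) u(2)] by metis
  obtain t' where t': "0 < t'" "t' \<le> t" "polydisc u t' \<subseteq> polydisc x s'"
    using open_cnE[OF open_cn_polydisc u(1) t(1)] .
  show "\<exists>u. \<exists>t>0. polydisc u t \<subseteq> polydisc x s \<inter> polydisc z r \<and> (\<forall>v\<in>polydisc u t. h v \<noteq> 0)"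
    using t t' s' polydisc_mono[of t' t u] polydisc_mono[of s' s x]
    by (intro exI[of _ u] exI[of _ t']) blast
qed

lemma quotient_meromorphic:
  assumes g: "holomorphic_cn n g (carrier_vec n)" and h: "holomorphic_cn n h (carrier_vec n)"
    and z0: "z0 \<in> carrier_vec n" "h z0 \<noteq> 0"
  shows "(\<lambda>\<xi>. g \<xi> / h \<xi>) \<in> meromorphic_cn n"
  unfolding meromorphic_cn_def
proof (intro CollectI ballI)
  fix z :: "complex vec" assume z: "z \<in> carrier_vec n"
  \<comment> \<open>Large enough for the polydisc to contain z0, since the local denominator must be
    nonzero somewhere in it; both functions are holomorphic on the whole space.\<close>
  define r where "r = 1 + l1dist n z0 z"
  have r: "r > 0" unfolding r_def by (intro add_pos_nonneg sum_nonneg) auto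
  have sub: "polydisc z r \<subseteq> carrier_vec n" using polydisc_carrier[OF _ z] by auto
  have "z0 \<in> polydisc z r"
    unfolding polydisc_iff
  proof (intro conjI allI impI)
    show "dim_vec z0 = dim_vec z" using z z0 by auto
    fix i assume "i < dim_vec z"
    then have "cmod (z0 $ i - z $ i) \<le> l1dist n z0 z" using z by (intro member_le_sum) auto
    then show "cmod (z0 $ i - z $ i) < r" by (simp add: r_def)
  qed
  then show "\<exists>r>0. \<exists>g' h'. holomorphic_cn n g' (polydisc z r) \<and> holomorphic_cn n h' (polydisc z r) \<and>
     (\<exists>w\<in>polydisc z r. h' w \<noteq> 0) \<and> (\<forall>w\<in>polydisc z r. h' w \<noteq> 0 \<longrightarrow> g w / h w = g' w / h' w)"
    using r z0 holomorphic_cn_subset[OF g sub] holomorphic_cn_subset[OF h sub]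
    by (intro exI[of _ r] conjI exI[of _ g] exI[of _ h]) auto
qed

lemma quotient_has_value:
  assumes g: "holomorphic_cn n g (carrier_vec n)" and h: "holomorphic_cn n h (carrier_vec n)"
    and z: "z \<in> carrier_vec n" "h z \<noteq> 0"
  shows "has_value n (\<lambda>\<xi>. g \<xi> / h \<xi>) z (g z / h z)"
proof -
  obtain s where s: "s > 0" "\<And>v. v \<in> polydisc z s \<Longrightarrow> h v \<noteq> 0"
    using holomorphic_cn_nonzero_nbhd[OF h z(1) z] by metis
  have sub: "polydisc z s \<subseteq> carrier_vec n" using polydisc_carrier[OF _ z(1)] by auto
  show ?thesis
    by (rule has_valueI[OF open_cn_polydisc sub])
       (use s in \<open>auto intro!: holomorphic_cn_divide holomorphic_cn_subset[OF g] holomorphic_cn_subset[OF h]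
          sub generically_all open_cn_polydisc\<close>)
qed

text \<open>Continuation from an open set that only accumulates at z. With f = g / h locally, the
  holomorphic function g - h e vanishes on a polydisc inside that set, hence on a full polydisc
  about z; dividing by h off its zeros gives f = e generically. The application is z = 0 with a
  region of convergence that does not contain the origin.\<close>

lemma meromorphic_agree_extend:
  assumes f: "f \<in> meromorphic_cn n" and e: "holomorphic_cn n e (polydisc z r)" "r > 0" "z \<in> carrier_vec n"
    and \<Omega>: "open_cn \<Omega>" "\<And>s. s > 0 \<Longrightarrow> \<Omega> \<inter> polydisc z s \<noteq> {}"
    and eq: "generically (\<Omega> \<inter> polydisc z r) (\<lambda>v. f v = e v)"
  obtains r' where "r' > 0" "r' \<le> r" "generically (polydisc z r') (\<lambda>v. f v = e v)"
proof -
  obtain R g h where R: "R > 0" "holomorphic_cn n g (polydisc z R)" "holomorphic_cn n h (polydisc z R)"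
    "\<exists>w\<in>polydisc z R. h w \<noteq> 0" "\<And>w. w \<in> polydisc z R \<Longrightarrow> h w \<noteq> 0 \<Longrightarrow> f w = g w / h w"
    using f e(3) unfolding meromorphic_cn_def by blast
  define r' where "r' = min r R"
  define U where "U = polydisc z r'"
  have r': "r' > 0" using R e by (simp add: r'_def)
  have U: "U \<subseteq> polydisc z r" "U \<subseteq> polydisc z R" "U \<subseteq> carrier_vec n" "open_cn U"
    using polydisc_mono[of r' r z] polydisc_mono[of r' R z] polydisc_carrier[OF _ e(3)]
    by (auto simp: U_def r'_def open_cn_polydisc)
  have hn: "generically (polydisc z R) (\<lambda>v. h v \<noteq> 0)"
    using holomorphic_cn_nonzero_generic[OF R(3) e(3)] R(4) by blast
  have \<Omega>U: "open_cn (\<Omega> \<inter> U)" using open_cn_Int \<Omega>(1) U(4) by blast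
  have hol: "holomorphic_cn n (\<lambda>v. g v - h v * e v) U"
    using U by (intro holomorphic_cn_diff holomorphic_cn_mult holomorphic_cn_subset[OF R(2)]
        holomorphic_cn_subset[OF R(3)] holomorphic_cn_subset[OF e(1)])
  have "generically (\<Omega> \<inter> U) (\<lambda>v. f v = e v \<and> h v \<noteq> 0)"
    by (intro generically_conj generically_subset[OF eq] generically_subset[OF hn] \<Omega>U) (use U in auto)
  then have g0: "generically (\<Omega> \<inter> U) (\<lambda>v. g v - h v * e v = 0)"
  proof (rule generically_mono)
    fix v assume v: "v \<in> \<Omega> \<inter> U" "f v = e v \<and> h v \<noteq> 0"
    then have "f v = g v / h v" using R(5) U by auto
    then show "g v - h v * e v = 0" using v by (simp add: field_simps)
  qed
  obtain w where "w \<in> \<Omega> \<inter> U" using \<Omega>(2)[OF r'] by (auto simp: U_def)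
  then obtain u t where "t > 0" "polydisc u t \<subseteq> \<Omega> \<inter> U" "\<And>v. v \<in> polydisc u t \<Longrightarrow> g v - h v * e v = 0"
    by (rule genericallyE[OF g0, of w 1]) auto
  then have z: "g v - h v * e v = 0" if "v \<in> U" for v
    using holomorphic_cn_identity[of n "\<lambda>v. g v - h v * e v" z r' t u v] hol e(3) that by (auto simp: U_def)
  have "generically U (\<lambda>v. h v \<noteq> 0)" by (rule generically_subset[OF hn]) (use U in auto)
  then have "generically U (\<lambda>v. f v = e v)"
  proof (rule generically_mono)
    fix v assume v: "v \<in> U" "h v \<noteq> 0"
    then have "f v = g v / h v" using R(5) U by auto
    then show "f v = e v" using z[OF v(1)] v(2) by (simp add: field_simps)
  qed
  then show thesis using that[of r'] r' by (auto simp: U_def r'_def)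
qed

subsection \<open>The generating function of the Bernoulli polynomials without its pole\<close>

text \<open>The quotient has the Laurent series with terms B_k(a) t^(k-1) / k!, so the value at 0 is
  the constant term B_1(a) = a - 1/2 that is left after removing 1 / t.\<close>

definition gam :: "complex \<Rightarrow> complex \<Rightarrow> complex" where
  "gam a t = (if t = 0 then a - 1/2 else exp (a * t) / (exp t - 1) - 1 / t)"

lemma gam_0 [simp]: "gam a 0 = a - 1/2"
  by (simp add: gam_def)

text \<open>The nonzero zeros of exp t - 1 have modulus at least 2 \<pi>; the radius 1 is a
  convenient smaller bound that is used throughout.\<close>

lemma exp_neq_1:
  assumes "norm (t::complex) < 1" "t \<noteq> 0"
  shows "exp t \<noteq> 1"
proof
  assume "exp t = 1"
  then obtain k :: int where k: "Re t = 0" "Im t = of_int (2 * k) * pi" by (auto simp: exp_eq_1)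
  with assms(2) have "k \<noteq> 0" by (auto simp: complex_eq_iff)
  have "2 * pi \<le> \<bar>of_int (2 * k) * pi\<bar>"
    using \<open>k \<noteq> 0\<close> by (simp add: abs_mult)
  also have "\<dots> \<le> norm t" using k abs_Im_le_cmod[of t] by simp
  finally show False using assms(1) pi_gt3 by simp
qed

lemma gam_holomorphic: "gam a holomorphic_on ball 0 1"
proof -
  \<comment> \<open>E is (exp t - 1) / t without its singularity and has no zero in the disc. With N
    t = exp (a t) - E t, which vanishes at 0, the function \<open>gam a\<close> is the quotient of N
    t / t by E t.\<close>
  define E where "E = (\<lambda>z::complex. if z = 0 then 1 else (exp z - 1) / z)"
  have "(\<lambda>z. if z = 0 then deriv exp 0 else (exp z - exp 0) / (z - 0)) holomorphic_on (UNIV :: complex set)"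
    by (rule pole_lemma_open) (auto intro: holomorphic_intros)
  then have E: "E holomorphic_on UNIV"
    by (rule holomorphic_transform) (auto simp: E_def DERIV_imp_deriv[OF DERIV_exp])
  obtain E' where E': "(E has_field_derivative E') (at 0)"
    using E holomorphic_on_imp_differentiable_at[of E UNIV 0] by (auto simp: field_differentiable_def)
  \<comment> \<open>Differentiating this functional equation at 0 gives - E'(0) = E'(0) - 1, hence
    E'(0) = 1/2 without a power series.\<close>
  have refl: "E (- t) = exp (- t) * E t" for t
    by (auto simp: E_def exp_minus field_simps)
  have "((\<lambda>t. E (- t)) has_field_derivative E' * (- 1)) (at 0)"
    by (rule DERIV_chain2[of E]) (use E' in \<open>auto intro!: derivative_eq_intros\<close>)
  moreover have "((\<lambda>t. exp (- t) * E t) has_field_derivative exp (- 0) * E' + (exp (- 0) * - 1) * E 0) (at 0)"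
    by (rule derivative_eq_intros E' refl | simp)+
  ultimately have "E' * (- 1) = exp (- 0) * E' + (exp (- 0) * - 1) * E 0"
    using DERIV_unique[of "\<lambda>t. E (- t)"] unfolding refl by blast
  then have "E' = 1/2" by (simp add: E_def field_simps)
  define N where "N = (\<lambda>t. exp (a * t) - E t)"
  have N: "N holomorphic_on UNIV" unfolding N_def by (intro holomorphic_intros E)
  have "(N has_field_derivative (exp (a * 0) * a - E')) (at 0)"
    unfolding N_def by (auto intro!: derivative_eq_intros E')
  then have dN: "deriv N 0 = a - 1/2" using \<open>E' = 1/2\<close> by (simp add: DERIV_imp_deriv)
  define G where "G = (\<lambda>z. if z = 0 then deriv N 0 else (N z - N 0) / (z - 0))"
  have "G holomorphic_on UNIV" unfolding G_def by (rule pole_lemma_open[OF N]) simp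
  then have G: "G holomorphic_on ball 0 1" by (rule holomorphic_on_subset) simp
  have Enz: "E z \<noteq> 0" if "z \<in> ball 0 1" for z
    using that exp_neq_1[of z] by (auto simp: E_def)
  have "(\<lambda>z. G z / E z) holomorphic_on ball 0 1"
    by (intro holomorphic_intros G holomorphic_on_subset[OF E] Enz) auto
  then show ?thesis
  proof (rule holomorphic_transform)
    fix z :: complex assume z: "z \<in> ball 0 1"
    show "G z / E z = gam a z"
    proof (cases "z = 0")
      case False
      then have "exp z - 1 \<noteq> 0" using exp_neq_1[of z] z by auto
      with False show ?thesis by (simp add: G_def E_def N_def gam_def field_simps)
    qed (simp add: G_def E_def dN)
  qed
qed

text \<open>Generating form of the reflection formula B_k(1 - a) = (-1)^k B_k(a). It relates boxes
  closed at 0 to boxes closed at 1, and thereby the functions \<open>rho\<close> of the two kinds of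
  interpolators.\<close>

lemma gam_reflect:
  assumes "norm t < 1"
  shows "gam (1 - a) t = - gam a (- t)"
proof (cases "t = 0")
  case False
  then have "exp t \<noteq> 1" "exp (- t) \<noteq> 1" using exp_neq_1[of t] exp_neq_1[of "- t"] assms by auto
  moreover have "exp (- t) - 1 = (1 - exp t) / exp t" by (simp add: exp_minus field_simps)
  moreover have "exp ((1 - a) * t) = exp t * exp (- (a * t))" by (simp add: exp_add[symmetric] algebra_simps)
  ultimately have "exp (a * - t) / (exp (- t) - 1) = - (exp ((1 - a) * t) / (exp t - 1))"
    by (simp add: divide_simps) (simp add: algebra_simps)
  then show ?thesis using False by (simp add: gam_def)
qed simp

text \<open>The distribution relation. The powers of exp (y / q) form a geometric sum, which turns
  the denominator exp y - 1 into exp (y / q) - 1, and q copies of 1 / y are 1 / (y / q).\<close>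

lemma gam_sum:
  assumes "norm y < 1" "y \<noteq> 0" "q > 0"
  shows "(\<Sum>k<q. gam (of_nat k / of_nat q) y) = gam 0 (y / of_nat q)"
proof -
  have q: "norm (y / of_nat q) < 1" "y / of_nat q \<noteq> 0"
    using assms by (auto simp: norm_divide divide_less_eq order_less_le_trans)
  define x where "x = exp (y / of_nat q)"
  have x: "x \<noteq> 1" using exp_neq_1[OF q] by (simp add: x_def)
  have xq: "x ^ q = exp y" using assms by (simp add: x_def exp_of_nat_mult[symmetric])
  have ey: "exp y \<noteq> 1" using exp_neq_1 assms by blast
  have xk: "exp (of_nat k / of_nat q * y) = x ^ k" for k
    by (simp add: x_def exp_of_nat_mult[symmetric] mult.commute)
  have "(\<Sum>k<q. gam (of_nat k / of_nat q) y) = (\<Sum>k<q. x ^ k / (exp y - 1) - 1 / y)"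
    using assms xk by (intro sum.cong) (auto simp: gam_def)
  also have "\<dots> = (\<Sum>k<q. x ^ k) / (exp y - 1) - of_nat q / y"
    by (simp add: sum_subtractf sum_divide_distrib)
  also have "(\<Sum>k<q. x ^ k) = (exp y - 1) / (x - 1)"
    using x geometric_sum[of x q] xq by simp
  finally show ?thesis using ey x q assms by (simp add: gam_def x_def)
qed

subsection \<open>Difference quotients of holomorphic functions\<close>

definition diff_quot :: "(complex \<Rightarrow> complex) \<Rightarrow> complex \<Rightarrow> complex \<Rightarrow> complex" where
  "diff_quot \<phi> x s = (if x = s then deriv \<phi> x else (\<phi> x - \<phi> s) / (x - s))"

lemma diff_quot_mult: "\<phi> x - \<phi> s = (x - s) * diff_quot \<phi> x s"
  by (simp add: diff_quot_def)

text \<open>Differentiability of the difference quotient, as a function of two variables, at the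
  diagonal point (c, c); both partial derivatives are half the second derivative of \<phi> at
  c.\<close>

lemma diff_quot_estimate:
  assumes \<phi>: "\<phi> holomorphic_on S" "open S" "c \<in> S" and e: "e > 0"
  obtains d where "d > 0" "\<And>x s. norm (x - c) < d \<Longrightarrow> norm (s - c) < d \<Longrightarrow>
     norm (diff_quot \<phi> x s - deriv \<phi> c - deriv (deriv \<phi>) c / 2 * ((x - c) + (s - c)))
       \<le> e * (norm (x - c) + norm (s - c))"
proof -
  define D where "D = deriv (deriv \<phi>) c"
  have "deriv \<phi> holomorphic_on S" using \<phi> by (intro holomorphic_deriv)
  then have "(deriv \<phi> has_field_derivative D) (at c)"
    using \<phi> holomorphic_derivI by (auto simp: D_def)
  then obtain d1 where d1: "d1 > 0" "\<And>y. norm (y - c) < d1 \<Longrightarrow> norm (deriv \<phi> y - deriv \<phi> c - D * (y - c)) \<le> e * norm (y - c)"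
    using e unfolding has_field_derivative_def has_derivative_at_alt by blast
  obtain d2 where d2: "d2 > 0" "ball c d2 \<subseteq> S" using \<phi> openE by blast
  \<comment> \<open>Subtracting the linear and quadratic Taylor terms leaves a function whose
    derivative is at most e m on the disc of radius m. The mean value bound for R x - R s is then
    divided by x - s.\<close>
  define R where "R = (\<lambda>y. \<phi> y - deriv \<phi> c * y - D / 2 * (y - c)\<^sup>2)"
  show thesis
  proof (rule that[of "min d1 d2"])
    fix x s assume x: "norm (x - c) < min d1 d2" and s: "norm (s - c) < min d1 d2"
    define m where "m = max (norm (x - c)) (norm (s - c))"
    have m: "m < min d1 d2" "m \<le> norm (x - c) + norm (s - c)" using x s by (auto simp: m_def)
    show "norm (diff_quot \<phi> x s - deriv \<phi> c - deriv (deriv \<phi>) c / 2 * ((x - c) + (s - c)))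
       \<le> e * (norm (x - c) + norm (s - c))"
    proof (cases "x = s")
      case True
      have "norm (deriv \<phi> x - deriv \<phi> c - D * (x - c)) \<le> e * norm (x - c)" using d1 x by auto
      also have "e * norm (x - c) \<le> e * (norm (x - c) + norm (s - c))" using e by (intro mult_left_mono) auto
      also have "D * (x - c) = D / 2 * ((x - c) + (s - c))" using True by (simp add: field_simps)
      finally show ?thesis unfolding D_def using True by (simp only: diff_quot_def simp_thms if_True)
    next
      case False
      have "norm (R x - R s) \<le> (e * m) * norm (x - s)"
      proof (rule field_differentiable_bound[where f' = "\<lambda>y. deriv \<phi> y - deriv \<phi> c - D * (y - c)"])
        show "convex (cball c m)" by simp
        fix y assume y: "y \<in> cball c m"
        then have yc: "norm (y - c) \<le> m" by (simp add: dist_norm norm_minus_commute)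
        then have "y \<in> S" using m d2 by (auto simp: dist_norm norm_minus_commute subset_iff)
        then have "(\<phi> has_field_derivative deriv \<phi> y) (at y)" using \<phi> holomorphic_derivI by blast
        then have "(R has_field_derivative deriv \<phi> y - deriv \<phi> c - D * (y - c)) (at y)"
          unfolding R_def by (auto intro!: derivative_eq_intros)
        then show "(R has_field_derivative deriv \<phi> y - deriv \<phi> c - D * (y - c)) (at y within cball c m)"
          by (rule has_field_derivative_at_within)
        have "norm (deriv \<phi> y - deriv \<phi> c - D * (y - c)) \<le> e * norm (y - c)" using d1 yc m by auto
        also have "\<dots> \<le> e * m" using e yc by simp
        finally show "norm (deriv \<phi> y - deriv \<phi> c - D * (y - c)) \<le> e * m" .
      qed (auto simp: m_def dist_norm norm_minus_commute)
      moreover have "R x - R s = (x - s) * (diff_quot \<phi> x s - deriv \<phi> c - D / 2 * ((x - c) + (s - c)))"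
      proof -
        have "R x - R s = (\<phi> x - \<phi> s) - deriv \<phi> c * (x - s) - D / 2 * ((x - c)\<^sup>2 - (s - c)\<^sup>2)"
          by (simp add: R_def right_diff_distrib)
        also have "\<dots> = (x - s) * diff_quot \<phi> x s - deriv \<phi> c * (x - s) - D / 2 * ((x - s) * ((x - c) + (s - c)))"
          unfolding diff_quot_mult by (simp add: power2_eq_square algebra_simps)
        finally show ?thesis by (simp only: right_diff_distrib mult.commute mult.left_commute)
      qed
      ultimately have "norm (diff_quot \<phi> x s - deriv \<phi> c - D / 2 * ((x - c) + (s - c))) * norm (x - s) \<le> (e * m) * norm (x - s)"
        by (simp add: norm_mult mult.commute)
      then have "norm (diff_quot \<phi> x s - deriv \<phi> c - D / 2 * ((x - c) + (s - c))) \<le> e * m"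
        using False by (simp add: mult_le_cancel_right)
      also have "\<dots> \<le> e * (norm (x - c) + norm (s - c))" using e m by simp
      finally show ?thesis by (simp add: D_def)
    qed
  qed (use d1 d2 in auto)
qed

lemma cn_deriv_cong:
  assumes "cn_deriv n f a z" "d > 0" "\<And>w. w \<in> polydisc z d \<Longrightarrow> f w = g w"
  shows "cn_deriv n g a z"
  unfolding cn_deriv_def
proof (intro conjI allI impI)
  fix e :: real assume "e > 0"
  obtain d' where d': "d' > 0" "\<And>w. w \<in> polydisc z d' \<Longrightarrow> cmod (f w - f z - a \<bullet> (w - z)) \<le> e * l1dist n w z"
    by (rule cn_derivE[OF assms(1) \<open>e > 0\<close>]) auto
  show "\<exists>d>0. \<forall>w\<in>polydisc z d. cmod (g w - g z - a \<bullet> (w - z)) \<le> e * l1dist n w z"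
  proof (intro exI[of _ "min d d'"] conjI ballI)
    fix w assume w: "w \<in> polydisc z (min d d')"
    then have "w \<in> polydisc z d" "w \<in> polydisc z d'" "z \<in> polydisc z d"
      using polydisc_mono[of "min d d'" d z] polydisc_mono[of "min d d'" d' z] assms(2) by auto
    then show "cmod (g w - g z - a \<bullet> (w - z)) \<le> e * l1dist n w z"
      using d'(2)[of w] assms(3) by simp
  qed (use d' assms in auto)
qed (use assms(1) in \<open>simp add: cn_deriv_def\<close>)

text \<open>Where f and g differ this is a quotient with nonzero denominator. At a point with f z =
  g z the diagonal estimate shows that the difference quotient deviates from the holomorphic H by a
  function with gradient 0, so it is differentiable there too.\<close>

lemma holomorphic_cn_diff_quot:
  assumes U: "open_cn U" "U \<subseteq> carrier_vec n" and f: "holomorphic_cn n f U" and g: "holomorphic_cn n g U"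
    and \<phi>: "\<phi> holomorphic_on S" "open S" and fS: "\<And>\<xi>. \<xi> \<in> U \<Longrightarrow> f \<xi> \<in> S" and gS: "\<And>\<xi>. \<xi> \<in> U \<Longrightarrow> g \<xi> \<in> S"
  shows "holomorphic_cn n (\<lambda>\<xi>. diff_quot \<phi> (f \<xi>) (g \<xi>)) U"
  unfolding holomorphic_cn_iff
proof
  fix z assume z: "z \<in> U"
  have zc: "z \<in> carrier_vec n" using z U by auto
  show "\<exists>a. cn_deriv n (\<lambda>\<xi>. diff_quot \<phi> (f \<xi>) (g \<xi>)) a z"
  proof (cases "f z = g z")
    case False
    have "holomorphic_cn n (\<lambda>\<xi>. f \<xi> - g \<xi>) U" using U f g by (intro holomorphic_cn_diff)
    then obtain s where s: "s > 0" "\<And>v. v \<in> polydisc z s \<Longrightarrow> f v - g v \<noteq> 0"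
      using holomorphic_cn_nonzero_nbhd[OF _ z zc, where h = "\<lambda>\<xi>. f \<xi> - g \<xi>"] False
      by (metis (no_types, lifting) right_minus_eq)
    obtain d where d: "0 < d" "d \<le> s" "polydisc z d \<subseteq> U" by (rule open_cnE[OF U(1) z s(1)])
    have dc: "polydisc z d \<subseteq> carrier_vec n" using d U by auto
    have fg: "f v \<noteq> g v" if "v \<in> polydisc z d" for v
      using s(2)[of v] that polydisc_mono[OF d(2), of z] by auto
    have "holomorphic_cn n (\<lambda>\<xi>. (\<phi> (f \<xi>) - \<phi> (g \<xi>)) / (f \<xi> - g \<xi>)) (polydisc z d)"
    proof (intro holomorphic_cn_divide holomorphic_cn_diff dc)
      show "holomorphic_cn n f (polydisc z d)" "holomorphic_cn n g (polydisc z d)"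
        using holomorphic_cn_subset f g d by blast+
      then show "holomorphic_cn n (\<lambda>\<xi>. \<phi> (f \<xi>)) (polydisc z d)" "holomorphic_cn n (\<lambda>\<xi>. \<phi> (g \<xi>)) (polydisc z d)"
        using dc \<phi> fS gS d by (auto intro!: holomorphic_cn_compose[where \<phi> = \<phi> and S = S])
    qed (use fg in auto)
    then obtain a where "cn_deriv n (\<lambda>\<xi>. (\<phi> (f \<xi>) - \<phi> (g \<xi>)) / (f \<xi> - g \<xi>)) a z"
      using polydisc_center[OF d(1)] unfolding holomorphic_cn_iff by blast
    then have "cn_deriv n (\<lambda>\<xi>. diff_quot \<phi> (f \<xi>) (g \<xi>)) a z"
      by (rule cn_deriv_cong[OF _ d(1)]) (use fg in \<open>auto simp: diff_quot_def\<close>)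
    then show ?thesis by blast
  next
    case True
    define c where "c = f z"
    define H where "H = (\<lambda>\<xi>. deriv \<phi> c + deriv (deriv \<phi>) c / 2 * ((f \<xi> - c) + (g \<xi> - c)))"
    define D where "D = (\<lambda>\<xi>. diff_quot \<phi> (f \<xi>) (g \<xi>) - H \<xi>)"
    have "holomorphic_cn n H U"
      unfolding H_def
      by (intro holomorphic_cn_add holomorphic_cn_cmult holomorphic_cn_diff holomorphic_cn_const U f g)
    then obtain a where a: "cn_deriv n H a z" using z by (auto simp: holomorphic_cn_iff)
    obtain af ag where fg: "cn_deriv n f af z" "cn_deriv n g ag z" using f g z unfolding holomorphic_cn_iff by blast
    have Dz: "D z = 0" using True by (simp add: D_def H_def c_def diff_quot_def)
    have "cn_deriv n D (0\<^sub>v n) z"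
      unfolding cn_deriv_def
    proof (intro conjI allI impI)
      fix e :: real assume e: "e > 0"
      obtain d1 L1 where d1: "d1 > 0" "L1 > 0" "\<And>w. w \<in> polydisc z d1 \<Longrightarrow> cmod (f w - f z) \<le> L1 * l1dist n w z"
        using cn_deriv_lipschitz[OF fg(1) zc] by metis
      obtain d2 L2 where d2: "d2 > 0" "L2 > 0" "\<And>w. w \<in> polydisc z d2 \<Longrightarrow> cmod (g w - g z) \<le> L2 * l1dist n w z"
        using cn_deriv_lipschitz[OF fg(2) zc] by metis
      have "e / (L1 + L2) > 0" using e d1 d2 by simp
      then obtain \<delta> where \<delta>: "\<delta> > 0" "\<And>x s. norm (x - c) < \<delta> \<Longrightarrow> norm (s - c) < \<delta> \<Longrightarrow>
         norm (diff_quot \<phi> x s - deriv \<phi> c - deriv (deriv \<phi>) c / 2 * ((x - c) + (s - c)))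
           \<le> e / (L1 + L2) * (norm (x - c) + norm (s - c))"
        using diff_quot_estimate[OF \<phi>, of c "e / (L1 + L2)"] fS[OF z] unfolding c_def by metis
      obtain d3 where d3: "d3 > 0" "\<And>w. w \<in> polydisc z d3 \<Longrightarrow> cmod (f w - f z) < \<delta>"
        using cn_deriv_continuous[OF fg(1) zc \<delta>(1)] by metis
      obtain d4 where d4: "d4 > 0" "\<And>w. w \<in> polydisc z d4 \<Longrightarrow> cmod (g w - g z) < \<delta>"
        using cn_deriv_continuous[OF fg(2) zc \<delta>(1)] by metis
      define d where "d = min (min d1 d2) (min d3 d4)"
      show "\<exists>d>0. \<forall>w\<in>polydisc z d. cmod (D w - D z - 0\<^sub>v n \<bullet> (w - z)) \<le> e * l1dist n w z"
      proof (intro exI[of _ d] conjI ballI)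
        fix w assume w: "w \<in> polydisc z d"
        then have w': "w \<in> polydisc z d1" "w \<in> polydisc z d2" "w \<in> polydisc z d3" "w \<in> polydisc z d4"
          using polydisc_mono[of d d1 z] polydisc_mono[of d d2 z] polydisc_mono[of d d3 z] polydisc_mono[of d d4 z]
          by (simp_all add: d_def subset_iff)
        have wz: "w - z \<in> carrier_vec n" using polydisc_carrier[OF w zc] zc by simp
        have "cmod (D w) \<le> e / (L1 + L2) * (norm (f w - c) + norm (g w - c))"
          using \<delta>(2)[of "f w" "g w"] d3(2)[OF w'(3)] d4(2)[OF w'(4)] True
          by (simp add: D_def H_def c_def algebra_simps)
        also have "\<dots> \<le> e / (L1 + L2) * (L1 * l1dist n w z + L2 * l1dist n w z)"
          using e d1 d2 d1(3)[OF w'(1)] d2(3)[OF w'(2)] True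
          by (intro mult_left_mono add_mono) (auto simp: c_def)
        also have "\<dots> = e * l1dist n w z" using d1 d2 by (simp add: field_simps)
        finally show "cmod (D w - D z - 0\<^sub>v n \<bullet> (w - z)) \<le> e * l1dist n w z"
          using wz Dz by simp
      qed (use d1 d2 d3 d4 in \<open>auto simp: d_def\<close>)
    qed auto
    then have "cn_deriv n (\<lambda>\<xi>. D \<xi> + H \<xi>) (0\<^sub>v n + a) z" using a zc by (rule cn_deriv_add)
    then show ?thesis by (auto simp: D_def)
  qed
qed

subsection \<open>Dual bases and coordinate cones\<close>

lemma scalar_prod_sum: "y \<in> carrier_vec n \<Longrightarrow> x \<in> carrier_vec n \<Longrightarrow> x \<bullet> y = (\<Sum>k<n. x $ k * y $ k)"
  by (simp add: scalar_prod_def atLeast0LessThan)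

text \<open>The number w i . x is the coordinate of x along v i: \<open>v\<close> supplies the edges
  of a cone and \<open>w\<close> its inequalities. Exchanging the two families is the passage to the
  dual space.\<close>

locale dual_basis =
  fixes n :: nat and v w :: "nat \<Rightarrow> 'a::field vec"
  assumes v_carrier [simp]: "i < n \<Longrightarrow> v i \<in> carrier_vec n"
    and w_carrier [simp]: "i < n \<Longrightarrow> w i \<in> carrier_vec n"
    and pairing: "i < n \<Longrightarrow> j < n \<Longrightarrow> w i \<bullet> v j = (if i = j then 1 else 0)"
begin

lemma swap: "dual_basis n w v"
proof
  fix i j assume "i < n" "j < n"
  then show "v i \<bullet> w j = (if i = j then 1 else 0)"
    using pairing[of j i] comm_scalar_prod[of "v i" n "w j"] by auto
qed auto

text \<open>The pairing relations say W V = 1 for the square matrices with rows w i and columns v i.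
  A one-sided inverse is two-sided, and the entries of V W = 1 are the claim.\<close>

lemma completeness:
  assumes "k < n" "l < n"
  shows "(\<Sum>i<n. v i $ k * w i $ l) = (if k = l then 1 else 0)"
proof -
  define W where "W = mat n n (\<lambda>(i, j). w i $ j)"
  define V where "V = mat n n (\<lambda>(i, j). v j $ i)"
  have "W * V = 1\<^sub>m n"
  proof (rule eq_matI)
    fix i j assume ij: "i < dim_row (1\<^sub>m n)" "j < dim_col (1\<^sub>m n)"
    then have dims: "dim_vec (w i) = n" "dim_vec (v j) = n"
      using v_carrier[of j] w_carrier[of i] by auto
    have "row W i = w i" by (rule eq_vecI) (insert ij, simp_all add: W_def dims)
    moreover have "col V j = v j" by (rule eq_vecI) (insert ij, simp_all add: V_def dims)
    ultimately show "(W * V) $$ (i, j) = 1\<^sub>m n $$ (i, j)"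
      using ij pairing[of i j] by (simp add: W_def V_def)
  qed (auto simp: W_def V_def)
  then have "V * W = 1\<^sub>m n"
    by (rule mat_mult_left_right_inverse[rotated 2]) (auto simp: W_def V_def)
  then have "(V * W) $$ (k, l) = 1\<^sub>m n $$ (k, l)" by simp
  then show ?thesis
    using assms by (simp add: V_def W_def scalar_prod_def atLeast0LessThan)
qed

lemma expand:
  assumes x: "x \<in> carrier_vec n" and k: "k < n"
  shows "x $ k = (\<Sum>i<n. (w i \<bullet> x) * v i $ k)"
proof -
  have "(\<Sum>i<n. (w i \<bullet> x) * v i $ k) = (\<Sum>i<n. \<Sum>l<n. x $ l * (v i $ k * w i $ l))"
    using x by (intro sum.cong refl) (simp add: scalar_prod_sum[OF x] sum_distrib_right sum_distrib_left algebra_simps)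
  also have "\<dots> = (\<Sum>l<n. x $ l * (\<Sum>i<n. v i $ k * w i $ l))"
    by (subst sum.swap) (simp add: sum_distrib_left)
  also have "\<dots> = (\<Sum>l<n. x $ l * (if k = l then 1 else 0))"
    using completeness k by (intro sum.cong) auto
  also have "\<dots> = (\<Sum>l<n. if l = k then x $ l else 0)" by (intro sum.cong) auto
  also have "\<dots> = x $ k" using k by simp
  finally show ?thesis ..
qed

lemma pair_expand:
  assumes x: "x \<in> carrier_vec n" and y: "y \<in> carrier_vec n"
  shows "y \<bullet> x = (\<Sum>i<n. (w i \<bullet> x) * (y \<bullet> v i))"
proof -
  have "y \<bullet> x = (\<Sum>k<n. y $ k * (\<Sum>i<n. (w i \<bullet> x) * v i $ k))"
    using expand[OF x] by (simp add: scalar_prod_sum[OF x y])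
  also have "\<dots> = (\<Sum>i<n. \<Sum>k<n. (w i \<bullet> x) * (y $ k * v i $ k))"
    by (subst sum.swap) (simp add: sum_distrib_left algebra_simps)
  also have "\<dots> = (\<Sum>i<n. (w i \<bullet> x) * (y \<bullet> v i))"
    by (intro sum.cong refl) (simp add: scalar_prod_sum[OF _ y] sum_distrib_left)
  finally show ?thesis .
qed

lemma coords_eqI:
  assumes "x \<in> carrier_vec n" "y \<in> carrier_vec n" "\<And>i. i < n \<Longrightarrow> w i \<bullet> x = w i \<bullet> y"
  shows "x = y"
  using assms by (intro eq_vecI) (auto simp: expand[of x] expand[of y])

definition comb :: "(nat \<Rightarrow> 'a) \<Rightarrow> 'a vec" where
  "comb c = vec n (\<lambda>k. \<Sum>i<n. c i * v i $ k)"

lemma comb_carrier [simp]: "comb c \<in> carrier_vec n"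
  by (simp add: comb_def)

lemma pair_comb:
  assumes "y \<in> carrier_vec n"
  shows "y \<bullet> comb c = (\<Sum>i<n. c i * (y \<bullet> v i))"
proof -
  have "y \<bullet> comb c = (\<Sum>k<n. \<Sum>i<n. c i * (y $ k * v i $ k))"
    unfolding scalar_prod_sum[OF comb_carrier assms]
    by (simp add: comb_def sum_distrib_left algebra_simps)
  also have "\<dots> = (\<Sum>i<n. c i * (y \<bullet> v i))"
    by (subst sum.swap, intro sum.cong refl) (simp add: scalar_prod_sum[OF _ assms] sum_distrib_left)
  finally show ?thesis .
qed

lemma coord_comb [simp]: "i < n \<Longrightarrow> w i \<bullet> comb c = c i"
proof -
  assume i: "i < n"
  then have "w i \<bullet> comb c = (\<Sum>j<n. if i = j then c j else 0)"
    unfolding pair_comb[OF w_carrier[OF i]] by (intro sum.cong) (auto simp: pairing)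
  then show ?thesis using i by simp
qed

end

section \<open>Cones, faces, tangent cones and duals in the coordinates of a dual basis\<close>

lemma neg_scalar_prod:
  fixes a x :: "'a::ring vec"
  assumes "a \<in> carrier_vec n" "x \<in> carrier_vec n"
  shows "(- a) \<bullet> x = - (a \<bullet> x)" "a \<bullet> (- x) = - (a \<bullet> x)"
  using assms by (auto simp: carrier_vecD)

text \<open>Coordinates are zero outside I, free on J and nonnegative on I - J. So J spans the
  lineality space and each index in I - J adds an edge. Faces and tangent cones only change the
  index sets, and duals also exchange v with w.\<close>

definition coord_cone :: "nat \<Rightarrow> (nat \<Rightarrow> 'a::linordered_field vec) \<Rightarrow> nat set \<Rightarrow> nat set \<Rightarrow> 'a vec set" where
  "coord_cone n w I J = {x \<in> carrier_vec n. \<forall>i<n. (i \<notin> I \<longrightarrow> w i \<bullet> x = 0) \<and> (i \<in> I - J \<longrightarrow> 0 \<le> w i \<bullet> x)}"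

abbreviation coord_space :: "nat \<Rightarrow> (nat \<Rightarrow> 'a::linordered_field vec) \<Rightarrow> nat set \<Rightarrow> 'a vec set" where
  "coord_space n w I \<equiv> coord_cone n w I I"

definition coord_interior :: "nat \<Rightarrow> (nat \<Rightarrow> 'a::linordered_field vec) \<Rightarrow> nat set \<Rightarrow> nat set \<Rightarrow> 'a vec set" where
  "coord_interior n w I J = {x \<in> carrier_vec n. \<forall>i<n. (i \<notin> I \<longrightarrow> w i \<bullet> x = 0) \<and> (i \<in> I - J \<longrightarrow> 0 < w i \<bullet> x)}"

lemma coord_space_def: "coord_space n w I = {x \<in> carrier_vec n. \<forall>i<n. i \<notin> I \<longrightarrow> w i \<bullet> x = 0}"
  by (auto simp: coord_cone_def)

lemma coord_space_full: "coord_space n w {..<n} = carrier_vec n"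
  by (auto simp: coord_cone_def)

lemma polyhedral_cone_constraints:
  assumes "finite S" "S \<subseteq> carrier_vec n"
  shows "polyhedral_cone n {x \<in> carrier_vec n. \<forall>a\<in>S. a \<bullet> x \<le> 0}"
proof -
  obtain as where as: "set as = S" using assms finite_list by blast
  define A where "A = mat_of_rows n as"
  have A: "A \<in> carrier_mat (length as) n" by (simp add: A_def)
  have "A *\<^sub>v x \<le> 0\<^sub>v (length as) \<longleftrightarrow> (\<forall>a\<in>S. a \<bullet> x \<le> 0)" if "x \<in> carrier_vec n" for x
  proof -
    have "(A *\<^sub>v x) $ i = as ! i \<bullet> x" if i: "i < length as" for i
    proof -
      have "as ! i \<in> carrier_vec n" using i as assms nth_mem by blast
      then show ?thesis using i by (simp add: A_def)
    qed
    then show ?thesis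
      using A unfolding less_eq_vec_def by (auto simp: as[symmetric] all_set_conv_all_nth)
  qed
  then have "{x \<in> carrier_vec n. \<forall>a\<in>S. a \<bullet> x \<le> 0} = {x \<in> carrier_vec n. A *\<^sub>v x \<le> 0\<^sub>v (length as)}"
    by auto
  then show ?thesis unfolding polyhedral_cone_def using A by blast
qed

lemma polyhedral_cone_imp_polyhedron:
  assumes "polyhedral_cone n C"
  shows "polyhedron n C"
proof -
  obtain k A where A: "A \<in> carrier_mat k n" "C = {x \<in> carrier_vec n. A *\<^sub>v x \<le> 0\<^sub>v k}"
    using assms unfolding polyhedral_cone_def by blast
  have "A *\<^sub>v 0\<^sub>v n = 0\<^sub>v k" using A by auto
  then have "0\<^sub>v n \<in> C" using A by simp
  then show ?thesis unfolding polyhedron_def using A zero_carrier_vec[of k] by blast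
qed

lemma zero_in_coord_cone: "(\<And>i. i < n \<Longrightarrow> w i \<in> carrier_vec n) \<Longrightarrow> 0\<^sub>v n \<in> coord_cone n w I J"
  by (simp add: coord_cone_def)

locale rat_dual_basis = dual_basis n v w for n and v w :: "nat \<Rightarrow> rat vec"
begin

lemma swap_rat: "rat_dual_basis n w v"
  using swap by (simp add: rat_dual_basis_def)

lemma zero_in_cone [simp]: "0\<^sub>v n \<in> coord_cone n w I J"
  by (rule zero_in_coord_cone) simp

lemma v_in_cone: "i \<in> I \<Longrightarrow> i < n \<Longrightarrow> v i \<in> coord_cone n w I J"
  by (auto simp: coord_cone_def pairing)

lemma coord_minus:
  "x \<in> carrier_vec n \<Longrightarrow> y \<in> carrier_vec n \<Longrightarrow> i < n \<Longrightarrow> w i \<bullet> (x - y) = w i \<bullet> x - w i \<bullet> y"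
  by (simp add: scalar_prod_minus_distrib[of _ n])

lemma coord_add:
  "x \<in> carrier_vec n \<Longrightarrow> y \<in> carrier_vec n \<Longrightarrow> i < n \<Longrightarrow> w i \<bullet> (x + y) = w i \<bullet> x + w i \<bullet> y"
  by (simp add: scalar_prod_add_distrib[of _ n])

lemma coord_smult:
  "x \<in> carrier_vec n \<Longrightarrow> i < n \<Longrightarrow> w i \<bullet> (c \<cdot>\<^sub>v x) = c * (w i \<bullet> x)"
  by (simp add: scalar_prod_smult_distrib[of _ n])

lemma coord_space_subspace: "is_subspace n (coord_space n w I)"
proof -
  interpret V: vec_space "TYPE(rat)" n .
  have "LinearCombinations.submodule class_ring (coord_space n w I) (module_vec TYPE(rat) n)"
    by (rule LinearCombinations.submodule.intro)
       (auto simp: module_vec_simps coord_space_def coord_add coord_smult V.module_axioms)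
  then show ?thesis
    unfolding VectorSpace.subspace_def using V.vectorspace_axioms by blast
qed

lemma lin_coord_cone:
  assumes "J \<subseteq> I"
  shows "lin n (coord_cone n w I J) = coord_space n w I"
proof -
  interpret V: vec_space "TYPE(rat)" n .
  have "{x - y | x y. x \<in> coord_cone n w I J \<and> y \<in> coord_cone n w I J} = coord_space n w I"
  proof (intro equalityI subsetI)
    fix z assume "z \<in> {x - y | x y. x \<in> coord_cone n w I J \<and> y \<in> coord_cone n w I J}"
    then show "z \<in> coord_space n w I" by (auto simp: coord_cone_def coord_minus)
  next
    fix z assume z: "z \<in> coord_space n w I"
    then have zc: "z \<in> carrier_vec n" by (simp add: coord_cone_def)
    define x where "x = comb (\<lambda>i. max 0 (w i \<bullet> z))"
    define y where "y = comb (\<lambda>i. max 0 (- (w i \<bullet> z)))"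
    have "x \<in> coord_cone n w I J" "y \<in> coord_cone n w I J"
      using z by (auto simp: coord_cone_def x_def y_def)
    moreover have "z = x - y"
      by (rule coords_eqI) (auto simp: zc x_def y_def coord_minus)
    ultimately show "z \<in> {x - y | x y. x \<in> coord_cone n w I J \<and> y \<in> coord_cone n w I J}" by blast
  qed
  moreover have "V.span (coord_space n w I) = coord_space n w I"
    using coord_space_subspace[of I] V.in_own_span[of "coord_space n w I"] V.span_is_subset[of "coord_space n w I" "coord_space n w I"]
    by (auto simp: VectorSpace.subspace_def coord_cone_def)
  ultimately show ?thesis by (simp add: lin_def)
qed

lemma aff_coord_cone:
  assumes "J \<subseteq> I"
  shows "aff n (coord_cone n w I J) = coord_space n w I"
  unfolding aff_def lin_coord_cone[OF assms]
proof (intro equalityI subsetI)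
  fix z assume "z \<in> {x + u |x u. x \<in> coord_cone n w I J \<and> u \<in> coord_space n w I}"
  then show "z \<in> coord_space n w I" by (auto simp: coord_cone_def coord_add)
next
  fix z assume z: "z \<in> coord_space n w I"
  then have "z = 0\<^sub>v n + z" by (auto simp: coord_cone_def)
  then show "z \<in> {x + u |x u. x \<in> coord_cone n w I J \<and> u \<in> coord_space n w I}"
    using z zero_in_cone by blast
qed

lemma coord_face:
  assumes "J \<subseteq> I'" "I' \<subseteq> I" "I \<subseteq> {..<n}"
  shows "coord_cone n w I' J \<in> faces n (coord_cone n w I J)"
proof -
  interpret D: dual_basis n w v by (rule swap)
  \<comment> \<open>The supporting functional is minus the sum of the \<open>w i\<close> with i in I
    - I'. On the cone it vanishes exactly where those coordinates do.\<close>
  define a where "a = D.comb (\<lambda>i. if i \<in> I - I' then -1 else 0)"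
  have a: "a \<in> carrier_vec n" by (simp add: a_def)
  have av: "a \<bullet> v i = (if i \<in> I - I' then -1 else 0)" if "i < n" for i
    using that comm_scalar_prod[OF a v_carrier[OF that]] by (simp add: a_def)
  have ax: "a \<bullet> x = - (\<Sum>i\<in>I - I'. w i \<bullet> x)" if "x \<in> carrier_vec n" for x
  proof -
    have "a \<bullet> x = (\<Sum>i<n. if i \<in> I - I' then - (w i \<bullet> x) else 0)"
      unfolding pair_expand[OF that a] by (intro sum.cong) (auto simp: av)
    also have "\<dots> = (\<Sum>i\<in>{..<n} \<inter> (I - I'). - (w i \<bullet> x))"
      by (simp add: sum.inter_restrict)
    also have "{..<n} \<inter> (I - I') = I - I'" using assms by blast
    finally show ?thesis by (simp add: sum_negf)
  qed
  have nonneg: "w i \<bullet> x \<ge> 0" if "x \<in> coord_cone n w I J" "i \<in> I - I'" for x i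
    using that assms by (force simp: coord_cone_def)
  have fin: "finite (I - I')" using assms finite_subset by blast
  have "\<forall>x\<in>coord_cone n w I J. a \<bullet> x \<le> 0"
    using nonneg by (auto simp: ax coord_cone_def intro!: sum_nonneg)
  moreover have "coord_cone n w I' J = {x \<in> coord_cone n w I J. a \<bullet> x = 0}"
  proof (intro equalityI subsetI)
    fix x assume x: "x \<in> coord_cone n w I' J"
    have xI: "x \<in> coord_cone n w I J"
      unfolding coord_cone_def
    proof (intro CollectI conjI allI impI)
      fix i assume i: "i < n"
      { assume "i \<notin> I" then show "w i \<bullet> x = 0" using x i assms by (auto simp: coord_cone_def) }
      { assume "i \<in> I - J" then show "0 \<le> w i \<bullet> x" using x i by (cases "i \<in> I'") (auto simp: coord_cone_def) }
    qed (use x in \<open>simp add: coord_cone_def\<close>)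
    have "w i \<bullet> x = 0" if "i \<in> I - I'" for i using x that assms by (auto simp: coord_cone_def)
    then show "x \<in> {x \<in> coord_cone n w I J. a \<bullet> x = 0}" using xI x by (auto simp: ax coord_cone_def)
  next
    fix x assume x: "x \<in> {x \<in> coord_cone n w I J. a \<bullet> x = 0}"
    then have "(\<Sum>i\<in>I - I'. w i \<bullet> x) = 0" using ax by (auto simp: coord_cone_def)
    then have "\<forall>i\<in>I - I'. w i \<bullet> x = 0"
      using sum_nonneg_eq_0_iff[OF fin, of "\<lambda>i. w i \<bullet> x"] nonneg x by blast
    then show "x \<in> coord_cone n w I' J" using x assms by (auto simp: coord_cone_def)
  qed
  moreover have "coord_cone n w I' J \<noteq> {}" using zero_in_cone by blast
  ultimately show ?thesis unfolding faces_def using a by blast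
qed

text \<open>Closure under doubling forces the bound of a supporting inequality to be 0, and closure
  under negating free directions makes a vanish on \<open>v i\<close> for i in J. The face then
  consists of the points whose coordinates are 0 at the edges where a is negative, so faces
  correspond to the index sets between J and I.\<close>

lemma faces_coord_cone:
  assumes "J \<subseteq> I" "I \<subseteq> {..<n}"
  shows "faces n (coord_cone n w I J) = (\<lambda>I'. coord_cone n w I' J) ` {I'. J \<subseteq> I' \<and> I' \<subseteq> I}"
proof (intro equalityI subsetI)
  fix F assume "F \<in> (\<lambda>I'. coord_cone n w I' J) ` {I'. J \<subseteq> I' \<and> I' \<subseteq> I}"
  then show "F \<in> faces n (coord_cone n w I J)" using coord_face assms by blast
next
  fix F assume "F \<in> faces n (coord_cone n w I J)"
  then obtain a b where F: "F \<noteq> {}" "a \<in> carrier_vec n" "\<And>x. x \<in> coord_cone n w I J \<Longrightarrow> a \<bullet> x \<le> b"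
    "F = {x \<in> coord_cone n w I J. a \<bullet> x = b}" by (auto simp: faces_def)
  have b0: "b \<ge> 0" using F(3)[OF zero_in_cone] F(2) by simp
  obtain y where y: "y \<in> coord_cone n w I J" "a \<bullet> y = b" using F by blast
  have scale: "c \<cdot>\<^sub>v x \<in> coord_cone n w I J" if "x \<in> coord_cone n w I J" "c \<ge> 0" for c x
    using that by (auto simp: coord_cone_def coord_smult)
  have "a \<bullet> (2 \<cdot>\<^sub>v y) \<le> b" using F(3)[OF scale[OF y(1)]] by simp
  then have "b \<le> 0" using F(2) y by (simp add: scalar_prod_smult_distrib[of _ n] coord_cone_def)
  with b0 have b: "b = 0" by simp
  have av: "a \<bullet> v i \<le> 0" if "i \<in> I" for i using F(3)[OF v_in_cone[OF that]] assms that b by auto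
  have avJ: "a \<bullet> v i = 0" if "i \<in> J" for i
  proof -
    have i: "i < n" "i \<in> I" using that assms by auto
    have "- v i \<in> coord_cone n w I J"
      using i that by (auto simp: coord_cone_def pairing neg_scalar_prod[of _ n])
    then have "a \<bullet> (- v i) \<le> 0" using F(3) b by blast
    then have "a \<bullet> v i \<ge> 0" using F(2) i v_carrier[of i] by (simp add: neg_scalar_prod[of _ n])
    then show ?thesis using av[OF i(2)] by simp
  qed
  define I' where "I' = {i \<in> I. a \<bullet> v i = 0}"
  have I': "J \<subseteq> I'" "I' \<subseteq> I" using avJ assms by (auto simp: I'_def)
  have "F = coord_cone n w I' J"
  proof (intro equalityI subsetI)
    fix x assume x: "x \<in> F"
    then have xc: "x \<in> carrier_vec n" "x \<in> coord_cone n w I J" using F by (auto simp: coord_cone_def)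
    have nonpos: "(w i \<bullet> x) * (a \<bullet> v i) \<le> 0" if "i \<in> {..<n}" for i
    proof (cases "i \<in> I - J")
      case True then show ?thesis using xc(2) that av by (auto simp: coord_cone_def mult_nonneg_nonpos)
    next
      case False then show ?thesis using xc(2) that avJ by (auto simp: coord_cone_def)
    qed
    have "(\<Sum>i<n. (w i \<bullet> x) * (a \<bullet> v i)) = 0" using pair_expand[OF xc(1) F(2)] x F(4) b by simp
    then have "\<forall>i\<in>{..<n}. (w i \<bullet> x) * (a \<bullet> v i) = 0"
      using sum_nonneg_eq_0_iff[of "{..<n}" "\<lambda>i. - ((w i \<bullet> x) * (a \<bullet> v i))"] nonpos
      by (auto simp: sum_negf)
    then have "w i \<bullet> x = 0" if "i < n" "i \<notin> I'" for i
      using that xc(2) by (cases "i \<in> I") (auto simp: I'_def coord_cone_def)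
    then show "x \<in> coord_cone n w I' J" using xc I' by (auto simp: coord_cone_def)
  next
    fix x assume x: "x \<in> coord_cone n w I' J"
    then have xc: "x \<in> carrier_vec n" by (simp add: coord_cone_def)
    have "(w i \<bullet> x) * (a \<bullet> v i) = 0" if "i < n" for i
      using x that by (cases "i \<in> I'") (auto simp: I'_def coord_cone_def)
    then have "a \<bullet> x = 0" unfolding pair_expand[OF xc F(2)] by (intro sum.neutral) auto
    moreover have "x \<in> coord_cone n w I J" using x I' by (force simp: coord_cone_def)
    ultimately show "x \<in> F" using F(4) b by simp
  qed
  then show "F \<in> (\<lambda>I'. coord_cone n w I' J) ` {I'. J \<subseteq> I' \<and> I' \<subseteq> I}" using I' by blast
qed

lemma coord_cone_inj: "inj_on (\<lambda>I'. coord_cone n w I' J) {I'. J \<subseteq> I' \<and> I' \<subseteq> {..<n}}"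
proof (rule inj_onI)
  fix A B assume *: "A \<in> {I'. J \<subseteq> I' \<and> I' \<subseteq> {..<n}}" "B \<in> {I'. J \<subseteq> I' \<and> I' \<subseteq> {..<n}}"
    "coord_cone n w A J = coord_cone n w B J"
  have mem: "i \<in> A \<longleftrightarrow> v i \<in> coord_cone n w A J" if i: "i < n" for A i
  proof
    assume "v i \<in> coord_cone n w A J"
    then have "i \<notin> A \<longrightarrow> w i \<bullet> v i = 0" using i by (simp add: coord_cone_def)
    then show "i \<in> A" using pairing[OF i i] by auto
  qed (use i v_in_cone in auto)
  have "i \<in> A \<longleftrightarrow> i \<in> B" if "i < n" for i using mem[OF that] *(3) by simp
  then show "A = B" using *(1,2) by blast
qed

lemma rel_interior_coord_cone:
  assumes "J \<subseteq> I" "I \<subseteq> {..<n}"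
  shows "rel_interior_vec n (coord_cone n w I J) = coord_interior n w I J"
proof (intro equalityI subsetI)
  fix x assume x: "x \<in> rel_interior_vec n (coord_cone n w I J)"
  then obtain e where e: "e > 0" "x \<in> coord_cone n w I J"
    "\<And>y. y \<in> coord_space n w I \<Longrightarrow> (\<forall>i<n. \<bar>y $ i - x $ i\<bar> < e) \<Longrightarrow> y \<in> coord_cone n w I J"
    unfolding rel_interior_vec_def aff_coord_cone[OF assms(1)] by blast
  have xc: "x \<in> carrier_vec n" using e by (simp add: coord_cone_def)
  have "0 < w i \<bullet> x" if i: "i \<in> I - J" for i
  proof (rule ccontr)
    assume "\<not> 0 < w i \<bullet> x"
    then have wx: "w i \<bullet> x = 0" using e(2) i assms by (force simp: coord_cone_def)
    have i': "i < n" using i assms by auto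
    define M where "M = (\<Sum>k<n. \<bar>v i $ k\<bar>) + 1"
    have M: "M > 0" unfolding M_def by (intro add_nonneg_pos sum_nonneg) auto
    \<comment> \<open>A point with a vanishing coordinate is moved against \<open>v i\<close> by
      less than e in each entry; it stays in the affine span but leaves the cone.\<close>
    define y where "y = x - (e / M) \<cdot>\<^sub>v v i"
    have yc: "y \<in> carrier_vec n" using xc i' by (simp add: y_def)
    have wy: "w j \<bullet> y = w j \<bullet> x - (e / M) * (if j = i then 1 else 0)" if "j < n" for j
      using that xc i' by (simp add: y_def coord_minus coord_smult pairing)
    have "y \<in> coord_space n w I"
      using e(2) i i' yc by (auto simp: coord_cone_def wy)
    moreover have "\<bar>y $ k - x $ k\<bar> < e" if k: "k < n" for k
    proof -
      have "\<bar>v i $ k\<bar> \<le> (\<Sum>k<n. \<bar>v i $ k\<bar>)" using k by (intro member_le_sum) auto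
      then have "\<bar>v i $ k\<bar> < M" by (simp add: M_def)
      moreover have "\<bar>y $ k - x $ k\<bar> = e / M * \<bar>v i $ k\<bar>"
        using xc k carrier_vecD[OF v_carrier[OF i']] e(1) M by (simp add: y_def abs_mult)
      moreover have "e / M * \<bar>v i $ k\<bar> < e / M * M"
        using calculation(1) e(1) M by (intro mult_strict_left_mono) auto
      ultimately show ?thesis using M by simp
    qed
    ultimately have "y \<in> coord_cone n w I J" using e(3) by blast
    then have "0 \<le> w i \<bullet> y" using i i' by (simp add: coord_cone_def)
    moreover have "e / M > 0" using e(1) M by simp
    ultimately show False using wy[OF i'] wx by simp
  qed
  then show "x \<in> coord_interior n w I J" using e(2) by (auto simp: coord_cone_def coord_interior_def)
next
  fix x assume x: "x \<in> coord_interior n w I J"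
  have xc: "x \<in> carrier_vec n" and xK: "x \<in> coord_cone n w I J"
    using x by (auto simp: coord_interior_def coord_cone_def less_imp_le)
  define M where "M = (\<Sum>j<n. \<Sum>k<n. \<bar>w j $ k\<bar>) + 1"
  have M: "M > 0" unfolding M_def by (intro add_nonneg_pos sum_nonneg) auto
  \<comment> \<open>The least coordinate of x that has to be positive, with 1 as a default when
    there is none. Changing each entry by less than m / M changes no coordinate by more than
    m.\<close>
  define m where "m = Min (insert 1 ((\<lambda>i. w i \<bullet> x) ` (I - J)))"
  have fin: "finite (I - J)" using assms finite_subset by blast
  have m: "m > 0" using x assms fin by (auto simp: m_def coord_interior_def)
  have mle: "m \<le> w i \<bullet> x" if "i \<in> I - J" for i using that fin by (auto simp: m_def)
  have "y \<in> coord_cone n w I J" if y: "y \<in> coord_space n w I" "\<forall>i<n. \<bar>y $ i - x $ i\<bar> < m / M" for y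
  proof -
    have yc: "y \<in> carrier_vec n" using y by (simp add: coord_cone_def)
    have "0 \<le> w i \<bullet> y" if i: "i < n" "i \<in> I - J" for i
    proof -
      have "\<bar>w i \<bullet> (y - x)\<bar> = \<bar>\<Sum>k<n. w i $ k * (y $ k - x $ k)\<bar>"
        using xc yc i by (simp add: scalar_prod_sum[of "y - x" n])
      also have "\<dots> \<le> (\<Sum>k<n. \<bar>w i $ k\<bar> * (m / M))"
      proof (rule order_trans[OF sum_abs], rule sum_mono)
        fix k assume "k \<in> {..<n}"
        then have "\<bar>y $ k - x $ k\<bar> \<le> m / M" using y(2) by (auto intro: less_imp_le)
        then show "\<bar>w i $ k * (y $ k - x $ k)\<bar> \<le> \<bar>w i $ k\<bar> * (m / M)"
          unfolding abs_mult by (rule mult_left_mono) simp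
      qed
      also have "\<dots> = (\<Sum>k<n. \<bar>w i $ k\<bar>) * (m / M)" by (rule sum_distrib_right[symmetric])
      also have "\<dots> \<le> M * (m / M)"
      proof (intro mult_right_mono)
        have "(\<Sum>k<n. \<bar>w i $ k\<bar>) \<le> (\<Sum>j<n. \<Sum>k<n. \<bar>w j $ k\<bar>)"
          using i by (intro member_le_sum[of i "{..<n}" "\<lambda>j. \<Sum>k<n. \<bar>w j $ k\<bar>"]) (auto intro: sum_nonneg)
        then show "(\<Sum>k<n. \<bar>w i $ k\<bar>) \<le> M" by (simp add: M_def)
      qed (use m M in auto)
      also have "\<dots> = m" using M by simp
      finally have "\<bar>w i \<bullet> y - w i \<bullet> x\<bar> \<le> m" using xc yc i by (simp add: coord_minus)
      then show ?thesis using mle[OF i(2)] by linarith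
    qed
    then show ?thesis using y by (auto simp: coord_cone_def)
  qed
  moreover have "m / M > 0" using m M by simp
  ultimately show "x \<in> rel_interior_vec n (coord_cone n w I J)"
    unfolding rel_interior_vec_def aff_coord_cone[OF assms(1)] using xK by blast
qed

text \<open>Coordinates that are positive at x impose nothing on small displacements, while those
  that vanish at x keep their condition. Hence the free index set grows from J to I'.\<close>

lemma tangent_coord_cone:
  assumes "J \<subseteq> I'" "I' \<subseteq> I" "I \<subseteq> {..<n}" and x: "x \<in> coord_interior n w I' J"
  shows "tangent_cone n (coord_cone n w I J) x = coord_cone n w I I'"
proof (intro equalityI subsetI)
  have xc: "x \<in> carrier_vec n" using x by (simp add: coord_interior_def)
  fix y assume "y \<in> tangent_cone n (coord_cone n w I J) x"
  then obtain d where y: "y \<in> carrier_vec n" "d > 0" "\<And>e. 0 < e \<Longrightarrow> e < d \<Longrightarrow> x + e \<cdot>\<^sub>v y \<in> coord_cone n w I J"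
    by (auto simp: tangent_cone_def)
  then have z: "x + (d/2) \<cdot>\<^sub>v y \<in> coord_cone n w I J" by simp
  have wz: "w i \<bullet> (x + (d/2) \<cdot>\<^sub>v y) = w i \<bullet> x + (d/2) * (w i \<bullet> y)" if "i < n" for i
    using that xc y by (simp add: coord_add coord_smult)
  show "y \<in> coord_cone n w I I'"
    unfolding coord_cone_def
  proof (intro CollectI conjI allI impI y(1))
    fix i assume i: "i < n"
    { assume "i \<notin> I"
      then show "w i \<bullet> y = 0"
        using z x i y(2) assms wz[OF i] by (auto simp: coord_cone_def coord_interior_def) }
    { assume "i \<in> I - I'"
      then have "w i \<bullet> x = 0" "i \<in> I - J" using x i assms by (auto simp: coord_interior_def)
      moreover have "0 \<le> w i \<bullet> (x + (d/2) \<cdot>\<^sub>v y)" using z i calculation(2) by (simp add: coord_cone_def)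
      ultimately show "0 \<le> w i \<bullet> y" using y(2) wz[OF i] by (simp add: zero_le_mult_iff) }
  qed
next
  have xc: "x \<in> carrier_vec n" using x by (simp add: coord_interior_def)
  fix y assume y: "y \<in> coord_cone n w I I'"
  have yc: "y \<in> carrier_vec n" using y by (simp add: coord_cone_def)
  define m where "m = Min (insert 1 ((\<lambda>i. w i \<bullet> x) ` (I' - J)))"
  have fin: "finite (I' - J)" using assms(2,3) by (meson finite_Diff finite_lessThan finite_subset order_trans)
  have m: "m > 0" using x assms fin by (auto simp: m_def coord_interior_def)
  have mle: "m \<le> w i \<bullet> x" if "i \<in> I' - J" for i using that fin by (auto simp: m_def)
  define M where "M = (\<Sum>i<n. \<bar>w i \<bullet> y\<bar>) + 1"
  have M: "M > 0" unfolding M_def by (intro add_nonneg_pos sum_nonneg) auto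
  have "x + e \<cdot>\<^sub>v y \<in> coord_cone n w I J" if e: "0 < e" "e < m / M" for e
    unfolding coord_cone_def
  proof (intro CollectI conjI allI impI)
    show "x + e \<cdot>\<^sub>v y \<in> carrier_vec n" using xc yc by simp
    fix i assume i: "i < n"
    have wz: "w i \<bullet> (x + e \<cdot>\<^sub>v y) = w i \<bullet> x + e * (w i \<bullet> y)"
      using i xc yc by (simp add: coord_add coord_smult)
    { assume "i \<notin> I"
      then show "w i \<bullet> (x + e \<cdot>\<^sub>v y) = 0"
        using x y i assms by (auto simp: wz coord_cone_def coord_interior_def) }
    { assume iJ: "i \<in> I - J"
      show "0 \<le> w i \<bullet> (x + e \<cdot>\<^sub>v y)"
      proof (cases "i \<in> I'")
        case False
        then show ?thesis using x y i iJ e assms by (auto simp: wz coord_cone_def coord_interior_def)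
      next
        case True
        have "\<bar>w i \<bullet> y\<bar> \<le> (\<Sum>i<n. \<bar>w i \<bullet> y\<bar>)" using i by (intro member_le_sum) auto
        then have "\<bar>w i \<bullet> y\<bar> \<le> M" by (simp add: M_def)
        then have "e * \<bar>w i \<bullet> y\<bar> \<le> e * M" using e by (intro mult_left_mono) auto
        also have "\<dots> < m" using e M by (simp add: field_simps)
        also have "m \<le> w i \<bullet> x" using mle True iJ by simp
        finally have "e * \<bar>w i \<bullet> y\<bar> < w i \<bullet> x" .
        moreover have "- (e * \<bar>w i \<bullet> y\<bar>) \<le> e * (w i \<bullet> y)"
          using e by (simp add: abs_if)
        ultimately show ?thesis unfolding wz by linarith
      qed }
  qed
  moreover have "m / M > 0" using m M by simp
  ultimately show "y \<in> tangent_cone n (coord_cone n w I J) x"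
    unfolding tangent_cone_def using yc by blast
qed

lemma coord_interior_nonempty: "comb (\<lambda>i. if i \<in> I - J then 1 else 0) \<in> coord_interior n w I J"
  by (simp add: coord_interior_def)

text \<open>The relative interior point chosen in \<open>Supp\<close> lies in the span of the face.
  This span is the lineality space of the tangent cone, so the translation has no effect.\<close>

lemma Supp_coord_cone:
  assumes "J \<subseteq> I'" "I' \<subseteq> I" "I \<subseteq> {..<n}"
  shows "Supp n (coord_cone n w I J) (coord_cone n w I' J) = coord_cone n w I I'"
proof -
  define x where "x = (SOME x. x \<in> rel_interior_vec n (coord_cone n w I' J))"
  have "rel_interior_vec n (coord_cone n w I' J) = coord_interior n w I' J"
    using assms by (intro rel_interior_coord_cone) auto
  then have x: "x \<in> coord_interior n w I' J"
    unfolding x_def using coord_interior_nonempty[of I' J] by (metis someI_ex)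
  then have xc: "x \<in> carrier_vec n" by (simp add: coord_interior_def)
  have wx: "w i \<bullet> x = 0" if "i < n" "i \<notin> I'" for i using x that by (simp add: coord_interior_def)
  have tr: "x + y \<in> coord_cone n w I I'" if "y \<in> coord_cone n w I I'" for y
    using that xc wx assms by (auto simp: coord_cone_def coord_add subset_iff)
  have "y \<in> translate x (coord_cone n w I I')" if y: "y \<in> coord_cone n w I I'" for y
  proof -
    have yc: "y \<in> carrier_vec n" using y by (simp add: coord_cone_def)
    have "y - x \<in> coord_cone n w I I'"
      using y yc xc wx assms by (auto simp: coord_cone_def coord_minus subset_iff)
    moreover have "y = x + (y - x)" using xc yc by (intro eq_vecI) auto
    ultimately show ?thesis unfolding translate_def by blast
  qed
  then have "translate x (coord_cone n w I I') = coord_cone n w I I'"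
    using tr by (auto simp: translate_def)
  then show ?thesis
    unfolding Supp_def Let_def x_def[symmetric] tangent_coord_cone[OF assms x] .
qed

lemma annihilator_coord_space:
  assumes "I \<subseteq> {..<n}"
  shows "annihilator n (coord_space n w I) = coord_space n v ({..<n} - I)"
proof (intro equalityI subsetI)
  fix y assume y: "y \<in> annihilator n (coord_space n w I)"
  have "v i \<bullet> y = 0" if "i \<in> I" "i < n" for i
    using y v_in_cone[OF that, of I] comm_scalar_prod[of "v i" n y] that by (auto simp: annihilator_def)
  then show "y \<in> coord_space n v ({..<n} - I)"
    using y by (auto simp: annihilator_def coord_cone_def)
next
  fix y assume y: "y \<in> coord_space n v ({..<n} - I)"
  then have yc: "y \<in> carrier_vec n" by (simp add: coord_cone_def)
  have yv: "y \<bullet> v i = 0" if "i < n" "i \<in> I" for i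
    using y that comm_scalar_prod[OF yc v_carrier[OF that(1)]] by (simp add: coord_cone_def)
  have "y \<bullet> x = 0" if x: "x \<in> coord_space n w I" for x
  proof -
    have "x \<in> carrier_vec n" using x by (simp add: coord_cone_def)
    then have "y \<bullet> x = (\<Sum>i<n. (w i \<bullet> x) * (y \<bullet> v i))" using yc by (intro pair_expand)
    also have "\<dots> = 0"
    proof (intro sum.neutral ballI)
      fix i assume "i \<in> {..<n}"
      then show "(w i \<bullet> x) * (y \<bullet> v i) = 0" using yv[of i] x by (cases "i \<in> I") (auto simp: coord_cone_def)
    qed
    finally show ?thesis .
  qed
  then show "y \<in> annihilator n (coord_space n w I)" using yc by (simp add: annihilator_def)
qed

text \<open>Pairing with \<open>v i\<close>, and for i in J also with \<open>- v i\<close>, shows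
  that a free coordinate of the cone must vanish on the dual, and that a coordinate vanishing on the
  cone is free on the dual. Both index sets are therefore complemented and exchanged.\<close>

lemma dual_coord_cone:
  assumes "J \<subseteq> I" "I \<subseteq> {..<n}"
  shows "dual_cone n (coord_cone n w I J) = coord_cone n v ({..<n} - J) ({..<n} - I)"
proof (intro equalityI subsetI)
  fix y assume y: "y \<in> dual_cone n (coord_cone n w I J)"
  have yc: "y \<in> carrier_vec n" using y by (simp add: dual_cone_def)
  have pos: "v i \<bullet> y \<ge> 0" if "i \<in> I" "i < n" for i
    using y v_in_cone[OF that, of J] comm_scalar_prod[of "v i" n y] that by (auto simp: dual_cone_def)
  have "v i \<bullet> y = 0" if i: "i \<in> J" "i < n" for i
  proof -
    have "- v i \<in> coord_cone n w I J"
      using i assms by (auto simp: coord_cone_def pairing neg_scalar_prod[of _ n])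
    then have "0 \<le> y \<bullet> (- v i)" using y by (auto simp: dual_cone_def)
    then have "y \<bullet> v i \<le> 0" using yc i v_carrier[of i] by (simp add: neg_scalar_prod[of _ n])
    then have "v i \<bullet> y \<le> 0" using comm_scalar_prod[OF yc v_carrier[OF i(2)]] by simp
    then show ?thesis using pos i assms by force
  qed
  then show "y \<in> coord_cone n v ({..<n} - J) ({..<n} - I)"
    using yc pos by (auto simp: coord_cone_def)
next
  fix y assume y: "y \<in> coord_cone n v ({..<n} - J) ({..<n} - I)"
  then have yc: "y \<in> carrier_vec n" by (simp add: coord_cone_def)
  have yv: "y \<bullet> v i = v i \<bullet> y" if "i < n" for i
    using that comm_scalar_prod[OF yc v_carrier[OF that(1)]] by simp
  have "0 \<le> y \<bullet> x" if x: "x \<in> coord_cone n w I J" for x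
  proof -
    have "x \<in> carrier_vec n" using x by (simp add: coord_cone_def)
    then have "y \<bullet> x = (\<Sum>i<n. (w i \<bullet> x) * (v i \<bullet> y))"
      using yc yv by (simp add: pair_expand[of x y])
    also have "\<dots> \<ge> 0"
    proof (intro sum_nonneg)
      fix i assume i: "i \<in> {..<n}"
      consider "i \<in> J" | "i \<notin> I" | "i \<in> I - J" by blast
      then show "0 \<le> (w i \<bullet> x) * (v i \<bullet> y)"
        by cases (use x y i assms in \<open>auto simp: coord_cone_def\<close>)
    qed
    finally show ?thesis .
  qed
  then show "y \<in> dual_cone n (coord_cone n w I J)" using yc by (simp add: dual_cone_def)
qed

lemma polyhedral_coord_cone:
  assumes "J \<subseteq> I" "I \<subseteq> {..<n}"
  shows "polyhedral_cone n (coord_cone n w I J)"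
proof -
  define S where "S = (\<lambda>i. - w i) ` ({..<n} - J) \<union> w ` ({..<n} - I)"
  have S: "finite S" "S \<subseteq> carrier_vec n" by (auto simp: S_def)
  have neg: "(- w i) \<bullet> x = - (w i \<bullet> x)" if "i < n" "x \<in> carrier_vec n" for i x
    using that w_carrier[of i] by (simp add: neg_scalar_prod[of _ n])
  have "coord_cone n w I J = {x \<in> carrier_vec n. \<forall>a\<in>S. a \<bullet> x \<le> 0}"
  proof (intro equalityI subsetI)
    fix x assume "x \<in> coord_cone n w I J"
    then show "x \<in> {x \<in> carrier_vec n. \<forall>a\<in>S. a \<bullet> x \<le> 0}"
      using assms by (auto simp: S_def coord_cone_def neg) 
  next
    fix x assume x: "x \<in> {x \<in> carrier_vec n. \<forall>a\<in>S. a \<bullet> x \<le> 0}"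
    then have 1: "w i \<bullet> x \<ge> 0" if "i < n" "i \<notin> J" for i
    proof -
      have "(- w i) \<bullet> x \<le> 0" using x that by (auto simp: S_def)
      then show ?thesis using neg[of i x] that x by (simp only: mem_Collect_eq neg_le_0_iff_le)
    qed
    have 2: "w i \<bullet> x \<le> 0" if "i < n" "i \<notin> I" for i
      using that x by (auto simp: S_def)
    have "w i \<bullet> x = 0" if "i < n" "i \<notin> I" for i
    proof -
      have "i \<notin> J" using that assms by blast
      then show ?thesis using 1[of i] 2[of i] that by simp
    qed
    then show "x \<in> coord_cone n w I J" using 1 x by (auto simp: coord_cone_def)
  qed
  then show ?thesis using polyhedral_cone_constraints[OF S] by simp
qed

lemma polyhedron_coord_cone: "J \<subseteq> I \<Longrightarrow> I \<subseteq> {..<n} \<Longrightarrow> polyhedron n (coord_cone n w I J)"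
  using polyhedral_coord_cone polyhedral_cone_imp_polyhedron by blast

lemma zero_int_lattice [simp]: "0\<^sub>v n \<in> int_lattice n"
  by (simp add: int_lattice_def)

lemma lattice_polyhedron_coord_cone:
  assumes "J \<subseteq> I" "I \<subseteq> {..<n}"
  shows "lattice_polyhedron n (coord_cone n w I J)"
  unfolding lattice_polyhedron_def faces_coord_cone[OF assms]
  using polyhedron_coord_cone[OF assms] zero_in_cone zero_int_lattice by blast

lemma affine_cone_coord_cone:
  assumes "J \<subseteq> I" "I \<subseteq> {..<n}"
  shows "affine_cone n (coord_cone n w I J)" "lattice_cone n (coord_cone n w I J)"
proof -
  let ?C = "coord_cone n w I J"
  have tr: "translate (0\<^sub>v n) ?C = ?C"
    by (force simp: translate_def coord_cone_def)
  show "affine_cone n ?C"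
    unfolding affine_cone_def using tr polyhedral_coord_cone[OF assms] zero_carrier_vec by metis
  have "0\<^sub>v n \<in> {x \<in> ?C. - x \<in> ?C}" by simp
  then have "0\<^sub>v n + 0\<^sub>v n \<in> translate (0\<^sub>v n) {x \<in> ?C. - x \<in> ?C}" unfolding translate_def by blast
  then have "translate (0\<^sub>v n) {x \<in> ?C. - x \<in> ?C} \<inter> int_lattice n \<noteq> {}" by auto
  then show "lattice_cone n ?C"
    unfolding lattice_cone_def using tr polyhedral_coord_cone[OF assms]
    by (intro bexI[of _ "0\<^sub>v n"] exI[of _ ?C]) auto
qed

lemma generic_coord_cone_iff:
  assumes "J \<subseteq> I" "I \<subseteq> {..<n}"
  shows "generic_cone n \<Psi> (coord_cone n w I J) \<longleftrightarrow>
    (\<forall>I'. J \<subseteq> I' \<and> I' \<subseteq> I \<longrightarrow> coord_space n v ({..<n} - I') \<in> dom \<Psi>)"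
proof -
  have "annihilator n (lin n (coord_cone n w I' J)) = coord_space n v ({..<n} - I')" if "J \<subseteq> I'" "I' \<subseteq> I" for I'
    using that assms by (subst lin_coord_cone, simp, subst annihilator_coord_space) auto
  then show ?thesis
    unfolding generic_cone_def generic_subspace_def faces_coord_cone[OF assms] by auto
qed

lemma generic_polyhedron_coord_cone:
  assumes "J \<subseteq> I" "I \<subseteq> {..<n}" "generic_cone n \<Psi> (coord_cone n w I J)"
  shows "generic_polyhedron n \<Psi> (coord_cone n w I J)"
  unfolding generic_polyhedron_def faces_coord_cone[OF assms(1,2)]
proof (intro ballI)
  fix F assume "F \<in> (\<lambda>I'. coord_cone n w I' J) ` {I'. J \<subseteq> I' \<and> I' \<subseteq> I}"
  then obtain I' where I': "J \<subseteq> I'" "I' \<subseteq> I" "F = coord_cone n w I' J" by blast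
  then show "generic_cone n \<Psi> (Supp n (coord_cone n w I J) F)"
    using assms(3) unfolding I'(3) Supp_coord_cone[OF I'(1,2) assms(2)]
      generic_coord_cone_iff[OF assms(1,2)] generic_coord_cone_iff[OF I'(2) assms(2)]
    by (meson order_trans)
qed

lemma no_line_coord_cone:
  assumes "A \<subseteq> coord_cone n w I {}"
  shows "\<not> contains_line n A"
proof
  assume "contains_line n A"
  then obtain x u where x: "x \<in> A" "u \<in> carrier_vec n" "u \<noteq> 0\<^sub>v n" "\<And>t. x + t \<cdot>\<^sub>v u \<in> A"
    by (auto simp: contains_line_def)
  have xc: "x \<in> carrier_vec n" using x assms by (auto simp: coord_cone_def)
  have "w i \<bullet> u = 0" if i: "i < n" for i
  proof -
    have eq: "w i \<bullet> (x + t \<cdot>\<^sub>v u) = w i \<bullet> x + t * (w i \<bullet> u)" for t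
      using i xc x by (simp add: coord_add coord_smult)
    have pos: "0 \<le> w i \<bullet> x + t * (w i \<bullet> u)" for t
    proof -
      have "x + t \<cdot>\<^sub>v u \<in> coord_cone n w I {}" using x(4) assms by blast
      then show ?thesis using i eq[of t] by (cases "i \<in> I") (auto simp: coord_cone_def)
    qed
    show ?thesis
    proof (rule ccontr)
      assume "w i \<bullet> u \<noteq> 0"
      \<comment> \<open>At this parameter the coordinate would be -1.\<close>
      then show False using pos[of "- (w i \<bullet> x + 1) / (w i \<bullet> u)"] by simp
    qed
  qed
  then have "u = 0\<^sub>v n" using x by (intro coords_eqI) auto
  with x show False by simp
qed

end

subsection \<open>Exponential sums over simplicial cones\<close>

lemma has_sum_geometric_nat:
  fixes x :: "'c::{real_normed_field, banach}"
  assumes "norm x < 1"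
  shows "((\<lambda>k. x ^ k) has_sum (1 / (1 - x))) (UNIV :: nat set)"
  using assms geometric_sums[OF assms]
  by (intro norm_summable_imp_has_sum) (auto simp: norm_power intro: summable_geometric)

lemma has_sum_geometric_PiE:
  fixes x :: "'i \<Rightarrow> 'c::{real_normed_field, banach}"
  assumes "finite I" "\<And>i. i \<in> I \<Longrightarrow> norm (x i) < 1"
  shows "((\<lambda>k. \<Prod>i\<in>I. x i ^ k i) has_sum (\<Prod>i\<in>I. 1 / (1 - x i))) (PiE I (\<lambda>_. UNIV :: nat set))"
proof -
  have nb: "((\<lambda>k. norm (x i) ^ k) has_sum (1 / (1 - norm (x i)))) (UNIV :: nat set)" if "i \<in> I" for i
    using has_sum_geometric_nat[of "norm (x i)"] assms(2)[OF that] by simp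
  then have abs: "(\<lambda>k. norm (x i ^ k)) summable_on (UNIV :: nat set)" if "i \<in> I" for i
    using that unfolding norm_power summable_on_def by blast
  have abs': "(\<lambda>k. norm (norm (x i) ^ k)) summable_on (UNIV :: nat set)" if "i \<in> I" for i
    using abs[OF that] by (simp add: norm_power)
  have "infsum (\<lambda>k. \<Prod>i\<in>I. norm (x i) ^ k i) (PiE I (\<lambda>_. UNIV :: nat set))
      = (\<Prod>i\<in>I. infsum (\<lambda>k. norm (x i) ^ k) (UNIV :: nat set))"
    by (rule infsum_prod_PiE_abs[OF assms(1) abs'])
  also have "\<dots> = (\<Prod>i\<in>I. 1 / (1 - norm (x i)))"
    using infsumI[OF nb] by (rule prod.cong[OF refl])
  \<comment> \<open>By convention \<open>infsum\<close> is 0 for a family that is not summable, so a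
    nonzero value proves summability.\<close>
  also have "\<dots> \<noteq> 0" using assms by (force simp: prod_zero_iff)
  finally have "(\<lambda>k. \<Prod>i\<in>I. norm (x i) ^ k i) summable_on (PiE I (\<lambda>_. UNIV :: nat set))"
    using infsum_not_exists by blast
  then have "(\<lambda>k. norm (\<Prod>i\<in>I. x i ^ k i)) summable_on (PiE I (\<lambda>_. UNIV :: nat set))"
    by (simp add: norm_power flip: prod_norm)
  then have "(\<lambda>k. \<Prod>i\<in>I. x i ^ k i) summable_on (PiE I (\<lambda>_. UNIV :: nat set))"
    by (rule abs_summable_summable)
  then have *: "((\<lambda>k. \<Prod>i\<in>I. x i ^ k i) has_sum infsum (\<lambda>k. \<Prod>i\<in>I. x i ^ k i) (PiE I (\<lambda>_. UNIV :: nat set)))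
      (PiE I (\<lambda>_. UNIV :: nat set))"
    by (rule has_sum_infsum)
  have "infsum (\<lambda>k. \<Prod>i\<in>I. x i ^ k i) (PiE I (\<lambda>_. UNIV :: nat set))
      = (\<Prod>i\<in>I. infsum (\<lambda>k. x i ^ k) (UNIV :: nat set))"
    by (rule infsum_prod_PiE_abs[OF assms(1) abs])
  also have "\<dots> = (\<Prod>i\<in>I. 1 / (1 - x i))"
    by (intro prod.cong[OF refl] infsumI has_sum_geometric_nat assms(2))
  finally have eq: "infsum (\<lambda>k. \<Prod>i\<in>I. x i ^ k i) (PiE I (\<lambda>_. UNIV :: nat set)) = (\<Prod>i\<in>I. 1 / (1 - x i))" .
  show ?thesis using * unfolding eq .
qed

lemma map_vec_carrier_iff [simp]: "map_vec f x \<in> carrier_vec n \<longleftrightarrow> x \<in> carrier_vec n"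
  unfolding carrier_dim_vec by simp

section \<open>Lattice points of a cone as box points plus natural multiples of the edges\<close>

abbreviation cvec :: "rat vec \<Rightarrow> complex vec" where "cvec \<equiv> map_vec of_rat"

definition half_line :: "bool \<Rightarrow> rat set" where
  "half_line c = (if c then {0..} else {0<..})"

text \<open>Representatives of the rationals modulo 1, closed at 0 or at 1, so that adding the
  natural numbers gives \<open>half_line c\<close>. The flag distinguishes a cone from its relative
  interior.\<close>

definition half_unit :: "bool \<Rightarrow> rat set" where
  "half_unit c = (if c then {0..<1} else {0<..1})"

lemma half_unit_decompose:
  obtains k :: int where "r - of_int k \<in> half_unit c" "r \<in> half_line c \<longleftrightarrow> 0 \<le> k"
proof (cases c)
  case True
  show ?thesis
    by (rule that[of "\<lfloor>r\<rfloor>"]) (use True in \<open>auto simp: half_unit_def half_line_def, linarith+\<close>)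
next
  case False
  show ?thesis
    by (rule that[of "\<lceil>r\<rceil> - 1"]) (use False in \<open>auto simp: half_unit_def half_line_def, linarith+\<close>)
qed

lemma half_unit_unique: "r - of_int k \<in> half_unit c \<Longrightarrow> r - of_int l \<in> half_unit c \<Longrightarrow> k = l"
proof -
  assume "r - of_int k \<in> half_unit c" "r - of_int l \<in> half_unit c"
  then have "of_int k - of_int l < (1::rat)" "of_int l - of_int k < (1::rat)"
    by (auto simp: half_unit_def split: if_splits)
  then show "k = l" by linarith
qed

lemma half_line_add: "r \<in> half_unit c \<Longrightarrow> r + of_nat k \<in> half_line c"
  by (auto simp: half_unit_def half_line_def split: if_splits)

context rat_dual_basis
begin

definition half_cone :: "bool \<Rightarrow> nat set \<Rightarrow> rat vec set" where
  "half_cone c I = {x \<in> carrier_vec n. \<forall>i<n. (i \<notin> I \<longrightarrow> w i \<bullet> x = 0) \<and> (i \<in> I \<longrightarrow> w i \<bullet> x \<in> half_line c)}"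

text \<open>The lattice points of the half-open parallelepiped spanned by the edges in I. For
  integral edges they represent the lattice of the span modulo the lattice generated by these
  edges.\<close>

definition box :: "bool \<Rightarrow> nat set \<Rightarrow> rat vec set" where
  "box c I = {x \<in> int_lattice n. \<forall>i<n. (i \<notin> I \<longrightarrow> w i \<bullet> x = 0) \<and> (i \<in> I \<longrightarrow> w i \<bullet> x \<in> half_unit c)}"

lemma half_cone_eq: "half_cone True I = coord_cone n w I {}" "half_cone False I = coord_interior n w I {}"
  by (auto simp: half_cone_def coord_cone_def coord_interior_def half_line_def)

lemma int_latticeD: "x \<in> int_lattice n \<Longrightarrow> x \<in> carrier_vec n"
  by (simp add: int_lattice_def)

lemma int_lattice_add: "x \<in> int_lattice n \<Longrightarrow> y \<in> int_lattice n \<Longrightarrow> x + y \<in> (int_lattice n :: rat vec set)"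
  by (auto simp: int_lattice_def)

lemma int_lattice_diff: "x \<in> int_lattice n \<Longrightarrow> y \<in> int_lattice n \<Longrightarrow> x - y \<in> (int_lattice n :: rat vec set)"
  by (auto simp: int_lattice_def)

lemma comb_int_lattice:
  assumes "\<And>i. i < n \<Longrightarrow> c i \<noteq> 0 \<Longrightarrow> v i \<in> int_lattice n" "\<And>i. c i \<in> \<int>"
  shows "comb c \<in> int_lattice n"
  unfolding int_lattice_def
proof (intro CollectI conjI allI impI)
  fix k assume k: "k < n"
  have "(\<Sum>i<n. c i * v i $ k) \<in> \<int>"
  proof (intro Ints_sum)
    fix i assume "i \<in> {..<n}"
    then show "c i * v i $ k \<in> \<int>"
      using assms k by (cases "c i = 0") (auto simp: int_lattice_def)
  qed
  then show "comb c $ k \<in> \<int>" using k by (simp add: comb_def)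
qed simp

definition shift :: "nat set \<Rightarrow> rat vec \<Rightarrow> (nat \<Rightarrow> nat) \<Rightarrow> rat vec" where
  "shift I b k = b + comb (\<lambda>i. if i \<in> I then of_nat (k i) else 0)"

lemma coord_shift:
  "b \<in> carrier_vec n \<Longrightarrow> i < n \<Longrightarrow> w i \<bullet> shift I b k = w i \<bullet> b + (if i \<in> I then of_nat (k i) else 0)"
  by (simp add: shift_def coord_add)

text \<open>A lattice point of the half-open cone is in exactly one way a box point plus natural
  multiples of the edges, because each coordinate has a unique representative in
  \<open>half_unit c\<close>. The summand E is abstract so that one statement serves the
  exponentials and their absolute values.\<close>

lemma has_sum_half_cone:
  fixes E :: "rat vec \<Rightarrow> 'c::{real_normed_field, banach}"
  assumes I: "I \<subseteq> {..<n}" and vI: "\<And>i. i \<in> I \<Longrightarrow> v i \<in> int_lattice n" and fin: "finite (box c I)"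
    and E: "\<And>b k. b \<in> box c I \<Longrightarrow> E (shift I b k) = E b * (\<Prod>i\<in>I. x i ^ k i)"
    and x: "\<And>i. i \<in> I \<Longrightarrow> norm (x i) < 1"
  shows "(E has_sum (\<Sum>b\<in>box c I. E b) / (\<Prod>i\<in>I. 1 - x i)) (half_cone c I \<inter> int_lattice n)"
proof -
  define T where "T = (\<lambda>b. shift I b ` (PiE I (\<lambda>_. UNIV :: nat set)))"
  have finI: "finite I" using I finite_subset by blast
  have bc: "b \<in> carrier_vec n" if "b \<in> box c I" for b using that by (simp add: box_def int_lattice_def)
  have inj: "inj_on (shift I b) (PiE I (\<lambda>_. UNIV))" if b: "b \<in> box c I" for b
  proof (rule inj_onI)
    fix k l assume kl: "k \<in> PiE I (\<lambda>_. UNIV)" "l \<in> PiE I (\<lambda>_. UNIV)" "shift I b k = shift I b l"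
    have "k i = l i" if "i \<in> I" for i
    proof -
      have "i < n" using that I by blast
      then have "w i \<bullet> shift I b k = w i \<bullet> b + of_nat (k i)" "w i \<bullet> shift I b l = w i \<bullet> b + of_nat (l i)"
        using that bc[OF b] by (simp_all add: coord_shift)
      then show ?thesis using kl(3) by simp
    qed
    then show "k = l" using kl by (intro PiE_ext)
  qed
  have "(E has_sum (E b * (\<Prod>i\<in>I. 1 / (1 - x i)))) (T b)" if b: "b \<in> box c I" for b
  proof -
    have "((\<lambda>k. E b * (\<Prod>i\<in>I. x i ^ k i)) has_sum (E b * (\<Prod>i\<in>I. 1 / (1 - x i)))) (PiE I (\<lambda>_. UNIV))"
      by (intro has_sum_cmult_right has_sum_geometric_PiE finI x)
    then show ?thesis
      unfolding T_def has_sum_reindex[OF inj[OF b]] o_def using E[OF b] by simp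
  qed
  moreover have "T b \<inter> T b' = {}" if b: "b \<in> box c I" "b' \<in> box c I" "b \<noteq> b'" for b b'
  proof (rule ccontr)
    assume "T b \<inter> T b' \<noteq> {}"
    then obtain k l where kl: "shift I b k = shift I b' l" by (auto simp: T_def)
    have "b = b'"
    proof (rule coords_eqI[OF bc[OF b(1)] bc[OF b(2)]])
      fix i assume i: "i < n"
      show "w i \<bullet> b = w i \<bullet> b'"
      proof (cases "i \<in> I")
        case True
        have "w i \<bullet> b + of_nat (k i) = w i \<bullet> b' + of_nat (l i)"
          using arg_cong[OF kl, of "\<lambda>z. w i \<bullet> z"] True i bc b by (simp add: coord_shift)
        then have eq: "w i \<bullet> b' = w i \<bullet> b - of_int (int (l i) - int (k i))" by simp
        have "w i \<bullet> b - of_int (int (l i) - int (k i)) \<in> half_unit c" "w i \<bullet> b - of_int 0 \<in> half_unit c"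
          unfolding eq[symmetric] using b True i by (auto simp: box_def)
        then have "int (l i) - int (k i) = 0" by (rule half_unit_unique)
        then show ?thesis using eq by simp
      qed (use b i in \<open>auto simp: box_def\<close>)
    qed
    with b show False by simp
  qed
  ultimately have "(E has_sum (\<Sum>b\<in>box c I. E b * (\<Prod>i\<in>I. 1 / (1 - x i)))) (\<Union>b\<in>box c I. T b)"
    by (intro sum_has_sum fin) auto
  moreover have "(\<Union>b\<in>box c I. T b) = half_cone c I \<inter> int_lattice n"
  proof (intro equalityI subsetI)
    fix z assume "z \<in> (\<Union>b\<in>box c I. T b)"
    then obtain b k where b: "b \<in> box c I" "z = shift I b k" by (auto simp: T_def)
    have "z \<in> int_lattice n"
      unfolding b(2) shift_def
      by (intro int_lattice_add comb_int_lattice) (use b(1) vI in \<open>auto simp: box_def split: if_splits\<close>)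
    moreover have "z \<in> half_cone c I"
      using b(1) bc[OF b(1)] int_latticeD[OF calculation]
      by (auto simp: half_cone_def b(2) coord_shift box_def half_line_add)
    ultimately show "z \<in> half_cone c I \<inter> int_lattice n" by simp
  next
    fix z assume z: "z \<in> half_cone c I \<inter> int_lattice n"
    then have zc: "z \<in> carrier_vec n" by (simp add: half_cone_def)
    have "\<exists>k. w i \<bullet> z - of_nat k \<in> half_unit c" if "i \<in> I" for i
    proof -
      obtain k :: int where k: "w i \<bullet> z - of_int k \<in> half_unit c" "w i \<bullet> z \<in> half_line c \<longleftrightarrow> 0 \<le> k"
        by (rule half_unit_decompose)
      have "i < n" using that I by blast
      then have "0 \<le> k" using z k(2) that by (simp add: half_cone_def)
      then have "w i \<bullet> z - of_nat (nat k) \<in> half_unit c" using k(1) by simp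
      then show ?thesis ..
    qed
    then obtain k where k: "\<And>i. i \<in> I \<Longrightarrow> w i \<bullet> z - of_nat (k i) \<in> half_unit c" by metis
    define u where "u = comb (\<lambda>i. if i \<in> I then of_nat (k i) else 0)"
    have u: "u \<in> int_lattice n"
      unfolding u_def by (intro comb_int_lattice) (use vI in \<open>auto split: if_splits\<close>)
    define b where "b = z - u"
    have b: "b \<in> box c I"
      using z k int_lattice_diff[of z u] u zc
      by (auto simp: box_def b_def coord_minus int_latticeD half_cone_def) (auto simp: u_def)
    have eq: "b + u = z"
    proof (rule eq_vecI)
      fix i assume "i < dim_vec z"
      then show "(b + u) $ i = z $ i" using zc int_latticeD[OF u] by (simp add: b_def)
    qed (use zc int_latticeD[OF u] in \<open>simp add: b_def\<close>)
    have "comb (\<lambda>i. if i \<in> I then of_nat (restrict k I i) else 0) = u"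
      unfolding u_def by (rule arg_cong[where f = comb]) (simp add: fun_eq_iff)
    then have "z = shift I b (restrict k I)" unfolding shift_def using eq by simp
    then have "z \<in> T b" unfolding T_def by (intro image_eqI[of _ _ "restrict k I"]) auto
    then show "z \<in> (\<Union>b\<in>box c I. T b)" using b by blast
  qed
  moreover have "(\<Sum>b\<in>box c I. E b * (\<Prod>i\<in>I. 1 / (1 - x i))) = (\<Sum>b\<in>box c I. E b) / (\<Prod>i\<in>I. 1 - x i)"
    by (simp add: sum_divide_distrib prod_dividef)
  ultimately show ?thesis by simp
qed

lemma exp_pair_expand:
  assumes \<xi>: "\<xi> \<in> carrier_vec n" and x: "x \<in> carrier_vec n"
  shows "\<xi> \<bullet> cvec x = (\<Sum>i<n. of_rat (w i \<bullet> x) * (\<xi> \<bullet> cvec (v i)))"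
proof -
  have cv: "\<xi> \<bullet> cvec z = (\<Sum>k<n. \<xi> $ k * of_rat (z $ k))" if "z \<in> carrier_vec n" for z
    using that \<xi> by (subst scalar_prod_sum[of _ n]) (auto simp: carrier_vecD intro!: sum.cong)
  have "\<xi> \<bullet> cvec x = (\<Sum>k<n. \<Sum>i<n. of_rat (w i \<bullet> x) * (\<xi> $ k * of_rat (v i $ k)))"
    unfolding cv[OF x]
  proof (intro sum.cong refl)
    fix k assume "k \<in> {..<n}"
    then have "x $ k = (\<Sum>i<n. (w i \<bullet> x) * v i $ k)" using expand[OF x] by blast
    then show "\<xi> $ k * of_rat (x $ k) = (\<Sum>i<n. of_rat (w i \<bullet> x) * (\<xi> $ k * of_rat (v i $ k)))"
      by (simp only: of_rat_sum of_rat_mult sum_distrib_left mult.left_commute)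
  qed
  also have "\<dots> = (\<Sum>i<n. of_rat (w i \<bullet> x) * (\<xi> \<bullet> cvec (v i)))"
    by (subst sum.swap, intro sum.cong refl) (simp add: cv sum_distrib_left)
  finally show ?thesis .
qed

lemma exp_pair_coord_space:
  assumes \<xi>: "\<xi> \<in> carrier_vec n" and x: "x \<in> coord_space n w I" and I: "I \<subseteq> {..<n}"
  shows "exp_pair \<xi> (cvec x) = (\<Prod>i\<in>I. exp (of_rat (w i \<bullet> x) * (\<xi> \<bullet> cvec (v i))))"
proof -
  have xc: "x \<in> carrier_vec n" using x by (simp add: coord_cone_def)
  have "\<xi> \<bullet> cvec x = (\<Sum>i\<in>I. of_rat (w i \<bullet> x) * (\<xi> \<bullet> cvec (v i)))"
    unfolding exp_pair_expand[OF \<xi> xc]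
    by (rule sum.mono_neutral_right) (use I x in \<open>auto simp: coord_cone_def\<close>)
  moreover have "finite I" using I finite_subset by blast
  ultimately show ?thesis by (simp add: exp_pair_def exp_sum)
qed

definition cone_sum :: "bool \<Rightarrow> nat set \<Rightarrow> complex vec \<Rightarrow> complex" where
  "cone_sum c I \<xi> = (\<Sum>b\<in>box c I. \<Prod>i\<in>I. exp (of_rat (w i \<bullet> b) * (\<xi> \<bullet> cvec (v i)))) /
     (\<Prod>i\<in>I. 1 - exp (\<xi> \<bullet> cvec (v i)))"

text \<open>Minus d times the sum of the \<open>w i\<close>. It pairs to -d with every edge and so
  provides points of the region of convergence arbitrarily close to 0.\<close>

definition neg_dir :: "real \<Rightarrow> complex vec" where
  "neg_dir d = vec n (\<lambda>k. - of_real d * (\<Sum>i<n. of_rat (w i $ k)))"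

lemma neg_dir_carrier [simp]: "neg_dir d \<in> carrier_vec n"
  by (simp add: neg_dir_def)

lemma neg_dir_pair:
  assumes "j < n"
  shows "neg_dir d \<bullet> cvec (v j) = - of_real d"
proof -
  have "neg_dir d \<bullet> cvec (v j) = (\<Sum>k<n. \<Sum>i<n. - of_real d * of_rat (w i $ k * v j $ k))"
    using v_carrier[OF assms] carrier_vecD[OF v_carrier[OF assms]]
    by (simp add: scalar_prod_sum[of _ n] neg_dir_def sum_distrib_left sum_distrib_right of_rat_mult algebra_simps)
  also have "\<dots> = - of_real d * (\<Sum>i<n. of_rat (w i \<bullet> v j))"
    using v_carrier[OF assms]
    by (subst sum.swap) (simp add: scalar_prod_sum[of _ n] sum_distrib_left of_rat_sum)
  also have "(\<Sum>i<n. of_rat (w i \<bullet> v j) :: complex) = (\<Sum>i<n. if i = j then 1 else 0)"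
    using assms by (intro sum.cong) (auto simp: pairing)
  finally show ?thesis using assms by simp
qed

lemma neg_dir_small:
  assumes "s > 0"
  obtains d where "d > 0" "neg_dir d \<in> polydisc (0\<^sub>v n) s"
proof -
  define M where "M = (\<Sum>k<n. cmod (\<Sum>i<n. of_rat (w i $ k))) + 1"
  have M: "M > 0" unfolding M_def by (intro add_nonneg_pos sum_nonneg) auto
  have "neg_dir (s / M) \<in> polydisc (0\<^sub>v n) s"
    unfolding polydisc_iff
  proof (intro conjI allI impI)
    fix k assume "k < dim_vec (0\<^sub>v n :: complex vec)"
    then have k: "k < n" by simp
    have "cmod (\<Sum>i<n. of_rat (w i $ k)) \<le> (\<Sum>k<n. cmod (\<Sum>i<n. of_rat (w i $ k)))"
      using k by (intro member_le_sum[of k "{..<n}" "\<lambda>k. cmod (\<Sum>i<n. of_rat (w i $ k))"]) auto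
    then have "cmod (\<Sum>i<n. of_rat (w i $ k)) < M" by (simp add: M_def)
    then have "s / M * cmod (\<Sum>i<n. of_rat (w i $ k)) < s / M * M"
      using assms M by (intro mult_strict_left_mono) auto
    then show "cmod (neg_dir (s / M) $ k - 0\<^sub>v n $ k) < s"
      using k assms M by (simp add: neg_dir_def norm_mult norm_divide)
  qed (simp add: neg_dir_def)
  then show thesis using that[of "s / M"] assms M by simp
qed

definition neg_region :: "nat set \<Rightarrow> complex vec set" where
  "neg_region I = {\<xi> \<in> carrier_vec n. \<forall>i\<in>I. Re (\<xi> \<bullet> cvec (v i)) < 0}"

lemma neg_region_open:
  assumes "I \<subseteq> {..<n}"
  shows "open_cn (neg_region I)"
proof -
  have "finite I" using assms finite_subset by blast
  then show ?thesis using assms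
  proof (induction I)
    case empty
    then show ?case by (simp add: neg_region_def open_cn_carrier)
  next
    case (insert i I)
    have "open_cn {\<xi> \<in> carrier_vec n. \<xi> \<bullet> cvec (v i) \<in> {z. Re z < 0}}"
      using insert.prems by (intro open_cn_linear_preimage) (auto simp: open_halfspace_Re_lt)
    moreover have "neg_region (insert i I) = neg_region I \<inter> {\<xi> \<in> carrier_vec n. \<xi> \<bullet> cvec (v i) \<in> {z. Re z < 0}}"
      by (auto simp: neg_region_def)
    ultimately show ?case using open_cn_Int insert by auto
  qed
qed

lemma neg_region_accumulates:
  assumes "I \<subseteq> {..<n}" "s > 0"
  shows "neg_region I \<inter> polydisc (0\<^sub>v n) s \<noteq> {}"
proof -
  obtain d where "d > 0" "neg_dir d \<in> polydisc (0\<^sub>v n) s" by (rule neg_dir_small[OF assms(2)])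
  then have "neg_dir d \<in> neg_region I \<inter> polydisc (0\<^sub>v n) s"
    using assms neg_dir_pair by (auto simp: neg_region_def subset_iff)
  then show ?thesis by blast
qed

text \<open>The common shape of sums and integrals over a simplicial cone: \<phi> y is 1 - exp y for
  sums and -y for integrals. Both are nonzero for Re y < 0, which supplies the point where a
  meromorphic denominator must not vanish.\<close>

lemma cone_quotient:
  fixes g h :: "complex vec \<Rightarrow> complex"
  assumes I: "I \<subseteq> {..<n}" and g: "holomorphic_cn n g (carrier_vec n)" and \<phi>: "\<phi> holomorphic_on UNIV"
    and nz: "\<And>y. Re y < 0 \<Longrightarrow> \<phi> y \<noteq> 0"
  shows "(\<lambda>\<xi>. g \<xi> / (\<Prod>i\<in>I. \<phi> (\<xi> \<bullet> cvec (v i)))) \<in> meromorphic_cn n"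
    and "\<xi> \<in> neg_region I \<Longrightarrow>
      has_value n (\<lambda>\<xi>. g \<xi> / (\<Prod>i\<in>I. \<phi> (\<xi> \<bullet> cvec (v i)))) \<xi> (g \<xi> / (\<Prod>i\<in>I. \<phi> (\<xi> \<bullet> cvec (v i))))"
proof -
  have finI: "finite I" using I finite_subset by blast
  have h: "holomorphic_cn n (\<lambda>\<xi>. \<Prod>i\<in>I. \<phi> (\<xi> \<bullet> cvec (v i))) (carrier_vec n)"
    by (intro holomorphic_cn_prod holomorphic_cn_compose[where \<phi> = \<phi> and S = UNIV] \<phi> holomorphic_cn_linear)
       (use I in auto)
  have nz': "(\<Prod>i\<in>I. \<phi> (\<xi> \<bullet> cvec (v i))) \<noteq> 0" if "\<xi> \<in> neg_region I" for \<xi>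
    using that nz finI by (auto simp: neg_region_def)
  obtain z0 where "z0 \<in> neg_region I" using neg_region_accumulates[OF I, of 1] by auto
  then show "(\<lambda>\<xi>. g \<xi> / (\<Prod>i\<in>I. \<phi> (\<xi> \<bullet> cvec (v i)))) \<in> meromorphic_cn n"
    by (intro quotient_meromorphic[OF g h, of z0] nz') (auto simp: neg_region_def)
  show "has_value n (\<lambda>\<xi>. g \<xi> / (\<Prod>i\<in>I. \<phi> (\<xi> \<bullet> cvec (v i)))) \<xi> (g \<xi> / (\<Prod>i\<in>I. \<phi> (\<xi> \<bullet> cvec (v i))))"
    if "\<xi> \<in> neg_region I"
    by (rule quotient_has_value[OF g h _ nz'[OF that]]) (use that in \<open>simp add: neg_region_def\<close>)
qed

text \<open>\<open>exp_sum\<close> is an arbitrary choice, so the closed form is shown to satisfy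
  \<open>is_exp_sum\<close>, and the values of the chosen function follow from this property. Since
  the property prescribes a value wherever the series converges absolutely, the converse is required
  as well: absolute convergence forces membership in \<open>neg_region I\<close>.\<close>

lemma exp_sum_half_cone:
  assumes I: "I \<subseteq> {..<n}" and vI: "\<And>i. i \<in> I \<Longrightarrow> v i \<in> int_lattice n"
    and fin: "finite (box c I)" and ne: "box c I \<noteq> {}" and \<xi>: "\<xi> \<in> neg_region I"
  shows "has_value n (exp_sum n (half_cone c I)) \<xi> (cone_sum c I \<xi>)"
proof -
  have finI: "finite I" using I finite_subset by blast
  have noline: "\<not> contains_line n (half_cone c I)"
    by (rule no_line_coord_cone[of _ I]) (auto simp: half_cone_def coord_cone_def half_line_def split: if_splits)
  have box_space: "shift I b k \<in> coord_space n w I" "b \<in> coord_space n w I" if "b \<in> box c I" for b k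
  proof -
    have "b \<in> carrier_vec n" using that by (simp add: box_def int_lattice_def)
    then show "b \<in> coord_space n w I" "shift I b k \<in> coord_space n w I"
      using that by (auto simp: coord_cone_def box_def coord_shift) (simp_all add: shift_def)
  qed
  have factor: "exp_pair \<xi> (cvec (shift I b k)) = exp_pair \<xi> (cvec b) * (\<Prod>i\<in>I. exp (\<xi> \<bullet> cvec (v i)) ^ k i)"
    if b: "b \<in> box c I" and \<xi>: "\<xi> \<in> carrier_vec n" for b k \<xi>
  proof -
    have bc: "b \<in> carrier_vec n" using b by (simp add: box_def int_lattice_def)
    have "exp (of_rat (w i \<bullet> shift I b k) * (\<xi> \<bullet> cvec (v i)))
        = exp (of_rat (w i \<bullet> b) * (\<xi> \<bullet> cvec (v i))) * exp (\<xi> \<bullet> cvec (v i)) ^ k i" if "i \<in> I" for i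
      using that I bc by (simp add: coord_shift subset_iff of_rat_add distrib_right exp_add flip: exp_of_nat_mult)
    then show ?thesis
      unfolding exp_pair_coord_space[OF \<xi> box_space(1)[OF b] I] exp_pair_coord_space[OF \<xi> box_space(2)[OF b] I]
      by (simp add: prod.distrib)
  qed
  have sum: "((\<lambda>x. exp_pair \<xi> (cvec x)) has_sum cone_sum c I \<xi>) (half_cone c I \<inter> int_lattice n)"
    if \<xi>: "\<xi> \<in> neg_region I" for \<xi>
  proof -
    have \<xi>c: "\<xi> \<in> carrier_vec n" using \<xi> by (simp add: neg_region_def)
    have "((\<lambda>x. exp_pair \<xi> (cvec x)) has_sum (\<Sum>b\<in>box c I. exp_pair \<xi> (cvec b)) / (\<Prod>i\<in>I. 1 - exp (\<xi> \<bullet> cvec (v i))))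
          (half_cone c I \<inter> int_lattice n)"
      by (rule has_sum_half_cone[OF I vI fin]) (use factor \<xi>c \<xi> in \<open>auto simp: neg_region_def\<close>)
    then show ?thesis
      unfolding cone_sum_def by (simp add: exp_pair_coord_space[OF \<xi>c box_space(2) I] cong: sum.cong)
  qed
  have norm_sum: "(\<lambda>x. norm (exp_pair \<xi> (cvec x))) summable_on (half_cone c I \<inter> int_lattice n)"
    if \<xi>: "\<xi> \<in> neg_region I" for \<xi>
  proof -
    have "((\<lambda>x. norm (exp_pair \<xi> (cvec x))) has_sum (\<Sum>b\<in>box c I. norm (exp_pair \<xi> (cvec b))) / (\<Prod>i\<in>I. 1 - norm (exp (\<xi> \<bullet> cvec (v i)))))
          (half_cone c I \<inter> int_lattice n)"
      by (rule has_sum_half_cone[OF I vI fin])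
         (use factor \<xi> in \<open>auto simp: neg_region_def norm_mult norm_power simp flip: prod_norm\<close>)
    then show ?thesis by (auto simp: summable_on_def)
  qed
  have conv: "\<xi> \<in> neg_region I"
    if \<xi>: "\<xi> \<in> carrier_vec n" and summ: "(\<lambda>x. norm (exp_pair \<xi> (cvec x))) summable_on (half_cone c I \<inter> int_lattice n)" for \<xi>
  proof -
    obtain b where b: "b \<in> box c I" using ne by blast
    have bc: "b \<in> carrier_vec n" using b by (simp add: box_def int_lattice_def)
    have "Re (\<xi> \<bullet> cvec (v i)) < 0" if i: "i \<in> I" for i
    proof -
      \<comment> \<open>The points of a single box point plus multiples of one edge. In absolute
        value the subseries is geometric with ratio exp (Re (\<xi> . v i)), so its convergence makes
        that real part negative.\<close>
      define f where "f = (\<lambda>k::nat. shift I b (\<lambda>j. if j = i then k else 0))"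
      have i': "i < n" using i I by blast
      have "inj f"
      proof (rule injI)
        fix k l assume "f k = f l"
        then have "w i \<bullet> f k = w i \<bullet> f l" by simp
        then show "k = l" using i i' bc by (simp add: f_def coord_shift)
      qed
      have "f k \<in> int_lattice n" for k
        unfolding f_def shift_def
        by (intro int_lattice_add comb_int_lattice) (use b vI in \<open>auto simp: box_def split: if_splits\<close>)
      moreover have "f k \<in> half_cone c I" for k
      proof -
        have "f k \<in> carrier_vec n" using bc by (simp add: f_def shift_def)
        then show ?thesis
          using b bc half_line_add[of _ c 0] half_line_add[of _ c k]
          by (auto simp: half_cone_def f_def coord_shift box_def)
      qed
      ultimately have "range f \<subseteq> half_cone c I \<inter> int_lattice n" by blast
      then have "(\<lambda>x. norm (exp_pair \<xi> (cvec x))) summable_on range f"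
        using summ summable_on_subset_banach by blast
      then have "(\<lambda>k. norm (exp_pair \<xi> (cvec (f k)))) summable_on UNIV"
        unfolding summable_on_reindex[OF \<open>inj f\<close>] by (simp add: o_def)
      moreover have "norm (exp_pair \<xi> (cvec (f k))) = norm (exp_pair \<xi> (cvec b)) * exp (Re (\<xi> \<bullet> cvec (v i))) ^ k" for k
      proof -
        have "(\<Prod>j\<in>I. exp (\<xi> \<bullet> cvec (v j)) ^ (if j = i then k else 0)) = exp (\<xi> \<bullet> cvec (v i)) ^ k"
          using i finI by (subst prod.remove[of _ i]) auto
        then show ?thesis
          unfolding f_def factor[OF b \<xi>] by (simp add: norm_mult norm_power)
      qed
      ultimately have "(\<lambda>k. exp (Re (\<xi> \<bullet> cvec (v i))) ^ k) summable_on (UNIV :: nat set)"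
        by (simp add: summable_on_cmult_right' exp_pair_def)
      then have "summable (\<lambda>k. exp (Re (\<xi> \<bullet> cvec (v i))) ^ k)" by (rule summable_on_imp_summable)
      then show ?thesis by (simp add: summable_geometric_iff)
    qed
    then show ?thesis using \<xi> by (simp add: neg_region_def)
  qed
  have g: "holomorphic_cn n (\<lambda>\<xi>. \<Sum>b\<in>box c I. \<Prod>i\<in>I. exp (of_rat (w i \<bullet> b) * (\<xi> \<bullet> cvec (v i)))) (carrier_vec n)"
    by (intro holomorphic_cn_sum holomorphic_cn_prod holomorphic_cn_compose[where \<phi> = exp and S = UNIV]
        holomorphic_cn_cmult holomorphic_cn_linear) (use I in \<open>auto intro: holomorphic_intros\<close>)
  have nz: "1 - exp y \<noteq> 0" if "Re y < 0" for y :: complex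
  proof
    assume "1 - exp y = 0"
    then have "norm (exp y) = 1" by simp
    with that show False by simp
  qed
  have hol: "(\<lambda>y::complex. 1 - exp y) holomorphic_on UNIV" by (intro holomorphic_intros)
  have "is_exp_sum n (half_cone c I) (cone_sum c I)"
    unfolding is_exp_sum_def
  proof (intro conjI)
    show "cone_sum c I \<in> meromorphic_cn n"
      using cone_quotient(1)[OF I g hol nz] unfolding cone_sum_def[abs_def] .
    have "has_value n (cone_sum c I) \<xi> (cone_sum c I \<xi>)" if "\<xi> \<in> neg_region I" for \<xi>
      using cone_quotient(2)[OF I g hol nz that] unfolding cone_sum_def[abs_def] .
    then show "if contains_line n (half_cone c I) then mero_eq n (cone_sum c I) (\<lambda>_. 0)
      else \<forall>\<xi>\<in>carrier_vec n. (\<lambda>x. norm (exp_pair \<xi> (cvec x))) summable_on half_cone c I \<inter> int_lattice n \<longrightarrow>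
        has_value n (cone_sum c I) \<xi> (\<Sum>\<^sub>\<infinity>x\<in>half_cone c I \<inter> int_lattice n. exp_pair \<xi> (cvec x))"
      using noline conv sum infsumI by metis
  qed
  then have "is_exp_sum n (half_cone c I) (exp_sum n (half_cone c I))"
    unfolding exp_sum_def by (rule someI[of "is_exp_sum n (half_cone c I)"])
  then have "has_value n (exp_sum n (half_cone c I)) \<xi> (\<Sum>\<^sub>\<infinity>x\<in>half_cone c I \<inter> int_lattice n. exp_pair \<xi> (cvec x))"
    unfolding is_exp_sum_def using noline norm_sum[OF \<xi>] \<xi> by (auto simp: neg_region_def)
  then show ?thesis using infsumI[OF sum[OF \<xi>]] by simp
qed

end

subsection \<open>Exponential integrals over orthants in affine coordinates\<close>

text \<open>The indicator is built in so that a product of such functions, evaluated at the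
  coordinates of a point, is the exponential on the cone extended by zero.\<close>

definition exp_ray :: "complex \<Rightarrow> real \<Rightarrow> complex" where
  "exp_ray y t = indicator {0..} t *\<^sub>R exp (y * of_real t)"

lemma exp_ray_measurable [measurable]: "exp_ray y \<in> borel_measurable borel"
proof -
  have "continuous_on UNIV (\<lambda>t::real. exp (y * of_real t))" by (intro continuous_intros)
  then have [measurable]: "(\<lambda>t::real. exp (y * of_real t)) \<in> borel_measurable borel"
    by (rule borel_measurable_continuous_onI)
  show ?thesis unfolding exp_ray_def[abs_def] by measurable
qed

lemma norm_exp_ray: "norm (exp_ray y t) = indicator {0..} t * exp (Re y * t)"
  by (simp add: exp_ray_def)

lemma has_bochner_integral_exp_ray:
  assumes "Re y < 0"
  shows "has_bochner_integral lborel (exp_ray y) (- 1 / y)"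
proof -
  have y: "y \<noteq> 0" using assms by auto
  have int: "integrable lborel (exp_ray y)"
  proof (rule integrableI_bounded)
    have "((\<lambda>t. exp (Re y * t) / Re y) \<longlongrightarrow> 0 / Re y) at_top"
      using assms by (intro tendsto_divide tendsto_const filterlim_compose[OF exp_at_bot] filterlim_tendsto_neg_mult_at_bot[OF tendsto_const])
        (auto simp: filterlim_ident)
    then have "(\<integral>\<^sup>+t. ennreal (exp (Re y * t)) * indicator {0..} t \<partial>lborel) = ennreal (0 - exp (Re y * 0) / Re y)"
      using assms by (intro nn_integral_FTC_atLeast) (auto intro!: derivative_eq_intros)
    also have "(\<integral>\<^sup>+t. ennreal (exp (Re y * t)) * indicator {0..} t \<partial>lborel) = (\<integral>\<^sup>+t. norm (exp_ray y t) \<partial>lborel)"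
      by (intro nn_integral_cong) (auto simp: norm_exp_ray indicator_def)
    finally show "(\<integral>\<^sup>+t. norm (exp_ray y t) \<partial>lborel) < \<infinity>" by simp
  qed simp
  have lim1: "((\<lambda>b. \<integral>t. indicator {..b} t *\<^sub>R exp_ray y t \<partial>lborel) \<longlongrightarrow> integral\<^sup>L lborel (exp_ray y)) at_top"
    by (rule tendsto_integral_at_top[OF _ int]) simp
  have fin: "(\<integral>t. indicator {..b} t *\<^sub>R exp_ray y t \<partial>lborel) = exp (y * of_real b) / y - 1 / y" if "b \<ge> 0" for b
  proof -
    have "(\<integral>t. indicator {..b} t *\<^sub>R exp_ray y t \<partial>lborel) = (\<integral>t. indicator {0..b} t *\<^sub>R exp (y * of_real t) \<partial>lborel)"
      by (intro Bochner_Integration.integral_cong) (auto simp: exp_ray_def indicator_def)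
    also have "\<dots> = exp (y * of_real b) / y - exp (y * of_real 0) / y"
    proof (rule integral_FTC_atLeastAtMost[OF that])
      fix t :: real
      have "((\<lambda>z. exp (y * z) / y) has_field_derivative exp (y * of_real t)) (at (of_real t))"
        using y by (auto intro!: derivative_eq_intros)
      then have "((\<lambda>t. exp (y * of_real t) / y) has_vector_derivative exp (y * of_real t)) (at t)"
        by (rule has_vector_derivative_real_field)
      then show "((\<lambda>t. exp (y * of_real t) / y) has_vector_derivative exp (y * of_real t)) (at t within {0..b})"
        by (rule has_vector_derivative_at_within)
    qed (intro continuous_intros)
    finally show ?thesis by simp
  qed
  have "((\<lambda>b. exp (y * of_real b) / y - 1 / y) \<longlongrightarrow> 0 / y - 1 / y) at_top"
  proof (intro tendsto_intros y)
    have "((\<lambda>b. exp (Re y * b)) \<longlongrightarrow> 0) at_top"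
      using assms by (intro filterlim_compose[OF exp_at_bot] filterlim_tendsto_neg_mult_at_bot[OF tendsto_const])
        (auto simp: filterlim_ident)
    then show "((\<lambda>b. exp (y * complex_of_real b)) \<longlongrightarrow> 0) at_top"
      by (intro tendsto_norm_zero_cancel[of "\<lambda>b. exp (y * complex_of_real b)"]) simp
  qed
  then have "((\<lambda>b. \<integral>t. indicator {..b} t *\<^sub>R exp_ray y t \<partial>lborel) \<longlongrightarrow> 0 / y - 1 / y) at_top"
    by (rule Lim_transform_eventually) (auto intro: eventually_mono[OF eventually_ge_at_top[of 0]] simp: fin)
  then have "integral\<^sup>L lborel (exp_ray y) = 0 / y - 1 / y"
    by (rule tendsto_unique[OF trivial_limit_at_top_linorder lim1])
  then show ?thesis using int by (simp add: has_bochner_integral_iff)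
qed

lemma integrable_exp_ray_iff: "integrable lborel (exp_ray y) \<longleftrightarrow> Re y < 0"
proof
  assume int: "integrable lborel (exp_ray y)"
  show "Re y < 0"
  proof (rule ccontr)
    assume "\<not> Re y < 0"
    \<comment> \<open>If Re y is not negative, the modulus dominates the indicator of [0, k] for
      every k, so the integral would exceed all bounds.\<close>
    then have bound: "norm (indicator {0..k} t :: real) \<le> norm (exp_ray y t)" for k t
      by (auto simp: norm_exp_ray indicator_def)
    have "k \<le> integral\<^sup>L lborel (\<lambda>t. norm (exp_ray y t))" if "k \<ge> 0" for k :: real
    proof -
      have "k = integral\<^sup>L lborel (indicator {0..k} :: real \<Rightarrow> real)" using that by simp
      also have "\<dots> \<le> integral\<^sup>L lborel (\<lambda>t. norm (exp_ray y t))"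
        using bound that by (intro integral_mono integrable_norm int) auto
      finally show ?thesis .
    qed
    from this[of "\<bar>integral\<^sup>L lborel (\<lambda>t. norm (exp_ray y t))\<bar> + 1"] show False by linarith
  qed
next
  assume "Re y < 0"
  then show "integrable lborel (exp_ray y)"
    using has_bochner_integral_exp_ray by (auto simp: has_bochner_integral_iff)
qed

interpretation lborel_pair: pair_sigma_finite "lborel :: real measure" "lborel :: real measure" ..

lemma exp_ray_prod:
  fixes y z :: complex
  defines "f \<equiv> \<lambda>(s, t). exp_ray y s * exp_ray z t"
  shows "integrable (lborel \<Otimes>\<^sub>M lborel) f \<longleftrightarrow> Re y < 0 \<and> Re z < 0"
    and "Re y < 0 \<Longrightarrow> Re z < 0 \<Longrightarrow> integral\<^sup>L (lborel \<Otimes>\<^sub>M lborel) f = 1 / (y * z)"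
proof -
  have [measurable]: "f \<in> borel_measurable (lborel \<Otimes>\<^sub>M lborel)"
    unfolding f_def by measurable
  \<comment> \<open>An almost everywhere statement holds at some s in the half-line, because [0, 1]
    is not a null set. At such an s the first factor is nonzero and can be divided out.\<close>
  have nz: "\<exists>s\<in>{0..}. P s" if "AE s in lborel. P s" for P :: "real \<Rightarrow> bool"
  proof (rule ccontr)
    assume "\<not> (\<exists>s\<in>{0..}. P s)"
    then have "AE s in lborel. s \<notin> {0..1::real}"
      using that by (auto elim!: eventually_mono)
    then have "{0..1::real} \<in> null_sets lborel"
      by (subst AE_iff_null_sets) auto
    then show False by (auto dest: null_setsD1)
  qed
  have half: "Re z < 0" if "integrable (lborel \<Otimes>\<^sub>M lborel) (\<lambda>(s, t). exp_ray y s * exp_ray z t)" for y z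
  proof -
    have "AE s in lborel. integrable lborel (\<lambda>t. exp_ray y s * exp_ray z t)"
      using lborel_pair.AE_integrable_fst'[OF that] by simp
    then obtain s :: real where s: "s \<ge> 0" "integrable lborel (\<lambda>t. exp_ray y s * exp_ray z t)"
      using nz by fastforce
    have "exp_ray y s \<noteq> 0" using s(1) by (simp add: exp_ray_def)
    then have "integrable lborel (exp_ray z)"
      using integrable_mult_right[of "inverse (exp_ray y s)" lborel "\<lambda>t. exp_ray y s * exp_ray z t"] s(2)
      by (simp add: mult.assoc[symmetric])
    then show ?thesis by (simp add: integrable_exp_ray_iff)
  qed
  have conv: "integrable (lborel \<Otimes>\<^sub>M lborel) f" if "Re y < 0" "Re z < 0"
  proof (rule lborel_pair.Fubini_integrable)
    have "integrable lborel (\<lambda>s. norm (exp_ray y s) * (\<integral>t. norm (exp_ray z t) \<partial>lborel))"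
      using that by (intro integrable_mult_left integrable_norm) (simp add: integrable_exp_ray_iff)
    then show "integrable lborel (\<lambda>x. \<integral>y. norm (f (x, y)) \<partial>lborel)"
      by (simp add: f_def norm_mult)
    show "AE x in lborel. integrable lborel (\<lambda>y. f (x, y))"
      using that by (auto simp: f_def integrable_exp_ray_iff)
  qed simp
  show "integrable (lborel \<Otimes>\<^sub>M lborel) f \<longleftrightarrow> Re y < 0 \<and> Re z < 0"
  proof
    assume int: "integrable (lborel \<Otimes>\<^sub>M lborel) f"
    have "integrable (lborel \<Otimes>\<^sub>M lborel) (\<lambda>(s, t). exp_ray z s * exp_ray y t)"
      using lborel_pair.integrable_product_swap[OF int] by (simp add: f_def mult.commute case_prod_unfold)
    then show "Re y < 0 \<and> Re z < 0" using half int by (auto simp: f_def)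
  qed (use conv in auto)
  assume yz: "Re y < 0" "Re z < 0"
  have "integral\<^sup>L (lborel \<Otimes>\<^sub>M lborel) f = (\<integral>s. (\<integral>t. f (s, t) \<partial>lborel) \<partial>lborel)"
    by (rule lborel_pair.integral_fst'[OF conv[OF yz], symmetric])
  also have "\<dots> = (\<integral>s. exp_ray y s * (- 1 / z) \<partial>lborel)"
    using has_bochner_integral_exp_ray[OF yz(2)] by (simp add: f_def has_bochner_integral_iff)
  also have "\<dots> = (- 1 / y) * (- 1 / z)"
    using has_bochner_integral_exp_ray[OF yz(1)] by (simp add: has_bochner_integral_iff)
  finally show "integral\<^sup>L (lborel \<Otimes>\<^sub>M lborel) f = 1 / (y * z)" by simp
qed

text \<open>Two substitutions on the line: with x fixed, v = \<beta> x + c t; then, with t fixed, x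
  = a + q t + p u. The factors |c| and |p| multiply to the absolute value of the
  determinant.\<close>

lemma nn_integral_affine_plane_aux:
  fixes h :: "real \<times> real \<Rightarrow> ennreal"
  assumes [measurable]: "h \<in> borel_measurable (lborel \<Otimes>\<^sub>M lborel)" and p: "p \<noteq> 0" and det: "p * s - q * r \<noteq> 0"
  shows "(\<integral>\<^sup>+z. h z \<partial>(lborel \<Otimes>\<^sub>M lborel)) =
    \<bar>p * s - q * r\<bar> * (\<integral>\<^sup>+t. \<integral>\<^sup>+u. h (a + p * u + q * t, b + r * u + s * t) \<partial>lborel \<partial>lborel)"
proof -
  define c where "c = (p * s - q * r) / p"
  have c: "c \<noteq> 0" using p det by (simp add: c_def)
  define \<beta> where "\<beta> = (\<lambda>x. b + r / p * (x - a))"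
  have [measurable]: "\<beta> \<in> borel_measurable borel" unfolding \<beta>_def by measurable
  have 1: "(\<integral>\<^sup>+v. h (x, v) \<partial>lborel) = \<bar>c\<bar> * (\<integral>\<^sup>+t. h (x, \<beta> x + c * t) \<partial>lborel)" for x
    by (rule nn_integral_real_affine[OF _ c]) simp
  have 2: "(\<integral>\<^sup>+x. h (x, \<beta> x + c * t) \<partial>lborel) = \<bar>p\<bar> * (\<integral>\<^sup>+u. h ((a + q * t) + p * u, \<beta> ((a + q * t) + p * u) + c * t) \<partial>lborel)" for t
    by (rule nn_integral_real_affine[OF _ p, where f = "\<lambda>x. h (x, \<beta> x + c * t)"]) simp
  have 3: "\<beta> ((a + q * t) + p * u) + c * t = b + r * u + s * t" for t u
    using p by (simp add: \<beta>_def c_def field_simps)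
  have "(\<integral>\<^sup>+z. h z \<partial>(lborel \<Otimes>\<^sub>M lborel)) = (\<integral>\<^sup>+x. \<integral>\<^sup>+v. h (x, v) \<partial>lborel \<partial>lborel)"
    by (rule lborel.nn_integral_fst[symmetric]) simp
  also have "\<dots> = \<bar>c\<bar> * (\<integral>\<^sup>+x. \<integral>\<^sup>+t. h (x, \<beta> x + c * t) \<partial>lborel \<partial>lborel)"
    unfolding 1 by (rule nn_integral_cmult) simp
  also have "(\<integral>\<^sup>+x. \<integral>\<^sup>+t. h (x, \<beta> x + c * t) \<partial>lborel \<partial>lborel) = (\<integral>\<^sup>+t. \<integral>\<^sup>+x. h (x, \<beta> x + c * t) \<partial>lborel \<partial>lborel)"
    by (rule lborel_pair.Fubini'[symmetric]) simp
  also have "\<dots> = \<bar>p\<bar> * (\<integral>\<^sup>+t. \<integral>\<^sup>+u. h (a + p * u + q * t, b + r * u + s * t) \<partial>lborel \<partial>lborel)"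
    unfolding 2 3 by (subst nn_integral_cmult) (auto simp: algebra_simps)
  finally have "(\<integral>\<^sup>+z. h z \<partial>(lborel \<Otimes>\<^sub>M lborel)) = ennreal \<bar>c\<bar> * (ennreal \<bar>p\<bar> *
     (\<integral>\<^sup>+t. \<integral>\<^sup>+u. h (a + p * u + q * t, b + r * u + s * t) \<partial>lborel \<partial>lborel))" .
  moreover have "ennreal \<bar>p * s - q * r\<bar> = ennreal \<bar>c\<bar> * ennreal \<bar>p\<bar>"
    using p by (simp add: c_def abs_mult flip: ennreal_mult)
  ultimately show ?thesis by (simp add: mult.assoc)
qed

lemma nn_integral_affine_plane:
  fixes h :: "real \<times> real \<Rightarrow> ennreal"
  assumes [measurable]: "h \<in> borel_measurable (lborel \<Otimes>\<^sub>M lborel)" and det: "p * s - q * r \<noteq> 0"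
  shows "(\<integral>\<^sup>+z. h z \<partial>(lborel \<Otimes>\<^sub>M lborel)) =
    \<bar>p * s - q * r\<bar> * (\<integral>\<^sup>+z. h (a + p * fst z + q * snd z, b + r * fst z + s * snd z) \<partial>(lborel \<Otimes>\<^sub>M lborel))"
proof (cases "p = 0")
  case False
  have "(\<integral>\<^sup>+z. h (a + p * fst z + q * snd z, b + r * fst z + s * snd z) \<partial>(lborel \<Otimes>\<^sub>M lborel))
      = (\<integral>\<^sup>+t. \<integral>\<^sup>+u. h (a + p * u + q * t, b + r * u + s * t) \<partial>lborel \<partial>lborel)"
    by (subst lborel_pair.nn_integral_snd[symmetric]) auto
  then show ?thesis using nn_integral_affine_plane_aux[OF assms(1) False det] by simp
next
  \<comment> \<open>The two columns are exchanged; for p = 0 the determinant condition makes q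
    nonzero.\<close>
  case True
  have "(\<integral>\<^sup>+z. h (a + p * fst z + q * snd z, b + r * fst z + s * snd z) \<partial>(lborel \<Otimes>\<^sub>M lborel))
      = (\<integral>\<^sup>+u. \<integral>\<^sup>+t. h (a + q * t + p * u, b + s * t + r * u) \<partial>lborel \<partial>lborel)"
    by (subst lborel.nn_integral_fst[symmetric]) (auto simp: algebra_simps)
  then show ?thesis
    using nn_integral_affine_plane_aux[OF assms(1), of q r p s a b] True det by (simp add: abs_minus_commute)
qed

lemma integral_distr_const_density:
  fixes f :: "'b \<Rightarrow> complex"
  assumes T [measurable]: "T \<in> measurable P N" and f [measurable]: "f \<in> borel_measurable N"
    and eq: "distr P N T = density N (\<lambda>_. ennreal \<kappa>)" and \<kappa>: "\<kappa> > 0"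
  shows "integrable P (\<lambda>t. f (T t)) \<longleftrightarrow> integrable N f"
    and "integral\<^sup>L P (\<lambda>t. f (T t)) = \<kappa> *\<^sub>R integral\<^sup>L N f"
proof -
  have "integrable P (\<lambda>t. f (T t)) \<longleftrightarrow> integrable (density N (\<lambda>_. ennreal \<kappa>)) f"
    unfolding eq[symmetric] by (rule integrable_distr_eq[symmetric]) auto
  also have "\<dots> \<longleftrightarrow> integrable N (\<lambda>x. \<kappa> *\<^sub>R f x)" using \<kappa> by (intro integrable_density) auto
  also have "\<dots> \<longleftrightarrow> integrable N f"
    using \<kappa> integrable_scaleR_right[of \<kappa> N f] integrable_scaleR_right[of "inverse \<kappa>" N "\<lambda>x. \<kappa> *\<^sub>R f x"]
    by auto
  finally show "integrable P (\<lambda>t. f (T t)) \<longleftrightarrow> integrable N f" .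
  have "integral\<^sup>L P (\<lambda>t. f (T t)) = integral\<^sup>L (density N (\<lambda>_. ennreal \<kappa>)) f"
    unfolding eq[symmetric] by (rule integral_distr[symmetric]) auto
  also have "\<dots> = integral\<^sup>L N (\<lambda>x. \<kappa> *\<^sub>R f x)" using \<kappa> by (intro integral_density) auto
  finally show "integral\<^sup>L P (\<lambda>t. f (T t)) = \<kappa> *\<^sub>R integral\<^sup>L N f" by simp
qed

interpretation lborel_product: product_sigma_finite "\<lambda>_ :: nat. lborel :: real measure" ..

lemma distr_affine_line:
  fixes m :: real
  assumes m: "m \<noteq> 0"
  shows "distr (\<Pi>\<^sub>M i\<in>{..<1::nat}. (lborel :: real measure)) lborel (\<lambda>t. a + m * t 0) = density lborel (\<lambda>_. ennreal (1 / \<bar>m\<bar>))"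
proof (rule measure_eqI)
  have T: "(\<lambda>t. a + m * t 0) \<in> measurable (\<Pi>\<^sub>M i\<in>{..<1::nat}. (lborel :: real measure)) lborel"
    by measurable
  show "emeasure (distr (\<Pi>\<^sub>M i\<in>{..<1::nat}. (lborel :: real measure)) lborel (\<lambda>t. a + m * t 0)) A
      = emeasure (density lborel (\<lambda>_. ennreal (1 / \<bar>m\<bar>))) A"
    if "A \<in> sets (distr (\<Pi>\<^sub>M i\<in>{..<1::nat}. (lborel :: real measure)) lborel (\<lambda>t. a + m * t 0))" for A
  proof -
    have A [measurable]: "A \<in> sets lborel" using that by simp
    have one: "{..<1::nat} = {0}" by auto
    have "emeasure (distr (\<Pi>\<^sub>M i\<in>{..<1::nat}. (lborel :: real measure)) lborel (\<lambda>t. a + m * t 0)) A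
        = (\<integral>\<^sup>+x. indicator A x \<partial>distr (\<Pi>\<^sub>M i\<in>{..<1::nat}. (lborel :: real measure)) lborel (\<lambda>t. a + m * t 0))"
      by (rule nn_integral_indicator[OF that, symmetric])
    also have "\<dots> = (\<integral>\<^sup>+t. indicator A (a + m * t 0) \<partial>(\<Pi>\<^sub>M i\<in>{0::nat}. (lborel :: real measure)))"
      unfolding one[symmetric] by (rule nn_integral_distr[OF T]) auto
    also have "\<dots> = (\<integral>\<^sup>+t. indicator A (a + m * t) \<partial>lborel)"
      by (rule lborel_product.product_nn_integral_singleton[where f = "\<lambda>t. indicator A (a + m * t)" and i = 0]) measurable
    also have "\<dots> = ennreal (1 / \<bar>m\<bar>) * (ennreal \<bar>m\<bar> * (\<integral>\<^sup>+t. indicator A (a + m * t) \<partial>lborel))"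
      using m by (simp add: mult.assoc[symmetric] flip: ennreal_mult)
    also have "ennreal \<bar>m\<bar> * (\<integral>\<^sup>+t. indicator A (a + m * t) \<partial>lborel) = (\<integral>\<^sup>+t. indicator A t \<partial>lborel)"
      by (rule nn_integral_real_affine[OF _ m, symmetric]) measurable
    also have "ennreal (1 / \<bar>m\<bar>) * \<dots> = emeasure (density lborel (\<lambda>_. ennreal (1 / \<bar>m\<bar>))) A"
      using A by (subst emeasure_density) (auto simp: nn_integral_cmult)
    finally show ?thesis .
  qed
qed simp

lemma distr_affine_plane:
  fixes p q r s :: real
  assumes det: "p * s - q * r \<noteq> 0"
  shows "distr (\<Pi>\<^sub>M i\<in>{..<2::nat}. (lborel :: real measure)) (lborel \<Otimes>\<^sub>M lborel)
       (\<lambda>t. (a + p * t 0 + q * t 1, b + r * t 0 + s * t 1))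
     = density (lborel \<Otimes>\<^sub>M lborel) (\<lambda>_. ennreal (1 / \<bar>p * s - q * r\<bar>))" (is "distr ?P ?N ?T = _")
proof (rule measure_eqI)
  have T [measurable]: "?T \<in> measurable ?P ?N" by measurable
  define \<delta> where "\<delta> = p * s - q * r"
  have \<delta>: "\<delta> \<noteq> 0" using det by (simp add: \<delta>_def)
  show "emeasure (distr ?P ?N ?T) A = emeasure (density ?N (\<lambda>_. ennreal (1 / \<bar>p * s - q * r\<bar>))) A"
    if "A \<in> sets (distr ?P ?N ?T)" for A
  proof -
    have A [measurable]: "A \<in> sets ?N" using that by simp
    let ?h = "\<lambda>u t. indicator A (a + p * u + q * t, b + r * u + s * t) :: ennreal"
    have two: "{..<2::nat} = {0, 1}" by auto
    have "emeasure (distr ?P ?N ?T) A = (\<integral>\<^sup>+x. indicator A x \<partial>distr ?P ?N ?T)"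
      by (rule nn_integral_indicator[OF that, symmetric])
    also have "\<dots> = (\<integral>\<^sup>+t. ?h (t 0) (t 1) \<partial>(\<Pi>\<^sub>M i\<in>{0, 1::nat}. (lborel :: real measure)))"
      unfolding two[symmetric] by (rule nn_integral_distr) auto
    also have "\<dots> = (\<integral>\<^sup>+z. ?h (fst z) (snd z) \<partial>?N)"
      by (rule lborel_product.product_nn_integral_pair) auto
    also have "\<dots> = ennreal (1 / \<bar>\<delta>\<bar>) * (ennreal \<bar>\<delta>\<bar> * (\<integral>\<^sup>+z. ?h (fst z) (snd z) \<partial>?N))"
      using \<delta> by (simp add: mult.assoc[symmetric] flip: ennreal_mult)
    also have "ennreal \<bar>\<delta>\<bar> * (\<integral>\<^sup>+z. ?h (fst z) (snd z) \<partial>?N) = (\<integral>\<^sup>+z. indicator A z \<partial>?N)"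
      using nn_integral_affine_plane[where h = "indicator A" and a = a and b = b, OF _ det] A by (simp add: \<delta>_def)
    also have "ennreal (1 / \<bar>\<delta>\<bar>) * \<dots> = emeasure (density ?N (\<lambda>_. ennreal (1 / \<bar>p * s - q * r\<bar>))) A"
      using A by (subst emeasure_density) (auto simp: nn_integral_cmult \<delta>_def)
    finally show ?thesis .
  qed
qed simp

subsection \<open>Exponential integrals of simplicial cones\<close>

abbreviation rvec :: "rat vec \<Rightarrow> real vec" where "rvec \<equiv> map_vec of_rat"

lemma of_rat_scalar_prod:
  fixes x y :: "rat vec"
  assumes "x \<in> carrier_vec n" "y \<in> carrier_vec n"
  shows "map_vec of_rat x \<bullet> map_vec of_rat y = (of_rat (x \<bullet> y) :: 'a::field_char_0)"
  using assms by (simp add: scalar_prod_def of_rat_sum of_rat_mult carrier_vecD)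

text \<open>M is the linear part of the coordinates \<open>w i\<close> in a lattice chart, and V is
  1 / |det M|, the volume of the parallelepiped spanned by the edges when a lattice basis spans
  volume 1. Only dimensions 0, 1 and 2 occur, so the determinant is written out.\<close>

definition chart_volume :: "(nat \<Rightarrow> nat \<Rightarrow> rat) \<Rightarrow> nat set \<Rightarrow> nat \<Rightarrow> rat \<Rightarrow> bool" where
  "chart_volume M I d V \<longleftrightarrow> V > 0 \<and>
     (I = {} \<and> d = 0 \<and> V = 1 \<or>
      (\<exists>i. I = {i} \<and> d = 1 \<and> V * \<bar>M i 0\<bar> = 1) \<or>
      (\<exists>i j. i \<noteq> j \<and> I = {i, j} \<and> d = 2 \<and> V * \<bar>M i 0 * M j 1 - M i 1 * M j 0\<bar> = 1))"

lemma of_real_of_rat [simp]: "complex_of_real (of_rat r) = of_rat r"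
  by (cases r) (simp add: of_rat_rat)

lemma of_rat_abs: "real_of_rat \<bar>r\<bar> = \<bar>of_rat r\<bar>"
  by (simp add: abs_if of_rat_minus)

lemma mult_unit_vec:
  fixes B :: "'a::comm_ring_1 mat"
  assumes "B \<in> carrier_mat n d" "k < d"
  shows "B *\<^sub>v unit_vec d k = col B k"
  using assms by (intro eq_vecI) (auto simp: scalar_prod_right_unit)

text \<open>The affine chart carries Lebesgue measure to V times Lebesgue measure in the coordinates
  of the cone, where the integral splits into one factor -1 / y i per edge.\<close>

lemma chart_integral:
  fixes y :: "nat \<Rightarrow> complex" and a :: "nat \<Rightarrow> real"
  assumes V: "chart_volume M I d V"
  defines "P \<equiv> \<Pi>\<^sub>M i\<in>{..<d}. (lborel :: real measure)"
    and "f \<equiv> \<lambda>t. \<Prod>i\<in>I. exp_ray (y i) (a i + (\<Sum>k<d. of_rat (M i k) * t k))"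
  shows "integrable P f \<longleftrightarrow> (\<forall>i\<in>I. Re (y i) < 0)"
    and "\<forall>i\<in>I. Re (y i) < 0 \<Longrightarrow> integral\<^sup>L P f = of_rat V / (\<Prod>i\<in>I. - y i)"
proof -
  have V0: "V > 0" using V by (simp add: chart_volume_def)
  consider (point) "I = {}" "d = 0" "V = 1"
    | (ray) i where "I = {i}" "d = 1" "V * \<bar>M i 0\<bar> = 1"
    | (plane) i j where "i \<noteq> j" "I = {i, j}" "d = 2" "V * \<bar>M i 0 * M j 1 - M i 1 * M j 0\<bar> = 1"
    using V unfolding chart_volume_def by blast
  then have "(integrable P f \<longleftrightarrow> (\<forall>i\<in>I. Re (y i) < 0)) \<and>
    ((\<forall>i\<in>I. Re (y i) < 0) \<longrightarrow> integral\<^sup>L P f = of_rat V / (\<Prod>i\<in>I. - y i))"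
  proof cases
    case point
    \<comment> \<open>The empty product of measures is the unit mass at the undefined function, in
      agreement with the unit mass at a point.\<close>
    have P: "P = count_space {\<lambda>_. undefined}"
      using point(2) by (simp add: P_def PiM_empty)
    have f: "f = (\<lambda>_. 1)" using point by (simp add: f_def)
    show ?thesis
      unfolding P f using point by (simp add: integrable_count_space lebesgue_integral_count_space_finite)
  next
    case ray
    define m where "m = (of_rat (M i 0) :: real)"
    have Vm: "of_rat V * \<bar>m\<bar> = 1"
      using arg_cong[OF ray(3), of "of_rat :: rat \<Rightarrow> real"] by (simp add: m_def of_rat_mult)
    then have m: "m \<noteq> 0" by auto
    have "of_rat V = 1 / \<bar>m\<bar>" using Vm m by (simp add: field_simps)
    then have dd: "distr P lborel (\<lambda>t. a i + m * t 0) = density lborel (\<lambda>_. ennreal (of_rat V))"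
      unfolding P_def ray(2) using distr_affine_line[OF m, of "a i"] by simp
    have T: "(\<lambda>t. a i + m * t 0) \<in> measurable P lborel" unfolding P_def ray(2) by measurable
    have f: "f = (\<lambda>t. exp_ray (y i) (a i + m * t 0))" using ray by (simp add: f_def m_def)
    note tr = integral_distr_const_density[OF T _ dd, of "exp_ray (y i)", folded f]
    have 1: "integrable P f \<longleftrightarrow> Re (y i) < 0"
      using tr(1) V0 integrable_exp_ray_iff by simp
    have 2: "integral\<^sup>L P f = of_rat V / - y i" if "Re (y i) < 0"
    proof -
      have "integral\<^sup>L P f = of_rat V *\<^sub>R integral\<^sup>L lborel (exp_ray (y i))" using tr(2) V0 by simp
      also have "\<dots> = of_rat V *\<^sub>R (- 1 / y i)"
        using has_bochner_integral_exp_ray[OF that] by (simp add: has_bochner_integral_iff)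
      finally show ?thesis by (simp add: scaleR_conv_of_real)
    qed
    show ?thesis using 1 2 ray by simp
  next
    case plane
    define p q r s where "p = (of_rat (M i 0) :: real)" "q = (of_rat (M i 1) :: real)"
      "r = (of_rat (M j 0) :: real)" "s = (of_rat (M j 1) :: real)"
    note defs = this
    have Vm: "of_rat V * \<bar>p * s - q * r\<bar> = 1"
      using arg_cong[OF plane(4), of "of_rat :: rat \<Rightarrow> real"] by (simp add: defs of_rat_mult of_rat_diff of_rat_abs)
    then have m: "p * s - q * r \<noteq> 0" by auto
    have "of_rat V = 1 / \<bar>p * s - q * r\<bar>" using Vm m by (simp add: field_simps)
    then have dd: "distr P (lborel \<Otimes>\<^sub>M lborel) (\<lambda>t. (a i + p * t 0 + q * t 1, a j + r * t 0 + s * t 1))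
        = density (lborel \<Otimes>\<^sub>M lborel) (\<lambda>_. ennreal (of_rat V))"
      unfolding P_def plane(3) using distr_affine_plane[OF m, of "a i" "a j"] by simp
    have T: "(\<lambda>t. (a i + p * t 0 + q * t 1, a j + r * t 0 + s * t 1)) \<in> measurable P (lborel \<Otimes>\<^sub>M lborel)"
      unfolding P_def plane(3) by measurable
    define F where "F = (\<lambda>(s, t). exp_ray (y i) s * exp_ray (y j) t)"
    have F [measurable]: "F \<in> borel_measurable (lborel \<Otimes>\<^sub>M lborel)" unfolding F_def by measurable
    have f: "f = (\<lambda>t. F (a i + p * t 0 + q * t 1, a j + r * t 0 + s * t 1))"
      using plane by (simp add: f_def F_def defs numeral_2_eq_2 add.assoc)
    note tr = integral_distr_const_density[OF T F dd, folded f]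
    have 1: "integrable P f \<longleftrightarrow> Re (y i) < 0 \<and> Re (y j) < 0"
      using tr(1) V0 exp_ray_prod(1)[of "y i" "y j"] by (simp add: F_def)
    have 2: "integral\<^sup>L P f = of_rat V / (y i * y j)" if "Re (y i) < 0" "Re (y j) < 0"
    proof -
      have "integral\<^sup>L P f = of_rat V *\<^sub>R integral\<^sup>L (lborel \<Otimes>\<^sub>M lborel) F" using tr(2) V0 by simp
      also have "\<dots> = of_rat V *\<^sub>R (1 / (y i * y j))"
        unfolding F_def using exp_ray_prod(2)[OF that] by simp
      finally show ?thesis by (simp add: scaleR_conv_of_real)
    qed
    show ?thesis using 1 2 plane by simp
  qed
  then show "integrable P f \<longleftrightarrow> (\<forall>i\<in>I. Re (y i) < 0)"
    "\<forall>i\<in>I. Re (y i) < 0 \<Longrightarrow> integral\<^sup>L P f = of_rat V / (\<Prod>i\<in>I. - y i)"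
    by blast+
qed

text \<open>Stated with rational multipliers instead of a gcd. The zero vector is excluded, since
  all its rational multiples are integral.\<close>

definition primitive_vec :: "nat \<Rightarrow> rat vec \<Rightarrow> bool" where
  "primitive_vec n x \<longleftrightarrow> x \<in> int_lattice n \<and> (\<forall>r. r \<cdot>\<^sub>v x \<in> int_lattice n \<longrightarrow> r \<in> \<int>)"

lemma primitive_vecD:
  "primitive_vec n x \<Longrightarrow> x \<in> int_lattice n" "primitive_vec n x \<Longrightarrow> x \<in> carrier_vec n"
  "primitive_vec n x \<Longrightarrow> r \<cdot>\<^sub>v x \<in> int_lattice n \<Longrightarrow> r \<in> \<int>"
  by (auto simp: primitive_vec_def int_lattice_def)

section \<open>Lattice bases of subspaces of dimension at most two\<close>

lemma Ints_mult_eq_1: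
  fixes a b :: rat
  assumes "a \<in> \<int>" "b \<in> \<int>" "a * b = 1"
  shows "\<bar>a\<bar> = 1"
proof -
  obtain k l where kl: "a = of_int k" "b = of_int l" using assms by (auto elim!: Ints_cases)
  then have "k * l = 1" using assms(3) by (metis of_int_eq_1_iff of_int_mult)
  then have "\<bar>k\<bar> = 1" using abs_zmult_eq_1 by (metis abs_1)
  then show ?thesis using kl by (metis of_int_1 of_int_abs)
qed

lemma lattice_basis_col:
  assumes "lattice_basis n U d B" "k < d"
  shows "col B k \<in> U" "col B k \<in> int_lattice n"
proof -
  have B: "B \<in> carrier_mat n d" using assms by (simp add: lattice_basis_def)
  have u: "unit_vec d k \<in> int_lattice d" using assms(2) by (simp add: int_lattice_def unit_vec_def)
  have "col B k = B *\<^sub>v unit_vec d k" using B assms(2) by (simp add: mult_unit_vec)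
  then show "col B k \<in> U" "col B k \<in> int_lattice n"
    using assms(1) u unfolding lattice_basis_def bij_betw_def by (metis IntD1 IntD2 imageI)+
qed

lemma lattice_basis_inj:
  assumes "lattice_basis n U d B" "x \<in> int_lattice d" "y \<in> int_lattice d" "B *\<^sub>v x = B *\<^sub>v y"
  shows "x = y"
  using assms unfolding lattice_basis_def bij_betw_def by (metis inj_onD)

lemma lattice_basis_surj:
  assumes "lattice_basis n U d B" "z \<in> U" "z \<in> int_lattice n"
  obtains x where "x \<in> int_lattice d" "B *\<^sub>v x = z"
  using assms unfolding lattice_basis_def bij_betw_def by (metis IntI imageE)

lemma unit_vec_int_lattice: "k < d \<Longrightarrow> unit_vec d k \<in> int_lattice d"
  by (simp add: int_lattice_def unit_vec_def)

lemma lattice_basis_point: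
  assumes "lattice_basis n {0\<^sub>v n} d B"
  shows "d = 0"
proof (rule ccontr)
  assume "d \<noteq> 0"
  then have d: "0 < d" by simp
  have B: "B \<in> carrier_mat n d" using assms by (simp add: lattice_basis_def)
  have "B *\<^sub>v unit_vec d 0 = 0\<^sub>v n"
    using lattice_basis_col(1)[OF assms d] B d by (simp add: mult_unit_vec)
  moreover have "B *\<^sub>v 0\<^sub>v d = 0\<^sub>v n" using B by auto
  ultimately have "unit_vec d 0 = (0\<^sub>v d :: rat vec)"
    by (intro lattice_basis_inj[OF assms unit_vec_int_lattice[OF d]]) (auto simp: int_lattice_def)
  then have "unit_vec d 0 $ 0 = (0\<^sub>v d $ 0 :: rat)" by simp
  then show False using d by simp
qed

text \<open>The columns of B are integral multiples m k of u, so B acts through the single row m.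
  Surjectivity onto u makes an integral combination of the m k equal to 1, and injectivity excludes
  a second column; the remaining m 0 is then a unit.\<close>

lemma lattice_basis_line:
  assumes B: "lattice_basis n {c \<cdot>\<^sub>v u | c. True} d B" and u: "primitive_vec n u"
  obtains m where "d = 1" "\<bar>m\<bar> = 1" "col B 0 = m \<cdot>\<^sub>v u"
proof -
  have uc: "u \<in> carrier_vec n" using u by (rule primitive_vecD)
  have Bc: "B \<in> carrier_mat n d" using B by (simp add: lattice_basis_def)
  have "\<exists>m\<in>\<int>. col B k = m \<cdot>\<^sub>v u" if "k < d" for k
    using lattice_basis_col[OF B that] primitive_vecD(3)[OF u] by auto
  then obtain m where m: "\<And>k. k < d \<Longrightarrow> m k \<in> \<int>" "\<And>k. k < d \<Longrightarrow> col B k = m k \<cdot>\<^sub>v u"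
    by metis
  have Bx: "B *\<^sub>v x = (\<Sum>k<d. m k * x $ k) \<cdot>\<^sub>v u" if x: "x \<in> carrier_vec d" for x
  proof (rule eq_vecI)
    fix i assume "i < dim_vec ((\<Sum>k<d. m k * x $ k) \<cdot>\<^sub>v u)"
    then have i: "i < n" using uc by simp
    have "B $$ (i, k) = m k * u $ i" if "k < d" for k
    proof -
      have "col B k $ i = (m k \<cdot>\<^sub>v u) $ i" using m(2)[OF that] by simp
      then show ?thesis using Bc i that uc by simp
    qed
    then show "(B *\<^sub>v x) $ i = ((\<Sum>k<d. m k * x $ k) \<cdot>\<^sub>v u) $ i"
    proof -
      have "(B *\<^sub>v x) $ i = (\<Sum>k<d. B $$ (i, k) * x $ k)"
        using Bc x i by (simp add: scalar_prod_def atLeast0LessThan)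
      also have "\<dots> = (\<Sum>k<d. m k * x $ k) * u $ i"
        unfolding sum_distrib_right by (intro sum.cong refl) (simp add: \<open>\<And>k. k < d \<Longrightarrow> B $$ (i, k) = m k * u $ i\<close>)
      finally show ?thesis using i uc by simp
    qed
  qed (use Bc uc in simp)
  have z: "0\<^sub>v d \<in> int_lattice d" by (simp add: int_lattice_def)
  have "u = 1 \<cdot>\<^sub>v u" using uc by simp
  then have "u \<in> {c \<cdot>\<^sub>v u | c. True}" by blast
  then obtain x where x: "x \<in> int_lattice d" "B *\<^sub>v x = u"
    using lattice_basis_surj[OF B _ primitive_vecD(1)[OF u]] by metis
  have xc: "x \<in> carrier_vec d" using x(1) by (simp add: int_lattice_def)
  define s where "s = (\<Sum>k<d. m k * x $ k)"
  have su: "s \<cdot>\<^sub>v u = u" using Bx[OF xc] x(2) by (simp add: s_def)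
  have s1: "s = 1"
  proof (rule ccontr)
    \<comment> \<open>This would make u the zero vector, whose half is integral, contrary to
      primitivity.\<close>
    assume "s \<noteq> 1"
    have "u = 0\<^sub>v n"
    proof (rule eq_vecI)
      fix i assume "i < dim_vec (0\<^sub>v n :: rat vec)"
      then have "s * u $ i = u $ i" using arg_cong[OF su, of "\<lambda>z. z $ i"] uc by simp
      then show "u $ i = 0\<^sub>v n $ i" using \<open>s \<noteq> 1\<close> \<open>i < dim_vec (0\<^sub>v n)\<close> by auto
    qed (use uc in simp)
    then have "(1/2) \<cdot>\<^sub>v u \<in> int_lattice n" by (simp add: int_lattice_def)
    then have "(1/2 :: rat) \<in> \<int>" by (rule primitive_vecD(3)[OF u])
    then obtain k :: int where "(1/2 :: rat) = of_int k" by (auto elim: Ints_cases)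
    then have "of_int (2 * k) = (1::rat)" by simp
    then have "2 * k = 1" by (metis of_int_eq_1_iff)
    then show False by presburger
  qed
  have d0: "d \<noteq> 0"
  proof
    assume "d = 0"
    then show False using s1 by (simp add: s_def)
  qed
  have d1: "\<not> 1 < d"
  proof
    assume d: "1 < d"
    \<comment> \<open>An integral relation between the first two columns: m 0 times m 1 minus m 1
      times m 0.\<close>
    define e where "e = vec d (\<lambda>k. if k = 0 then m 1 else if k = 1 then - m 0 else 0)"
    have ei: "e \<in> int_lattice d" using m(1)[of 0] m(1)[of 1] d by (auto simp: e_def int_lattice_def)
    have "(\<Sum>k<d. m k * e $ k) = (\<Sum>k\<in>{0, 1}. m k * e $ k)"
      using d by (intro sum.mono_neutral_right) (auto simp: e_def)
    also have "\<dots> = 0" using d by (simp add: e_def)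
    finally have "B *\<^sub>v e = B *\<^sub>v 0\<^sub>v d" using Bx[of e] Bx[of "0\<^sub>v d"] by (simp add: e_def)
    then have "e = 0\<^sub>v d" using lattice_basis_inj[OF B ei z] by simp
    then have "e $ 1 = 0" using d by simp
    then have m0: "m 0 = 0" using d by (simp add: e_def)
    have "(\<Sum>k<d. m k * unit_vec d 0 $ k) = (\<Sum>k\<in>{0}. m k * unit_vec d 0 $ k)"
      using d by (intro sum.mono_neutral_right) auto
    then have "(\<Sum>k<d. m k * unit_vec d 0 $ k) = 0" using m0 by simp
    then have "B *\<^sub>v unit_vec d 0 = B *\<^sub>v 0\<^sub>v d" using Bx[of "unit_vec d 0"] Bx[of "0\<^sub>v d"] by simp
    then have "unit_vec d 0 = (0\<^sub>v d :: rat vec)"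
      using lattice_basis_inj[OF B unit_vec_int_lattice[of 0 d] z] d by simp
    then have "unit_vec d 0 $ 0 = (0\<^sub>v d $ 0 :: rat)" by simp
    then show False using d by simp
  qed
  have d: "d = 1" using d0 d1 by linarith
  have "m 0 * x $ 0 = 1" using s1 d by (simp add: s_def)
  then have "\<bar>m 0\<bar> = 1" using m(1)[of 0] x(1) d by (intro Ints_mult_eq_1) (auto simp: int_lattice_def)
  then show thesis using that[of "m 0"] d m(2)[of 0] by simp
qed

text \<open>Integral preimages of the unit vectors give X with B X = 1, and injectivity of B on
  integral vectors gives X B = 1. Comparing the traces of the two products yields d = 2, and the
  determinants of B and X are integers with product 1.\<close>

lemma lattice_basis_square:
  assumes B: "lattice_basis 2 (carrier_vec 2) d B"
  shows "d = 2" "\<bar>B $$ (0, 0) * B $$ (1, 1) - B $$ (0, 1) * B $$ (1, 0)\<bar> = 1"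
proof -
  have Bc: "B \<in> carrier_mat 2 d" using B by (simp add: lattice_basis_def)
  have "\<exists>x\<in>int_lattice d. B *\<^sub>v x = unit_vec 2 a" if "a < 2" for a
    using lattice_basis_surj[OF B _ unit_vec_int_lattice[OF that]] by (metis unit_vec_carrier)
  then obtain x where x: "\<And>a. a < 2 \<Longrightarrow> x a \<in> int_lattice d" "\<And>a. a < 2 \<Longrightarrow> B *\<^sub>v x a = unit_vec 2 a"
    by metis
  define X where "X = mat d 2 (\<lambda>(k, a). x a $ k)"
  have Xc: "X \<in> carrier_mat d 2" by (simp add: X_def)
  have xc: "x a \<in> carrier_vec d" if "a < 2" for a using x(1)[OF that] by (simp add: int_lattice_def)
  have colX: "col X a = x a" if "a < 2" for a
    using that xc[OF that] by (intro eq_vecI) (auto simp: X_def)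
  have BX: "B * X = 1\<^sub>m 2"
  proof (rule mat_col_eqI)
    fix a assume "a < dim_col (1\<^sub>m 2 :: rat mat)"
    then have a: "a < 2" by simp
    have "col (B * X) a = B *\<^sub>v col X a" using Bc Xc a by (intro col_mult2) auto
    then show "col (B * X) a = col (1\<^sub>m 2) a" using a x(2) colX by simp
  qed (use Bc Xc in auto)
  have XB: "X * B = 1\<^sub>m d"
  proof (rule mat_col_eqI)
    fix k assume "k < dim_col (1\<^sub>m d :: rat mat)"
    then have k: "k < d" by simp
    have b: "col B k \<in> int_lattice 2" using lattice_basis_col[OF B k] by simp
    have bc: "col B k \<in> carrier_vec 2" using b by (simp add: int_lattice_def)
    have "X *\<^sub>v col B k \<in> int_lattice d"
      unfolding int_lattice_def
    proof (intro CollectI conjI allI impI)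
      fix l assume l: "l < d"
      have "(X *\<^sub>v col B k) $ l = (\<Sum>a<2. x a $ l * col B k $ a)"
        using Xc bc l Bc by (simp add: X_def scalar_prod_def atLeast0LessThan)
      also have "\<dots> \<in> \<int>"
        using x(1) b l by (intro Ints_sum Ints_mult) (auto simp: int_lattice_def)
      finally show "(X *\<^sub>v col B k) $ l \<in> \<int>" .
    qed (use Xc bc in simp)
    moreover have "B *\<^sub>v (X *\<^sub>v col B k) = (B * X) *\<^sub>v col B k"
      using Bc Xc bc by (intro assoc_mult_mat_vec[symmetric]) auto
    then have "B *\<^sub>v (X *\<^sub>v col B k) = B *\<^sub>v unit_vec d k"
      using BX bc k Bc by (simp add: mult_unit_vec)
    ultimately have "X *\<^sub>v col B k = unit_vec d k"
      using lattice_basis_inj[OF B _ unit_vec_int_lattice[OF k]] by blast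
    moreover have "col (X * B) k = X *\<^sub>v col B k" using Bc Xc k by (intro col_mult2) auto
    ultimately show "col (X * B) k = col (1\<^sub>m d) k" using k by simp
  qed (use Bc Xc in auto)
  have "(\<Sum>a<2. (B * X) $$ (a, a)) = (\<Sum>a<2. \<Sum>k<d. B $$ (a, k) * X $$ (k, a))"
    using Bc Xc by (intro sum.cong refl) (simp add: scalar_prod_def atLeast0LessThan)
  also have "\<dots> = (\<Sum>k<d. \<Sum>a<2. X $$ (k, a) * B $$ (a, k))"
    by (subst sum.swap) (simp add: mult.commute)
  also have "\<dots> = (\<Sum>k<d. (X * B) $$ (k, k))"
    using Bc Xc by (intro sum.cong refl) (simp add: scalar_prod_def atLeast0LessThan)
  finally have "(2 :: rat) = of_nat d" unfolding BX XB by simp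
  then have "of_nat d = (of_nat 2 :: rat)" by simp
  then show d: "d = 2" by (simp only: of_nat_eq_iff)
  have ent: "B $$ (a, 0) * X $$ (0, c) + B $$ (a, 1) * X $$ (1, c) = (if a = c then 1 else 0)" if "a < 2" "c < 2" for a c
  proof -
    have "(B * X) $$ (a, c) = (1\<^sub>m 2) $$ (a, c)" by (simp add: BX)
    then show ?thesis
      using Bc Xc that d by (simp add: scalar_prod_def atLeast0LessThan numeral_2_eq_2)
  qed
  have "(B $$ (0, 0) * B $$ (1, 1) - B $$ (0, 1) * B $$ (1, 0)) * (X $$ (0, 0) * X $$ (1, 1) - X $$ (0, 1) * X $$ (1, 0))
     = (B $$ (0, 0) * X $$ (0, 0) + B $$ (0, 1) * X $$ (1, 0)) * (B $$ (1, 0) * X $$ (0, 1) + B $$ (1, 1) * X $$ (1, 1))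
     - (B $$ (0, 0) * X $$ (0, 1) + B $$ (0, 1) * X $$ (1, 1)) * (B $$ (1, 0) * X $$ (0, 0) + B $$ (1, 1) * X $$ (1, 0))"
    by (simp add: algebra_simps)
  also have "\<dots> = 1" using ent[of 0 0] ent[of 0 1] ent[of 1 0] ent[of 1 1] by simp
  finally have prod: "(B $$ (0, 0) * B $$ (1, 1) - B $$ (0, 1) * B $$ (1, 0)) * (X $$ (0, 0) * X $$ (1, 1) - X $$ (0, 1) * X $$ (1, 0)) = 1" .
  have Bi: "B $$ (a, k) \<in> \<int>" if "a < 2" "k < 2" for a k
    using lattice_basis_col(2)[OF B, of k] Bc that d by (auto simp: int_lattice_def)
  have Xi: "X $$ (k, a) \<in> \<int>" if "a < 2" "k < 2" for a k
    using x(1)[OF that(1)] that d by (auto simp: int_lattice_def X_def)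
  show "\<bar>B $$ (0, 0) * B $$ (1, 1) - B $$ (0, 1) * B $$ (1, 0)\<bar> = 1"
    by (rule Ints_mult_eq_1[OF _ _ prod]) (auto intro!: Ints_diff Ints_mult Bi Xi)
qed

context rat_dual_basis
begin

lemma rvec_dual_basis: "dual_basis n (\<lambda>i. rvec (v i)) (\<lambda>i. rvec (w i))"
proof
  fix i j assume "i < n" "j < n"
  then show "rvec (w i) \<bullet> rvec (v j) = (if i = j then 1 else 0)"
    using pairing[of i j] by (simp add: of_rat_scalar_prod[of _ n])
qed auto

text \<open>A rational inequality valid on the cone has a nonnegative bound and is nonpositive on
  each edge, so by expansion in coordinates it also holds on the real cone. Conversely, the
  coordinate inequalities are themselves among the valid ones.\<close>

lemma real_polyhedron_coord_cone:
  assumes I: "I \<subseteq> {..<n}"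
  shows "real_polyhedron n (coord_cone n w I {}) = coord_cone n (\<lambda>i. rvec (w i)) I {}"
proof (intro equalityI subsetI)
  fix x assume x: "x \<in> real_polyhedron n (coord_cone n w I {})"
  then have xc: "x \<in> carrier_vec n" by (simp add: real_polyhedron_def)
  have valid: "rvec a \<bullet> x \<le> of_rat b" if "a \<in> carrier_vec n" "\<And>y. y \<in> coord_cone n w I {} \<Longrightarrow> a \<bullet> y \<le> b" for a b
    using x that by (simp add: real_polyhedron_def)
  have neg: "rvec (- a) \<bullet> x = - (rvec a \<bullet> x)" if "a \<in> carrier_vec n" for a
  proof -
    have "rvec (- a) = - rvec a" using that by (intro eq_vecI) (auto simp: of_rat_minus)
    then show ?thesis using neg_scalar_prod(1)[of "rvec a" n x] that xc by simp
  qed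
  have pos: "0 \<le> rvec (w i) \<bullet> x" if i: "i < n" for i
  proof -
    have "(- w i) \<bullet> y \<le> 0" if "y \<in> coord_cone n w I {}" for y
      using that i neg_scalar_prod(1)[of "w i" n y] by (cases "i \<in> I") (auto simp: coord_cone_def)
    then have "rvec (- w i) \<bullet> x \<le> of_rat 0" using i by (intro valid) auto
    then show ?thesis using neg i by simp
  qed
  moreover have "rvec (w i) \<bullet> x \<le> 0" if i: "i < n" "i \<notin> I" for i
    using valid[of "w i" 0] i by (auto simp: coord_cone_def)
  ultimately show "x \<in> coord_cone n (\<lambda>i. rvec (w i)) I {}"
    using xc by (auto simp: coord_cone_def intro: antisym)
next
  interpret R: dual_basis n "\<lambda>i. rvec (v i)" "\<lambda>i. rvec (w i)" by (rule rvec_dual_basis)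
  fix x assume x: "x \<in> coord_cone n (\<lambda>i. rvec (w i)) I {}"
  then have xc: "x \<in> carrier_vec n" by (simp add: coord_cone_def)
  have "rvec a \<bullet> x \<le> of_rat b" if a: "a \<in> carrier_vec n" and valid: "\<forall>y\<in>coord_cone n w I {}. a \<bullet> y \<le> b" for a b
  proof -
    have "a \<bullet> 0\<^sub>v n \<le> b" using valid zero_in_cone[of I "{}"] by blast
    then have b: "b \<ge> 0" using a by simp
    have av: "a \<bullet> v i \<le> 0" if i: "i \<in> I" for i
    proof (rule ccontr)
      assume "\<not> a \<bullet> v i \<le> 0"
      then have pos: "a \<bullet> v i > 0" by simp
      have i': "i < n" using i I by blast
      \<comment> \<open>On this multiple of the edge the functional takes the value b + 1, above the
        assumed bound.\<close>
      define t where "t = (b + 1) / (a \<bullet> v i)"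
      have "t \<cdot>\<^sub>v v i \<in> coord_cone n w I {}"
        using i i' pos b by (auto simp: coord_cone_def coord_smult pairing t_def)
      then have "a \<bullet> (t \<cdot>\<^sub>v v i) \<le> b" using valid by blast
      then have "t * (a \<bullet> v i) \<le> b" using a i' by (simp add: scalar_prod_smult_distrib[of _ n])
      then show False using pos by (simp add: t_def)
    qed
    have "rvec a \<bullet> x = (\<Sum>i<n. (rvec (w i) \<bullet> x) * (rvec a \<bullet> rvec (v i)))"
      using a xc by (intro R.pair_expand) auto
    also have "\<dots> \<le> 0"
    proof (rule sum_nonpos)
      fix i assume i: "i \<in> {..<n}"
      show "(rvec (w i) \<bullet> x) * (rvec a \<bullet> rvec (v i)) \<le> 0"
      proof (cases "i \<in> I")
        case True
        have "rvec a \<bullet> rvec (v i) \<le> 0" using av[OF True] a i by (simp add: of_rat_scalar_prod[of _ n])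
        then show ?thesis using x i True by (auto simp: coord_cone_def mult_nonneg_nonpos)
      qed (use x i in \<open>auto simp: coord_cone_def\<close>)
    qed
    finally show ?thesis using b by (simp add: order_trans[of _ 0])
  qed
  then show "x \<in> real_polyhedron n (coord_cone n w I {})" using xc by (simp add: real_polyhedron_def)
qed

lemma aff_param_carrier: "B \<in> carrier_mat n d \<Longrightarrow> x0 \<in> carrier_vec n \<Longrightarrow> aff_param x0 B d t \<in> carrier_vec n"
  by (auto simp: aff_param_def)

lemma aff_param_coord:
  assumes B: "B \<in> carrier_mat n d" and x0: "x0 \<in> carrier_vec n" and i: "i < n"
  shows "rvec (w i) \<bullet> aff_param x0 B d t = of_rat (w i \<bullet> x0) + (\<Sum>k<d. of_rat (w i \<bullet> col B k) * t k)"
proof -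
  have Bt: "(map_mat of_rat B *\<^sub>v vec d t) \<in> carrier_vec n" using B by auto
  have wi: "w i \<in> carrier_vec n" using i by simp
  have "rvec (w i) \<bullet> (map_mat of_rat B *\<^sub>v vec d t)
      = (\<Sum>l<n. of_rat (w i $ l) * (\<Sum>k<d. of_rat (B $$ (l, k)) * t k))"
    unfolding scalar_prod_sum[OF Bt map_vec_carrier_iff[THEN iffD2, OF wi]]
    using B wi by (intro sum.cong refl) (simp add: scalar_prod_def atLeast0LessThan carrier_vecD)
  also have "\<dots> = (\<Sum>k<d. \<Sum>l<n. of_rat (w i $ l * B $$ (l, k)) * t k)"
    by (subst sum.swap) (simp add: sum_distrib_left of_rat_mult mult.assoc)
  also have "\<dots> = (\<Sum>k<d. of_rat (w i \<bullet> col B k) * t k)"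
    using B wi by (intro sum.cong refl) (simp add: scalar_prod_sum[of _ n] of_rat_sum sum_distrib_right)
  finally show ?thesis
    using Bt x0 wi of_rat_scalar_prod[OF wi x0, where 'a = real]
    by (simp add: aff_param_def scalar_prod_add_distrib[of _ n])
qed

lemma complex_pair_real_expand:
  assumes \<xi>: "\<xi> \<in> carrier_vec n" and x: "x \<in> carrier_vec n"
  shows "\<xi> \<bullet> map_vec complex_of_real x = (\<Sum>i<n. of_real (rvec (w i) \<bullet> x) * (\<xi> \<bullet> cvec (v i)))"
proof -
  interpret R: dual_basis n "\<lambda>i. rvec (v i)" "\<lambda>i. rvec (w i)" by (rule rvec_dual_basis)
  have cv: "\<xi> \<bullet> z = (\<Sum>k<n. \<xi> $ k * z $ k)" if "z \<in> carrier_vec n" for z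
    using that \<xi> by (rule scalar_prod_sum)
  have ent: "map_vec complex_of_real x $ k = (\<Sum>i<n. of_real (rvec (w i) \<bullet> x) * cvec (v i) $ k)" if k: "k < n" for k
  proof -
    have "x $ k = (\<Sum>i<n. (rvec (w i) \<bullet> x) * rvec (v i) $ k)" by (rule R.expand[OF x k])
    then have "complex_of_real (x $ k) = (\<Sum>i<n. of_real (rvec (w i) \<bullet> x) * of_real (rvec (v i) $ k))" by simp
    also have "\<dots> = (\<Sum>i<n. of_real (rvec (w i) \<bullet> x) * cvec (v i) $ k)"
    proof (intro sum.cong refl)
      fix i assume "i \<in> {..<n}"
      then have "dim_vec (v i) = n" by auto
      then show "complex_of_real (rvec (w i) \<bullet> x) * of_real (rvec (v i) $ k) = of_real (rvec (w i) \<bullet> x) * cvec (v i) $ k"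
        using k by simp
    qed
    finally have "complex_of_real (x $ k) = (\<Sum>i<n. of_real (rvec (w i) \<bullet> x) * cvec (v i) $ k)" .
    then show ?thesis using k x by simp
  qed
  have "\<xi> \<bullet> map_vec complex_of_real x = (\<Sum>k<n. \<Sum>i<n. of_real (rvec (w i) \<bullet> x) * (\<xi> $ k * cvec (v i) $ k))"
    unfolding cv[OF map_vec_carrier_iff[THEN iffD2, OF x]]
  proof (intro sum.cong refl)
    fix k assume "k \<in> {..<n}"
    then have "map_vec complex_of_real x $ k = (\<Sum>i<n. of_real (rvec (w i) \<bullet> x) * cvec (v i) $ k)" using ent by blast
    then show "\<xi> $ k * map_vec complex_of_real x $ k = (\<Sum>i<n. of_real (rvec (w i) \<bullet> x) * (\<xi> $ k * cvec (v i) $ k))"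
      by (simp only: sum_distrib_left mult.left_commute)
  qed
  also have "\<dots> = (\<Sum>i<n. of_real (rvec (w i) \<bullet> x) * (\<xi> \<bullet> cvec (v i)))"
    by (subst sum.swap, intro sum.cong refl) (simp add: cv sum_distrib_left)
  finally show ?thesis .
qed

text \<open>One volume for all lattice bases, since \<open>is_exp_integral\<close> quantifies over
  them. The existence of a basis is part of the notion because the value of the chosen
  \<open>exp_integral\<close> is read off from one.\<close>

definition cone_volume :: "nat set \<Rightarrow> rat \<Rightarrow> bool" where
  "cone_volume I V \<longleftrightarrow> (\<exists>d B. lattice_basis n (coord_space n w I) d B) \<and>
     (\<forall>d B. lattice_basis n (coord_space n w I) d B \<longrightarrow> chart_volume (\<lambda>i k. w i \<bullet> col B k) I d V)"

lemma exp_integral_coord_cone: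
  assumes I: "I \<subseteq> {..<n}" and V: "cone_volume I V" and \<xi>: "\<xi> \<in> neg_region I"
  shows "has_value n (exp_integral n (coord_cone n w I {})) \<xi> (of_rat V / (\<Prod>i\<in>I. - (\<xi> \<bullet> cvec (v i))))"
proof -
  define K where "K = coord_cone n w I {}"
  have finI: "finite I" using I finite_subset by blast
  have noline: "\<not> contains_line n K" unfolding K_def by (rule no_line_coord_cone[of _ I]) simp
  have linK: "lin n K = coord_space n w I" unfolding K_def by (rule lin_coord_cone) simp
  define M where "M = (\<lambda>d::nat. \<Pi>\<^sub>M i\<in>{..<d}. (lborel :: real measure))"
  define D where "D = (\<lambda>x0 (d::nat) B. {t \<in> space (M d). aff_param x0 B d t \<in> real_polyhedron n K})"
  define g where "g = (\<lambda>x0 (d::nat) B \<xi> t. exp_pair \<xi> (map_vec complex_of_real (aff_param x0 B d t)))"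
  \<comment> \<open>In a chart the coordinates are affine in t and vanish outside I, so the
    integrand is a product of \<open>exp_ray\<close> factors. As for sums, integrability has to be
    characterized in both directions.\<close>
  have key: "(set_integrable (M d) (D x0 d B) (g x0 d B \<xi>) \<longleftrightarrow> \<xi> \<in> neg_region I) \<and>
     (\<xi> \<in> neg_region I \<longrightarrow> set_lebesgue_integral (M d) (D x0 d B) (g x0 d B \<xi>) = of_rat V / (\<Prod>i\<in>I. - (\<xi> \<bullet> cvec (v i))))"
    if \<xi>: "\<xi> \<in> carrier_vec n" and x0: "x0 \<in> K" and B: "lattice_basis n (lin n K) d B" for \<xi> x0 d B
  proof -
    have Bc: "B \<in> carrier_mat n d" using B by (simp add: lattice_basis_def)
    have x0c: "x0 \<in> carrier_vec n" using x0 by (simp add: K_def coord_cone_def)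
    have ch: "chart_volume (\<lambda>i k. w i \<bullet> col B k) I d V" using V B unfolding cone_volume_def linK by blast
    define \<tau> where "\<tau> = (\<lambda>i t. of_rat (w i \<bullet> x0) + (\<Sum>k<d. of_rat (w i \<bullet> col B k) * t k) :: real)"
    have \<tau>: "rvec (w i) \<bullet> aff_param x0 B d t = \<tau> i t" if "i < n" for i t
      unfolding \<tau>_def by (rule aff_param_coord[OF Bc x0c that])
    have \<tau>0: "\<tau> i t = 0" if "i < n" "i \<notin> I" for i t
    proof -
      have "w i \<bullet> x0 = 0" using x0 that by (simp add: K_def coord_cone_def)
      moreover have "w i \<bullet> col B k = 0" if "k < d" for k
        using lattice_basis_col(1)[OF B that] \<open>i < n\<close> \<open>i \<notin> I\<close> by (simp add: linK coord_cone_def)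
      ultimately show ?thesis by (simp add: \<tau>_def)
    qed
    have eq: "indicator (D x0 d B) t *\<^sub>R g x0 d B \<xi> t = (\<Prod>i\<in>I. exp_ray (\<xi> \<bullet> cvec (v i)) (\<tau> i t))"
      if t: "t \<in> space (M d)" for t
    proof -
      have ac: "aff_param x0 B d t \<in> carrier_vec n" by (rule aff_param_carrier[OF Bc x0c])
      have "t \<in> D x0 d B \<longleftrightarrow> (\<forall>i\<in>I. 0 \<le> \<tau> i t)"
        using t ac I \<tau> \<tau>0 unfolding D_def K_def real_polyhedron_coord_cone[OF I]
        by (auto simp: coord_cone_def)
      moreover have "g x0 d B \<xi> t = (\<Prod>i\<in>I. exp (\<xi> \<bullet> cvec (v i) * of_real (\<tau> i t)))"
      proof -
        have "\<xi> \<bullet> map_vec complex_of_real (aff_param x0 B d t) = (\<Sum>i<n. of_real (\<tau> i t) * (\<xi> \<bullet> cvec (v i)))"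
          unfolding complex_pair_real_expand[OF \<xi> ac] using \<tau> by simp
        also have "\<dots> = (\<Sum>i\<in>I. of_real (\<tau> i t) * (\<xi> \<bullet> cvec (v i)))"
          by (rule sum.mono_neutral_right) (use I \<tau>0 in auto)
        finally show ?thesis
          by (simp add: g_def exp_pair_def exp_sum[OF finI] mult.commute)
      qed
      moreover have "(\<Prod>i\<in>I. exp_ray (\<xi> \<bullet> cvec (v i)) (\<tau> i t)) =
          (if \<forall>i\<in>I. 0 \<le> \<tau> i t then \<Prod>i\<in>I. exp (\<xi> \<bullet> cvec (v i) * of_real (\<tau> i t)) else 0)"
        using finI by (auto simp: exp_ray_def indicator_def intro!: prod.cong)
      ultimately show ?thesis by (simp add: indicator_def)
    qed
    note ci = chart_integral[OF ch, of "\<lambda>i. \<xi> \<bullet> cvec (v i)" "\<lambda>i. of_rat (w i \<bullet> x0)"]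
    have "set_integrable (M d) (D x0 d B) (g x0 d B \<xi>) \<longleftrightarrow> integrable (M d) (\<lambda>t. \<Prod>i\<in>I. exp_ray (\<xi> \<bullet> cvec (v i)) (\<tau> i t))"
      unfolding set_integrable_def by (intro Bochner_Integration.integrable_cong refl eq)
    moreover have "set_lebesgue_integral (M d) (D x0 d B) (g x0 d B \<xi>) = integral\<^sup>L (M d) (\<lambda>t. \<Prod>i\<in>I. exp_ray (\<xi> \<bullet> cvec (v i)) (\<tau> i t))"
      unfolding set_lebesgue_integral_def by (intro Bochner_Integration.integral_cong refl eq)
    ultimately show ?thesis using ci \<xi> unfolding M_def \<tau>_def by (simp add: neg_region_def)
  qed
  define f where "f = (\<lambda>\<xi>. of_rat V / (\<Prod>i\<in>I. - (\<xi> \<bullet> cvec (v i))) :: complex)"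
  have g1: "holomorphic_cn n (\<lambda>_. of_rat V) (carrier_vec n)" by (rule holomorphic_cn_const) simp
  have g2: "(\<lambda>y::complex. - y) holomorphic_on UNIV" by (intro holomorphic_intros)
  have g3: "- y \<noteq> 0" if "Re y < 0" for y :: complex using that by auto
  note cq = cone_quotient[OF I g1 g2 g3, folded f_def]
  have "is_exp_integral n K f"
    unfolding is_exp_integral_def Let_def
    using cq(1) noline key cq(2) unfolding M_def D_def g_def f_def by auto
  then have "is_exp_integral n K (exp_integral n K)"
    unfolding exp_integral_def by (rule someI[of "is_exp_integral n K"])
  moreover obtain d B where B: "lattice_basis n (lin n K) d B"
    using V unfolding cone_volume_def linK by blast
  moreover have "0\<^sub>v n \<in> K" by (simp add: K_def)
  ultimately have "\<forall>\<xi>\<in>carrier_vec n. set_integrable (M d) (D (0\<^sub>v n) d B) (g (0\<^sub>v n) d B \<xi>) \<longrightarrow>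
      has_value n (exp_integral n K) \<xi> (set_lebesgue_integral (M d) (D (0\<^sub>v n) d B) (g (0\<^sub>v n) d B \<xi>))"
    using noline unfolding is_exp_integral_def Let_def M_def D_def g_def by auto
  moreover have "\<xi> \<in> carrier_vec n" using \<xi> by (simp add: neg_region_def)
  ultimately show ?thesis
    using key[OF _ \<open>0\<^sub>v n \<in> K\<close> B] \<xi> unfolding K_def[symmetric] by metis
qed

lemma coord_space_empty: "coord_space n w {} = {0\<^sub>v n}"
proof (intro equalityI subsetI)
  fix x assume "x \<in> coord_space n w {}"
  then show "x \<in> {0\<^sub>v n}" by (auto simp: coord_cone_def intro!: coords_eqI)
qed (use zero_in_cone in blast)

lemma coord_space_singleton:
  assumes "i < n"
  shows "coord_space n w {i} = {c \<cdot>\<^sub>v v i | c. True}"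
proof (intro equalityI subsetI)
  fix x assume x: "x \<in> coord_space n w {i}"
  have "x = (w i \<bullet> x) \<cdot>\<^sub>v v i"
  proof (rule coords_eqI)
    fix j assume j: "j < n"
    then show "w j \<bullet> x = w j \<bullet> ((w i \<bullet> x) \<cdot>\<^sub>v v i)"
      using assms x by (cases "j = i") (auto simp: coord_smult pairing coord_cone_def)
  qed (use x assms in \<open>auto simp: coord_cone_def\<close>)
  then show "x \<in> {c \<cdot>\<^sub>v v i | c. True}" by blast
next
  fix x assume "x \<in> {c \<cdot>\<^sub>v v i | c. True}"
  then show "x \<in> coord_space n w {i}" using assms by (auto simp: coord_cone_def coord_smult pairing)
qed

lemma cone_volume_point: "cone_volume {} 1"
  unfolding cone_volume_def coord_space_empty
proof (intro conjI allI impI)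
  have l0: "int_lattice 0 = {0\<^sub>v 0 :: rat vec}" by (auto simp: int_lattice_def)
  have "lattice_basis n {0\<^sub>v n} 0 (0\<^sub>m n 0)"
    unfolding lattice_basis_def l0 by (auto simp: bij_betw_def int_lattice_def)
  then show "\<exists>d B. lattice_basis n {0\<^sub>v n} d B" by blast
  fix d B assume "lattice_basis n {0\<^sub>v n} d B"
  then have "d = 0" by (rule lattice_basis_point)
  then show "chart_volume (\<lambda>i k. w i \<bullet> col B k) {} d 1" by (simp add: chart_volume_def)
qed

lemma cone_volume_ray:
  assumes i: "i < n" and p: "primitive_vec n (v i)"
  shows "cone_volume {i} 1"
  unfolding cone_volume_def coord_space_singleton[OF i]
proof (intro conjI allI impI)
  have vc: "v i \<in> carrier_vec n" using i by simp
  define B where "B = mat n 1 (\<lambda>(k, _). v i $ k)"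
  have Bx: "B *\<^sub>v x = x $ 0 \<cdot>\<^sub>v v i" if "x \<in> carrier_vec 1" for x
    using that vc by (intro eq_vecI) (auto simp: B_def scalar_prod_def mult.commute)
  have v0: "c = d" if "c \<cdot>\<^sub>v v i = d \<cdot>\<^sub>v v i" for c d
  proof -
    have "w i \<bullet> (c \<cdot>\<^sub>v v i) = w i \<bullet> (d \<cdot>\<^sub>v v i)" using that by simp
    then show ?thesis using i by (simp add: coord_smult pairing)
  qed
  have "bij_betw (\<lambda>c. B *\<^sub>v c) (int_lattice 1) ({c \<cdot>\<^sub>v v i |c. True} \<inter> int_lattice n)"
    unfolding bij_betw_def
  proof (intro conjI equalityI subsetI)
    show "inj_on (\<lambda>c. B *\<^sub>v c) (int_lattice 1)"
    proof (rule inj_onI)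
      fix x y :: "rat vec" assume xy: "x \<in> int_lattice 1" "y \<in> int_lattice 1" "B *\<^sub>v x = B *\<^sub>v y"
      then have "x $ 0 = y $ 0" using Bx v0 by (simp add: int_lattice_def)
      then show "x = y" using xy by (intro eq_vecI) (auto simp: int_lattice_def)
    qed
  next
    fix z assume "z \<in> (\<lambda>c. B *\<^sub>v c) ` int_lattice 1"
    then obtain x where x: "x \<in> int_lattice 1" "z = x $ 0 \<cdot>\<^sub>v v i" using Bx by (auto simp: int_lattice_def)
    then show "z \<in> {c \<cdot>\<^sub>v v i |c. True} \<inter> int_lattice n"
      using primitive_vecD(1)[OF p] by (auto simp: int_lattice_def)
  next
    fix z assume z: "z \<in> {c \<cdot>\<^sub>v v i |c. True} \<inter> int_lattice n"
    then obtain c where c: "z = c \<cdot>\<^sub>v v i" by blast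
    then have "c \<in> \<int>" using z primitive_vecD(3)[OF p] by auto
    then have "vec 1 (\<lambda>_. c) \<in> int_lattice 1" by (simp add: int_lattice_def)
    moreover have "z = B *\<^sub>v vec 1 (\<lambda>_. c)" using Bx[of "vec 1 (\<lambda>_. c)"] c by simp
    ultimately show "z \<in> (\<lambda>c. B *\<^sub>v c) ` int_lattice 1" by blast
  qed
  then have "lattice_basis n {c \<cdot>\<^sub>v v i | c. True} 1 B" by (simp add: lattice_basis_def B_def)
  then show "\<exists>d B. lattice_basis n {c \<cdot>\<^sub>v v i |c. True} d B" by blast
  fix d B assume "lattice_basis n {c \<cdot>\<^sub>v v i |c. True} d B"
  then obtain m where m: "d = 1" "\<bar>m\<bar> = 1" "col B 0 = m \<cdot>\<^sub>v v i"
    using lattice_basis_line[OF _ p] by metis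
  then show "chart_volume (\<lambda>i k. w i \<bullet> col B k) {i} d 1"
    using i by (simp add: chart_volume_def coord_smult pairing)
qed

text \<open>The determinants of w and v are reciprocal, and a lattice basis of the plane has
  determinant 1 or -1.\<close>

lemma cone_volume_plane:
  assumes n: "n = 2"
  shows "cone_volume {0, 1} \<bar>v 0 $ 0 * v 1 $ 1 - v 0 $ 1 * v 1 $ 0\<bar>"
proof -
  have full: "{0, 1} = {..<n}" using n by auto
  have sp: "coord_space n w {0, 1} = carrier_vec 2" unfolding full coord_space_full n ..
  have pr: "w i \<bullet> v j = w i $ 0 * v j $ 0 + w i $ 1 * v j $ 1" if "i < n" "j < n" for i j
    using v_carrier[OF that(2)] w_carrier[OF that(1)] by (simp add: scalar_prod_sum[of _ n] n numeral_2_eq_2)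
  have det: "(w 0 $ 0 * w 1 $ 1 - w 0 $ 1 * w 1 $ 0) * (v 0 $ 0 * v 1 $ 1 - v 0 $ 1 * v 1 $ 0) = 1"
  proof -
    have "(w 0 $ 0 * w 1 $ 1 - w 0 $ 1 * w 1 $ 0) * (v 0 $ 0 * v 1 $ 1 - v 0 $ 1 * v 1 $ 0)
        = (w 0 \<bullet> v 0) * (w 1 \<bullet> v 1) - (w 0 \<bullet> v 1) * (w 1 \<bullet> v 0)"
      using n by (simp add: pr algebra_simps)
    then show ?thesis using n by (simp add: pairing)
  qed
  show ?thesis
    unfolding cone_volume_def sp
  proof (intro conjI allI impI)
    have "lattice_basis n (carrier_vec 2) 2 (1\<^sub>m 2)"
      unfolding lattice_basis_def n
    proof (intro conjI)
      have "bij_betw (\<lambda>c. c) (int_lattice 2) (carrier_vec 2 \<inter> int_lattice 2 :: rat vec set)"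
        by (auto simp: bij_betw_def int_lattice_def)
      then show "bij_betw (\<lambda>c. 1\<^sub>m 2 *\<^sub>v c) (int_lattice 2) (carrier_vec 2 \<inter> int_lattice 2 :: rat vec set)"
        by (subst bij_betw_cong[where g = "\<lambda>c. c"]) (auto simp: int_lattice_def)
    qed auto
    then show "\<exists>d B. lattice_basis n (carrier_vec 2) d B" by blast
    fix d B assume "lattice_basis n (carrier_vec 2) d B"
    then have B: "lattice_basis 2 (carrier_vec 2) d B" by (simp add: n)
    have Bc: "B \<in> carrier_mat 2 2" using B lattice_basis_square(1)[OF B] by (simp add: lattice_basis_def)
    have wB: "w i \<bullet> col B k = w i $ 0 * B $$ (0, k) + w i $ 1 * B $$ (1, k)" if "i < 2" "k < 2" for i k
      using w_carrier[of i] that Bc n by (simp add: scalar_prod_def numeral_2_eq_2)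
    have "(w 0 \<bullet> col B 0) * (w 1 \<bullet> col B 1) - (w 0 \<bullet> col B 1) * (w 1 \<bullet> col B 0)
        = (w 0 $ 0 * w 1 $ 1 - w 0 $ 1 * w 1 $ 0) * (B $$ (0, 0) * B $$ (1, 1) - B $$ (0, 1) * B $$ (1, 0))"
      by (simp add: wB algebra_simps)
    then have "\<bar>(w 0 \<bullet> col B 0) * (w 1 \<bullet> col B 1) - (w 0 \<bullet> col B 1) * (w 1 \<bullet> col B 0)\<bar>
        = \<bar>w 0 $ 0 * w 1 $ 1 - w 0 $ 1 * w 1 $ 0\<bar>"
      using lattice_basis_square(2)[OF B] by (simp add: abs_mult)
    moreover have "\<bar>v 0 $ 0 * v 1 $ 1 - v 0 $ 1 * v 1 $ 0\<bar> * \<bar>w 0 $ 0 * w 1 $ 1 - w 0 $ 1 * w 1 $ 0\<bar> = 1"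
      using arg_cong[OF det, of abs] by (simp add: abs_mult mult.commute)
    moreover have "v 0 $ 0 * v 1 $ 1 - v 0 $ 1 * v 1 $ 0 \<noteq> 0" using det by auto
    ultimately show "chart_volume (\<lambda>i k. w i \<bullet> col B k) {0, 1} d \<bar>v 0 $ 0 * v 1 $ 1 - v 0 $ 1 * v 1 $ 0\<bar>"
      unfolding chart_volume_def using lattice_basis_square(1)[OF B]
      by (intro conjI disjI2 exI[of _ 0] exI[of _ 1]) auto
  qed
qed

end

declare One_nat_def [simp del]

lemma sum_lessThan_2: "(\<Sum>k<2. f k) = f 0 + f (1::nat)"
  by (simp add: numeral_2_eq_2 One_nat_def)

subsection \<open>Quotients by rational lines\<close>

lemma mat_polydisc:
  fixes A :: "complex mat"
  assumes A: "A \<in> carrier_mat m n"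
  obtains C where "C > 0"
    "\<And>x y s. x \<in> carrier_vec n \<Longrightarrow> y \<in> polydisc x s \<Longrightarrow> 0 < s \<Longrightarrow> A *\<^sub>v y \<in> polydisc (A *\<^sub>v x) (C * s)"
proof -
  define C where "C = (\<Sum>i<m. \<Sum>j<n. cmod (A $$ (i, j))) + 1"
  have C: "C > 0" unfolding C_def by (intro add_nonneg_pos sum_nonneg) auto
  show thesis
  proof (rule that[OF C])
    fix x y :: "complex vec" and s :: real assume x: "x \<in> carrier_vec n" and y: "y \<in> polydisc x s" and s: "0 < s"
    have yc: "y \<in> carrier_vec n" using polydisc_carrier[OF y x] .
    show "A *\<^sub>v y \<in> polydisc (A *\<^sub>v x) (C * s)"
      unfolding polydisc_iff
    proof (intro conjI allI impI)
      fix i assume "i < dim_vec (A *\<^sub>v x)"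
      then have i: "i < m" using A by simp
      have row: "(A *\<^sub>v z) $ i = (\<Sum>j<n. A $$ (i, j) * z $ j)" if "z \<in> carrier_vec n" for z
        using A i that by (simp add: scalar_prod_def atLeast0LessThan)
      have "cmod ((A *\<^sub>v y) $ i - (A *\<^sub>v x) $ i) = cmod (\<Sum>j<n. A $$ (i, j) * (y $ j - x $ j))"
        unfolding row[OF x] row[OF yc] by (simp add: sum_subtractf right_diff_distrib)
      also have "\<dots> \<le> (\<Sum>j<n. cmod (A $$ (i, j)) * s)"
      proof (rule order_trans[OF norm_sum], rule sum_mono)
        fix j assume "j \<in> {..<n}"
        then have "cmod (y $ j - x $ j) \<le> s" using y x by (auto simp: polydisc_iff intro: less_imp_le)
        then show "cmod (A $$ (i, j) * (y $ j - x $ j)) \<le> cmod (A $$ (i, j)) * s"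
          unfolding norm_mult by (rule mult_left_mono) simp
      qed
      also have "\<dots> = (\<Sum>j<n. cmod (A $$ (i, j))) * s" by (rule sum_distrib_right[symmetric])
      also have "\<dots> < C * s"
      proof (intro mult_strict_right_mono s)
        have "(\<Sum>j<n. cmod (A $$ (i, j))) \<le> (\<Sum>i<m. \<Sum>j<n. cmod (A $$ (i, j)))"
          using i by (intro member_le_sum[of i "{..<m}" "\<lambda>i. \<Sum>j<n. cmod (A $$ (i, j))"]) (auto intro: sum_nonneg)
        then show "(\<Sum>j<n. cmod (A $$ (i, j))) < C" by (simp add: C_def)
      qed
      finally show "cmod ((A *\<^sub>v y) $ i - (A *\<^sub>v x) $ i) < C * s" .
    qed simp
  qed
qed

lemma polydisc_translate:
  assumes "y \<in> polydisc z s" "w \<in> carrier_vec n" "z \<in> carrier_vec n"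
  shows "w + (y - z) \<in> polydisc w s"
  using assms polydisc_carrier[OF assms(1,3)] by (auto simp: polydisc_iff)

lemma mult_mat_zero_vec: "A \<in> carrier_mat m n \<Longrightarrow> A *\<^sub>v 0\<^sub>v n = (0\<^sub>v m :: 'a::comm_ring_1 vec)"
  by auto

text \<open>A linear map with a right inverse is open, so it pulls back generic properties.\<close>

lemma generically_pullback:
  fixes p r :: "complex mat"
  assumes p: "p \<in> carrier_mat m n" and r: "r \<in> carrier_mat n m" and pr: "p * r = 1\<^sub>m m"
    and P: "generically U P" and V: "open_cn V" "V \<subseteq> carrier_vec n" "\<And>\<xi>. \<xi> \<in> V \<Longrightarrow> p *\<^sub>v \<xi> \<in> U"
  shows "generically V (\<lambda>\<xi>. P (p *\<^sub>v \<xi>))"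
  unfolding generically_def
proof (intro ballI allI impI)
  fix w and s :: real assume w: "w \<in> V" "s > 0"
  have wc: "w \<in> carrier_vec n" using w V by auto
  obtain s' where s': "0 < s'" "s' \<le> s" "polydisc w s' \<subseteq> V" by (rule open_cnE[OF V(1) w])
  obtain Cp where Cp: "Cp > 0"
    "\<And>x y s. x \<in> carrier_vec n \<Longrightarrow> y \<in> polydisc x s \<Longrightarrow> 0 < s \<Longrightarrow> p *\<^sub>v y \<in> polydisc (p *\<^sub>v x) (Cp * s)"
    using mat_polydisc[OF p] by metis
  obtain Cr where Cr: "Cr > 0"
    "\<And>x y s. x \<in> carrier_vec m \<Longrightarrow> y \<in> polydisc x s \<Longrightarrow> 0 < s \<Longrightarrow> r *\<^sub>v y \<in> polydisc (r *\<^sub>v x) (Cr * s)"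
    using mat_polydisc[OF r] by metis
  define z where "z = p *\<^sub>v w"
  have zc: "z \<in> carrier_vec m" using p wc by (simp add: z_def)
  have "s' / Cr > 0" using s' Cr by simp
  then obtain u t where u: "t > 0" "polydisc u t \<subseteq> polydisc z (s' / Cr)" "\<And>v. v \<in> polydisc u t \<Longrightarrow> P v"
    using genericallyE[OF P, of z "s' / Cr"] V(3)[OF w(1)] unfolding z_def by metis
  have uz: "u \<in> polydisc z (s' / Cr)" using u by auto
  have uc: "u \<in> carrier_vec m" using polydisc_carrier[OF uz zc] .
  \<comment> \<open>A point over u and close to w: the displacement u - z is lifted by the right
    inverse r.\<close>
  define \<zeta> where "\<zeta> = w + (r *\<^sub>v u - r *\<^sub>v z)"
  have rc: "r *\<^sub>v u \<in> carrier_vec n" "r *\<^sub>v z \<in> carrier_vec n" using r uc zc by auto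
  have "r *\<^sub>v u \<in> polydisc (r *\<^sub>v z) s'"
    using Cr(2)[OF zc uz] s' Cr(1) by simp
  then have "\<zeta> \<in> polydisc w s'" unfolding \<zeta>_def by (rule polydisc_translate[OF _ wc rc(2)])
  then obtain t' where t': "0 < t'" "t' \<le> t / Cp" "polydisc \<zeta> t' \<subseteq> polydisc w s'"
    using open_cnE[OF open_cn_polydisc, of \<zeta> w s' "t / Cp"] u(1) Cp(1) by (metis divide_pos_pos)
  have \<zeta>c: "\<zeta> \<in> carrier_vec n" using wc rc by (simp add: \<zeta>_def)
  have "p *\<^sub>v \<zeta> = p *\<^sub>v w + (p *\<^sub>v (r *\<^sub>v u) - p *\<^sub>v (r *\<^sub>v z))"
    using p wc rc by (simp add: \<zeta>_def mult_add_distrib_mat_vec[of p m n] mult_minus_distrib_mat_vec[of p m n])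
  also have "p *\<^sub>v (r *\<^sub>v u) = u" using p r uc pr by (simp add: assoc_mult_mat_vec[symmetric, of p m n r m])
  also have "p *\<^sub>v (r *\<^sub>v z) = z" using p r zc pr by (simp add: assoc_mult_mat_vec[symmetric, of p m n r m])
  also have "p *\<^sub>v w + (u - z) = u" using zc uc by (intro eq_vecI) (auto simp: z_def[symmetric])
  finally have p\<zeta>: "p *\<^sub>v \<zeta> = u" .
  have "P (p *\<^sub>v v)" if "v \<in> polydisc \<zeta> t'" for v
  proof (rule u(3))
    have "p *\<^sub>v v \<in> polydisc u (Cp * t')" using Cp(2)[OF \<zeta>c that t'(1)] p\<zeta> by simp
    moreover have "Cp * t' \<le> t" using t'(2) Cp(1) by (simp add: field_simps)
    ultimately show "p *\<^sub>v v \<in> polydisc u t" using polydisc_mono by blast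
  qed
  moreover have "polydisc \<zeta> t' \<subseteq> polydisc w s \<inter> V"
    using t'(3) s'(2,3) polydisc_mono[of s' s w] by auto
  ultimately show "\<exists>u. \<exists>t>0. polydisc u t \<subseteq> polydisc w s \<inter> V \<and> (\<forall>v\<in>polydisc u t. P (p *\<^sub>v v))"
    using t'(1) by blast
qed

section \<open>Rank-one quotients of the plane given by a primitive functional\<close>

lemma scalar_prod_2:
  assumes "x \<in> carrier_vec 2" "y \<in> carrier_vec 2"
  shows "x \<bullet> y = x $ 0 * y $ 0 + x $ 1 * y $ 1"
  using assms by (simp add: scalar_prod_sum[of _ 2] sum_lessThan_2)

lemma vec_2_eqI:
  "x \<in> carrier_vec 2 \<Longrightarrow> y \<in> carrier_vec 2 \<Longrightarrow> x $ 0 = y $ 0 \<Longrightarrow> x $ 1 = y $ 1 \<Longrightarrow> x = y"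
  by (intro eq_vecI) (auto simp: less_2_cases_iff One_nat_def)

text \<open>Dividing W by the gcd g of its entries gives an integral vector, so 1 / g is an integer
  and g = 1. The Bezout coefficients are the entries of z.\<close>

lemma primitive_bezout:
  assumes W: "primitive_vec 2 W"
  obtains z where "z \<in> int_lattice 2" "W \<bullet> z = 1"
proof -
  have Wi: "W $ 0 \<in> \<int>" "W $ 1 \<in> \<int>" using primitive_vecD(1)[OF W] by (auto simp: int_lattice_def)
  then obtain a b where ab: "W $ 0 = of_int a" "W $ 1 = of_int b" by (auto elim!: Ints_cases)
  have Wc: "W \<in> carrier_vec 2" using primitive_vecD(2)[OF W] .
  define g where "g = gcd a b"
  have int2: "x \<in> int_lattice 2" if "x \<in> carrier_vec 2" "x $ 0 \<in> \<int>" "x $ 1 \<in> \<int>" for x :: "rat vec"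
    using that by (auto simp: int_lattice_def less_2_cases_iff One_nat_def)
  have g: "g \<noteq> 0"
  proof
    assume "g = 0"
    then have "(1/2) \<cdot>\<^sub>v W \<in> int_lattice 2" using Wc ab by (intro int2) (auto simp: g_def)
    then have "(1/2 :: rat) \<in> \<int>" by (rule primitive_vecD(3)[OF W])
    then obtain k :: int where "(1/2 :: rat) = of_int k" by (auto elim: Ints_cases)
    then have "of_int (2 * k) = (1::rat)" by simp
    then have "2 * k = 1" by (metis of_int_eq_1_iff)
    then show False by presburger
  qed
  obtain a' b' where a'b': "a = g * a'" "b = g * b'" unfolding g_def by (meson dvdE gcd_dvd1 gcd_dvd2)
  have "(1 / of_int g) \<cdot>\<^sub>v W \<in> int_lattice 2"
    using Wc ab a'b' g by (intro int2) auto
  then have "(1 / of_int g :: rat) \<in> \<int>" by (rule primitive_vecD(3)[OF W])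
  then obtain k :: int where "(1 / of_int g :: rat) = of_int k" by (auto elim: Ints_cases)
  then have "of_int (g * k) = (1::rat)" using g by (simp add: field_simps)
  then have "g * k = 1" by (metis of_int_eq_1_iff)
  moreover have "g \<ge> 0" by (simp add: g_def)
  ultimately have "g = 1" using zmult_eq_1_iff by auto
  then obtain x y where xy: "x * a + y * b = 1" using bezout_int[of a b] by (auto simp: g_def)
  define z where "z = vec 2 (\<lambda>i. if i = 0 then of_int x else of_int y :: rat)"
  have zc: "z \<in> carrier_vec 2" by (simp add: z_def)
  have "W \<bullet> z = W $ 0 * z $ 0 + W $ 1 * z $ 1" by (rule scalar_prod_2[OF Wc zc])
  also have "\<dots> = of_int (x * a + y * b)" by (simp add: ab z_def mult.commute)
  finally have "W \<bullet> z = of_int (x * a + y * b)" .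
  then have "W \<bullet> z = 1" unfolding xy by simp
  moreover have "z \<in> int_lattice 2" by (intro int2) (auto simp: z_def)
  ultimately show thesis using that by blast
qed

text \<open>For a primitive functional x of the plane this matrix presents the quotient by the
  kernel of x, and its transpose embeds the dual of that quotient as the line through x.\<close>

definition row_mat :: "'a vec \<Rightarrow> 'a mat" where
  "row_mat x = mat 1 (dim_vec x) (\<lambda>(_, k). x $ k)"

lemma row_mat_carrier [simp]: "x \<in> carrier_vec n \<Longrightarrow> row_mat x \<in> carrier_mat 1 n"
  by (auto simp: row_mat_def)

lemma row_mat_mult:
  fixes x y :: "'a::comm_ring_1 vec"
  assumes "x \<in> carrier_vec n" "y \<in> carrier_vec n"
  shows "row_mat x *\<^sub>v y = vec 1 (\<lambda>_. x \<bullet> y)"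
  using assms by (intro eq_vecI) (auto simp: row_mat_def scalar_prod_def)

lemma row_mat_transpose_mult:
  fixes x c :: "'a::comm_ring_1 vec"
  assumes "x \<in> carrier_vec n" "c \<in> carrier_vec 1"
  shows "transpose_mat (row_mat x) *\<^sub>v c = c $ 0 \<cdot>\<^sub>v x"
  using assms by (intro eq_vecI) (auto simp: row_mat_def scalar_prod_def mult.commute One_nat_def)

lemma vec_1_eq: "c \<in> carrier_vec 1 \<Longrightarrow> vec 1 (\<lambda>_. c $ 0) = c"
  by (intro eq_vecI) auto

definition unit1 :: "nat \<Rightarrow> rat vec" where "unit1 = (\<lambda>_. vec 1 (\<lambda>_. 1))"

lemma unit1_basis: "rat_dual_basis 1 unit1 unit1"
  by unfold_locales (auto simp: unit1_def scalar_prod_def)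

lemma unit1_primitive: "primitive_vec 1 (unit1 i)"
  by (auto simp: primitive_vec_def unit1_def int_lattice_def)

lemma zero_basis: "rat_dual_basis 0 v w"
  by unfold_locales auto

abbreviation line :: "rat vec \<Rightarrow> rat vec set" where
  "line x \<equiv> {c \<cdot>\<^sub>v x | c. True}"

lemma dual_image_row_mat:
  assumes "W \<in> carrier_vec n"
  shows "dual_image (row_mat W) (carrier_vec 1) = line W"
proof (intro equalityI subsetI)
  fix y assume "y \<in> dual_image (row_mat W) (carrier_vec 1)"
  then show "y \<in> line W" using row_mat_transpose_mult[OF assms] by (auto simp: dual_image_def)
next
  fix y assume "y \<in> line W"
  then obtain c where c: "y = c \<cdot>\<^sub>v W" by blast
  have "y = transpose_mat (row_mat W) *\<^sub>v vec 1 (\<lambda>_. c)"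
    using row_mat_transpose_mult[OF assms, of "vec 1 (\<lambda>_. c)"] c by simp
  then show "y \<in> dual_image (row_mat W) (carrier_vec 1)" unfolding dual_image_def by (rule image_eqI) simp
qed

lemma lattice_quotient_row_mat:
  assumes W: "primitive_vec 2 W"
  shows "lattice_quotient 2 1 (row_mat W)"
  unfolding lattice_quotient_def
proof (intro conjI equalityI subsetI)
  have Wc: "W \<in> carrier_vec 2" using primitive_vecD(2)[OF W] .
  show "row_mat W \<in> carrier_mat 1 2" using Wc by (rule row_mat_carrier)
  { fix y assume "y \<in> (\<lambda>x. row_mat W *\<^sub>v x) ` int_lattice 2"
    then obtain x where x: "x \<in> int_lattice 2" "y = row_mat W *\<^sub>v x" by blast
    have xc: "x \<in> carrier_vec 2" using x by (simp add: int_lattice_def)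
    have "W \<bullet> x \<in> \<int>"
      unfolding scalar_prod_2[OF Wc xc] using x(1) primitive_vecD(1)[OF W]
      by (intro Ints_add Ints_mult) (auto simp: int_lattice_def)
    then show "y \<in> int_lattice 1" using x(2) row_mat_mult[OF Wc xc] by (simp add: int_lattice_def) }
  { fix y :: "rat vec" assume y: "y \<in> int_lattice 1"
    obtain z where z: "z \<in> int_lattice 2" "W \<bullet> z = 1" by (rule primitive_bezout[OF W])
    have zc: "z \<in> carrier_vec 2" using z by (simp add: int_lattice_def)
    have "y $ 0 \<cdot>\<^sub>v z \<in> int_lattice 2" using y z by (auto simp: int_lattice_def)
    moreover have "row_mat W *\<^sub>v (y $ 0 \<cdot>\<^sub>v z) = y"
    proof -
      have "W \<bullet> (y $ 0 \<cdot>\<^sub>v z) = y $ 0" using zc z(2) Wc by (simp add: scalar_prod_smult_distrib[of _ 2])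
      then have "row_mat W *\<^sub>v (y $ 0 \<cdot>\<^sub>v z) = vec 1 (\<lambda>_. y $ 0)"
        using row_mat_mult[OF Wc, of "y $ 0 \<cdot>\<^sub>v z"] zc by simp
      moreover have "y \<in> carrier_vec 1" using y by (simp add: int_lattice_def)
      ultimately show ?thesis using vec_1_eq[of y] by metis
    qed
    ultimately show "y \<in> (\<lambda>x. row_mat W *\<^sub>v x) ` int_lattice 2" by (metis imageI) }
qed

text \<open>The dual of the quotient is a line and has only two subspaces. With both in the domain
  of the induced map, no genericity condition remains on the cones of the quotient.\<close>

lemma induced_line_dom:
  assumes W: "W \<in> carrier_vec 2" and u: "u \<in> carrier_vec 2" "u \<bullet> W = 1"
    and \<Psi>0: "\<Psi> {0\<^sub>v 2} = Some (carrier_vec 2)" and \<Psi>W: "\<Psi> (line W) = Some {y \<in> carrier_vec 2. u \<bullet> y = 0}"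
  shows "{0\<^sub>v 1} \<in> dom (induced_map \<Psi> 1 (row_mat W))" "carrier_vec 1 \<in> dom (induced_map \<Psi> 1 (row_mat W))"
proof -
  have lc: "line W \<subseteq> carrier_vec 2" using W by auto
  have dc: "dim_col (row_mat W) = 2" using row_mat_carrier[OF W] by (simp only: carrier_matD)
  have im0: "dual_image (row_mat W) {0\<^sub>v 1} = {0\<^sub>v 2}"
    using row_mat_transpose_mult[OF W, of "0\<^sub>v 1"] W by (auto simp: dual_image_def)
  have z: "0\<^sub>v 2 \<in> line W"
  proof -
    have "0\<^sub>v 2 = 0 \<cdot>\<^sub>v W" using W by auto
    then show ?thesis by blast
  qed
  have "direct_sum 2 (line W) {0\<^sub>v 2} (carrier_vec 2 \<inter> line W)"
    unfolding direct_sum_def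
  proof (intro conjI equalityI subsetI)
    fix x assume x: "x \<in> line W"
    then have "x = 0\<^sub>v 2 + x" using lc by auto
    then show "x \<in> {u + w |u w. u \<in> {0\<^sub>v 2} \<and> w \<in> carrier_vec 2 \<inter> line W}" using x lc by blast
  next
    fix x assume "x \<in> {u + w |u w. u \<in> {0\<^sub>v 2} \<and> w \<in> carrier_vec 2 \<inter> line W}"
    then obtain y where "x = 0\<^sub>v 2 + y" "y \<in> carrier_vec 2" "y \<in> line W" by blast
    then show "x \<in> line W" by simp
  qed (use z in auto)
  then show "{0\<^sub>v 1} \<in> dom (induced_map \<Psi> 1 (row_mat W))"
    unfolding induced_map_def Let_def dom_def mem_Collect_eq im0 dual_image_row_mat[OF W] dc \<Psi>0 by simp
  have X: "{y \<in> carrier_vec 2. u \<bullet> y = 0} \<inter> line W = {0\<^sub>v 2}"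
  proof (intro equalityI subsetI)
    fix x assume x: "x \<in> {y \<in> carrier_vec 2. u \<bullet> y = 0} \<inter> line W"
    then obtain c where c: "x = c \<cdot>\<^sub>v W" by blast
    have "u \<bullet> x = c" using c u W by (simp add: scalar_prod_smult_distrib[of _ 2])
    then have "c = 0" using x by simp
    then show "x \<in> {0\<^sub>v 2}" using c W by auto
  qed (use z u in auto)
  have "direct_sum 2 (line W) (line W) ({y \<in> carrier_vec 2. u \<bullet> y = 0} \<inter> line W)"
    unfolding direct_sum_def X
  proof (intro conjI equalityI subsetI)
    fix x assume x: "x \<in> line W"
    then have "x = x + 0\<^sub>v 2" using lc by auto
    then show "x \<in> {u + w |u w. u \<in> line W \<and> w \<in> {0\<^sub>v 2}}" using x by blast
  next
    fix x assume "x \<in> {u + w |u w. u \<in> line W \<and> w \<in> {0\<^sub>v 2}}"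
    then obtain y where "x = y + 0\<^sub>v 2" "y \<in> line W" by blast
    moreover then have "y \<in> carrier_vec 2" using lc by blast
    ultimately show "x \<in> line W" by simp
  qed (use z in auto)
  then show "carrier_vec 1 \<in> dom (induced_map \<Psi> 1 (row_mat W))"
    unfolding induced_map_def Let_def dom_def mem_Collect_eq dual_image_row_mat[OF W] dc \<Psi>W by simp
qed

text \<open>The projection onto the line through W along the kernel of u sends y to (u . y) W, so in
  the coordinate of the quotient its matrix is the row u.\<close>

lemma projection_row_mat:
  assumes W: "W \<in> carrier_vec 2" and u: "u \<in> carrier_vec 2" "u \<bullet> W = 1"
    and \<Psi>W: "\<Psi> (line W) = Some {y \<in> carrier_vec 2. u \<bullet> y = 0}"
  shows "is_projection 2 \<Psi> 1 (row_mat W) (row_mat u)"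
  unfolding is_projection_def dual_image_row_mat[OF W] \<Psi>W option.sel
proof (intro conjI)
  show "row_mat u \<in> carrier_mat 1 2" using u(1) by (rule row_mat_carrier)
  have dims: "dim_vec u = 2" "dim_vec W = 2" using u W by auto
  show "row_mat u * transpose_mat (row_mat W) = 1\<^sub>m 1"
    using u scalar_prod_2[OF u(1) W]
    by (intro eq_matI) (auto simp: row_mat_def scalar_prod_def dims numeral_2_eq_2)
  show "{\<xi> \<in> carrier_vec 2. row_mat u *\<^sub>v \<xi> = 0\<^sub>v 1} = {y \<in> carrier_vec 2. u \<bullet> y = 0}"
  proof (intro Collect_cong conj_cong refl)
    fix \<xi> :: "rat vec" assume "\<xi> \<in> carrier_vec 2"
    then have "row_mat u *\<^sub>v \<xi> = vec 1 (\<lambda>_. u \<bullet> \<xi>)" by (rule row_mat_mult[OF u(1)])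
    then show "(row_mat u *\<^sub>v \<xi> = 0\<^sub>v 1) = (u \<bullet> \<xi> = 0)" by (auto simp: vec_eq_iff)
  qed
qed

lemma preim_row_mat:
  assumes W: "W \<in> carrier_vec 2"
  shows "preim 2 (row_mat W) {0\<^sub>v 1} = {x \<in> carrier_vec 2. W \<bullet> x = 0}"
    "preim 2 (row_mat W) (coord_cone 1 unit1 {0} {}) = {x \<in> carrier_vec 2. 0 \<le> W \<bullet> x}"
    "preim 2 (row_mat W) (carrier_vec 1) = carrier_vec 2"
proof -
  have eq: "row_mat W *\<^sub>v x = vec 1 (\<lambda>_. W \<bullet> x)" if "x \<in> carrier_vec 2" for x
    by (rule row_mat_mult[OF W that])
  have 0: "vec 1 (\<lambda>_. c) = 0\<^sub>v 1 \<longleftrightarrow> c = 0" for c :: rat by (auto simp: vec_eq_iff)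
  have 1: "vec 1 (\<lambda>_. c) \<in> coord_cone 1 unit1 {0} {} \<longleftrightarrow> 0 \<le> c" for c
    by (auto simp: coord_cone_def unit1_def scalar_prod_def)
  have 2: "vec 1 (\<lambda>_. c) \<in> carrier_vec 1" for c :: rat by simp
  show "preim 2 (row_mat W) {0\<^sub>v 1} = {x \<in> carrier_vec 2. W \<bullet> x = 0}"
    unfolding preim_def by (intro Collect_cong conj_cong refl) (simp only: eq 0 singleton_iff)
  show "preim 2 (row_mat W) (coord_cone 1 unit1 {0} {}) = {x \<in> carrier_vec 2. 0 \<le> W \<bullet> x}"
    unfolding preim_def by (intro Collect_cong conj_cong refl) (simp only: eq 1)
  show "preim 2 (row_mat W) (carrier_vec 1) = carrier_vec 2"
    unfolding preim_def using eq 2 by auto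
qed

lemma polydisc_zero_carrier: "polydisc (0\<^sub>v n) r \<subseteq> carrier_vec n"
  using polydisc_carrier[of _ "0\<^sub>v n" r n] by auto

lemma (in rat_dual_basis) neg_region_extend:
  assumes f: "f \<in> meromorphic_cn n" and e: "holomorphic_cn n e (polydisc (0\<^sub>v n) r0)" and r0: "r0 > 0"
    and I: "I \<subseteq> {..<n}" and eq: "generically (neg_region I \<inter> polydisc (0\<^sub>v n) r0) (\<lambda>\<xi>. f \<xi> = e \<xi>)"
  obtains r where "r > 0" "r \<le> r0" "generically (polydisc (0\<^sub>v n) r) (\<lambda>\<xi>. f \<xi> = e \<xi>)"
  using meromorphic_agree_extend[OF f e r0 zero_carrier_vec neg_region_open[OF I] neg_region_accumulates[OF I] eq]
  by blast

subsection \<open>Interpolators near the origin\<close>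

text \<open>
  Both kinds of interpolator solve \<open>A(P) = \<Sum> \<mu>(Supp(P, F)) B(F)\<close>: for \<open>\<mu>\<close> the pair \<open>(A, B)\<close> is
  \<open>(S, I)\<close>, for \<open>\<nu>\<close> it is \<open>(I, S\<^sup>0)\<close>. On a ray with generator v both sides are functions \<open>\<alpha>\<close>,
  \<open>\<beta>\<close> of \<open>\<langle>\<xi>, v\<rangle>\<close> whose difference \<open>\<rho>\<close> is regular at 0.
\<close>

locale interpolation =
  fixes cone_class :: "nat \<Rightarrow> rat vec set \<Rightarrow> bool"
    and identity :: "nat \<Rightarrow> complement_map \<Rightarrow> interpolator \<Rightarrow> bool"
    and A B :: "nat \<Rightarrow> rat vec set \<Rightarrow> complex vec \<Rightarrow> complex"
    and \<alpha> \<beta> \<rho> :: "complex \<Rightarrow> complex"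
  assumes cone_class: "rat_dual_basis n v w \<Longrightarrow> J \<subseteq> I \<Longrightarrow> I \<subseteq> {..<n} \<Longrightarrow> cone_class n (coord_cone n w I J)"
    and identity: "rat_dual_basis n v w \<Longrightarrow> I \<subseteq> {..<n} \<Longrightarrow> generic_cone n \<Psi> (coord_cone n w I {}) \<Longrightarrow>
      identity n \<Psi> \<mu> \<Longrightarrow> mero_eq n (A n (coord_cone n w I {}))
        (\<lambda>\<xi>. \<Sum>I'\<in>Pow I. \<mu> (coord_cone n w I I') \<xi> * B n (coord_cone n w I' {}) \<xi>)"
    and A_point: "\<xi> \<in> carrier_vec n \<Longrightarrow> has_value n (A n {0\<^sub>v n}) \<xi> 1"
    and B_point: "\<xi> \<in> carrier_vec n \<Longrightarrow> has_value n (B n {0\<^sub>v n}) \<xi> 1"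
    and A_ray: "rat_dual_basis n v w \<Longrightarrow> i < n \<Longrightarrow> primitive_vec n (v i) \<Longrightarrow> \<xi> \<in> carrier_vec n \<Longrightarrow>
      Re (\<xi> \<bullet> cvec (v i)) < 0 \<Longrightarrow> has_value n (A n (coord_cone n w {i} {})) \<xi> (\<alpha> (\<xi> \<bullet> cvec (v i)))"
    and B_ray: "rat_dual_basis n v w \<Longrightarrow> i < n \<Longrightarrow> primitive_vec n (v i) \<Longrightarrow> \<xi> \<in> carrier_vec n \<Longrightarrow>
      Re (\<xi> \<bullet> cvec (v i)) < 0 \<Longrightarrow> has_value n (B n (coord_cone n w {i} {})) \<xi> (\<beta> (\<xi> \<bullet> cvec (v i)))"
    and rho_eq: "Re y < 0 \<Longrightarrow> norm y < 1 \<Longrightarrow> \<alpha> y = \<rho> y + \<beta> y"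
    and rho_holomorphic: "\<rho> holomorphic_on ball 0 1"
begin

lemma linear_small:
  assumes "a \<in> carrier_vec n" "e > 0"
  obtains r where "r > 0" "\<And>\<xi>. \<xi> \<in> polydisc (0\<^sub>v n) r \<Longrightarrow> cmod (\<xi> \<bullet> a) < e"
proof -
  have z: "0\<^sub>v n \<in> carrier_vec n" by simp
  obtain r where "r > 0" "\<And>\<xi>. \<xi> \<in> polydisc (0\<^sub>v n) r \<Longrightarrow> cmod (\<xi> \<bullet> a - 0\<^sub>v n \<bullet> a) < e"
    using cn_deriv_continuous[OF cn_deriv_linear[OF assms(1) z] z assms(2)] by metis
  then show thesis using that[of r] assms(1) by simp
qed

text \<open>A point has a single face, and A and B both take the value 1 on it.\<close>

lemma point:
  assumes "rat_dual_basis n v w" "identity n \<Psi> \<mu>" "generic_cone n \<Psi> {0\<^sub>v n}"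
  shows "generically (carrier_vec n) (\<lambda>\<xi>. \<mu> {0\<^sub>v n} \<xi> = 1)"
proof -
  interpret D: rat_dual_basis n v w by fact
  have eq: "coord_cone n w {} {} = {0\<^sub>v n}" by (rule D.coord_space_empty)
  have "mero_eq n (A n {0\<^sub>v n}) (\<lambda>\<xi>. \<mu> {0\<^sub>v n} \<xi> * B n {0\<^sub>v n} \<xi>)"
    using identity[OF assms(1), of "{}" \<Psi> \<mu>] assms eq by simp
  then have 1: "generically (carrier_vec n) (\<lambda>\<xi>. A n {0\<^sub>v n} \<xi> = \<mu> {0\<^sub>v n} \<xi> * B n {0\<^sub>v n} \<xi>)"
    by (simp add: mero_eq_def agree_generically_iff)
  have 2: "generically (carrier_vec n) (\<lambda>\<xi>. A n {0\<^sub>v n} \<xi> = 1)" "generically (carrier_vec n) (\<lambda>\<xi>. B n {0\<^sub>v n} \<xi> = 1)"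
    using A_point B_point by (auto intro!: has_value_imp_generically open_cn_carrier)
  show ?thesis
    by (rule generically_mono[OF generically_conj[OF 1 generically_conj[OF 2]]]) auto
qed

text \<open>The identity for a ray reads \<alpha> = \<mu>(ray) + \<mu>(span) \<beta> with
  \<mu>(span) = 1, so \<mu>(ray) = \<rho> where the edge pairs to a negative real part. As \<rho> is
  regular at 0 and \<mu>(ray) is meromorphic, the equality extends to a polydisc.\<close>

lemma ray:
  assumes D: "rat_dual_basis n v w" and id: "identity n \<Psi> \<mu>" and gen: "generic_cone n \<Psi> (coord_cone n w {i} {})"
    and i: "i < n" and prim: "primitive_vec n (v i)" and mero: "\<mu> (coord_cone n w {i} {}) \<in> meromorphic_cn n"
    and lin: "generically (carrier_vec n) (\<lambda>\<xi>. \<mu> (coord_space n w {i}) \<xi> = 1)"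
  obtains r where "r > 0" "\<And>\<xi>. \<xi> \<in> polydisc (0\<^sub>v n) r \<Longrightarrow> cmod (\<xi> \<bullet> cvec (v i)) < 1"
    "generically (polydisc (0\<^sub>v n) r) (\<lambda>\<xi>. \<mu> (coord_cone n w {i} {}) \<xi> = \<rho> (\<xi> \<bullet> cvec (v i)))"
proof -
  interpret D: rat_dual_basis n v w by fact
  let ?K = "coord_cone n w {i} {}"
  define y where "y = (\<lambda>\<xi>. \<xi> \<bullet> cvec (v i))"
  have vc: "cvec (v i) \<in> carrier_vec n" using i by simp
  obtain r0 where r0: "r0 > 0" "\<And>\<xi>. \<xi> \<in> polydisc (0\<^sub>v n) r0 \<Longrightarrow> cmod (y \<xi>) < 1"
    unfolding y_def by (rule linear_small[OF vc, of 1]) auto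
  define U where "U = D.neg_region {i} \<inter> polydisc (0\<^sub>v n) r0"
  have U: "open_cn U" "U \<subseteq> carrier_vec n"
    using D.neg_region_open[of "{i}"] i open_cn_polydisc open_cn_Int by (auto simp: U_def D.neg_region_def)
  have UR: "Re (y \<xi>) < 0" "\<xi> \<in> carrier_vec n" "cmod (y \<xi>) < 1" if "\<xi> \<in> U" for \<xi>
    using that r0 by (auto simp: U_def D.neg_region_def y_def)
  have Pow: "Pow {i} = {{}, {i}}" by auto
  have "mero_eq n (A n ?K) (\<lambda>\<xi>. \<Sum>I'\<in>Pow {i}. \<mu> (coord_cone n w {i} I') \<xi> * B n (coord_cone n w I' {}) \<xi>)"
    using identity[OF D _ gen id] i by simp
  then have 1: "generically (carrier_vec n) (\<lambda>\<xi>. A n ?K \<xi> = \<mu> ?K \<xi> * B n {0\<^sub>v n} \<xi> + \<mu> (coord_space n w {i}) \<xi> * B n ?K \<xi>)"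
    unfolding Pow by (simp add: mero_eq_def agree_generically_iff D.coord_space_empty)
  have 2: "generically U (\<lambda>\<xi>. A n ?K \<xi> = \<alpha> (y \<xi>))" "generically U (\<lambda>\<xi>. B n ?K \<xi> = \<beta> (y \<xi>))"
    using A_ray[OF D i prim] B_ray[OF D i prim] UR by (auto intro!: has_value_imp_generically U simp: y_def)
  have 3: "generically U (\<lambda>\<xi>. B n {0\<^sub>v n} \<xi> = 1)"
    using B_point UR by (auto intro!: has_value_imp_generically U)
  have "generically U (\<lambda>\<xi>. \<mu> ?K \<xi> = \<rho> (y \<xi>))"
  proof (rule generically_mono[OF generically_conj[OF generically_subset[OF 1 U(2,1)]
        generically_conj[OF generically_subset[OF lin U(2,1)] generically_conj[OF generically_conj[OF 2] 3]]]])
    fix \<xi> assume \<xi>: "\<xi> \<in> U"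
    have "\<alpha> (y \<xi>) = \<rho> (y \<xi>) + \<beta> (y \<xi>)" by (rule rho_eq) (use UR[OF \<xi>] in auto)
    then show "A n ?K \<xi> = \<mu> ?K \<xi> * B n {0\<^sub>v n} \<xi> + \<mu> (coord_space n w {i}) \<xi> * B n ?K \<xi> \<and>
         \<mu> (coord_space n w {i}) \<xi> = 1 \<and> (A n ?K \<xi> = \<alpha> (y \<xi>) \<and> B n ?K \<xi> = \<beta> (y \<xi>)) \<and> B n {0\<^sub>v n} \<xi> = 1 \<Longrightarrow>
         \<mu> ?K \<xi> = \<rho> (y \<xi>)" by auto
  qed
  moreover have "holomorphic_cn n (\<lambda>\<xi>. \<rho> (y \<xi>)) (polydisc (0\<^sub>v n) r0)"
    unfolding y_def
    by (rule holomorphic_cn_compose[OF polydisc_zero_carrier holomorphic_cn_linear[OF polydisc_zero_carrier vc] rho_holomorphic])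
       (use r0 in \<open>auto simp: y_def\<close>)
  ultimately obtain r where r: "r > 0" "r \<le> r0" "generically (polydisc (0\<^sub>v n) r) (\<lambda>\<xi>. \<mu> ?K \<xi> = \<rho> (y \<xi>))"
    using D.neg_region_extend[OF mero _ r0(1), of "\<lambda>\<xi>. \<rho> (y \<xi>)" "{i}"] i unfolding U_def by auto
  show thesis
    by (rule that[OF r(1)]) (use r0(2) polydisc_mono[OF r(2)] r(3) in \<open>auto simp: y_def\<close>)
qed

text \<open>Compatibility expresses \<mu> of a preimage as its restriction to the dual of the
  quotient composed with the projection p. The transpose of q is a right inverse of p, so generic
  statements can be pulled back along p.\<close>

lemma pullback:
  assumes compat: "compatible_interpolator cone_class identity n \<Psi> \<mu>"
    and q: "generic_quotient n \<Psi> m q" and p: "is_projection n \<Psi> m q p"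
    and K: "cone_class m K" "generic_cone m (induced_map \<Psi> m q) K"
    and eq: "generically U (\<lambda>\<eta>. restriction n q (\<mu> (preim n q K)) \<eta> = e \<eta>)"
    and V: "open_cn V" "V \<subseteq> carrier_vec n" "\<And>\<xi>. \<xi> \<in> V \<Longrightarrow> map_mat of_rat p *\<^sub>v \<xi> \<in> U"
  shows "generically V (\<lambda>\<xi>. \<mu> (preim n q K) \<xi> = e (map_mat of_rat p *\<^sub>v \<xi>))"
proof -
  have pc: "p \<in> carrier_mat m n" and pq: "p * transpose_mat q = 1\<^sub>m m" using p by (auto simp: is_projection_def)
  have qc: "q \<in> carrier_mat m n" using q by (simp add: generic_quotient_def lattice_quotient_def)
  have "(map_mat of_rat p :: complex mat) * map_mat of_rat (transpose_mat q) = map_mat of_rat (p * transpose_mat q)"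
    using pc qc by (intro eq_matI) (auto simp: scalar_prod_def of_rat_sum of_rat_mult)
  also have "\<dots> = 1\<^sub>m m" unfolding pq by (intro eq_matI) auto
  finally have inv: "(map_mat of_rat p :: complex mat) * map_mat of_rat (transpose_mat q) = 1\<^sub>m m" .
  have "generically V (\<lambda>\<xi>. restriction n q (\<mu> (preim n q K)) (map_mat of_rat p *\<^sub>v \<xi>) = e (map_mat of_rat p *\<^sub>v \<xi>))"
    by (rule generically_pullback[OF _ _ inv eq V]) (use pc qc in auto)
  moreover have "mero_eq n (\<mu> (preim n q K)) (\<lambda>\<xi>. restriction n q (\<mu> (preim n q K)) (map_mat of_rat p *\<^sub>v \<xi>))"
    using compat q p K unfolding compatible_interpolator_def Let_def by blast
  then have "generically V (\<lambda>\<xi>. \<mu> (preim n q K) \<xi> = restriction n q (\<mu> (preim n q K)) (map_mat of_rat p *\<^sub>v \<xi>))"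
    unfolding mero_eq_def agree_generically_iff using V by (blast intro: generically_subset)
  ultimately show ?thesis by (rule generically_mono[OF generically_conj]) auto
qed

lemma quotient_facts:
  assumes "compatible_interpolator cone_class identity n \<Psi> \<mu>" "generic_quotient n \<Psi> m q"
  shows "identity m (induced_map \<Psi> m q) (\<lambda>K. restriction n q (\<mu> (preim n q K)))"
    and "cone_class m K \<Longrightarrow> generic_cone m (induced_map \<Psi> m q) K \<Longrightarrow> restriction n q (\<mu> (preim n q K)) \<in> meromorphic_cn m"
  using assms unfolding compatible_interpolator_def Let_def by blast+

text \<open>The whole space is the preimage of the point in the quotient of dimension 0, which is
  presented by the matrix without rows.\<close>

lemma whole_space:
  assumes compat: "compatible_interpolator cone_class identity n \<Psi> \<mu>"
    and \<Psi>0: "\<Psi> {0\<^sub>v n} = Some (carrier_vec n)"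
  shows "generically (carrier_vec n) (\<lambda>\<xi>. \<mu> (carrier_vec n) \<xi> = 1)"
proof -
  interpret Z: rat_dual_basis 0 unit1 unit1 by (rule zero_basis)
  define q where "q = (0\<^sub>m 0 n :: rat mat)"
  have c0: "carrier_vec 0 = {0\<^sub>v 0 :: 'a::zero vec}" by auto
  have im: "dual_image q X = {0\<^sub>v n}" if "X = {0\<^sub>v 0}" for X
    using that by (auto simp: dual_image_def q_def)
  have il: "int_lattice 0 = {0\<^sub>v 0 :: rat vec}" by (auto simp: int_lattice_def)
  have q0: "q *\<^sub>v x = 0\<^sub>v 0" for x by (rule eq_vecI) (auto simp: q_def)
  have "0\<^sub>v n \<in> (int_lattice n :: rat vec set)" by (simp add: int_lattice_def)
  then have "(\<lambda>x. q *\<^sub>v x) ` int_lattice n = int_lattice 0" unfolding il by (auto simp: q0)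
  moreover have "dual_image q (carrier_vec 0) \<in> dom \<Psi>" unfolding im[OF c0] using \<Psi>0 by blast
  moreover have "q \<in> carrier_mat 0 n" by (simp add: q_def)
  ultimately have gq: "generic_quotient n \<Psi> 0 q"
    unfolding generic_quotient_def lattice_quotient_def by blast
  have pr: "is_projection n \<Psi> 0 q (0\<^sub>m 0 n)"
    unfolding is_projection_def im[OF c0] \<Psi>0 by (auto simp: q_def)
  have pre: "preim n q {0\<^sub>v 0} = carrier_vec n" by (auto simp: preim_def q_def)
  have dc: "dim_col q = n" by (simp add: q_def)
  have ds: "direct_sum n {0\<^sub>v n} {0\<^sub>v n} (carrier_vec n \<inter> {0\<^sub>v n})" by (auto simp: direct_sum_def)
  have dom: "{0\<^sub>v 0} \<in> dom (induced_map \<Psi> 0 q)"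
    unfolding induced_map_def Let_def dom_def mem_Collect_eq im[OF c0] im[OF refl] \<Psi>0 dc using ds by simp
  have cs: "coord_space 0 unit1 I = {0\<^sub>v 0}" for I by (auto simp: coord_cone_def)
  have gen: "generic_cone 0 (induced_map \<Psi> 0 q) {0\<^sub>v 0}"
    using Z.generic_coord_cone_iff[of "{}" "{}" "induced_map \<Psi> 0 q"] dom unfolding cs by simp
  have "cone_class 0 (coord_space 0 unit1 {})" by (rule cone_class[OF zero_basis]) auto
  then have cl: "cone_class 0 {0\<^sub>v 0}" unfolding cs .
  have "generically (carrier_vec 0) (\<lambda>\<eta>. restriction n q (\<mu> (preim n q {0\<^sub>v 0})) \<eta> = 1)"
    by (rule point[OF zero_basis quotient_facts(1)[OF compat gq] gen])
  then have "generically (carrier_vec n) (\<lambda>\<xi>. \<mu> (preim n q {0\<^sub>v 0}) \<xi> = 1)"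
  proof (rule pullback[OF compat gq pr cl gen _ open_cn_carrier, where e = "\<lambda>_. 1"])
    fix \<xi> :: "complex vec" assume "\<xi> \<in> carrier_vec n"
    show "map_mat of_rat (0\<^sub>m 0 n) *\<^sub>v \<xi> \<in> carrier_vec 0" by (rule carrier_vecI) simp
  qed simp
  then show ?thesis unfolding pre .
qed

text \<open>In the rank-one quotient defined by W, the kernel of W is the preimage of a point and
  the half-plane is the preimage of a ray. The projection sends \<xi> to the multiple \<xi> . u of
  W, and this multiple is the argument of \<rho>.\<close>

lemma quotient_line:
  assumes compat: "compatible_interpolator cone_class identity 2 \<Psi> \<mu>"
    and \<Psi>0: "\<Psi> {0\<^sub>v 2} = Some (carrier_vec 2)"
    and W: "primitive_vec 2 W" and u: "u \<in> carrier_vec 2" "u \<bullet> W = 1"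
    and \<Psi>W: "\<Psi> (line W) = Some {y \<in> carrier_vec 2. u \<bullet> y = 0}"
  shows "generically (carrier_vec 2) (\<lambda>\<xi>. \<mu> {x \<in> carrier_vec 2. W \<bullet> x = 0} \<xi> = 1)"
    and "\<exists>r>0. generically (polydisc (0\<^sub>v 2) r) (\<lambda>\<xi>. \<mu> {x \<in> carrier_vec 2. 0 \<le> W \<bullet> x} \<xi> = \<rho> (\<xi> \<bullet> cvec u))"
proof -
  interpret D: rat_dual_basis 1 unit1 unit1 by (rule unit1_basis)
  have Wc: "W \<in> carrier_vec 2" using primitive_vecD(2)[OF W] .
  define q where "q = row_mat W"
  define p where "p = row_mat u"
  have gq: "generic_quotient 2 \<Psi> 1 q"
    unfolding generic_quotient_def q_def dual_image_row_mat[OF Wc] using lattice_quotient_row_mat[OF W] \<Psi>W by auto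
  have pr: "is_projection 2 \<Psi> 1 q p" unfolding q_def p_def using projection_row_mat[of W u \<Psi>] Wc u \<Psi>W by blast
  have dom: "{0\<^sub>v 1} \<in> dom (induced_map \<Psi> 1 q)" "carrier_vec 1 \<in> dom (induced_map \<Psi> 1 q)"
    unfolding q_def using induced_line_dom[of W u \<Psi>] Wc u \<Psi>0 \<Psi>W by blast+
  note pre = preim_row_mat[OF Wc, folded q_def]
  have one: "{..<1::nat} = {0}" by auto
  have cs: "coord_space 1 unit1 {} = {0\<^sub>v 1}" "coord_space 1 unit1 {0} = carrier_vec 1"
    using D.coord_space_empty coord_space_full[of 1 unit1] unfolding one by auto
  have csd: "coord_space 1 unit1 ({..<1} - I') \<in> dom (induced_map \<Psi> 1 q)" if "I' \<subseteq> {0}" for I'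
  proof -
    have "I' = {} \<or> I' = {0}" using that by blast
    then show ?thesis using dom cs by (auto simp: one)
  qed
  have gen: "generic_cone 1 (induced_map \<Psi> 1 q) (coord_cone 1 unit1 I J)" if "J \<subseteq> I" "I \<subseteq> {0}" for I J
  proof -
    have "I \<subseteq> {..<1}" using that one by simp
    then show ?thesis using D.generic_coord_cone_iff[OF that(1)] csd that(2) by (meson order_trans)
  qed
  have cl: "cone_class 1 (coord_cone 1 unit1 I J)" if "J \<subseteq> I" "I \<subseteq> {0}" for I J
    using cone_class[OF unit1_basis, of J I] that by (auto simp: one)
  have gen0: "generic_cone 1 (induced_map \<Psi> 1 q) {0\<^sub>v 1}" using gen[of "{}" "{}"] cs by simp
  have cl0: "cone_class 1 {0\<^sub>v 1}" using cl[of "{}" "{}"] cs by simp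
  have "generically (carrier_vec 1) (\<lambda>\<eta>. restriction 2 q (\<mu> (preim 2 q {0\<^sub>v 1})) \<eta> = 1)"
    by (rule point[OF unit1_basis quotient_facts(1)[OF compat gq] gen0])
  moreover have pm: "(map_mat of_rat p :: complex mat) \<in> carrier_mat 1 2"
    using row_mat_carrier[OF u(1)] unfolding p_def by auto
  ultimately show "generically (carrier_vec 2) (\<lambda>\<xi>. \<mu> {x \<in> carrier_vec 2. W \<bullet> x = 0} \<xi> = 1)"
    unfolding pre(1)[symmetric]
    by (intro pullback[OF compat gq pr cl0 gen0 _ open_cn_carrier, where e = "\<lambda>_. 1" and U = "carrier_vec 1"]) auto
  let ?R = "coord_cone 1 unit1 {0} {}"
  \<comment> \<open>The restriction lives on a line in the plane, about which generic agreement says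
    nothing. As \<open>restriction\<close> is defined through values, the generic equality is
    converted into a value at every point.\<close>
  have "has_value 2 (\<mu> (carrier_vec 2)) z 1" if "z \<in> carrier_vec 2" for z
    using has_valueI[OF open_cn_carrier _ that, where e = "\<lambda>_. 1" and f = "\<mu> (carrier_vec 2)"] whole_space[OF compat \<Psi>0]
    by (auto intro: holomorphic_cn_const)
  then have mv: "mero_value 2 (\<mu> (carrier_vec 2)) z = 1" if "z \<in> carrier_vec 2" for z
    using mero_value_eq that by blast
  have "restriction 2 q (\<mu> (preim 2 q (coord_space 1 unit1 {0}))) \<eta> = 1" if "\<eta> \<in> carrier_vec 1" for \<eta>
  proof -
    have "map_mat of_rat (transpose_mat q) *\<^sub>v \<eta> \<in> carrier_vec 2"
      using that row_mat_carrier[OF Wc] by (auto simp: q_def)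
    then show ?thesis unfolding cs(2) pre(3) restriction_def by (rule mv)
  qed
  then have lin: "generically (carrier_vec 1) (\<lambda>\<eta>. restriction 2 q (\<mu> (preim 2 q (coord_space 1 unit1 {0}))) \<eta> = 1)"
    by (intro generically_all open_cn_carrier) auto
  have genR: "generic_cone 1 (induced_map \<Psi> 1 q) ?R" by (rule gen) auto
  have m: "restriction 2 q (\<mu> (preim 2 q ?R)) \<in> meromorphic_cn 1"
    by (rule quotient_facts(2)[OF compat gq cl gen]) auto
  obtain r where r: "r > 0"
    "generically (polydisc (0\<^sub>v 1) r) (\<lambda>\<eta>. restriction 2 q (\<mu> (preim 2 q ?R)) \<eta> = \<rho> (\<eta> \<bullet> cvec (unit1 0)))"
    by (rule ray[OF unit1_basis quotient_facts(1)[OF compat gq] genR]) (use unit1_primitive m lin in auto)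
  obtain C where C: "C > 0" "\<And>x y s. x \<in> carrier_vec 2 \<Longrightarrow> y \<in> polydisc x s \<Longrightarrow> 0 < s \<Longrightarrow>
      (map_mat of_rat p :: complex mat) *\<^sub>v y \<in> polydisc (map_mat of_rat p *\<^sub>v x) (C * s)"
    using mat_polydisc[OF pm] by metis
  have p0: "(map_mat of_rat p :: complex mat) *\<^sub>v 0\<^sub>v 2 = 0\<^sub>v 1" by (rule mult_mat_zero_vec[OF pm])
  have into: "map_mat of_rat p *\<^sub>v \<xi> \<in> polydisc (0\<^sub>v 1) r" if "\<xi> \<in> polydisc (0\<^sub>v 2) (r / C)" for \<xi>
    using C(2)[OF zero_carrier_vec that] r(1) C(1) by (simp add: p0)
  have val: "(map_mat of_rat p *\<^sub>v \<xi>) \<bullet> cvec (unit1 0) = \<xi> \<bullet> cvec u" if "\<xi> \<in> carrier_vec 2" for \<xi>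
  proof -
    have "(map_mat of_rat p *\<^sub>v \<xi>) $ 0 = (\<Sum>k<2. of_rat (u $ k) * \<xi> $ k)"
      using that u(1) by (simp add: p_def row_mat_def scalar_prod_def atLeast0LessThan)
    also have "\<dots> = \<xi> \<bullet> cvec u"
      using u(1) that by (simp add: scalar_prod_2 sum_lessThan_2 mult.commute)
    finally show ?thesis using pm by (simp add: unit1_def scalar_prod_def One_nat_def)
  qed
  have "generically (polydisc (0\<^sub>v 2) (r / C)) (\<lambda>\<xi>. \<mu> (preim 2 q ?R) \<xi> = \<rho> ((map_mat of_rat p *\<^sub>v \<xi>) \<bullet> cvec (unit1 0)))"
    by (rule pullback[OF compat gq pr cl gen r(2) open_cn_polydisc polydisc_zero_carrier into]) auto
  then have "generically (polydisc (0\<^sub>v 2) (r / C)) (\<lambda>\<xi>. \<mu> {x \<in> carrier_vec 2. 0 \<le> W \<bullet> x} \<xi> = \<rho> (\<xi> \<bullet> cvec u))"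
    unfolding pre(2) by (rule generically_mono) (use val subsetD[OF polydisc_zero_carrier] in auto)
  then show "\<exists>r>0. generically (polydisc (0\<^sub>v 2) r) (\<lambda>\<xi>. \<mu> {x \<in> carrier_vec 2. 0 \<le> W \<bullet> x} \<xi> = \<rho> (\<xi> \<bullet> cvec u))"
    using r(1) C(1) by (intro exI[of _ "r / C"]) auto
qed

end

subsection \<open>Lattice points in half-open parallelograms\<close>

text \<open>Rotation preserves the lattice and the pairing and satisfies x . rot y = - (rot x . y);
  this skewness is the source of the signs in the duality.\<close>

definition rot :: "rat vec \<Rightarrow> rat vec" where
  "rot x = vec 2 (\<lambda>i. if i = 0 then - x $ 1 else x $ 0)"

lemma rot_carrier [simp]: "rot x \<in> carrier_vec 2"
  by (simp add: rot_def)

lemma rot_index [simp]: "rot x $ 0 = - x $ 1" "rot x $ 1 = x $ 0"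
  by (simp_all add: rot_def)

lemma int_lattice_2: "x \<in> int_lattice 2 \<longleftrightarrow> x \<in> carrier_vec 2 \<and> x $ 0 \<in> \<int> \<and> x $ 1 \<in> \<int>"
  by (auto simp: int_lattice_def less_2_cases_iff One_nat_def)

lemma rot_primitive: "primitive_vec 2 x \<Longrightarrow> primitive_vec 2 (rot x)"
proof -
  assume x: "primitive_vec 2 x"
  note xi = primitive_vecD(1)[OF x, unfolded int_lattice_2]
  have *: "r \<in> \<int>" if "r \<cdot>\<^sub>v rot x \<in> int_lattice 2" for r
  proof (rule primitive_vecD(3)[OF x])
    have "r * x $ 0 \<in> \<int>" "- (r * x $ 1) \<in> \<int>"
      using that rot_carrier[of x] by (auto simp: int_lattice_2)
    then have "r * x $ 0 \<in> \<int>" "r * x $ 1 \<in> \<int>" using Ints_minus[of "- (r * x $ 1)"] by auto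
    then show "r \<cdot>\<^sub>v x \<in> int_lattice 2" using xi by (auto simp: int_lattice_2)
  qed
  have "rot x \<in> int_lattice 2" using xi by (simp add: int_lattice_2)
  then show ?thesis unfolding primitive_vec_def using * by blast
qed

lemma neg_primitive: "primitive_vec n x \<Longrightarrow> primitive_vec n (- x)"
proof -
  assume x: "primitive_vec n x"
  note xi = primitive_vecD(1)[OF x]
  have *: "r \<in> \<int>" if "r \<cdot>\<^sub>v (- x) \<in> int_lattice n" for r
  proof -
    have "(- r) \<cdot>\<^sub>v x = r \<cdot>\<^sub>v (- x)" by (intro eq_vecI) auto
    then have "- r \<in> \<int>" using primitive_vecD(3)[OF x, of "- r"] that by simp
    then show ?thesis using Ints_minus[of "- r"] by simp
  qed
  have "- x \<in> int_lattice n" using xi by (auto simp: int_lattice_def)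
  then show ?thesis unfolding primitive_vec_def using * by blast
qed

text \<open>Q is the index of the sublattice spanned by the edges, and therefore the number of box
  points. Taking the edges in positive order fixes the signs of their relation to the rotated dual
  basis.\<close>

locale primitive_plane = rat_dual_basis 2 v w for v w :: "nat \<Rightarrow> rat vec" +
  fixes Q :: nat
  assumes prim: "i < 2 \<Longrightarrow> primitive_vec 2 (v i)"
    and Q_pos: "Q > 0"
    and det: "v 0 $ 0 * v 1 $ 1 - v 0 $ 1 * v 1 $ 0 = of_nat Q"
begin

text \<open>Cramer's rule: up to the determinant and a sign, the dual basis is the rotated basis
  with its members exchanged. Hence \<open>of_nat Q \<cdot>\<^sub>v w i\<close> is a primitive edge
  of the dual cone.\<close>

lemma dual_rot: "of_nat Q \<cdot>\<^sub>v w 0 = - rot (v 1)" "of_nat Q \<cdot>\<^sub>v w 1 = rot (v 0)"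
proof -
  interpret D: rat_dual_basis 2 w v by (rule swap_rat)
  have pr: "v i \<bullet> w j = (if i = j then 1 else 0)" if "i < 2" "j < 2" for i j
    using D.pairing[OF that] .
  have vr: "v i \<bullet> rot x = - (v i $ 0 * x $ 1) + v i $ 1 * x $ 0" if "i < 2" for i x
    using that by (subst scalar_prod_2) auto
  have lt: "i = 0 \<or> i = 1" if "i < 2" for i :: nat using that by auto
  show "of_nat Q \<cdot>\<^sub>v w 0 = - rot (v 1)"
  proof (rule D.coords_eqI)
    fix i :: nat assume i: "i < 2"
    have "v i \<bullet> (- rot (v 1)) = v i $ 0 * v 1 $ 1 - v i $ 1 * v 1 $ 0"
      using i vr[OF i, of "v 1"] by (simp add: neg_scalar_prod[of _ 2])
    then show "v i \<bullet> (of_nat Q \<cdot>\<^sub>v w 0) = v i \<bullet> (- rot (v 1))"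
      using lt[OF i] det pr[OF i, of 0] i by (auto simp: D.coord_smult)
  qed auto
  show "of_nat Q \<cdot>\<^sub>v w 1 = rot (v 0)"
  proof (rule D.coords_eqI)
    fix i :: nat assume i: "i < 2"
    show "v i \<bullet> (of_nat Q \<cdot>\<^sub>v w 1) = v i \<bullet> rot (v 0)"
      unfolding vr[OF i] using lt[OF i] det pr[OF i, of 1] i by (auto simp: D.coord_smult algebra_simps)
  qed auto
qed

lemma dual_primitive: "i < 2 \<Longrightarrow> primitive_vec 2 (of_nat Q \<cdot>\<^sub>v w i)"
proof -
  assume "i < 2"
  then have "i = 0 \<or> i = 1" by auto
  then show ?thesis using dual_rot rot_primitive neg_primitive prim[of 0] prim[of 1] by auto
qed

lemma coord_frac:
  assumes "b \<in> int_lattice 2" "i < 2"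
  shows "of_nat Q * (w i \<bullet> b) \<in> \<int>"
proof -
  have bc: "b \<in> carrier_vec 2" using assms by (simp add: int_lattice_def)
  have "of_nat Q * (w i \<bullet> b) = (of_nat Q \<cdot>\<^sub>v w i) \<bullet> b" using bc assms by simp
  also have "\<dots> \<in> \<int>"
    using scalar_prod_2[OF primitive_vecD(2)[OF dual_primitive[OF assms(2)]] bc]
      primitive_vecD(1)[OF dual_primitive[OF assms(2)]] assms(1)
    unfolding int_lattice_2 by auto
  finally show ?thesis .
qed

definition box_coords :: "bool \<Rightarrow> rat set" where
  "box_coords c = (\<lambda>k. of_nat k / of_nat Q) ` (if c then {..<Q} else {1..Q})"

lemma half_unit_coords:
  assumes "of_nat Q * r \<in> \<int>"
  shows "r \<in> half_unit c \<longleftrightarrow> r \<in> box_coords c"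
proof
  assume r: "r \<in> half_unit c"
  obtain z :: int where z: "of_nat Q * r = of_int z" using assms by (auto elim: Ints_cases)
  have "0 \<le> r" using r by (auto simp: half_unit_def split: if_splits)
  then have "(0 :: rat) \<le> of_int z" using z by (metis mult_nonneg_nonneg of_nat_0_le_iff)
  then have z0: "0 \<le> z" by simp
  then have rz: "r = of_nat (nat z) / of_nat Q" using z Q_pos by (simp add: field_simps)
  have "if c then nat z < Q else 0 < nat z \<and> nat z \<le> Q"
    using r Q_pos unfolding rz half_unit_def by (auto simp: field_simps split: if_splits)
  then have "nat z \<in> (if c then {..<Q} else {1..Q})" by (auto split: if_splits)
  then show "r \<in> box_coords c" unfolding box_coords_def rz by blast
next
  assume "r \<in> box_coords c"
  then show "r \<in> half_unit c" using Q_pos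
    by (auto simp: box_coords_def half_unit_def field_simps split: if_splits)
qed

text \<open>A single coordinate determines a box point: two points with the same i-th coordinate
  differ by a multiple of the primitive vector \<open>v j\<close>, hence by an integral multiple,
  and this is 0 in a half-open box. Every k / Q occurs because
  \<open>of_nat Q \<cdot>\<^sub>v w i\<close> is primitive: some lattice point has i-th coordinate 1
  / Q, and a multiple of it is shifted along \<open>v j\<close> into the box.\<close>

lemma box_coord_bij:
  assumes i: "i < 2"
  shows "bij_betw (\<lambda>b. w i \<bullet> b) (box c {0, 1}) (box_coords c)"
proof -
  define j where "j = 1 - i"
  have "i = 0 \<or> i = 1" using i by auto
  then have ij: "j < 2" "i \<noteq> j" "{0, 1} = {i, j}" "\<And>k. k < 2 \<Longrightarrow> k = i \<or> k = j" by (auto simp: j_def)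
  have bD: "b \<in> int_lattice 2" "b \<in> carrier_vec 2" "w i \<bullet> b \<in> half_unit c" "w j \<bullet> b \<in> half_unit c"
    if "b \<in> box c {0, 1}" for b
    using that i ij by (auto simp: box_def int_lattice_def)
  show ?thesis
    unfolding bij_betw_def
  proof (intro conjI equalityI subsetI)
    show "inj_on (\<lambda>b. w i \<bullet> b) (box c {0, 1})"
    proof (rule inj_onI)
      fix b b' assume b: "b \<in> box c {0, 1}" "b' \<in> box c {0, 1}" "w i \<bullet> b = w i \<bullet> b'"
      define t where "t = w j \<bullet> b - w j \<bullet> b'"
      have "b - b' = t \<cdot>\<^sub>v v j"
      proof (rule coords_eqI)
        fix k :: nat assume k: "k < 2"
        show "w k \<bullet> (b - b') = w k \<bullet> (t \<cdot>\<^sub>v v j)"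
          using ij(4)[OF k] b bD i ij by (auto simp: coord_minus coord_smult pairing t_def)
      qed (use bD b ij in auto)
      then have "t \<cdot>\<^sub>v v j \<in> int_lattice 2" using int_lattice_diff[of b b'] bD(1) b by metis
      then have "t \<in> \<int>" by (rule primitive_vecD(3)[OF prim[OF ij(1)]])
      then obtain z :: int where z: "t = of_int z" by (auto elim: Ints_cases)
      have "w j \<bullet> b - of_int z = w j \<bullet> b'" using z by (simp add: t_def)
      then have "w j \<bullet> b - of_int 0 \<in> half_unit c" "w j \<bullet> b - of_int z \<in> half_unit c"
        using bD(4)[OF b(1)] bD(4)[OF b(2)] by simp_all
      then have "0 = z" by (rule half_unit_unique)
      then have "w j \<bullet> b = w j \<bullet> b'" using z by (simp add: t_def)
      then show "b = b'" using b(3) bD(2) b ij(4) by (intro coords_eqI) auto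
    qed
  next
    fix r assume "r \<in> (\<lambda>b. w i \<bullet> b) ` box c {0, 1}"
    then obtain b where b: "b \<in> box c {0, 1}" "r = w i \<bullet> b" by blast
    then show "r \<in> box_coords c" using bD coord_frac[of b i] half_unit_coords[of r c] i by auto
  next
    fix r assume r: "r \<in> box_coords c"
    then obtain k where k: "r = of_nat k / of_nat Q" by (auto simp: box_coords_def)
    obtain z where z: "z \<in> int_lattice 2" "(of_nat Q \<cdot>\<^sub>v w i) \<bullet> z = 1"
      by (rule primitive_bezout[OF dual_primitive[OF i]])
    have zc: "z \<in> carrier_vec 2" using z by (simp add: int_lattice_def)
    have wz: "of_nat Q * (w i \<bullet> z) = 1" using z(2) zc i by simp
    define y where "y = of_nat k \<cdot>\<^sub>v z"
    have yi: "y \<in> int_lattice 2" using z(1) by (auto simp: y_def int_lattice_def)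
    have yc: "y \<in> carrier_vec 2" using zc by (simp add: y_def)
    have wy: "w i \<bullet> y = r" using wz Q_pos zc i by (simp add: y_def coord_smult k field_simps)
    obtain l :: int where l: "w j \<bullet> y - of_int l \<in> half_unit c" by (rule half_unit_decompose)
    define b where "b = y - of_int l \<cdot>\<^sub>v v j"
    have lv: "of_int l \<cdot>\<^sub>v v j \<in> int_lattice 2"
      using primitive_vecD(1)[OF prim[OF ij(1)]] by (auto simp: int_lattice_def)
    have bi: "b \<in> int_lattice 2" unfolding b_def by (rule int_lattice_diff[OF yi lv])
    have wb: "w i \<bullet> b = r" "w j \<bullet> b = w j \<bullet> y - of_int l"
      using wy yc ij i by (auto simp: b_def coord_minus coord_smult pairing)
    have "of_nat Q * r \<in> \<int>" unfolding k using Q_pos by simp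
    then have "r \<in> half_unit c" using half_unit_coords r by blast
    then have "w k \<bullet> b \<in> half_unit c" if "k < 2" for k using ij(4)[OF that] wb l by metis
    moreover have "k \<in> {0, 1}" if "k < 2" for k :: nat using that by auto
    ultimately have "b \<in> box c {0, 1}" using bi unfolding box_def by blast
    then show "r \<in> (\<lambda>b. w i \<bullet> b) ` box c {0, 1}" using wb(1) by blast
  qed
qed

lemma box_finite: "finite (box c {0, 1})"
  using bij_betw_finite[OF box_coord_bij[of 0 c]] by (simp add: box_coords_def)

lemma box_coords_sum:
  assumes i: "i < 2"
  shows "(\<Sum>b\<in>box c {0, 1}. f (w i \<bullet> b)) = (\<Sum>k\<in>(if c then {..<Q} else {1..Q}). f (of_nat k / of_nat Q))"
proof -
  have "(\<Sum>b\<in>box c {0, 1}. f (w i \<bullet> b)) = (\<Sum>r\<in>box_coords c. f r)"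
    by (rule sum.reindex_bij_betw[OF box_coord_bij[OF i]])
  also have "\<dots> = (\<Sum>k\<in>(if c then {..<Q} else {1..Q}). f (of_nat k / of_nat Q))"
    unfolding box_coords_def using Q_pos by (subst sum.reindex) (auto simp: inj_on_def)
  finally show ?thesis .
qed

lemma box_card: "card (box c {0, 1}) = Q"
  using box_coords_sum[of 0 "\<lambda>_. 1 :: nat" c] by (simp split: if_splits)

text \<open>Along one coordinate the box runs exactly once through the fractions k / Q, so this is
  the distribution relation. For the box closed at 1, replacing k by Q - k and reflecting leads back
  to the box closed at 0.\<close>

lemma box_gam_sum:
  assumes i: "i < 2" and y: "norm y < 1" "y \<noteq> 0"
  shows "(\<Sum>b\<in>box c {0, 1}. gam (of_rat (w i \<bullet> b)) y) = gam (if c then 0 else 1) (y / of_nat Q)"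
proof (cases c)
  case True
  then show ?thesis
    using box_coords_sum[OF i, of "\<lambda>r. gam (of_rat r) y" c] gam_sum[OF y Q_pos] by (simp add: of_rat_divide)
next
  case False
  have yq: "norm (y / of_nat Q) < 1"
    using y Q_pos by (auto simp: norm_divide divide_less_eq intro: order_less_le_trans)
  have "(\<Sum>b\<in>box c {0, 1}. gam (of_rat (w i \<bullet> b)) y) = (\<Sum>k\<in>{1..Q}. gam (of_nat k / of_nat Q) y)"
    using box_coords_sum[OF i, of "\<lambda>r. gam (of_rat r) y" c] False by (simp add: of_rat_divide)
  also have "\<dots> = (\<Sum>k<Q. gam (of_nat (Q - k) / of_nat Q) y)"
    by (rule sum.reindex_bij_witness[of _ "\<lambda>k. Q - k" "\<lambda>k. Q - k"]) auto
  also have "\<dots> = (\<Sum>k<Q. - gam (of_nat k / of_nat Q) (- y))"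
  proof (intro sum.cong refl)
    fix k assume "k \<in> {..<Q}"
    then have "of_nat (Q - k) / of_nat Q = (1 - of_nat k / of_nat Q :: complex)"
      using Q_pos by (simp add: field_simps of_nat_diff)
    then show "gam (of_nat (Q - k) / of_nat Q) y = - gam (of_nat k / of_nat Q) (- y)"
      using gam_reflect[OF y(1)] by simp
  qed
  also have "\<dots> = - gam 0 (- y / of_nat Q)" using gam_sum[of "- y" Q] y Q_pos by (simp add: sum_negf)
  also have "\<dots> = gam 1 (y / of_nat Q)" using gam_reflect[OF yq, of 0] by simp
  finally show ?thesis using False by simp
qed

lemma box_primitive_nonempty: "box c {0, 1} \<noteq> {}"
  using box_card[of c] Q_pos by (metis card.empty less_numeral_extra(3))

end

section \<open>Sums and integrals over points, rays and plane cones\<close>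

context rat_dual_basis
begin

lemma box_empty: "box c {} = {0\<^sub>v n}"
proof (intro equalityI subsetI)
  fix x assume "x \<in> box c {}"
  then show "x \<in> {0\<^sub>v n}" by (auto simp: box_def int_lattice_def intro!: coords_eqI)
qed (auto simp: box_def)

lemma box_ray:
  assumes i: "i < n" and p: "primitive_vec n (v i)"
  shows "box c {i} = {if c then 0\<^sub>v n else v i}"
proof (intro equalityI subsetI)
  fix x assume x: "x \<in> box c {i}"
  then have "x \<in> coord_space n w {i}" by (auto simp: box_def int_lattice_def coord_cone_def)
  then obtain r where r: "x = r \<cdot>\<^sub>v v i" using coord_space_singleton[OF i] by blast
  then have "r \<in> \<int>" using x primitive_vecD(3)[OF p] by (auto simp: box_def)
  then obtain z :: int where z: "r = of_int z" by (auto elim: Ints_cases)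
  have "w i \<bullet> x = r" using i by (simp add: r coord_smult pairing)
  then have "r \<in> half_unit c" using x i by (auto simp: box_def)
  then have "z = (if c then 0 else 1)" unfolding z half_unit_def by (auto split: if_splits)
  then show "x \<in> {if c then 0\<^sub>v n else v i}" using r z v_carrier[OF i] by auto
next
  fix x assume "x \<in> {if c then 0\<^sub>v n else v i}"
  then show "x \<in> box c {i}"
    using i primitive_vecD(1)[OF p] by (auto simp: box_def half_unit_def pairing split: if_splits)
qed

lemma exp_ratio_gam:
  assumes "Re y < 0"
  shows "exp (a * y) / (1 - exp y) = - (gam a y + 1 / y)"
proof -
  have "exp y \<noteq> 1"
  proof
    assume "exp y = 1"
    then have "norm (exp y) = 1" by simp
    then show False using assms by simp
  qed
  then have "exp y - 1 \<noteq> 0" "1 - exp y \<noteq> 0" by auto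
  moreover have "y \<noteq> 0" using assms by auto
  ultimately show ?thesis by (simp add: gam_def field_simps)
qed

lemma exp_sum_point: "\<xi> \<in> carrier_vec n \<Longrightarrow> has_value n (exp_sum n {0\<^sub>v n}) \<xi> 1"
proof -
  assume \<xi>: "\<xi> \<in> carrier_vec n"
  have "half_cone True {} = {0\<^sub>v n}" unfolding half_cone_eq coord_space_empty ..
  then show ?thesis
    using exp_sum_half_cone[of "{}" True \<xi>] \<xi> by (simp add: box_empty neg_region_def cone_sum_def)
qed

lemma exp_sum_ray:
  assumes i: "i < n" and p: "primitive_vec n (v i)" and \<xi>: "\<xi> \<in> carrier_vec n" "Re (\<xi> \<bullet> cvec (v i)) < 0"
  shows "has_value n (exp_sum n (half_cone c {i})) \<xi>
    (- (gam (if c then 0 else 1) (\<xi> \<bullet> cvec (v i)) + 1 / (\<xi> \<bullet> cvec (v i))))"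
proof -
  have "cone_sum c {i} \<xi> = exp ((if c then 0 else 1) * (\<xi> \<bullet> cvec (v i))) / (1 - exp (\<xi> \<bullet> cvec (v i)))"
    unfolding cone_sum_def box_ray[OF i p] using i by (simp add: pairing)
  then show ?thesis
    using exp_sum_half_cone[of "{i}" c \<xi>] i \<xi> box_ray[OF i p, of c] primitive_vecD(1)[OF p] exp_ratio_gam[OF \<xi>(2)]
    by (simp add: neg_region_def)
qed

lemma exp_integral_point: "\<xi> \<in> carrier_vec n \<Longrightarrow> has_value n (exp_integral n {0\<^sub>v n}) \<xi> 1"
  using exp_integral_coord_cone[OF _ cone_volume_point, of \<xi>] by (simp add: neg_region_def coord_space_empty)

lemma exp_integral_ray:
  assumes i: "i < n" and p: "primitive_vec n (v i)" and \<xi>: "\<xi> \<in> carrier_vec n" "Re (\<xi> \<bullet> cvec (v i)) < 0"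
  shows "has_value n (exp_integral n (coord_cone n w {i} {})) \<xi> (- 1 / (\<xi> \<bullet> cvec (v i)))"
  using exp_integral_coord_cone[OF _ cone_volume_ray[OF i p], of \<xi>] i \<xi> by (simp add: neg_region_def)

lemma exp_sum0_coord_cone:
  assumes "I \<subseteq> {..<n}"
  shows "exp_sum0 n (coord_cone n w I {}) = exp_sum n (half_cone False I)"
  unfolding exp_sum0_def half_cone_eq using rel_interior_coord_cone[of "{}" I] assms by simp

lemma sum_faces:
  assumes "I \<subseteq> {..<n}"
  shows "(\<Sum>F\<in>faces n (coord_cone n w I {}). g (Supp n (coord_cone n w I {}) F) F)
    = (\<Sum>I'\<in>Pow I. g (coord_cone n w I I') (coord_cone n w I' {}))"
proof -
  have eq: "{I'. {} \<subseteq> I' \<and> I' \<subseteq> I} = Pow I" by auto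
  have "inj_on (\<lambda>I'. coord_cone n w I' {}) (Pow I)"
    by (rule inj_on_subset[OF coord_cone_inj[of "{}"]]) (use assms in auto)
  then show ?thesis
    unfolding faces_coord_cone[OF empty_subsetI assms] eq
    by (subst sum.reindex) (auto simp: Supp_coord_cone[OF empty_subsetI _ assms] intro!: sum.cong)
qed

end

context primitive_plane
begin

lemma exp_sum_plane:
  assumes \<xi>: "\<xi> \<in> neg_region {0, 1}"
  shows "has_value 2 (exp_sum 2 (half_cone c {0, 1})) \<xi>
    (\<Sum>b\<in>box c {0, 1}. \<Prod>i\<in>{0, 1}. gam (of_rat (w i \<bullet> b)) (\<xi> \<bullet> cvec (v i)) + 1 / (\<xi> \<bullet> cvec (v i)))"
proof -
  have re: "Re (\<xi> \<bullet> cvec (v i)) < 0" if "i \<in> {0, 1}" for i using \<xi> that by (auto simp: neg_region_def)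
  have "cone_sum c {0, 1} \<xi> = (\<Sum>b\<in>box c {0, 1}. \<Prod>i\<in>{0, 1}. exp (of_rat (w i \<bullet> b) * (\<xi> \<bullet> cvec (v i))) / (1 - exp (\<xi> \<bullet> cvec (v i))))"
    by (simp add: cone_sum_def sum_divide_distrib prod_dividef)
  also have "\<dots> = (\<Sum>b\<in>box c {0, 1}. \<Prod>i\<in>{0, 1}. - (gam (of_rat (w i \<bullet> b)) (\<xi> \<bullet> cvec (v i)) + 1 / (\<xi> \<bullet> cvec (v i))))"
    by (intro sum.cong prod.cong refl exp_ratio_gam re)
  also have "\<dots> = (\<Sum>b\<in>box c {0, 1}. \<Prod>i\<in>{0, 1}. gam (of_rat (w i \<bullet> b)) (\<xi> \<bullet> cvec (v i)) + 1 / (\<xi> \<bullet> cvec (v i)))"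
    by (intro sum.cong refl) (simp add: algebra_simps)
  finally have eq: "cone_sum c {0, 1} \<xi> = \<dots>" .
  have "{0, 1} \<subseteq> {..<2::nat}" by auto
  moreover have "v i \<in> int_lattice 2" if "i \<in> {0, 1}" for i
    using primitive_vecD(1)[OF prim[of i]] that by auto
  ultimately have "has_value 2 (exp_sum 2 (half_cone c {0, 1})) \<xi> (cone_sum c {0, 1} \<xi>)"
    using exp_sum_half_cone[OF _ _ box_finite box_primitive_nonempty \<xi>] by blast
  then show ?thesis unfolding eq .
qed

lemma exp_integral_plane:
  assumes \<xi>: "\<xi> \<in> neg_region {0, 1}"
  shows "has_value 2 (exp_integral 2 (coord_cone 2 w {0, 1} {})) \<xi>
    (of_nat Q / ((\<xi> \<bullet> cvec (v 0)) * (\<xi> \<bullet> cvec (v 1))))"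
proof -
  have "{0, 1} \<subseteq> {..<2::nat}" by auto
  then show ?thesis
    using exp_integral_coord_cone[OF _ cone_volume_plane[OF refl] \<xi>] det by simp
qed

end

text \<open>The flag is true for \<open>\<mu>\<close> and false for \<open>\<nu>\<close>.\<close>

definition rho :: "bool \<Rightarrow> complex \<Rightarrow> complex" where
  "rho c y = (if c then - gam 0 y else gam 1 y)"

text \<open>The lattice sum over a ray, which is 1 / (1 - exp y) with the apex and exp y / (1 - exp
  y) without it, split into regular part and pole.\<close>

definition ray_sum :: "bool \<Rightarrow> complex \<Rightarrow> complex" where
  "ray_sum c y = - (gam (if c then 0 else 1) y + 1 / y)"

text \<open>With c true, A is the sum and B the integral; with c false they are exchanged and the
  sum omits the boundary. A common flag allows the poles to be treated once for both kinds.\<close>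

locale plane_interpolation = interpolation cone_class identity A B
    "if c then ray_sum c else (\<lambda>y. - 1 / y)" "if c then (\<lambda>y. - 1 / y) else ray_sum c" "rho c"
  for cone_class identity A B and c :: bool +
  assumes A_plane: "primitive_plane v w Q \<Longrightarrow> \<xi> \<in> rat_dual_basis.neg_region 2 v {0, 1} \<Longrightarrow>
      has_value 2 (A 2 (coord_cone 2 w {0, 1} {})) \<xi>
       (if c then \<Sum>b\<in>rat_dual_basis.box 2 w c {0, 1}. \<Prod>i\<in>{0, 1}. gam (of_rat (w i \<bullet> b)) (\<xi> \<bullet> cvec (v i)) + 1 / (\<xi> \<bullet> cvec (v i))
        else of_nat Q / ((\<xi> \<bullet> cvec (v 0)) * (\<xi> \<bullet> cvec (v 1))))"
    and B_plane: "primitive_plane v w Q \<Longrightarrow> \<xi> \<in> rat_dual_basis.neg_region 2 v {0, 1} \<Longrightarrow>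
      has_value 2 (B 2 (coord_cone 2 w {0, 1} {})) \<xi>
       (if c then of_nat Q / ((\<xi> \<bullet> cvec (v 0)) * (\<xi> \<bullet> cvec (v 1)))
        else \<Sum>b\<in>rat_dual_basis.box 2 w c {0, 1}. \<Prod>i\<in>{0, 1}. gam (of_rat (w i \<bullet> b)) (\<xi> \<bullet> cvec (v i)) + 1 / (\<xi> \<bullet> cvec (v i)))"

section \<open>The two kinds of interpolators as instances\<close>

lemma rho_holomorphic: "rho c holomorphic_on ball 0 1"
  unfolding rho_def[abs_def] by (cases c) (auto intro!: holomorphic_intros gam_holomorphic)

interpretation SI: plane_interpolation affine_cone SI_identity exp_sum exp_integral True
proof (unfold_locales, unfold if_True)
  fix n v w and J I :: "nat set" assume D: "rat_dual_basis n v w" and I: "J \<subseteq> I" "I \<subseteq> {..<n}"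
  interpret D: rat_dual_basis n v w by fact
  show "affine_cone n (coord_cone n w I J)" by (rule D.affine_cone_coord_cone[OF I])
next
  fix n v w \<Psi> \<mu> and I :: "nat set"
  assume D: "rat_dual_basis n v w" and I: "I \<subseteq> {..<n}" and gen: "generic_cone n \<Psi> (coord_cone n w I {})"
    and id: "SI_identity n \<Psi> \<mu>"
  interpret D: rat_dual_basis n v w by fact
  show "mero_eq n (exp_sum n (coord_cone n w I {}))
      (\<lambda>\<xi>. \<Sum>I'\<in>Pow I. \<mu> (coord_cone n w I I') \<xi> * exp_integral n (coord_cone n w I' {}) \<xi>)"
    using id D.polyhedron_coord_cone[OF empty_subsetI I] D.generic_polyhedron_coord_cone[OF empty_subsetI I gen]
    unfolding SI_identity_def D.sum_faces[OF I, of "\<lambda>S F. \<mu> S _ * exp_integral n F _", symmetric] by blast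
next
  fix n and \<xi> :: "complex vec" assume \<xi>: "\<xi> \<in> carrier_vec n"
  interpret D: rat_dual_basis n "unit_vec n" "unit_vec n" by unfold_locales auto
  show "has_value n (exp_sum n {0\<^sub>v n}) \<xi> 1" "has_value n (exp_integral n {0\<^sub>v n}) \<xi> 1"
    using D.exp_sum_point D.exp_integral_point \<xi> by auto
next
  fix n v w i \<xi>
  assume D: "rat_dual_basis n v w" and i: "i < n" "primitive_vec n (v i)" "\<xi> \<in> carrier_vec n" "Re (\<xi> \<bullet> cvec (v i)) < 0"
  interpret D: rat_dual_basis n v w by fact
  show "has_value n (exp_sum n (coord_cone n w {i} {})) \<xi> (ray_sum True (\<xi> \<bullet> cvec (v i)))"
    using D.exp_sum_ray[OF i, of True] by (simp add: D.half_cone_eq ray_sum_def)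
  show "has_value n (exp_integral n (coord_cone n w {i} {})) \<xi> (- 1 / (\<xi> \<bullet> cvec (v i)))"
    by (rule D.exp_integral_ray[OF i])
next
  fix v w Q \<xi> assume P: "primitive_plane v w Q" and \<xi>: "\<xi> \<in> rat_dual_basis.neg_region 2 v {0, 1}"
  interpret P: primitive_plane v w Q by fact
  show "has_value 2 (exp_sum 2 (coord_cone 2 w {0, 1} {})) \<xi>
     (\<Sum>b\<in>P.box True {0, 1}. \<Prod>i\<in>{0, 1}. gam (of_rat (w i \<bullet> b)) (\<xi> \<bullet> cvec (v i)) + 1 / (\<xi> \<bullet> cvec (v i)))"
    using P.exp_sum_plane[OF \<xi>, of True] by (simp add: P.half_cone_eq)
  show "has_value 2 (exp_integral 2 (coord_cone 2 w {0, 1} {})) \<xi> (of_nat Q / ((\<xi> \<bullet> cvec (v 0)) * (\<xi> \<bullet> cvec (v 1))))"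
    by (rule P.exp_integral_plane[OF \<xi>])
qed (auto simp: ray_sum_def rho_def[abs_def] intro!: holomorphic_intros gam_holomorphic)

interpretation IS: plane_interpolation lattice_cone IS0_identity exp_integral exp_sum0 False
proof (unfold_locales, unfold if_False)
  fix n v w and J I :: "nat set" assume D: "rat_dual_basis n v w" and I: "J \<subseteq> I" "I \<subseteq> {..<n}"
  interpret D: rat_dual_basis n v w by fact
  show "lattice_cone n (coord_cone n w I J)" by (rule D.affine_cone_coord_cone[OF I])
next
  fix n v w \<Psi> \<mu> and I :: "nat set"
  assume D: "rat_dual_basis n v w" and I: "I \<subseteq> {..<n}" and gen: "generic_cone n \<Psi> (coord_cone n w I {})"
    and id: "IS0_identity n \<Psi> \<mu>"
  interpret D: rat_dual_basis n v w by fact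
  show "mero_eq n (exp_integral n (coord_cone n w I {}))
      (\<lambda>\<xi>. \<Sum>I'\<in>Pow I. \<mu> (coord_cone n w I I') \<xi> * exp_sum0 n (coord_cone n w I' {}) \<xi>)"
    using id D.lattice_polyhedron_coord_cone[OF empty_subsetI I] D.generic_polyhedron_coord_cone[OF empty_subsetI I gen]
    unfolding IS0_identity_def D.sum_faces[OF I, of "\<lambda>S F. \<mu> S _ * exp_sum0 n F _", symmetric] by blast
next
  fix n and \<xi> :: "complex vec" assume \<xi>: "\<xi> \<in> carrier_vec n"
  interpret D: rat_dual_basis n "unit_vec n" "unit_vec n" by unfold_locales auto
  \<comment> \<open>The relative interior of a point is the point, so open and closed sums agree
    there.\<close>
  have "half_cone' = {0\<^sub>v n}" if "half_cone' = D.half_cone False {}" for half_cone'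
    unfolding that D.half_cone_eq using D.rel_interior_coord_cone[of "{}" "{}"]
    by (auto simp: coord_interior_def intro!: D.coords_eqI)
  then have e: "exp_sum0 n {0\<^sub>v n} = exp_sum n {0\<^sub>v n}"
    using D.exp_sum0_coord_cone[of "{}"] by (simp add: D.coord_space_empty)
  show "has_value n (exp_sum0 n {0\<^sub>v n}) \<xi> 1" "has_value n (exp_integral n {0\<^sub>v n}) \<xi> 1"
    unfolding e using D.exp_sum_point D.exp_integral_point \<xi> by auto
next
  fix n v w i \<xi>
  assume D: "rat_dual_basis n v w" and i: "i < n" "primitive_vec n (v i)" "\<xi> \<in> carrier_vec n" "Re (\<xi> \<bullet> cvec (v i)) < 0"
  interpret D: rat_dual_basis n v w by fact
  show "has_value n (exp_sum0 n (coord_cone n w {i} {})) \<xi> (ray_sum False (\<xi> \<bullet> cvec (v i)))"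
    using D.exp_sum_ray[OF i, of False] i(1) by (simp add: D.exp_sum0_coord_cone ray_sum_def)
  show "has_value n (exp_integral n (coord_cone n w {i} {})) \<xi> (- 1 / (\<xi> \<bullet> cvec (v i)))"
    by (rule D.exp_integral_ray[OF i])
next
  fix v w Q \<xi> assume P: "primitive_plane v w Q" and \<xi>: "\<xi> \<in> rat_dual_basis.neg_region 2 v {0, 1}"
  interpret P: primitive_plane v w Q by fact
  have "{0, 1} \<subseteq> {..<2::nat}" by auto
  then show "has_value 2 (exp_sum0 2 (coord_cone 2 w {0, 1} {})) \<xi>
     (\<Sum>b\<in>P.box False {0, 1}. \<Prod>i\<in>{0, 1}. gam (of_rat (w i \<bullet> b)) (\<xi> \<bullet> cvec (v i)) + 1 / (\<xi> \<bullet> cvec (v i)))"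
    using P.exp_sum_plane[OF \<xi>, of False] by (simp add: P.exp_sum0_coord_cone)
  show "has_value 2 (exp_integral 2 (coord_cone 2 w {0, 1} {})) \<xi> (of_nat Q / ((\<xi> \<bullet> cvec (v 0)) * (\<xi> \<bullet> cvec (v 1))))"
    by (rule P.exp_integral_plane[OF \<xi>])
qed (auto simp: ray_sum_def rho_def[abs_def] intro!: holomorphic_intros gam_holomorphic)

subsection \<open>The value at a two-dimensional cone\<close>

text \<open>Bookkeeping of the poles. The double pole of the box sum cancels against the integral.
  The coefficient of 1 / y0 is the half-plane numerator \<rho>0 minus the numerator s1 that comes
  from the other coordinate of the box, and this difference is divisible by y0; likewise for
  y1.\<close>

lemma plane_cone_algebra:
  fixes y0 y1 S G0 G1 q s0 s1 :: complex
  assumes "y0 \<noteq> 0" "y1 \<noteq> 0"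
    and "P = S + G0 / y1 + G1 / y0 + q / (y0 * y1)" and "\<epsilon> * G0 = - s0" "\<epsilon> * G1 = - s1"
    and "\<rho>0 - s1 = d0 * y0 * D0" "\<rho>1 - s0 = d1 * y1 * D1"
  shows "\<epsilon> * (P - q / (y0 * y1)) + \<rho>0 * (\<kappa>0 + 1 / y0) + \<rho>1 * (\<kappa>1 + 1 / y1)
    = \<epsilon> * S + (d0 * D0 + d1 * D1) + (\<rho>0 * \<kappa>0 + \<rho>1 * \<kappa>1)"
proof -
  have "\<epsilon> * (P - q / (y0 * y1)) = \<epsilon> * S + (\<epsilon> * G0) / y1 + (\<epsilon> * G1) / y0"
    unfolding assms(3) by (simp add: algebra_simps)
  also have "\<dots> = \<epsilon> * S - s0 / y1 - s1 / y0" unfolding assms(4,5) by simp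
  finally have 1: "\<epsilon> * (P - q / (y0 * y1)) = \<epsilon> * S - s0 / y1 - s1 / y0" .
  have "\<rho>0 / y0 - s1 / y0 = d0 * D0" "\<rho>1 / y1 - s0 / y1 = d1 * D1"
    using assms by (simp_all flip: diff_divide_distrib)
  then show ?thesis unfolding 1 by (simp add: algebra_simps)
qed

context plane_interpolation
begin

text \<open>
  In the identity for the cone, the simple poles along an edge come from the box sum and from a
  half-plane, with numerators \<open>\<rho>\<close> at two points that coincide on the polar line. The resulting
  difference quotients give the multiple of \<open>\<rho>'(0)\<close>.
\<close>

lemma plane_cone:
  assumes P: "primitive_plane v w Q" and compat: "compatible_interpolator cone_class identity 2 \<Psi> \<mu>"
    and \<Psi>0: "\<Psi> {0\<^sub>v 2} = Some (carrier_vec 2)" and gen: "generic_cone 2 \<Psi> (coord_cone 2 w {0, 1} {})"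
    and u: "\<And>i. i < 2 \<Longrightarrow> u i \<in> carrier_vec 2" "\<And>i. i < 2 \<Longrightarrow> u i \<bullet> (of_nat Q \<cdot>\<^sub>v w (1 - i)) = 1"
    and \<Psi>u: "\<And>i. i < 2 \<Longrightarrow> \<Psi> (line (of_nat Q \<cdot>\<^sub>v w (1 - i))) = Some {y \<in> carrier_vec 2. u i \<bullet> y = 0}"
  shows "has_value 2 (\<mu> (coord_cone 2 w {0, 1} {})) (0\<^sub>v 2)
     ((if c then 1 else - 1) * (\<Sum>b\<in>rat_dual_basis.box 2 w c {0, 1}. (of_rat (w 0 \<bullet> b) - 1/2) * (of_rat (w 1 \<bullet> b) - 1/2))
      + (of_rat (w 0 \<bullet> u 0) + of_rat (w 1 \<bullet> u 1)) * deriv (rho c) 0 + (if c then 0 else 1/2))"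
proof -
  interpret P: primitive_plane v w Q by fact
  let ?K = "coord_cone 2 w {0, 1} {}"
  define y where "y = (\<lambda>i \<xi>. \<xi> \<bullet> cvec (v i))"
  define U where "U = (\<lambda>i \<xi>. \<xi> \<bullet> cvec (u i))"
  \<comment> \<open>Up to sign the regular part of B on a ray: zero if B is an integral, and that of
    an open ray sum otherwise.\<close>
  define \<kappa> where "\<kappa> = (\<lambda>y. if c then 0 else gam 1 y)"
  define \<epsilon> where "\<epsilon> = (if c then 1 else - 1 :: complex)"
  define d where "d = (\<lambda>i. of_rat (w i \<bullet> u i) :: complex)"
  define T where "T = P.box c {0, 1}"
  define g where "g = (\<lambda>i b \<xi>. gam (of_rat (w i \<bullet> b)) (y i \<xi>))"
  \<comment> \<open>The regular function that represents \<open>\<mu> ?K\<close> near 0. Each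
    difference of two values of \<open>rho c\<close>, divided by the pairing with an edge, appears
    as a difference quotient.\<close>
  define e where "e = (\<lambda>\<xi>. \<epsilon> * (\<Sum>b\<in>T. g 0 b \<xi> * g 1 b \<xi>)
      + (d 0 * diff_quot (rho c) (U 0 \<xi>) (1 / of_nat Q * y 1 \<xi>) + d 1 * diff_quot (rho c) (U 1 \<xi>) (1 / of_nat Q * y 0 \<xi>))
      + (rho c (U 0 \<xi>) * \<kappa> (y 0 \<xi>) + rho c (U 1 \<xi>) * \<kappa> (y 1 \<xi>)))"
  have two: "i = 0 \<or> i = 1" if "i < 2" for i :: nat using that by auto
  have full: "{0, 1} = {..<2::nat}" by auto
  have vc: "cvec (v i) \<in> carrier_vec 2" "cvec (u i) \<in> carrier_vec 2" if "i < 2" for i using that u by auto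
  have D: "rat_dual_basis 2 v w" by unfold_locales

  \<comment> \<open>Freeing the edge i leaves only the inequality of the other coordinate, hence the
    index 1 - i.\<close>
  have half: "{x \<in> carrier_vec 2. 0 \<le> (of_nat Q \<cdot>\<^sub>v w (1 - i)) \<bullet> x} = coord_cone 2 w {0, 1} {i}" if i: "i < 2" for i
  proof -
    have "0 \<le> (of_nat Q \<cdot>\<^sub>v w (1 - i)) \<bullet> x \<longleftrightarrow> 0 \<le> w (1 - i) \<bullet> x" if "x \<in> carrier_vec 2" for x
      using that P.Q_pos by (simp add: zero_le_mult_iff)
    moreover have "(\<forall>k<2. (k \<notin> {0, 1} \<longrightarrow> w k \<bullet> x = 0) \<and> (k \<in> {0, 1} - {i} \<longrightarrow> 0 \<le> w k \<bullet> x)) \<longleftrightarrow> 0 \<le> w (1 - i) \<bullet> x" for x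
      using two[OF i] by (auto simp: less_2_cases_iff One_nat_def)
    ultimately show ?thesis unfolding coord_cone_def by blast
  qed
  have "\<exists>r. i < 2 \<longrightarrow> r > 0 \<and> generically (polydisc (0\<^sub>v 2) r) (\<lambda>\<xi>. \<mu> (coord_cone 2 w {0, 1} {i}) \<xi> = rho c (U i \<xi>))" for i
  proof (cases "i < 2")
    case i: True
    have "1 - i < 2" using i by auto
    then have W: "primitive_vec 2 (of_nat Q \<cdot>\<^sub>v w (1 - i))" by (rule P.dual_primitive)
    show ?thesis
      using quotient_line(2)[of \<Psi> \<mu> "of_nat Q \<cdot>\<^sub>v w (1 - i)" "u i"] compat \<Psi>0 W u(1)[OF i] u(2)[OF i] \<Psi>u[OF i]
      unfolding half[OF i] U_def by blast
  qed simp
  then obtain rh where "\<forall>i. i < 2 \<longrightarrow> rh i > 0 \<and> generically (polydisc (0\<^sub>v 2) (rh i)) (\<lambda>\<xi>. \<mu> (coord_cone 2 w {0, 1} {i}) \<xi> = rho c (U i \<xi>))"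
    using choice[of "\<lambda>i r. i < 2 \<longrightarrow> r > 0 \<and> generically (polydisc (0\<^sub>v 2) r) (\<lambda>\<xi>. \<mu> (coord_cone 2 w {0, 1} {i}) \<xi> = rho c (U i \<xi>))"] by blast
  then have rh: "\<And>i. i < 2 \<Longrightarrow> rh i > 0"
    "\<And>i. i < 2 \<Longrightarrow> generically (polydisc (0\<^sub>v 2) (rh i)) (\<lambda>\<xi>. \<mu> (coord_cone 2 w {0, 1} {i}) \<xi> = rho c (U i \<xi>))"
    by blast+
  have "\<exists>r. i < 2 \<longrightarrow> r > 0 \<and> (\<forall>\<xi>\<in>polydisc (0\<^sub>v 2) r. cmod (y i \<xi>) < 1)" for i
  proof (cases "i < 2")
    case True
    show ?thesis unfolding y_def by (rule linear_small[OF vc(1)[OF True], of 1]) auto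
  qed simp
  then obtain ry where "\<forall>i. i < 2 \<longrightarrow> ry i > 0 \<and> (\<forall>\<xi>\<in>polydisc (0\<^sub>v 2) (ry i). cmod (y i \<xi>) < 1)"
    using choice[of "\<lambda>i r. i < 2 \<longrightarrow> r > 0 \<and> (\<forall>\<xi>\<in>polydisc (0\<^sub>v 2) r. cmod (y i \<xi>) < 1)"] by blast
  then have ry: "\<And>i. i < 2 \<Longrightarrow> ry i > 0" "\<And>i \<xi>. i < 2 \<Longrightarrow> \<xi> \<in> polydisc (0\<^sub>v 2) (ry i) \<Longrightarrow> cmod (y i \<xi>) < 1"
    by blast+
  have "\<exists>r. i < 2 \<longrightarrow> r > 0 \<and> (\<forall>\<xi>\<in>polydisc (0\<^sub>v 2) r. cmod (U i \<xi>) < 1)" for i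
  proof (cases "i < 2")
    case True
    show ?thesis unfolding U_def by (rule linear_small[OF vc(2)[OF True], of 1]) auto
  qed simp
  then obtain ru where "\<forall>i. i < 2 \<longrightarrow> ru i > 0 \<and> (\<forall>\<xi>\<in>polydisc (0\<^sub>v 2) (ru i). cmod (U i \<xi>) < 1)"
    using choice[of "\<lambda>i r. i < 2 \<longrightarrow> r > 0 \<and> (\<forall>\<xi>\<in>polydisc (0\<^sub>v 2) r. cmod (U i \<xi>) < 1)"] by blast
  then have ru: "\<And>i. i < 2 \<Longrightarrow> ru i > 0" "\<And>i \<xi>. i < 2 \<Longrightarrow> \<xi> \<in> polydisc (0\<^sub>v 2) (ru i) \<Longrightarrow> cmod (U i \<xi>) < 1"
    by blast+
  define R where "R = Min ({rh 0, rh 1} \<union> {ry 0, ry 1} \<union> {ru 0, ru 1})"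
  have R: "R > 0" using rh ry ru by (simp add: R_def)
  have Rle: "R \<le> rh i" "R \<le> ry i" "R \<le> ru i" if "i < 2" for i
    using two[OF that] unfolding R_def by (metis Min_le finite.emptyI finite_insert finite_UnI UnI1 UnI2 insertI1 insertI2)+
  have small: "cmod (y i \<xi>) < 1" "cmod (U i \<xi>) < 1" "cmod (1 / of_nat Q * y i \<xi>) < 1" if "i < 2" "\<xi> \<in> polydisc (0\<^sub>v 2) R" for i \<xi>
  proof -
    show y1: "cmod (y i \<xi>) < 1" using ry(2)[OF that(1)] polydisc_mono[OF Rle(2)[OF that(1)]] that(2) by blast
    show "cmod (U i \<xi>) < 1" using ru(2)[OF that(1)] polydisc_mono[OF Rle(3)[OF that(1)]] that(2) by blast
    have "cmod (1 / of_nat Q * y i \<xi>) \<le> cmod (y i \<xi>)"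
      using P.Q_pos mult_left_mono[of 1 "real Q" "cmod (y i \<xi>)"] by (simp add: norm_mult norm_divide divide_le_eq)
    then show "cmod (1 / of_nat Q * y i \<xi>) < 1" using y1 by linarith
  qed
  define \<Omega> where "\<Omega> = P.neg_region {0, 1} \<inter> polydisc (0\<^sub>v 2) R"
  have \<Omega>: "open_cn \<Omega>" "\<Omega> \<subseteq> carrier_vec 2"
    using P.neg_region_open[of "{0, 1}"] open_cn_polydisc open_cn_Int by (auto simp: \<Omega>_def P.neg_region_def full)
  have neg: "Re (y i \<xi>) < 0" "\<xi> \<in> carrier_vec 2" if "i < 2" "\<xi> \<in> \<Omega>" for i \<xi>
    using that two[OF that(1)] by (auto simp: \<Omega>_def P.neg_region_def y_def)
  have \<beta>: "(if c then \<lambda>y. - 1 / y else ray_sum c) = (\<lambda>z. - (\<kappa> z + 1 / z))"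
    by (auto simp: \<kappa>_def ray_sum_def)

  have Ki: "\<mu> ?K \<in> meromorphic_cn 2"
    using compat gen cone_class[OF D, of "{}" "{0, 1}"] unfolding compatible_interpolator_def full by blast
  have Pow: "Pow {0, 1} = {{}, {0}, {1}, {0, 1 :: nat}}" by auto
  have "mero_eq 2 (A 2 ?K) (\<lambda>\<xi>. \<Sum>I'\<in>Pow {0, 1}. \<mu> (coord_cone 2 w {0, 1} I') \<xi> * B 2 (coord_cone 2 w I' {}) \<xi>)"
    using identity[OF D _ gen] compat unfolding compatible_interpolator_def by (simp add: full)
  then have id: "generically (carrier_vec 2) (\<lambda>\<xi>. A 2 ?K \<xi> = \<mu> ?K \<xi> * B 2 {0\<^sub>v 2} \<xi>
      + (\<mu> (coord_cone 2 w {0, 1} {0}) \<xi> * B 2 (coord_cone 2 w {0} {}) \<xi>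
      + (\<mu> (coord_cone 2 w {0, 1} {1}) \<xi> * B 2 (coord_cone 2 w {1} {}) \<xi>
      + \<mu> (carrier_vec 2) \<xi> * B 2 ?K \<xi>)))"
    unfolding Pow mero_eq_def agree_generically_iff
    by (simp add: P.coord_space_empty coord_space_full[of 2 w, folded full] insert_eq_iff)
  have whole: "generically \<Omega> (\<lambda>\<xi>. \<mu> (carrier_vec 2) \<xi> = 1)"
    by (rule generically_subset[OF whole_space[OF compat \<Psi>0] \<Omega>(2,1)])
  have point': "generically \<Omega> (\<lambda>\<xi>. B 2 {0\<^sub>v 2} \<xi> = 1)"
    using B_point \<Omega> by (auto intro!: has_value_imp_generically)
  have rays: "generically \<Omega> (\<lambda>\<xi>. B 2 (coord_cone 2 w {i} {}) \<xi> = - (\<kappa> (y i \<xi>) + 1 / y i \<xi>))" if i: "i < 2" for i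
    using B_ray[OF D i P.prim[OF i]] neg[OF i] \<Omega> unfolding \<beta>
    by (intro has_value_imp_generically) (auto simp: y_def)
  have halves: "generically \<Omega> (\<lambda>\<xi>. \<mu> (coord_cone 2 w {0, 1} {i}) \<xi> = rho c (U i \<xi>))" if i: "i < 2" for i
    by (rule generically_subset[OF rh(2)[OF i] _ \<Omega>(1)]) (use polydisc_mono[OF Rle(1)[OF i]] in \<open>auto simp: \<Omega>_def\<close>)
  define PS where "PS = (\<lambda>\<xi>. \<Sum>b\<in>T. (g 0 b \<xi> + 1 / y 0 \<xi>) * (g 1 b \<xi> + 1 / y 1 \<xi>))"
  define V where "V = (\<lambda>\<xi>. of_nat Q / (y 0 \<xi> * y 1 \<xi>))"
  have AK: "generically \<Omega> (\<lambda>\<xi>. A 2 ?K \<xi> = (if c then PS \<xi> else V \<xi>))"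
    by (rule has_value_imp_generically[OF \<Omega>])
       (use A_plane[OF P] in \<open>auto simp: PS_def V_def T_def g_def y_def \<Omega>_def\<close>)
  have BK: "generically \<Omega> (\<lambda>\<xi>. B 2 ?K \<xi> = (if c then V \<xi> else PS \<xi>))"
    by (rule has_value_imp_generically[OF \<Omega>])
       (use B_plane[OF P] in \<open>auto simp: PS_def V_def T_def g_def y_def \<Omega>_def\<close>)

  have key: "\<epsilon> * (PS \<xi> - V \<xi>) + rho c (U 0 \<xi>) * (\<kappa> (y 0 \<xi>) + 1 / y 0 \<xi>) + rho c (U 1 \<xi>) * (\<kappa> (y 1 \<xi>) + 1 / y 1 \<xi>) = e \<xi>"
    if \<xi>: "\<xi> \<in> \<Omega>" for \<xi>
    unfolding V_def e_def
  proof (rule plane_cone_algebra[where ?s0.0 = "rho c (1 / of_nat Q * y 0 \<xi>)" and ?s1.0 = "rho c (1 / of_nat Q * y 1 \<xi>)"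
        and ?G0.0 = "\<Sum>b\<in>T. g 0 b \<xi>" and ?G1.0 = "\<Sum>b\<in>T. g 1 b \<xi>"])
    have \<xi>R: "\<xi> \<in> polydisc (0\<^sub>v 2) R" using \<xi> by (simp add: \<Omega>_def)
    have \<xi>c: "\<xi> \<in> carrier_vec 2" using \<xi> \<Omega> by blast
    show y0: "y 0 \<xi> \<noteq> 0" "y 1 \<xi> \<noteq> 0" using neg[of 0, OF _ \<xi>] neg[of 1, OF _ \<xi>] by auto
    have "PS \<xi> = (\<Sum>b\<in>T. g 0 b \<xi> * g 1 b \<xi> + g 0 b \<xi> / y 1 \<xi> + g 1 b \<xi> / y 0 \<xi> + 1 / (y 0 \<xi> * y 1 \<xi>))"
      unfolding PS_def by (intro sum.cong refl) (simp add: algebra_simps)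
    then show "PS \<xi> = (\<Sum>b\<in>T. g 0 b \<xi> * g 1 b \<xi>) + (\<Sum>b\<in>T. g 0 b \<xi>) / y 1 \<xi> + (\<Sum>b\<in>T. g 1 b \<xi>) / y 0 \<xi> + of_nat Q / (y 0 \<xi> * y 1 \<xi>)"
      using P.box_card[of c] by (simp add: sum.distrib sum_divide_distrib T_def)
    have G: "\<epsilon> * (\<Sum>b\<in>T. g i b \<xi>) = - rho c (1 / of_nat Q * y i \<xi>)" if i: "i < 2" for i
    proof -
      have "y i \<xi> \<noteq> 0" using neg(1)[OF i \<xi>] by auto
      then show ?thesis
        using P.box_gam_sum[OF i small(1)[OF i \<xi>R], of c] by (simp add: T_def g_def \<epsilon>_def rho_def)
    qed
    show "\<epsilon> * (\<Sum>b\<in>T. g 0 b \<xi>) = - rho c (1 / of_nat Q * y 0 \<xi>)" "\<epsilon> * (\<Sum>b\<in>T. g 1 b \<xi>) = - rho c (1 / of_nat Q * y 1 \<xi>)"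
      using G by auto
    \<comment> \<open>Together with w (1 - i) . u i = 1 / Q this writes U i as d i times y i plus y
      (1 - i) / Q. On the polar line y i = 0 it coincides with the argument that comes from the box
      sum.\<close>
    have Ue: "U i \<xi> = of_rat (w 0 \<bullet> u i) * y 0 \<xi> + of_rat (w 1 \<bullet> u i) * y 1 \<xi>" if i: "i < 2" for i
      using P.exp_pair_expand[OF \<xi>c u(1)[OF i]] by (simp add: U_def y_def sum_lessThan_2)
    have wu: "of_rat (w (1 - i) \<bullet> u i) = (1 / of_nat Q :: complex)" if i: "i < 2" for i
    proof -
      have "of_nat Q * (w (1 - i) \<bullet> u i) = 1"
        using u(2)[OF i] u(1)[OF i] comm_scalar_prod[OF u(1)[OF i], of "w (1 - i)"] by simp
      then have "w (1 - i) \<bullet> u i = 1 / of_nat Q" using P.Q_pos by (simp add: field_simps)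
      then show ?thesis by (simp add: of_rat_divide)
    qed
    have "U 0 \<xi> - 1 / of_nat Q * y 1 \<xi> = d 0 * y 0 \<xi>" "U 1 \<xi> - 1 / of_nat Q * y 0 \<xi> = d 1 * y 1 \<xi>"
      using Ue[of 0] Ue[of 1] wu[of 0] wu[of 1] by (simp_all add: d_def)
    then show "rho c (U 0 \<xi>) - rho c (1 / of_nat Q * y 1 \<xi>) = d 0 * y 0 \<xi> * diff_quot (rho c) (U 0 \<xi>) (1 / of_nat Q * y 1 \<xi>)"
      "rho c (U 1 \<xi>) - rho c (1 / of_nat Q * y 0 \<xi>) = d 1 * y 1 \<xi> * diff_quot (rho c) (U 1 \<xi>) (1 / of_nat Q * y 0 \<xi>)"
      unfolding diff_quot_mult by simp_all
  qed
  have "generically \<Omega> (\<lambda>\<xi>. \<mu> ?K \<xi> = e \<xi>)"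
  proof (rule generically_mono[OF generically_conj[OF generically_conj[OF generically_subset[OF id \<Omega>(2,1)] whole]
        generically_conj[OF generically_conj[OF generically_conj[OF point' rays[of 0]] generically_conj[OF rays[of 1] halves[of 0]]]
          generically_conj[OF halves[of 1] generically_conj[OF AK BK]]]]])
    fix \<xi> assume \<xi>: "\<xi> \<in> \<Omega>" and
      *: "(A 2 ?K \<xi> = \<mu> ?K \<xi> * B 2 {0\<^sub>v 2} \<xi>
      + (\<mu> (coord_cone 2 w {0, 1} {0}) \<xi> * B 2 (coord_cone 2 w {0} {}) \<xi>
      + (\<mu> (coord_cone 2 w {0, 1} {1}) \<xi> * B 2 (coord_cone 2 w {1} {}) \<xi>
      + \<mu> (carrier_vec 2) \<xi> * B 2 ?K \<xi>)) \<and> \<mu> (carrier_vec 2) \<xi> = 1) \<and>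
      ((B 2 {0\<^sub>v 2} \<xi> = 1 \<and> B 2 (coord_cone 2 w {0} {}) \<xi> = - (\<kappa> (y 0 \<xi>) + 1 / y 0 \<xi>)) \<and>
       (B 2 (coord_cone 2 w {1} {}) \<xi> = - (\<kappa> (y 1 \<xi>) + 1 / y 1 \<xi>) \<and> \<mu> (coord_cone 2 w {0, 1} {0}) \<xi> = rho c (U 0 \<xi>))) \<and>
      \<mu> (coord_cone 2 w {0, 1} {1}) \<xi> = rho c (U 1 \<xi>) \<and>
      A 2 ?K \<xi> = (if c then PS \<xi> else V \<xi>) \<and> B 2 ?K \<xi> = (if c then V \<xi> else PS \<xi>)"
    have *: "A 2 ?K \<xi> = \<mu> ?K \<xi> * 1 + (rho c (U 0 \<xi>) * - (\<kappa> (y 0 \<xi>) + 1 / y 0 \<xi>)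
        + (rho c (U 1 \<xi>) * - (\<kappa> (y 1 \<xi>) + 1 / y 1 \<xi>) + 1 * B 2 ?K \<xi>))"
      and AB: "A 2 ?K \<xi> = (if c then PS \<xi> else V \<xi>)" "B 2 ?K \<xi> = (if c then V \<xi> else PS \<xi>)"
      using * by metis+
    have "\<mu> ?K \<xi> = (A 2 ?K \<xi> - B 2 ?K \<xi>) + rho c (U 0 \<xi>) * (\<kappa> (y 0 \<xi>) + 1 / y 0 \<xi>) + rho c (U 1 \<xi>) * (\<kappa> (y 1 \<xi>) + 1 / y 1 \<xi>)"
      unfolding * by (simp add: algebra_simps)
    also have "A 2 ?K \<xi> - B 2 ?K \<xi> = \<epsilon> * (PS \<xi> - V \<xi>)" unfolding AB by (simp add: \<epsilon>_def)
    finally show "\<mu> ?K \<xi> = e \<xi>" using key[OF \<xi>] by simp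
  qed auto
  moreover have pc: "polydisc (0\<^sub>v 2) R \<subseteq> carrier_vec 2" by (rule polydisc_zero_carrier)
  have hy: "holomorphic_cn 2 (y i) (polydisc (0\<^sub>v 2) R)" "holomorphic_cn 2 (U i) (polydisc (0\<^sub>v 2) R)" if "i < 2" for i
    unfolding y_def U_def using vc[OF that] by (intro holomorphic_cn_linear pc; simp)+
  have hk: "\<kappa> holomorphic_on ball 0 1" unfolding \<kappa>_def by (cases c) (auto intro: gam_holomorphic)
  have comp: "holomorphic_cn 2 (\<lambda>\<xi>. \<phi> (f \<xi>)) (polydisc (0\<^sub>v 2) R)"
    if "\<phi> holomorphic_on ball 0 1" "holomorphic_cn 2 f (polydisc (0\<^sub>v 2) R)" "\<And>\<xi>. \<xi> \<in> polydisc (0\<^sub>v 2) R \<Longrightarrow> cmod (f \<xi>) < 1" for \<phi> f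
    by (rule holomorphic_cn_compose[OF pc that(2,1)]) (use that(3) in auto)
  have dq: "holomorphic_cn 2 (\<lambda>\<xi>. diff_quot (rho c) (U i \<xi>) (1 / of_nat Q * y j \<xi>)) (polydisc (0\<^sub>v 2) R)" if "i < 2" "j < 2" for i j
    by (rule holomorphic_cn_diff_quot[OF open_cn_polydisc pc hy(2)[OF that(1)] holomorphic_cn_cmult[OF pc hy(1)[OF that(2)]] rho_holomorphic])
       (use small that in auto)
  have hg: "holomorphic_cn 2 (\<lambda>\<xi>. gam (of_rat (w i \<bullet> b)) (y i \<xi>)) (polydisc (0\<^sub>v 2) R)" if "i < 2" for i b
    by (rule comp[OF gam_holomorphic hy(1)[OF that] small(1)[OF that]])
  have h\<kappa>: "holomorphic_cn 2 (\<lambda>\<xi>. \<kappa> (y i \<xi>)) (polydisc (0\<^sub>v 2) R)" if "i < 2" for i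
    by (rule comp[OF hk hy(1)[OF that] small(1)[OF that]])
  have h\<rho>: "holomorphic_cn 2 (\<lambda>\<xi>. rho c (U i \<xi>)) (polydisc (0\<^sub>v 2) R)" if "i < 2" for i
    by (rule comp[OF rho_holomorphic hy(2)[OF that] small(2)[OF that]])
  have "holomorphic_cn 2 e (polydisc (0\<^sub>v 2) R)"
    unfolding e_def g_def
    by (intro holomorphic_cn_add[OF pc] holomorphic_cn_cmult[OF pc] holomorphic_cn_sum[OF pc] holomorphic_cn_mult[OF pc] dq hg h\<kappa> h\<rho>) auto
  ultimately obtain r where r: "r > 0" "r \<le> R" "generically (polydisc (0\<^sub>v 2) r) (\<lambda>\<xi>. \<mu> ?K \<xi> = e \<xi>)"
    using P.neg_region_extend[OF Ki _ R, of e "{0, 1}"] unfolding \<Omega>_def full by auto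
  have "has_value 2 (\<mu> ?K) (0\<^sub>v 2) (e (0\<^sub>v 2))"
    by (rule has_valueI[OF open_cn_polydisc polydisc_zero_carrier polydisc_center[OF r(1)] _ r(3)])
       (rule holomorphic_cn_subset[OF \<open>holomorphic_cn 2 e (polydisc (0\<^sub>v 2) R)\<close> polydisc_mono[OF r(2)]])
  \<comment> \<open>At the origin the arguments of each difference quotient coincide, which leaves
    the derivative of \<open>rho c\<close>. If c is false, each product of \<open>rho c\<close> and
    \<kappa> is 1/2 times 1/2, and the two edges give 1/2 in total.\<close>
  moreover have "e (0\<^sub>v 2) = \<epsilon> * (\<Sum>b\<in>T. (of_rat (w 0 \<bullet> b) - 1/2) * (of_rat (w 1 \<bullet> b) - 1/2)) + (d 0 + d 1) * deriv (rho c) 0 + (if c then 0 else 1/2)"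
  proof -
    have "y i (0\<^sub>v 2) = 0" "U i (0\<^sub>v 2) = 0" if "i < 2" for i using vc[OF that] by (auto simp: y_def U_def)
    then show ?thesis by (simp add: e_def g_def diff_quot_def \<kappa>_def rho_def algebra_simps)
  qed
  ultimately show ?thesis by (simp add: \<epsilon>_def T_def d_def)
qed

end

subsection \<open>Values at the remaining cones\<close>

definition kernel :: "rat vec \<Rightarrow> rat vec set" where
  "kernel u = {y \<in> carrier_vec 2. u \<bullet> y = 0}"

text \<open>The complement of a line is recorded by the functional u that vanishes on it and is 1 at
  W. The normalization determines u and makes it the matrix of the projection onto the line.\<close>

definition line_complement :: "complement_map \<Rightarrow> rat vec \<Rightarrow> rat vec \<Rightarrow> bool" where
  "line_complement \<Psi> W u \<longleftrightarrow> u \<in> carrier_vec 2 \<and> u \<bullet> W = 1 \<and> \<Psi> (line W) = Some (kernel u)"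

lemma line_smult: "c \<noteq> 0 \<Longrightarrow> line (c \<cdot>\<^sub>v x) = line x"
proof (intro equalityI subsetI)
  fix y assume c: "c \<noteq> 0" and "y \<in> line x"
  then obtain d where "y = d \<cdot>\<^sub>v x" by blast
  then have "y = (d / c) \<cdot>\<^sub>v (c \<cdot>\<^sub>v x)" using c by (simp add: smult_smult_assoc)
  then show "y \<in> line (c \<cdot>\<^sub>v x)" by blast
qed (auto simp: smult_smult_assoc)

lemma line_complement_smult:
  assumes "line_complement \<Psi> W u" "c \<noteq> 0" "W \<in> carrier_vec 2"
  shows "line_complement \<Psi> (c \<cdot>\<^sub>v W) ((1 / c) \<cdot>\<^sub>v u)"
  using assms unfolding line_complement_def line_smult[OF assms(2)]
  by (auto simp: kernel_def)

lemma primitive_multiple: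
  assumes x: "x \<in> carrier_vec n" "x \<noteq> 0\<^sub>v n"
  obtains c where "c > 0" "primitive_vec n (c \<cdot>\<^sub>v x)"
proof -
  \<comment> \<open>The product of all denominators, which clears every entry of x at once.\<close>
  define d where "d = (\<Prod>i<n. snd (quotient_of (x $ i)))"
  have dpos: "d > 0" unfolding d_def by (intro prod_pos) (simp add: quotient_of_denom_pos')
  have "of_int d * x $ i \<in> \<int>" if i: "i < n" for i
  proof -
    obtain p q where pq: "quotient_of (x $ i) = (p, q)" by fastforce
    have q: "q > 0" using quotient_of_denom_pos[OF pq] .
    have "q dvd d" unfolding d_def using i pq by (intro dvd_trans[OF _ dvd_prodI[of _ i]]) auto
    then obtain k where k: "d = q * k" by blast
    have "of_int d * x $ i = of_int (k * p)"
      using quotient_of_div[OF pq] q by (simp add: k)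
    then show ?thesis by simp
  qed
  then have dx: "of_int d \<cdot>\<^sub>v x \<in> int_lattice n" using x by (simp add: int_lattice_def)
  obtain k where k: "k < n" "x $ k \<noteq> 0" using x by (metis eq_vecI carrier_vecD index_zero_vec)
  \<comment> \<open>Among the positive integral multiples of x, one with the least k-th entry in
    absolute value is primitive: the fractional part of a non-integral multiplier would produce a
    smaller one.\<close>
  define S where "S = {m :: nat. m > 0 \<and> (\<exists>c>0. c \<cdot>\<^sub>v x \<in> int_lattice n \<and> \<bar>c * x $ k\<bar> = of_nat m)}"
  have mem: "\<exists>m\<in>S. \<bar>c * x $ k\<bar> = of_nat m" if c: "c > 0" "c \<cdot>\<^sub>v x \<in> int_lattice n" for c
  proof -
    have "c * x $ k \<in> \<int>" using c x k by (auto simp: int_lattice_def)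
    then obtain z :: int where z: "c * x $ k = of_int z" by (auto elim: Ints_cases)
    have "z \<noteq> 0" using z c k by auto
    moreover have "\<bar>c * x $ k\<bar> = of_nat (nat \<bar>z\<bar>)" by (simp add: z)
    ultimately show ?thesis using c unfolding S_def by (intro bexI[of _ "nat \<bar>z\<bar>"]) auto
  qed
  then have "S \<noteq> {}" using dx dpos by (metis empty_iff of_int_0_less_iff)
  then have m: "(LEAST m. m \<in> S) \<in> S" by (auto intro: LeastI)
  then obtain c where c: "c > 0" "c \<cdot>\<^sub>v x \<in> int_lattice n" "\<bar>c * x $ k\<bar> = of_nat (LEAST m. m \<in> S)"
    unfolding S_def by blast
  have "r \<in> \<int>" if r: "r \<cdot>\<^sub>v (c \<cdot>\<^sub>v x) \<in> int_lattice n" for r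
  proof (rule ccontr)
    assume nz: "r \<notin> \<int>"
    define f where "f = r - of_int \<lfloor>r\<rfloor>"
    have f: "0 < f" "f < 1" using nz unfolding f_def
      by (auto simp: less_le) (metis Ints_of_int, linarith+)
    have "(f * c) \<cdot>\<^sub>v x \<in> int_lattice n"
      unfolding int_lattice_def
    proof (intro CollectI conjI allI impI)
      fix i assume i: "i < n"
      have "((f * c) \<cdot>\<^sub>v x) $ i = (r \<cdot>\<^sub>v (c \<cdot>\<^sub>v x)) $ i - of_int \<lfloor>r\<rfloor> * (c \<cdot>\<^sub>v x) $ i"
        using i x by (simp add: f_def algebra_simps)
      also have "\<dots> \<in> \<int>" using r c(2) i by (auto simp: int_lattice_def)
      finally show "((f * c) \<cdot>\<^sub>v x) $ i \<in> \<int>" .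
    qed (use x in simp)
    then obtain m where m: "m \<in> S" "\<bar>f * c * x $ k\<bar> = of_nat m" using mem[of "f * c"] f c by auto
    have "\<bar>f * c * x $ k\<bar> = f * \<bar>c * x $ k\<bar>" using f by (simp add: abs_mult)
    also have "\<dots> < 1 * \<bar>c * x $ k\<bar>" using f(2) c(1) k by (intro mult_strict_right_mono) simp_all
    also have "\<dots> = \<bar>c * x $ k\<bar>" by simp
    finally have "m < (LEAST m. m \<in> S)" unfolding m(2) c(3) by simp
    then show False using not_less_Least m(1) by blast
  qed
  then have "primitive_vec n (c \<cdot>\<^sub>v x)" using c(2) by (simp add: primitive_vec_def)
  then show thesis using that c(1) by blast
qed

lemma (in rat_dual_basis) nonzero: "i < n \<Longrightarrow> v i \<noteq> 0\<^sub>v n" "i < n \<Longrightarrow> w i \<noteq> 0\<^sub>v n"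
  using pairing[of i i] v_carrier[of i] w_carrier[of i] by auto

lemma subset_lessThan_1: "I \<subseteq> {..<1::nat} \<Longrightarrow> I = {} \<or> I = {..<1}"
  by (auto simp: One_nat_def lessThan_Suc subset_singleton_iff)

lemma lessThan_2: "{..<2::nat} = {0, 1}"
  by (auto simp: less_2_cases_iff One_nat_def)

lemma subset_lessThan_2: "I \<subseteq> {..<2::nat} \<Longrightarrow> I = {} \<or> I = {0} \<or> I = {1} \<or> I = {0, 1}"
proof -
  assume "I \<subseteq> {..<2::nat}"
  then have "I \<in> Pow {0, 1}" by (simp add: lessThan_2)
  moreover have "Pow {0, 1::nat} = {{}, {0}, {1}, {0, 1}}" by auto
  ultimately show ?thesis by simp
qed

context plane_interpolation
begin

text \<open>A linear space is a point, the whole space, or a line in the plane; the last two are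
  preimages of points in quotients of dimension 0 and 1.\<close>

lemma linear_space:
  assumes n: "n \<le> 2" and D: "rat_dual_basis n v w" and I: "I \<subseteq> {..<n}"
    and compat: "compatible_interpolator cone_class identity n \<Psi> \<mu>"
    and \<Psi>0: "\<Psi> {0\<^sub>v n} = Some (carrier_vec n)" and gen: "generic_cone n \<Psi> (coord_space n w I)"
    and line: "\<And>W. n = 2 \<Longrightarrow> W \<in> carrier_vec 2 \<Longrightarrow> W \<noteq> 0\<^sub>v 2 \<Longrightarrow> line W \<in> dom \<Psi> \<Longrightarrow> \<exists>u. line_complement \<Psi> W u"
  shows "generically (carrier_vec n) (\<lambda>\<xi>. \<mu> (coord_space n w I) \<xi> = 1)"
proof -
  interpret D: rat_dual_basis n v w by fact
  interpret D': rat_dual_basis n w v by (rule D.swap_rat)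
  consider "I = {}" | "I = {..<n}" | i where "n = 2" "i < 2" "I = {i}" "{..<n} - I = {1 - i}"
  proof -
    consider "n = 0" | "n = 1" | "n = 2" using n by linarith
    then show ?thesis
    proof cases
      case 3
      have "{0, 1} - {0} = {1 - (0::nat)}" "{0, 1} - {1} = {1 - (1::nat)}" by auto
      then show ?thesis
        using subset_lessThan_2[of I] I that(1,2) that(3)[of 0] that(3)[of 1] unfolding 3 lessThan_2 by auto
    qed (use I that(1,2) subset_lessThan_1[of I] in auto)
  qed
  then show ?thesis
  proof cases
    case 1
    then show ?thesis using point[OF D, of \<Psi> \<mu>] gen compat
      by (simp add: D.coord_space_empty compatible_interpolator_def)
  next
    case 2
    then show ?thesis using whole_space[OF compat \<Psi>0] by (simp add: coord_space_full)
  next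
    case (3 i)
    define j where "j = 1 - i"
    have j: "j < n" using 3 by (auto simp: j_def)
    have "coord_space n v {j} \<in> dom \<Psi>"
      using gen D.generic_coord_cone_iff[of I I \<Psi>] I 3(4) by (auto simp: j_def)
    then have dom: "line (w j) \<in> dom \<Psi>" unfolding D'.coord_space_singleton[OF j] .
    obtain c where c: "c > 0" "primitive_vec 2 (c \<cdot>\<^sub>v w j)"
      by (rule primitive_multiple[of "w j" 2]) (use D.nonzero(2)[OF j] D.w_carrier[OF j] 3(1) in auto)
    have wj: "w j \<in> carrier_vec 2" "w j \<noteq> 0\<^sub>v 2" using D.nonzero(2)[OF j] D.w_carrier[OF j] 3(1) by auto
    obtain u where u: "line_complement \<Psi> (w j) u" using line[OF 3(1) wj dom] by blast
    have u': "line_complement \<Psi> (c \<cdot>\<^sub>v w j) ((1 / c) \<cdot>\<^sub>v u)" using line_complement_smult[OF u _ wj(1)] c(1) by simp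
    have "{x \<in> carrier_vec 2. (c \<cdot>\<^sub>v w j) \<bullet> x = 0} = coord_space n w I"
    proof -
      have "(\<forall>k<2. k \<notin> I \<longrightarrow> w k \<bullet> x = 0) \<longleftrightarrow> w j \<bullet> x = 0" for x
      proof -
        have "k < 2 \<and> k \<notin> I \<longleftrightarrow> k = j" for k
        proof -
          have "k \<in> {..<2} - I \<longleftrightarrow> k \<in> {1 - i}" using 3(4) by (simp only: 3(1))
          then show ?thesis by (simp only: Diff_iff lessThan_iff singleton_iff j_def)
        qed
        then show ?thesis by metis
      qed
      then show ?thesis using c(1) wj unfolding coord_space_def 3(1) by auto
    qed
    then show ?thesis
      using quotient_line(1)[of \<Psi> \<mu> "c \<cdot>\<^sub>v w j" "(1 / c) \<cdot>\<^sub>v u"] compat \<Psi>0 c(2) u'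
      unfolding line_complement_def kernel_def 3(1) by simp
  qed
qed

text \<open>Apart from the pointed cone of dimension 2, the cone is a linear space, a ray or a
  half-plane, and the last two lead to a value of \<rho> at 0. Since \<rho>(0) = 1/2 for both kinds
  of interpolators, only the distinction between linear spaces and other cones remains, and duality
  preserves it.\<close>

lemma low_dimensional_value:
  assumes n: "n \<le> 2" and D: "rat_dual_basis n v w" and I: "J \<subseteq> I" "I \<subseteq> {..<n}"
    and prim: "\<And>i. i < n \<Longrightarrow> primitive_vec n (v i)"
    and compat: "compatible_interpolator cone_class identity n \<Psi> \<mu>"
    and \<Psi>0: "\<Psi> {0\<^sub>v n} = Some (carrier_vec n)" and gen: "generic_cone n \<Psi> (coord_cone n w I J)"
    and line: "\<And>W. n = 2 \<Longrightarrow> W \<in> carrier_vec 2 \<Longrightarrow> W \<noteq> 0\<^sub>v 2 \<Longrightarrow> line W \<in> dom \<Psi> \<Longrightarrow> \<exists>u. line_complement \<Psi> W u"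
    and excl: "\<not> (n = 2 \<and> I = {0, 1} \<and> J = {})"
  shows "has_value n (\<mu> (coord_cone n w I J)) (0\<^sub>v n) (if I = J then 1 else 1/2)"
proof -
  interpret D: rat_dual_basis n v w by fact
  interpret D': rat_dual_basis n w v by (rule D.swap_rat)
  have const: "has_value n f (0\<^sub>v n) 1" if "generically (carrier_vec n) (\<lambda>\<xi>. f \<xi> = 1)" for f
    using has_valueI[OF open_cn_carrier _ _ holomorphic_cn_const[of "carrier_vec n" n 1] that] by simp
  have val: "has_value n f (0\<^sub>v n) (1/2)"
    if r: "r > 0" "generically (polydisc (0\<^sub>v n) r) (\<lambda>\<xi>. f \<xi> = rho c (\<xi> \<bullet> cvec u))" and u: "u \<in> carrier_vec n" for f r u
  proof -
    have uc: "cvec u \<in> carrier_vec n" using u by simp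
    obtain r' where r': "r' > 0" "\<And>\<xi>. \<xi> \<in> polydisc (0\<^sub>v n) r' \<Longrightarrow> cmod (\<xi> \<bullet> cvec u) < 1"
      by (rule linear_small[OF uc, of 1]) auto
    define s where "s = min r r'"
    have s: "s > 0" "polydisc (0\<^sub>v n) s \<subseteq> polydisc (0\<^sub>v n) r" "polydisc (0\<^sub>v n) s \<subseteq> polydisc (0\<^sub>v n) r'"
      using r(1) r'(1) polydisc_mono by (auto simp: s_def)
    have hol: "holomorphic_cn n (\<lambda>\<xi>. rho c (\<xi> \<bullet> cvec u)) (polydisc (0\<^sub>v n) s)"
      by (rule holomorphic_cn_compose[OF polydisc_zero_carrier holomorphic_cn_linear[OF polydisc_zero_carrier uc] rho_holomorphic])
         (use r'(2) s in auto)
    have "has_value n f (0\<^sub>v n) (rho c (0\<^sub>v n \<bullet> cvec u))"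
      by (rule has_valueI[OF open_cn_polydisc polydisc_zero_carrier polydisc_center[OF s(1)] hol
            generically_subset[OF r(2) s(2) open_cn_polydisc]])
    then show ?thesis using uc by (simp add: rho_def split: if_splits)
  qed
  consider "I = J" | i where "J = {}" "I = {i}" "i < n" | i where "n = 2" "i < 2" "I = {0, 1}" "J = {1 - i}"
  proof -
    consider "n = 0" | "n = 1" | "n = 2" using n by linarith
    then show ?thesis
    proof cases
      case 1
      then show ?thesis using I that(1) by auto
    next
      case 2
      have "{..<1} = {0::nat}" by (simp add: One_nat_def lessThan_Suc)
      then show ?thesis using I that(1) that(2)[of 0] subset_lessThan_1[of I] subset_lessThan_1[of J] 2 by auto
    next
      case 3
      have IJ: "I \<subseteq> {..<2}" "J \<subseteq> {..<2}" using I 3 by auto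
      show ?thesis
        using subset_lessThan_2[OF IJ(1)] subset_lessThan_2[OF IJ(2)] I(1) excl 3 that(1) that(2)[of 0] that(2)[of 1] that(3)[of 0] that(3)[of 1]
        by (elim disjE) simp_all
    qed
  qed
  then show ?thesis
  proof cases
    case 1
    then show ?thesis using const[OF linear_space[OF n D I(2) compat \<Psi>0 _ line]] gen by simp
  next
    case (2 i)
    have g: "generic_cone n \<Psi> (coord_space n w {i})"
      using gen I 2 D.generic_coord_cone_iff[of "{}" "{i}" \<Psi>] D.generic_coord_cone_iff[of "{i}" "{i}" \<Psi>] by auto
    have mero: "\<mu> (coord_cone n w {i} {}) \<in> meromorphic_cn n"
      using compat gen cone_class[OF D, of "{}" "{i}"] 2 unfolding compatible_interpolator_def by auto
    have id: "identity n \<Psi> \<mu>" using compat by (simp add: compatible_interpolator_def)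
    have sp: "generically (carrier_vec n) (\<lambda>\<xi>. \<mu> (coord_space n w {i}) \<xi> = 1)"
      using linear_space[OF n D _ compat \<Psi>0 g line] 2 by auto
    have gr: "generic_cone n \<Psi> (coord_cone n w {i} {})" using gen 2 by simp
    obtain r where "r > 0" "generically (polydisc (0\<^sub>v n) r) (\<lambda>\<xi>. \<mu> (coord_cone n w {i} {}) \<xi> = rho c (\<xi> \<bullet> cvec (v i)))"
      by (rule ray[OF D id gr 2(3) prim[OF 2(3)] mero sp])
    then show ?thesis using val D.v_carrier[OF 2(3)] 2 by simp
  next
    case (3 i)
    have i: "i < n" using 3 by simp
    have wi: "w i \<in> carrier_vec 2" "w i \<noteq> 0\<^sub>v 2" using D.nonzero(2)[OF i] D.w_carrier[OF i] 3(1) by auto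
    have full: "{..<n} = {0, 1}" using 3(1) by (auto simp: less_2_cases_iff One_nat_def)
    have "i = 0 \<or> i = 1" using 3(2) by auto
    then have diff: "{..<n} - {1 - i} = {i}" "J \<subseteq> {1 - i}" unfolding full using 3 by auto
    have "coord_space n v ({..<n} - {1 - i}) \<in> dom \<Psi>"
      using gen D.generic_coord_cone_iff[OF I, of \<Psi>] 3(3,4) \<open>i = 0 \<or> i = 1\<close> by auto
    then have dom: "line (w i) \<in> dom \<Psi>" unfolding diff D'.coord_space_singleton[OF i] .
    obtain d where d: "d > 0" "primitive_vec 2 (d \<cdot>\<^sub>v w i)"
      by (rule primitive_multiple[OF wi])
    obtain u where u: "line_complement \<Psi> (w i) u" using line[OF 3(1) wi dom] by blast
    have u': "line_complement \<Psi> (d \<cdot>\<^sub>v w i) ((1 / d) \<cdot>\<^sub>v u)" using line_complement_smult[OF u _ wi(1)] d(1) by simp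
    have half: "{x \<in> carrier_vec 2. 0 \<le> (d \<cdot>\<^sub>v w i) \<bullet> x} = coord_cone n w I J"
    proof -
      have "0 \<le> (d \<cdot>\<^sub>v w i) \<bullet> x \<longleftrightarrow> 0 \<le> w i \<bullet> x" if "x \<in> carrier_vec 2" for x
        using that d(1) wi by (simp add: zero_le_mult_iff)
      moreover have "(\<forall>k<2. (k \<notin> I \<longrightarrow> w k \<bullet> x = 0) \<and> (k \<in> I - J \<longrightarrow> 0 \<le> w k \<bullet> x)) \<longleftrightarrow> 0 \<le> w i \<bullet> x" for x
        using \<open>i = 0 \<or> i = 1\<close> unfolding 3(3,4) by (auto simp: less_2_cases_iff One_nat_def)
      ultimately show ?thesis unfolding coord_cone_def 3(1) by blast
    qed
    have "\<exists>r>0. generically (polydisc (0\<^sub>v 2) r) (\<lambda>\<xi>. \<mu> (coord_cone n w I J) \<xi> = rho c (\<xi> \<bullet> cvec ((1 / d) \<cdot>\<^sub>v u)))"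
      using quotient_line(2)[of \<Psi> \<mu> "d \<cdot>\<^sub>v w i" "(1 / d) \<cdot>\<^sub>v u"] compat \<Psi>0 d(2) u'
      unfolding half line_complement_def kernel_def 3(1) by simp
    then show ?thesis using val u' 3 unfolding line_complement_def by force
  qed
qed

end

subsection \<open>Duality of the values at two-dimensional cones\<close>

text \<open>By the reflection formula, \<open>rho True y\<close> equals
  \<open>rho False (- y)\<close> near 0.\<close>

lemma deriv_rho: "deriv (rho True) 0 = - deriv (rho False) 0"
proof -
  have "((\<lambda>y. rho False (- y)) has_field_derivative deriv (rho False) (- 0) * - 1) (at 0)"
  proof (rule DERIV_chain2[where g = uminus])
    show "(rho False has_field_derivative deriv (rho False) (- 0)) (at (- 0))"
      by (rule holomorphic_derivI[OF IS.rho_holomorphic]) auto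
  qed (auto intro!: derivative_eq_intros)
  then have "((\<lambda>y. rho False (- y)) has_field_derivative - deriv (rho False) 0) (at 0)" by simp
  then have "(rho True has_field_derivative - deriv (rho False) 0) (at 0)"
  proof (rule has_field_derivative_transform_within_open[where S = "ball 0 1"])
    fix y :: complex assume "y \<in> ball 0 1"
    then show "rho False (- y) = rho True y" using gam_reflect[of "- y" 0] by (simp add: rho_def)
  qed (auto)
  then show ?thesis by (rule DERIV_imp_deriv)
qed

lemma rot_rot: "x \<in> carrier_vec 2 \<Longrightarrow> rot (rot x) = - x"
  by (intro vec_2_eqI) auto

lemma rot_pair:
  assumes "x \<in> carrier_vec 2" "y \<in> carrier_vec 2"
  shows "rot x \<bullet> rot y = x \<bullet> y" "x \<bullet> rot y = - (rot x \<bullet> y)"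
  using assms by (simp_all add: scalar_prod_2)

lemma rot_int_lattice: "x \<in> int_lattice 2 \<Longrightarrow> rot x \<in> int_lattice 2"
  by (auto simp: int_lattice_2)

context primitive_plane
begin

abbreviation dual_edge :: "nat \<Rightarrow> rat vec" where "dual_edge i \<equiv> of_nat Q \<cdot>\<^sub>v w i"
abbreviation dual_coord :: "nat \<Rightarrow> rat vec" where "dual_coord i \<equiv> (1 / of_nat Q) \<cdot>\<^sub>v v i"

text \<open>Up to sign the dual edges are the rotated edges in exchanged order, so their determinant
  is again Q. The formula for a pointed cone thus applies to the dual cone with
  \<open>dual_coord\<close> as coordinates.\<close>

lemma dual_plane: "primitive_plane dual_edge dual_coord Q"
proof
  interpret D: rat_dual_basis 2 w v by (rule swap_rat)
  fix i j :: nat assume "i < 2" "j < 2"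
  then show "dual_coord i \<bullet> dual_edge j = (if i = j then 1 else 0)"
    using Q_pos D.pairing[of i j] by (simp add: D.coord_smult smult_scalar_prod_distrib[of _ 2])
next
  show "dual_edge 0 $ 0 * dual_edge 1 $ 1 - dual_edge 0 $ 1 * dual_edge 1 $ 0 = of_nat Q"
    unfolding dual_rot using det by (simp add: algebra_simps carrier_vecD[OF rot_carrier])
qed (use Q_pos dual_primitive in auto)

lemma box_iff: "b \<in> box c {0, 1} \<longleftrightarrow> b \<in> int_lattice 2 \<and> w 0 \<bullet> b \<in> half_unit c \<and> w 1 \<bullet> b \<in> half_unit c"
  unfolding box_def lessThan_2[symmetric] by (auto simp: less_2_cases_iff One_nat_def)

text \<open>The rotation matches the lattice points of the two boxes, except for the corner with
  coordinates (1, 1) of the first one and the origin in the second one.\<close>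

lemma box_duality:
  "(\<Sum>b\<in>box False {0, 1}. (w 0 \<bullet> b - 1/2) * (w 1 \<bullet> b - 1/2))
   + (\<Sum>b\<in>rat_dual_basis.box 2 dual_coord True {0, 1}. (dual_coord 0 \<bullet> b - 1/2) * (dual_coord 1 \<bullet> b - 1/2)) = 1/2"
proof -
  interpret D: primitive_plane dual_edge dual_coord Q by (rule dual_plane)
  define p where "p = v 0 + v 1"
  define S where "S = box False {0, 1} - {p}"
  define T where "T = D.box True {0, 1} - {0\<^sub>v 2}"
  have vi: "v 0 \<in> int_lattice 2" "v 1 \<in> int_lattice 2" using primitive_vecD(1)[OF prim] by auto
  have vc: "v i \<in> carrier_vec 2" "w i \<in> carrier_vec 2" if "i < 2" for i using that by auto
  have boxD: "b \<in> int_lattice 2" "b \<in> carrier_vec 2" "w 0 \<bullet> b \<in> half_unit False" "w 1 \<bullet> b \<in> half_unit False"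
    if "b \<in> box False {0, 1}" for b using that by (auto simp: box_iff int_lattice_def)
  have boxD': "b \<in> int_lattice 2" "b \<in> carrier_vec 2" "dual_coord 0 \<bullet> b \<in> half_unit True" "dual_coord 1 \<bullet> b \<in> half_unit True"
    if "b \<in> D.box True {0, 1}" for b using that unfolding D.box_iff by (auto simp: int_lattice_def)
  have wp: "w 0 \<bullet> p = 1" "w 1 \<bullet> p = 1" using pairing by (auto simp: p_def coord_add)
  have p: "p \<in> box False {0, 1}"
    using int_lattice_add[OF vi] wp by (simp add: box_iff half_unit_def p_def[symmetric])
  have z: "0\<^sub>v 2 \<in> D.box True {0, 1}"
    unfolding D.box_iff using D.w_carrier[of 0] D.w_carrier[of 1] by (simp add: half_unit_def)
  have dc: "dual_coord 0 \<bullet> rot b = - (w 1 \<bullet> b)" "dual_coord 1 \<bullet> rot b = w 0 \<bullet> b" if b: "b \<in> carrier_vec 2" for b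
  proof -
    have 1: "dual_coord i \<bullet> rot b = (1 / of_nat Q) * - (rot (v i) \<bullet> b)" if "i < 2" for i
      using that b rot_pair(2)[OF vc(1)[OF that] b] vc(1)[OF that] by (simp add: smult_scalar_prod_distrib[of _ 2])
    have "rot (v 0) \<bullet> b = of_nat Q * (w 1 \<bullet> b)" using arg_cong[OF dual_rot(2), of "\<lambda>x. x \<bullet> b"] b by simp
    moreover have "rot (v 1) \<bullet> b = - (of_nat Q * (w 0 \<bullet> b))"
      using arg_cong[OF dual_rot(1), of "\<lambda>x. x \<bullet> b"] b by (simp add: neg_scalar_prod[of _ 2])
    ultimately show "dual_coord 0 \<bullet> rot b = - (w 1 \<bullet> b)" "dual_coord 1 \<bullet> rot b = w 0 \<bullet> b"
      using 1[of 0] 1[of 1] Q_pos by simp_all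
  qed
  \<comment> \<open>Rotation alone gives the coordinates - (w 1 . b) and w 0 . b; adding the first
    dual edge raises the first of them by 1 and brings it into [0, 1).\<close>
  define \<phi> where "\<phi> = (\<lambda>b. rot b + dual_edge 0)"
  define \<psi> where "\<psi> = (\<lambda>b. - rot (b - dual_edge 0))"
  have ec: "dual_edge 0 \<in> carrier_vec 2" "dual_edge 0 \<in> int_lattice 2" using D.v_carrier[of 0] primitive_vecD(1)[OF D.prim[of 0]] by auto
  have \<phi>: "dual_coord 0 \<bullet> \<phi> b = 1 - w 1 \<bullet> b" "dual_coord 1 \<bullet> \<phi> b = w 0 \<bullet> b" if b: "b \<in> carrier_vec 2" for b
    using dc[OF b] D.pairing[of 0 0] D.pairing[of 1 0] ec by (simp_all add: \<phi>_def D.coord_add del: scalar_prod_smult_left)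
  have inv: "\<psi> (\<phi> b) = b" "\<phi> (\<psi> b) = b" if "b \<in> carrier_vec 2" for b
    using that by (auto simp: \<phi>_def \<psi>_def carrier_vecD[OF rot_carrier] carrier_vecD[OF w_carrier[of 0]] intro!: vec_2_eqI)
  \<comment> \<open>A box point is determined by either coordinate, so only the corner p has a
    coordinate equal to 1. It is the only point that would be mapped outside the dual box.\<close>
  have one: "b = p" if "b \<in> box False {0, 1}" "i < 2" "w i \<bullet> b = 1" for b i
  proof (rule inj_onD[OF bij_betw_imp_inj_on[OF box_coord_bij[OF that(2), of False]] _ that(1) p])
    show "w i \<bullet> b = w i \<bullet> p" using that wp by (auto simp: less_2_cases_iff One_nat_def)
  qed
  have zero: "b = 0\<^sub>v 2" if "b \<in> D.box True {0, 1}" "i < 2" "dual_coord i \<bullet> b = 0" for b i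
  proof (rule inj_onD[OF bij_betw_imp_inj_on[OF D.box_coord_bij[OF that(2), of True]] _ that(1) z])
    show "dual_coord i \<bullet> b = dual_coord i \<bullet> 0\<^sub>v 2" using that D.w_carrier[OF that(2)] by simp
  qed
  have "(\<Sum>b\<in>S. (w 0 \<bullet> b - 1/2) * (w 1 \<bullet> b - 1/2)) = (\<Sum>b\<in>T. - ((dual_coord 0 \<bullet> b - 1/2) * (dual_coord 1 \<bullet> b - 1/2)))"
  proof (rule sum.reindex_bij_witness[of _ \<psi> \<phi>])
    fix b assume b: "b \<in> S"
    then have bb: "b \<in> box False {0, 1}" "b \<noteq> p" by (auto simp: S_def)
    show "\<psi> (\<phi> b) = b" using inv boxD(2)[OF bb(1)] by simp
    have "w 0 \<bullet> b \<noteq> 1" "w 1 \<bullet> b \<noteq> 1" using one[OF bb(1), of 0] one[OF bb(1), of 1] bb(2) by auto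
    then have c: "dual_coord 0 \<bullet> \<phi> b \<in> half_unit True" "dual_coord 1 \<bullet> \<phi> b \<in> half_unit True" "dual_coord 0 \<bullet> \<phi> b \<noteq> 0"
      using boxD(3,4)[OF bb(1)] unfolding \<phi>[OF boxD(2)[OF bb(1)]] by (auto simp: half_unit_def)
    have "\<phi> b \<in> int_lattice 2" unfolding \<phi>_def by (intro int_lattice_add rot_int_lattice boxD(1) bb ec)
    then have "\<phi> b \<in> D.box True {0, 1}" using c unfolding D.box_iff by simp
    moreover have "\<phi> b \<noteq> 0\<^sub>v 2" using c(3) D.w_carrier[of 0] by auto
    ultimately show "\<phi> b \<in> T" by (simp add: T_def)
    \<comment> \<open>Replacing a coordinate t by 1 - t negates t - 1/2, which accounts for the
      sign.\<close>
    show "- ((dual_coord 0 \<bullet> \<phi> b - 1/2) * (dual_coord 1 \<bullet> \<phi> b - 1/2)) = (w 0 \<bullet> b - 1/2) * (w 1 \<bullet> b - 1/2)"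
      unfolding \<phi>[OF boxD(2)[OF bb(1)]] by (simp add: algebra_simps)
  next
    fix b assume b: "b \<in> T"
    then have bb: "b \<in> D.box True {0, 1}" "b \<noteq> 0\<^sub>v 2" by (auto simp: T_def)
    show \<phi>\<psi>: "\<phi> (\<psi> b) = b" using inv boxD'(2)[OF bb(1)] by simp
    have \<psi>c: "\<psi> b \<in> carrier_vec 2" by (simp add: \<psi>_def)
    have nz: "dual_coord 0 \<bullet> b \<noteq> 0" "dual_coord 1 \<bullet> b \<noteq> 0" using zero[OF bb(1), of 0] zero[OF bb(1), of 1] bb(2) by auto
    have c: "dual_coord 0 \<bullet> b = 1 - w 1 \<bullet> \<psi> b" "dual_coord 1 \<bullet> b = w 0 \<bullet> \<psi> b" using \<phi>[OF \<psi>c] unfolding \<phi>\<psi> .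
    have "w 0 \<bullet> \<psi> b \<in> half_unit False" "w 1 \<bullet> \<psi> b \<in> half_unit False" "w 1 \<bullet> \<psi> b \<noteq> 1"
      using boxD'(3,4)[OF bb(1)] nz unfolding c by (auto simp: half_unit_def)
    moreover have "\<psi> b \<in> int_lattice 2"
      using rot_int_lattice[OF int_lattice_diff[OF boxD'(1)[OF bb(1)] ec(2)]] by (auto simp: \<psi>_def int_lattice_def carrier_vecD[OF rot_carrier])
    ultimately show "\<psi> b \<in> S" using wp(2) unfolding S_def by (auto simp: box_iff)
  qed
  \<comment> \<open>The corner contributes 1/2 times 1/2 here, and the origin contributes -1/2 times
    -1/2 to the dual sum; these two quarters are the right-hand side.\<close>
  moreover have "(\<Sum>b\<in>box False {0, 1}. (w 0 \<bullet> b - 1/2) * (w 1 \<bullet> b - 1/2))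
      = 1/4 + (\<Sum>b\<in>S. (w 0 \<bullet> b - 1/2) * (w 1 \<bullet> b - 1/2))"
    unfolding S_def by (subst sum.remove[OF box_finite p]) (simp add: wp)
  moreover have "(\<Sum>b\<in>D.box True {0, 1}. (dual_coord 0 \<bullet> b - 1/2) * (dual_coord 1 \<bullet> b - 1/2))
      = 1/4 + (\<Sum>b\<in>T. (dual_coord 0 \<bullet> b - 1/2) * (dual_coord 1 \<bullet> b - 1/2))"
    unfolding T_def using D.w_carrier[of 0] D.w_carrier[of 1] by (subst sum.remove[OF D.box_finite z]) simp
  ultimately show ?thesis by (simp add: sum_negf)
qed

end

subsection \<open>Complement maps in dimension at most two\<close>

lemma zero_subspace: "is_subspace n {0\<^sub>v n}"
proof -
  interpret V: vec_space "TYPE(rat)" n .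
  have "LinearCombinations.submodule class_ring {0\<^sub>v n} (module_vec TYPE(rat) n)"
    by (rule LinearCombinations.submodule.intro) (auto simp: module_vec_simps V.module_axioms)
  then show ?thesis unfolding VectorSpace.subspace_def using V.vectorspace_axioms by blast
qed

lemma carrier_subspace: "is_subspace n (carrier_vec n)"
proof -
  interpret V: vec_space "TYPE(rat)" n .
  have "LinearCombinations.submodule class_ring (carrier_vec n) (module_vec TYPE(rat) n)"
    by (rule LinearCombinations.submodule.intro) (auto simp: module_vec_simps V.module_axioms)
  then show ?thesis unfolding VectorSpace.subspace_def using V.vectorspace_axioms by blast
qed

lemma line_subspace:
  assumes x: "x \<in> carrier_vec n"
  shows "is_subspace n (line x)"
proof -
  interpret V: vec_space "TYPE(rat)" n .
  have z: "0\<^sub>v n \<in> line x" using x by (auto intro: exI[of _ 0])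
  have a: "y + z \<in> line x" if yz: "y \<in> line x" "z \<in> line x" for y z
  proof -
    obtain c d where "y = c \<cdot>\<^sub>v x" "z = d \<cdot>\<^sub>v x" using yz by blast
    then have "y + z = (c + d) \<cdot>\<^sub>v x" by (simp add: add_smult_distrib_vec)
    then show ?thesis by blast
  qed
  have s: "c \<cdot>\<^sub>v y \<in> line x" if y: "y \<in> line x" for c y
    using y by (auto simp: smult_smult_assoc)
  have "LinearCombinations.submodule class_ring (line x) (module_vec TYPE(rat) n)"
    using x z a s by (intro LinearCombinations.submodule.intro) (auto simp: module_vec_simps V.module_axioms)
  then show ?thesis unfolding VectorSpace.subspace_def using V.vectorspace_axioms by blast
qed

text \<open>Independence inside U is independence in the ambient space, so independent subsets of U
  have at most n elements and a maximal one exists. Span and independence of the basis are stated in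
  the ambient space, where dimension arguments are applied.\<close>

lemma subspace_basis:
  assumes U: "is_subspace n U"
  obtains B where "finite B" "B \<subseteq> U" "card B = sdim n U"
    "U = LinearCombinations.module.span class_ring (module_vec TYPE(rat) n) B"
    "\<not> module.lin_dep class_ring (module_vec TYPE(rat) n) B"
proof -
  interpret V: vec_space "TYPE(rat)" n .
  have sub: "LinearCombinations.submodule class_ring U (module_vec TYPE(rat) n)"
    using U by (simp add: VectorSpace.subspace_def)
  have Uc: "U \<subseteq> carrier_vec n" using LinearCombinations.submodule.subset[OF sub] by (simp add: module_vec_simps)
  interpret K: vectorspace class_ring "V.vs U" by (rule V.subspace_is_vs[OF U])
  note indep = V.span_li_not_depend(2)[OF _ sub] and span = V.span_li_not_depend(1)[OF _ sub]
  have small: "finite A \<and> card A \<le> n" if "A \<subseteq> U \<and> K.lin_indpt A" for A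
    using V.li_le_dim[OF V.fin_dim, of A] that indep[of A] Uc V.dim_is_n by auto
  obtain B where B: "finite B" "maximal B (\<lambda>S. S \<subseteq> U \<and> K.lin_indpt S)"
  proof -
    have "\<exists>A. finite A \<and> maximal A (\<lambda>S. S \<subseteq> U \<and> K.lin_indpt S)"
    proof (rule maximal_exists[where N = n and B = "{}"])
      show "\<And>A. A \<subseteq> U \<and> K.lin_indpt A \<Longrightarrow> finite A \<and> card A \<le> n" by (rule small)
      show "{} \<subseteq> U \<and> K.lin_indpt {}" by (auto simp: K.lin_dep_def)
    qed
    then show ?thesis using that by blast
  qed
  have "K.basis B" by (rule K.max_li_is_basis) (use B(2) in simp)
  then have BU: "B \<subseteq> U" "K.lin_indpt B" "K.span B = U" by (auto simp: K.basis_def)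
  have card: "card B = sdim n U" using K.dim_basis[OF B(1) \<open>K.basis B\<close>] by (simp add: sdim_def)
  show thesis by (rule that[OF B(1) BU(1) card]) (use BU indep[OF BU(1)] span[OF BU(1)] in simp_all)
qed

lemma sdim_zero: "sdim n {0\<^sub>v n} = 0"
proof -
  interpret V: vec_space "TYPE(rat)" n .
  interpret K: vectorspace class_ring "V.vs {0\<^sub>v n}" by (rule V.subspace_is_vs[OF zero_subspace])
  have "K.span {0\<^sub>v n} = {0\<^sub>v n}" using K.span_is_subset2[of "{0\<^sub>v n}"] K.in_own_span[of "{0\<^sub>v n}"] by auto
  then show ?thesis unfolding sdim_def using K.dim0I by (simp add: module_vec_simps)
qed

lemma sdim_carrier: "sdim n (carrier_vec n) = n"
proof -
  interpret V: vec_space "TYPE(rat)" n .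
  have "V.vs (carrier_vec n) = module_vec TYPE(rat) n" by (simp add: module_vec_def)
  then show ?thesis unfolding sdim_def by (simp only: V.dim_is_n)
qed

lemma span_singleton:
  assumes x: "x \<in> carrier_vec n"
  shows "LinearCombinations.module.span class_ring (module_vec TYPE(rat) n) {x} = line x"
proof -
  interpret V: vec_space "TYPE(rat)" n .
  have sub: "LinearCombinations.submodule class_ring (line x) (module_vec TYPE(rat) n)"
    using line_subspace[OF x] by (simp add: VectorSpace.subspace_def)
  have "x = 1 \<cdot>\<^sub>v x" by simp
  then have "x \<in> line x" by blast
  then have "V.span {x} \<subseteq> line x" using V.span_is_subset[OF _ sub] by simp
  moreover have cs: "c \<cdot>\<^sub>v x \<in> V.span {x}" for c
  proof -
    have "LinearCombinations.submodule class_ring (V.span {x}) (module_vec TYPE(rat) n)"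
      using V.span_is_submodule[of "{x}"] x by simp
    moreover have "x \<in> V.span {x}" using V.in_own_span[of "{x}"] x by simp
    ultimately show ?thesis
      using LinearCombinations.submodule.smult_closed[of class_ring "V.span {x}" "module_vec TYPE(rat) n" c x]
      by (simp add: module_vec_simps class_ring_simps)
  qed
  have "line x \<subseteq> V.span {x}" by (intro subsetI, elim CollectE exE conjE) (simp only: cs)
  ultimately show ?thesis by (rule equalityI)
qed

lemma sdim_line:
  assumes x: "x \<in> carrier_vec n" "x \<noteq> 0\<^sub>v n"
  shows "sdim n (line x) = 1"
proof -
  interpret V: vec_space "TYPE(rat)" n .
  have sub: "LinearCombinations.submodule class_ring (line x) (module_vec TYPE(rat) n)"
    using line_subspace[OF x(1)] by (simp add: VectorSpace.subspace_def)
  interpret K: vectorspace class_ring "V.vs (line x)" by (rule V.subspace_is_vs[OF line_subspace[OF x(1)]])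
  have "x = 1 \<cdot>\<^sub>v x" by simp
  then have xl: "x \<in> line x" by blast
  have "K.span {x} = line x" using V.span_li_not_depend(1)[OF _ sub, of "{x}"] xl span_singleton[OF x(1)] by simp
  then show ?thesis unfolding sdim_def using K.dim1I[of x] x(2) xl by (simp add: module_vec_simps)
qed

lemma sdim_0_imp_zero: "is_subspace n U \<Longrightarrow> sdim n U = 0 \<Longrightarrow> U = {0\<^sub>v n}"
proof -
  assume U: "is_subspace n U" "sdim n U = 0"
  interpret V: vec_space "TYPE(rat)" n .
  obtain B where "finite B" "card B = sdim n U" "U = V.span B" by (rule subspace_basis[OF U(1)])
  then show ?thesis using U(2) V.span_empty by simp
qed

lemma sdim_n_imp_carrier: "is_subspace n U \<Longrightarrow> sdim n U = n \<Longrightarrow> U = carrier_vec n"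
proof -
  assume U: "is_subspace n U" "sdim n U = n"
  interpret V: vec_space "TYPE(rat)" n .
  have Uc: "U \<subseteq> carrier_vec n"
    using U LinearCombinations.submodule.subset[of class_ring U "module_vec TYPE(rat) n"] by (simp add: VectorSpace.subspace_def module_vec_simps)
  obtain B where B: "finite B" "B \<subseteq> U" "card B = sdim n U" "U = V.span B" "V.lin_indpt B" by (rule subspace_basis[OF U(1)])
  have "V.basis B" using V.dim_li_is_basis[OF V.fin_dim B(1) _ B(5)] B(2,3) U(2) Uc V.dim_is_n by simp
  then show ?thesis using B(4) by (simp add: V.basis_def)
qed

lemma sdim_1_imp_line:
  assumes U: "is_subspace n U" "sdim n U = 1"
  obtains x where "x \<in> carrier_vec n" "x \<noteq> 0\<^sub>v n" "U = line x"
proof -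
  interpret V: vec_space "TYPE(rat)" n .
  have Uc: "U \<subseteq> carrier_vec n"
    using U LinearCombinations.submodule.subset[of class_ring U "module_vec TYPE(rat) n"] by (simp add: VectorSpace.subspace_def module_vec_simps)
  obtain B where B: "finite B" "B \<subseteq> U" "card B = sdim n U" "U = V.span B" "V.lin_indpt B" by (rule subspace_basis[OF U(1)])
  obtain x where x: "B = {x}" using B(3) U(2) by (auto simp: card_1_singleton_iff One_nat_def)
  have xc: "x \<in> carrier_vec n" using x B(2) Uc by blast
  have "U = line x" using B(4) span_singleton[OF xc] x by simp
  moreover have "(UNIV :: rat set) \<noteq> {0}" by (metis UNIV_I singletonD zero_neq_one)
  then have "x \<noteq> 0\<^sub>v n" using B(5) V.zero_nin_lin_indpt[of B] B(2) Uc x by auto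
  ultimately show thesis using that xc by blast
qed

section \<open>Lines and kernels of functionals in the plane\<close>

lemma kernel_rot:
  assumes "x \<in> carrier_vec 2" "x \<noteq> 0\<^sub>v 2"
  shows "kernel (rot x) = line x"
proof (intro equalityI subsetI)
  have nz: "x $ 0 \<noteq> 0 \<or> x $ 1 \<noteq> 0" using assms vec_2_eqI[of x "0\<^sub>v 2"] by auto
  fix y assume "y \<in> kernel (rot x)"
  then have y: "y \<in> carrier_vec 2" "x $ 0 * y $ 1 = x $ 1 * y $ 0" by (auto simp: kernel_def scalar_prod_2)
  define c where "c = (if x $ 0 \<noteq> 0 then y $ 0 / x $ 0 else y $ 1 / x $ 1)"
  have "y = c \<cdot>\<^sub>v x"
    using assms y nz by (intro vec_2_eqI) (auto simp: c_def field_simps)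
  then show "y \<in> line x" by blast
next
  fix y assume "y \<in> line x"
  then show "y \<in> kernel (rot x)" using assms(1) by (auto simp: kernel_def scalar_prod_2)
qed

lemma kernel_minus: "u \<in> carrier_vec 2 \<Longrightarrow> kernel (- u) = kernel u"
  by (auto simp: kernel_def neg_scalar_prod[of _ 2])

lemma kernel_line:
  assumes "u \<in> carrier_vec 2" "u \<noteq> 0\<^sub>v 2"
  shows "kernel u = line (rot u)"
proof -
  have "kernel (rot (rot u)) = line (rot u)"
  proof (rule kernel_rot)
    show "rot u \<noteq> 0\<^sub>v 2"
    proof
      assume "rot u = 0\<^sub>v 2"
      then have "(rot u) $ 0 = 0" "(rot u) $ 1 = 0" by auto
      then show False using assms vec_2_eqI[of u "0\<^sub>v 2"] by auto
    qed
  qed simp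
  then show ?thesis using kernel_minus[OF assms(1)] rot_rot[OF assms(1)] by simp
qed

lemma direct_sum_kernel:
  assumes u: "u \<in> carrier_vec 2" and W: "W \<in> carrier_vec 2" and 1: "u \<bullet> W = 1"
  shows "direct_sum 2 (carrier_vec 2) (line W) (kernel u)"
  unfolding direct_sum_def
proof (intro conjI equalityI subsetI)
  fix x :: "rat vec" assume x: "x \<in> carrier_vec 2"
  have "x - (u \<bullet> x) \<cdot>\<^sub>v W \<in> kernel u"
    using assms x by (simp add: kernel_def scalar_prod_minus_distrib[of _ 2])
  moreover have "x = (u \<bullet> x) \<cdot>\<^sub>v W + (x - (u \<bullet> x) \<cdot>\<^sub>v W)" using x W by (intro vec_2_eqI) auto
  ultimately show "x \<in> {y + z |y z. y \<in> line W \<and> z \<in> kernel u}" by blast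
next
  fix x assume "x \<in> line W \<inter> kernel u"
  then obtain c where "x = c \<cdot>\<^sub>v W" "u \<bullet> x = 0" by (auto simp: kernel_def)
  then have "x = 0 \<cdot>\<^sub>v W" using assms by simp
  also have "\<dots> = 0\<^sub>v 2" using W by (intro eq_vecI) auto
  finally show "x \<in> {0\<^sub>v 2}" by simp
next
  fix x assume "x \<in> {0\<^sub>v 2 :: rat vec}"
  then show "x \<in> line W \<inter> kernel u" using W u by (auto simp: kernel_def intro!: exI[of _ 0])
qed (use W in \<open>auto simp: kernel_def\<close>)

text \<open>The rotation maps a line to its annihilator.\<close>

definition dual_complements :: "nat \<Rightarrow> complement_map \<Rightarrow> complement_map \<Rightarrow> bool" where
  "dual_complements n \<Psi> \<Psi>\<^sub>d \<longleftrightarrow>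
     \<Psi> {0\<^sub>v n} = Some (carrier_vec n) \<and> \<Psi>\<^sub>d {0\<^sub>v n} = Some (carrier_vec n) \<and> carrier_vec n \<in> dom \<Psi>\<^sub>d \<and>
     (n = 2 \<longrightarrow> (\<forall>W\<in>carrier_vec 2. W \<noteq> 0\<^sub>v 2 \<and> line W \<in> dom \<Psi> \<longrightarrow>
        (\<exists>u. line_complement \<Psi> W u \<and> line_complement \<Psi>\<^sub>d (rot W) (rot u))) \<and>
      (\<forall>W\<in>carrier_vec 2. W \<noteq> 0\<^sub>v 2 \<and> line W \<in> dom \<Psi>\<^sub>d \<longrightarrow> (\<exists>u. line_complement \<Psi>\<^sub>d W u)))"

section \<open>Complement maps of flags and their duals\<close>

lemma diff_2_1: "2 - 1 = (1::nat)"
  by simp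

lemma kernel_smult: "c \<noteq> 0 \<Longrightarrow> u \<in> carrier_vec 2 \<Longrightarrow> kernel (c \<cdot>\<^sub>v u) = kernel u"
  by (auto simp: kernel_def)

lemma line_self: "x \<in> line x"
  by (rule CollectI, rule exI[of _ 1]) simp

text \<open>The complement of a line in the plane is always L 1. Written as the kernel of a
  functional, it is complementary to the line through W only if the functional does not vanish at W,
  and then the functional can be normalized to 1 there.\<close>

lemma line_complement_flag:
  assumes W: "W \<in> carrier_vec 2" "W \<noteq> 0\<^sub>v 2" and L: "complete_flag 2 L" and dom: "line W \<in> dom (flag_map 2 L)"
  obtains u where "line_complement (flag_map 2 L) W u" "L 1 = kernel u"
proof -
  have "is_subspace 2 (L 1)" "sdim 2 (L 1) = 1" using L by (auto simp: complete_flag_def)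
  then obtain x where x: "x \<in> carrier_vec 2" "x \<noteq> 0\<^sub>v 2" "L 1 = line x" by (rule sdim_1_imp_line)
  define u0 where "u0 = rot x"
  have L1: "L 1 = kernel u0" using kernel_rot[OF x(1,2)] x(3) by (simp add: u0_def)
  have d: "sdim 2 (line W) = 1" using sdim_line[OF W] .
  have e: "2 - sdim 2 (line W) = 1" unfolding d by (rule diff_2_1)
  have val: "flag_map 2 L (line W) = Some (L 1)" and ds: "direct_sum 2 (carrier_vec 2) (line W) (L 1)"
  proof -
    have fm: "flag_map 2 L (line W) = (if is_subspace 2 (line W) \<and> direct_sum 2 (carrier_vec 2) (line W) (L 1) then Some (L 1) else None)"
      unfolding flag_map_def e ..
    show "flag_map 2 L (line W) = Some (L 1)" "direct_sum 2 (carrier_vec 2) (line W) (L 1)"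
      using dom unfolding fm domIff by (simp_all split: if_splits)
  qed
  have c: "u0 \<bullet> W \<noteq> 0"
  proof
    assume "u0 \<bullet> W = 0"
    then have "W \<in> L 1" using W(1) unfolding L1 kernel_def by simp
    with line_self have "W \<in> line W \<inter> L 1" by (rule IntI)
    moreover have "line W \<inter> L 1 = {0\<^sub>v 2}" using ds unfolding direct_sum_def by (rule conjunct2)
    ultimately have "W \<in> {0\<^sub>v 2}" by (simp only:)
    then show False using W(2) by simp
  qed
  define u where "u = (1 / (u0 \<bullet> W)) \<cdot>\<^sub>v u0"
  have uc: "u \<in> carrier_vec 2" by (simp add: u_def u0_def)
  have "kernel u = L 1" unfolding L1 u_def by (rule kernel_smult) (use c in \<open>auto simp: u0_def\<close>)
  then have "line_complement (flag_map 2 L) W u" "L 1 = kernel u"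
    unfolding line_complement_def val using c W uc by (auto simp: u_def u0_def)
  then show thesis by (rule that)
qed

lemma rot_nonzero: "x \<in> carrier_vec 2 \<Longrightarrow> x \<noteq> 0\<^sub>v 2 \<Longrightarrow> rot x \<noteq> 0\<^sub>v 2"
proof
  assume x: "x \<in> carrier_vec 2" "x \<noteq> 0\<^sub>v 2" "rot x = 0\<^sub>v 2"
  have "x $ 1 = 0" "x $ 0 = 0" using arg_cong[OF x(3), of "\<lambda>y. y $ 0"] arg_cong[OF x(3), of "\<lambda>y. y $ 1"] by auto
  then show False using x vec_2_eqI[of x "0\<^sub>v 2"] by auto
qed

lemma annihilator_zero: "annihilator n {0\<^sub>v n} = carrier_vec n"
  by (auto simp: annihilator_def)

lemma annihilator_carrier: "annihilator n (carrier_vec n) = {0\<^sub>v n}"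
proof (intro equalityI subsetI)
  fix x assume x: "x \<in> annihilator n (carrier_vec n)"
  then have "x $ i = 0" if "i < n" for i
  proof -
    have "x \<bullet> unit_vec n i = 0" using x unfolding annihilator_def by simp
    then show ?thesis using that by simp
  qed
  then show "x \<in> {0\<^sub>v n}" using x by (auto simp: annihilator_def)
qed (auto simp: annihilator_def)

lemma annihilator_line: "x \<in> carrier_vec 2 \<Longrightarrow> annihilator 2 (line x) = kernel x"
proof (intro equalityI subsetI)
  assume x: "x \<in> carrier_vec 2"
  { fix y assume y: "y \<in> annihilator 2 (line x)"
    then have "y \<bullet> x = 0" using line_self[of x] unfolding annihilator_def by blast
    then show "y \<in> kernel x" using y x comm_scalar_prod[of x 2 y] by (simp add: annihilator_def kernel_def) }
  { fix y assume "y \<in> kernel x"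
    then show "y \<in> annihilator 2 (line x)" using x comm_scalar_prod[of x 2 y] by (auto simp: annihilator_def kernel_def) }
qed

lemma direct_sum_trivial: "direct_sum n (carrier_vec n) {0\<^sub>v n} (carrier_vec n)" "direct_sum n (carrier_vec n) (carrier_vec n) {0\<^sub>v n}"
proof -
  have ex: "\<exists>w. x = 0\<^sub>v n + w \<and> w \<in> carrier_vec n" "\<exists>w. x = w + 0\<^sub>v n \<and> w \<in> carrier_vec n"
    if "x \<in> carrier_vec n" for x :: "rat vec" using that by (intro exI[of _ x]; simp)+
  show "direct_sum n (carrier_vec n) {0\<^sub>v n} (carrier_vec n)" "direct_sum n (carrier_vec n) (carrier_vec n) {0\<^sub>v n}"
    unfolding direct_sum_def by (auto intro: ex)
qed

lemma flag_map_trivial: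
  assumes "L 0 = {0\<^sub>v n}" "L n = carrier_vec n"
  shows "flag_map n L {0\<^sub>v n} = Some (carrier_vec n)" "carrier_vec n \<in> dom (flag_map n L)"
  using assms unfolding flag_map_def
  by (simp_all add: sdim_zero sdim_carrier zero_subspace carrier_subspace direct_sum_trivial dom_def)

text \<open>The kernel of u is spanned by rot u, so the annihilator of L 1 is the kernel of rot u.
  Rotation preserves the pairing, hence rot u is normalized at rot W.\<close>

lemma flag_dual_complements:
  assumes L: "complete_flag n L"
  shows "dual_complements n (flag_map n L) (flag_map n (dual_flag n L))"
proof -
  have L0: "L 0 = {0\<^sub>v n}" and Ln: "L n = carrier_vec n"
    using L sdim_0_imp_zero[of "L 0" n] sdim_n_imp_carrier[of "L n" n] by (auto simp: complete_flag_def)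
  have L': "dual_flag n L 0 = {0\<^sub>v n}" "dual_flag n L n = carrier_vec n"
    by (simp_all add: dual_flag_def L0 Ln annihilator_zero annihilator_carrier)
  have plane: "\<exists>u. line_complement (flag_map 2 L) W u \<and> line_complement (flag_map 2 (dual_flag 2 L)) (rot W) (rot u)"
    if L2: "complete_flag 2 L" and W: "W \<in> carrier_vec 2" "W \<noteq> 0\<^sub>v 2" "line W \<in> dom (flag_map 2 L)" for W
  proof -
    obtain u where u: "line_complement (flag_map 2 L) W u" "L 1 = kernel u" by (rule line_complement_flag[OF W(1,2) L2 W(3)])
    have uc: "u \<in> carrier_vec 2" "u \<bullet> W = 1" using u(1) by (auto simp: line_complement_def)
    have u0: "u \<noteq> 0\<^sub>v 2" using uc W by auto
    have "dual_flag 2 L 1 = kernel (rot u)"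
      unfolding dual_flag_def diff_2_1 u(2) kernel_line[OF uc(1) u0] by (rule annihilator_line) simp
    moreover have "2 - sdim 2 (line (rot W)) = 1"
      unfolding sdim_line[OF rot_carrier rot_nonzero[OF W(1,2)]] by (rule diff_2_1)
    moreover have r1: "rot u \<bullet> rot W = 1" using uc W rot_pair(1) by simp
    moreover have "direct_sum 2 (carrier_vec 2) (line (rot W)) (kernel (rot u))"
      by (rule direct_sum_kernel[OF _ _ r1]) auto
    ultimately have "flag_map 2 (dual_flag 2 L) (line (rot W)) = Some (kernel (rot u))"
      unfolding flag_map_def using line_subspace[OF rot_carrier, of W] by presburger
    then have "line_complement (flag_map 2 (dual_flag 2 L)) (rot W) (rot u)"
      unfolding line_complement_def using r1 by simp
    then show ?thesis using u(1) by blast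
  qed
  have dual: "complete_flag 2 (dual_flag 2 L)" if L2: "complete_flag 2 L" and n: "n = 2"
  proof -
    have "is_subspace 2 (L 1)" "sdim 2 (L 1) = 1" using L2 by (auto simp: complete_flag_def)
    then obtain x where x: "x \<in> carrier_vec 2" "x \<noteq> 0\<^sub>v 2" "L 1 = line x" by (rule sdim_1_imp_line)
    have "kernel x = line (rot x)" by (rule kernel_line[OF x(1,2)])
    then have 1: "dual_flag 2 L 1 = line (rot x)"
      unfolding dual_flag_def diff_2_1 x(3) using annihilator_line[OF x(1)] by simp
    have sub: "is_subspace 2 (dual_flag 2 L i) \<and> sdim 2 (dual_flag 2 L i) = i" if "i = 0 \<or> i = 1 \<or> i = 2" for i
      using that L' sdim_zero sdim_carrier sdim_line[OF rot_carrier rot_nonzero[OF x(1,2)]] line_subspace[OF rot_carrier, of x]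
        zero_subspace carrier_subspace unfolding n by (elim disjE) (simp_all only: 1)
    have "{0\<^sub>v 2} \<subseteq> line (rot x)" by (auto intro!: exI[of _ 0] eq_vecI simp: carrier_vecD[OF rot_carrier])
    moreover have "line (rot x) \<subseteq> carrier_vec 2" by auto
    ultimately have "dual_flag 2 L i \<subseteq> dual_flag 2 L (Suc i)" if "i = 0 \<or> i = 1" for i
      using that L' 1 unfolding n by (elim disjE) (simp_all add: One_nat_def[symmetric] numeral_2_eq_2[symmetric])
    then show ?thesis using sub unfolding complete_flag_def
      by (metis One_nat_def le_Suc_eq le_zero_eq less_2_cases numeral_2_eq_2)
  qed
  have "\<exists>u. line_complement (flag_map 2 (dual_flag 2 L)) W u"
    if L2: "complete_flag 2 L" "n = 2" and W: "W \<in> carrier_vec 2" "W \<noteq> 0\<^sub>v 2" "line W \<in> dom (flag_map 2 (dual_flag 2 L))" for W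
    by (rule line_complement_flag[OF W(1,2) dual[OF L2] W(3)]) blast
  then show ?thesis
    using plane L flag_map_trivial[OF L0 Ln] flag_map_trivial[OF L'] unfolding dual_complements_def by blast
qed

section \<open>Complement maps of inner products and their duals\<close>

lemma inner_productD:
  assumes "inner_product n Q"
  shows "x \<in> carrier_vec n \<Longrightarrow> y \<in> carrier_vec n \<Longrightarrow> Q x y = Q y x"
    and "x \<in> carrier_vec n \<Longrightarrow> y \<in> carrier_vec n \<Longrightarrow> z \<in> carrier_vec n \<Longrightarrow> Q (x + y) z = Q x z + Q y z"
    and "x \<in> carrier_vec n \<Longrightarrow> y \<in> carrier_vec n \<Longrightarrow> Q (c \<cdot>\<^sub>v x) y = c * Q x y"
    and "x \<in> carrier_vec n \<Longrightarrow> x \<noteq> 0\<^sub>v n \<Longrightarrow> 0 < Q x x"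
    and "x \<in> carrier_vec n \<Longrightarrow> y \<in> carrier_vec n \<Longrightarrow> z \<in> carrier_vec n \<Longrightarrow> Q z (x + y) = Q z x + Q z y"
    and "x \<in> carrier_vec n \<Longrightarrow> y \<in> carrier_vec n \<Longrightarrow> Q y (c \<cdot>\<^sub>v x) = c * Q y x"
    and "y \<in> carrier_vec n \<Longrightarrow> Q (0\<^sub>v n) y = 0"
proof -
  show *: "x \<in> carrier_vec n \<Longrightarrow> y \<in> carrier_vec n \<Longrightarrow> Q x y = Q y x"
    "x \<in> carrier_vec n \<Longrightarrow> y \<in> carrier_vec n \<Longrightarrow> z \<in> carrier_vec n \<Longrightarrow> Q (x + y) z = Q x z + Q y z"
    "x \<in> carrier_vec n \<Longrightarrow> y \<in> carrier_vec n \<Longrightarrow> Q (c \<cdot>\<^sub>v x) y = c * Q x y"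
    "x \<in> carrier_vec n \<Longrightarrow> x \<noteq> 0\<^sub>v n \<Longrightarrow> 0 < Q x x" for x y z c
    using assms unfolding inner_product_def by blast+
  show "x \<in> carrier_vec n \<Longrightarrow> y \<in> carrier_vec n \<Longrightarrow> z \<in> carrier_vec n \<Longrightarrow> Q z (x + y) = Q z x + Q z y"
    using *(1)[of z "x + y"] *(1)[of z x] *(1)[of z y] *(2)[of x y z] by simp
  show "x \<in> carrier_vec n \<Longrightarrow> y \<in> carrier_vec n \<Longrightarrow> Q y (c \<cdot>\<^sub>v x) = c * Q y x"
    using *(1)[of y "c \<cdot>\<^sub>v x"] *(1)[of y x] *(3)[of x y c] by simp
  have "0 \<cdot>\<^sub>v 0\<^sub>v n = (0\<^sub>v n :: rat vec)" by (intro eq_vecI) auto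
  then show "y \<in> carrier_vec n \<Longrightarrow> Q (0\<^sub>v n) y = 0" using *(3)[of "0\<^sub>v n" y 0] by simp
qed

lemma riesz_eqI:
  assumes Q: "inner_product n Q" and x: "x \<in> carrier_vec n" "\<And>y. y \<in> carrier_vec n \<Longrightarrow> Q x y = y \<bullet> v"
  shows "riesz n Q v = x"
  unfolding riesz_def
proof (rule the_equality)
  fix z assume z: "z \<in> carrier_vec n \<and> (\<forall>y\<in>carrier_vec n. Q z y = y \<bullet> v)"
  define d where "d = z + (- 1) \<cdot>\<^sub>v x"
  have dc: "d \<in> carrier_vec n" using z x by (simp add: d_def)
  have "Q d d = Q z d + (- 1) * Q x d"
    using inner_productD(2)[OF Q, of z "(- 1) \<cdot>\<^sub>v x" d] inner_productD(3)[OF Q, of x d "- 1"] z x dc by (simp add: d_def[symmetric])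
  also have "\<dots> = 0" using z x dc by simp
  finally have "d = 0\<^sub>v n" using inner_productD(4)[OF Q dc] by (metis less_irrefl)
  then have "d $ i = 0" if "i < n" for i using that by simp
  then show "z = x" using z x by (intro eq_vecI) (auto simp: d_def)
qed (use x in auto)

text \<open>The functional u is Q W divided by Q W W. The functional y . rot W vanishes at W, and so
  does Q (rot u), so the two are proportional; comparing them at rot u gives the factor t = 1 / Q
  (rot u) (rot u).\<close>

lemma inner_product_plane:
  assumes Q: "inner_product 2 Q" and W: "W \<in> carrier_vec 2" "W \<noteq> 0\<^sub>v 2"
  obtains u t where "u \<in> carrier_vec 2" "u \<bullet> W = 1" "\<And>y. y \<in> carrier_vec 2 \<Longrightarrow> Q W y = Q W W * (u \<bullet> y)" "t > 0"
    "\<And>y. y \<in> carrier_vec 2 \<Longrightarrow> Q (t \<cdot>\<^sub>v rot u) y = y \<bullet> rot W"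
proof -
  note D = inner_productD[OF Q]
  have pos: "Q W W > 0" by (rule D(4)[OF W])
  define u where "u = (1 / Q W W) \<cdot>\<^sub>v vec 2 (\<lambda>i. Q W (unit_vec 2 i))"
  have uc: "u \<in> carrier_vec 2" by (simp add: u_def)
  have Qu: "Q W y = Q W W * (u \<bullet> y)" if y: "y \<in> carrier_vec 2" for y
  proof -
    have "y = y $ 0 \<cdot>\<^sub>v unit_vec 2 0 + y $ 1 \<cdot>\<^sub>v unit_vec 2 1" using y by (intro vec_2_eqI) auto
    then have "Q W y = y $ 0 * Q W (unit_vec 2 0) + y $ 1 * Q W (unit_vec 2 1)" using D(5,6) W(1) by (metis smult_carrier_vec unit_vec_carrier)
    then show ?thesis using y pos by (simp add: u_def scalar_prod_2 field_simps)
  qed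
  have uW: "u \<bullet> W = 1" using Qu[OF W(1)] pos by simp
  then have u0: "u \<noteq> 0\<^sub>v 2" using W by auto
  have posr: "Q (rot u) (rot u) > 0" by (rule D(4)[OF rot_carrier rot_nonzero[OF uc u0]])
  define t where "t = 1 / Q (rot u) (rot u)"
  have "Q (t \<cdot>\<^sub>v rot u) y = y \<bullet> rot W" if y: "y \<in> carrier_vec 2" for y
  proof -
    have "y - (u \<bullet> y) \<cdot>\<^sub>v W \<in> kernel u" using y W uc uW by (simp add: kernel_def scalar_prod_minus_distrib[of _ 2])
    then obtain b where b: "y - (u \<bullet> y) \<cdot>\<^sub>v W = b \<cdot>\<^sub>v rot u" unfolding kernel_line[OF uc u0] by blast
    have "y = (u \<bullet> y) \<cdot>\<^sub>v W + (y - (u \<bullet> y) \<cdot>\<^sub>v W)" using y W by (intro vec_2_eqI) auto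
    then have ye: "y = (u \<bullet> y) \<cdot>\<^sub>v W + b \<cdot>\<^sub>v rot u" unfolding b .
    have perp: "u \<bullet> rot u = 0" "W \<bullet> rot W = 0" using uc W by (simp_all add: scalar_prod_2)
    have "Q (rot u) W = 0" using D(1)[of W "rot u"] Qu[OF rot_carrier, of u] perp W by simp
    then have "Q (rot u) y = b * Q (rot u) (rot u)"
      using D(5)[of "(u \<bullet> y) \<cdot>\<^sub>v W" "b \<cdot>\<^sub>v rot u" "rot u"] D(6)[of W "rot u" "u \<bullet> y"] D(6)[of "rot u" "rot u" b] W
      by (simp add: ye[symmetric])
    then have "Q (t \<cdot>\<^sub>v rot u) y = b" using D(3)[of "rot u" y t] y posr by (simp add: t_def)
    also have "b = b * (rot u \<bullet> rot W)" using rot_pair(1)[OF uc W(1)] uW by simp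
    also have "\<dots> = ((u \<bullet> y) \<cdot>\<^sub>v W + b \<cdot>\<^sub>v rot u) \<bullet> rot W"
      using perp W by (simp add: add_scalar_prod_distrib[of _ 2] smult_scalar_prod_distrib[of _ 2])
    finally show ?thesis by (simp add: ye[symmetric])
  qed
  then show thesis using that[of u t] uc uW Qu posr by (simp add: t_def)
qed

text \<open>In the plane v is the rotation of - rot v, so \<open>inner_product_plane\<close> yields
  a representative. On a line v itself is rescaled.\<close>

lemma riesz_exists:
  assumes n: "n \<le> 2" and Q: "inner_product n Q" and v: "v \<in> carrier_vec n"
  obtains x where "x \<in> carrier_vec n" "\<And>y. y \<in> carrier_vec n \<Longrightarrow> Q x y = y \<bullet> v"
proof -
  note D = inner_productD[OF Q]
  consider "v = 0\<^sub>v n" | "n = 1" "v \<noteq> 0\<^sub>v n" | "n = 2" "v \<noteq> 0\<^sub>v n"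
  proof -
    have "v = 0\<^sub>v n" if "n = 0" using v that by auto
    moreover have "n = 0 \<or> n = 1 \<or> n = 2" using n by linarith
    ultimately show ?thesis using that by blast
  qed
  then show thesis
  proof cases
    case 1
    then show thesis using that[of "0\<^sub>v n"] D(7) by simp
  next
    case 2
    have mult: "y = (y $ 0 / v $ 0) \<cdot>\<^sub>v v" if "y \<in> carrier_vec 1" for y
    proof -
      have "v $ 0 \<noteq> 0" using 2 v by (auto intro!: eq_vecI)
      then show ?thesis using that v 2 by (intro eq_vecI) auto
    qed
    have pos: "Q v v > 0" by (rule D(4)[OF v 2(2)])
    have ex: "Q (((v \<bullet> v) / Q v v) \<cdot>\<^sub>v v) y = y \<bullet> v" if y: "y \<in> carrier_vec n" for y
    proof -
      obtain c where c: "y = c \<cdot>\<^sub>v v" using mult[of y] y 2 by blast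
      show ?thesis using pos v by (simp add: c D(3,6) smult_scalar_prod_distrib[of _ n])
    qed
    show thesis by (rule that[OF _ ex]) (use v in auto)
  next
    case 3
    have "- rot v \<in> carrier_vec 2" "- rot v \<noteq> 0\<^sub>v 2" "rot (- rot v) = v"
    proof -
      show r: "rot (- rot v) = v" using v 3 by (intro vec_2_eqI) (auto simp: carrier_vecD[OF rot_carrier])
      show "- rot v \<noteq> 0\<^sub>v 2"
      proof
        assume "- rot v = 0\<^sub>v 2"
        then have "rot (0\<^sub>v 2) = v" using r by simp
        moreover have "rot (0\<^sub>v 2) = 0\<^sub>v 2" by (intro vec_2_eqI) auto
        ultimately show False using 3 by simp
      qed
    qed simp
    then obtain u t where "u \<in> carrier_vec 2" "\<And>y. y \<in> carrier_vec 2 \<Longrightarrow> Q (t \<cdot>\<^sub>v rot u) y = y \<bullet> v"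
      using inner_product_plane[of Q "- rot v"] Q 3(1) by metis
    then show thesis using that[of "t \<cdot>\<^sub>v rot u"] 3(1) by simp
  qed
qed

lemma dual_inner_product_riesz:
  assumes n: "n \<le> 2" and Q: "inner_product n Q" and v: "v \<in> carrier_vec n" and y: "y \<in> carrier_vec n"
  shows "riesz n Q v \<in> carrier_vec n" "dual_inner_product n Q v y = riesz n Q v \<bullet> y"
proof -
  obtain x where x: "x \<in> carrier_vec n" "\<And>z. z \<in> carrier_vec n \<Longrightarrow> Q x z = z \<bullet> v" by (rule riesz_exists[OF n Q v]) blast
  obtain x' where x': "x' \<in> carrier_vec n" "\<And>z. z \<in> carrier_vec n \<Longrightarrow> Q x' z = z \<bullet> y" by (rule riesz_exists[OF n Q y]) blast
  have r: "riesz n Q v = x" "riesz n Q y = x'" using riesz_eqI[OF Q] x x' by auto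
  show "riesz n Q v \<in> carrier_vec n" using r x by simp
  show "dual_inner_product n Q v y = riesz n Q v \<bullet> y"
    using inner_productD(1)[OF Q x(1) x'(1)] x'(2)[OF x(1)] by (simp add: dual_inner_product_def r)
qed

text \<open>The complement of W under Q is the kernel of the normalized functional u. The Riesz
  representative of rot W is a positive multiple of rot u, so being orthogonal to rot W under the
  dual product means pairing to 0 with rot u.\<close>

lemma orthogonal_dual_complements:
  assumes n: "n \<le> 2" and Q: "inner_product n Q"
  shows "dual_complements n (orthogonal_map n Q) (orthogonal_map n (dual_inner_product n Q))"
proof -
  note D = inner_productD[OF Q]
  have zp: "orthogonal_map n Q {0\<^sub>v n} = Some (carrier_vec n)"
    using zero_subspace[of n] D(7) by (auto simp: orthogonal_map_def)
  have "riesz n Q (0\<^sub>v n) = 0\<^sub>v n" using riesz_eqI[OF Q, of "0\<^sub>v n" "0\<^sub>v n"] D(7) by simp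
  then have zd: "orthogonal_map n (dual_inner_product n Q) {0\<^sub>v n} = Some (carrier_vec n)"
    using zero_subspace[of n] dual_inner_product_riesz[OF n Q zero_carrier_vec] by (auto simp: orthogonal_map_def)
  have dom: "carrier_vec n \<in> dom (orthogonal_map n (dual_inner_product n Q))"
    using carrier_subspace by (simp add: orthogonal_map_def dom_def)
  have plane: "\<exists>u. line_complement (orthogonal_map 2 Q) W u \<and> line_complement (orthogonal_map 2 (dual_inner_product 2 Q)) (rot W) (rot u)"
    if n2: "n = 2" and W: "W \<in> carrier_vec 2" "W \<noteq> 0\<^sub>v 2" for W
  proof -
    have Q2: "inner_product 2 Q" using Q n2 by simp
    note D = inner_productD[OF Q2]
    obtain u t where u: "u \<in> carrier_vec 2" "u \<bullet> W = 1" "\<And>y. y \<in> carrier_vec 2 \<Longrightarrow> Q W y = Q W W * (u \<bullet> y)"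
      and t: "t > 0" "\<And>y. y \<in> carrier_vec 2 \<Longrightarrow> Q (t \<cdot>\<^sub>v rot u) y = y \<bullet> rot W"
      by (rule inner_product_plane[OF Q2 W]) blast
    have "(\<forall>z\<in>line W. Q z y = 0) \<longleftrightarrow> u \<bullet> y = 0" if y: "y \<in> carrier_vec 2" for y
    proof -
      have "(\<forall>z\<in>line W. Q z y = 0) \<longleftrightarrow> Q W y = 0" using D(3)[OF W(1) y] line_self[of W] by force
      then show ?thesis using u(3)[OF y] D(4)[OF W] by simp
    qed
    then have "{y \<in> carrier_vec 2. \<forall>z\<in>line W. Q z y = 0} = kernel u" unfolding kernel_def by blast
    then have 1: "orthogonal_map 2 Q (line W) = Some (kernel u)"
      using line_subspace[OF W(1)] unfolding orthogonal_map_def by presburger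
    have rz: "riesz 2 Q (c \<cdot>\<^sub>v rot W) = (c * t) \<cdot>\<^sub>v rot u" for c
    proof (rule riesz_eqI[OF Q2])
      fix y :: "rat vec" assume y: "y \<in> carrier_vec 2"
      have "(c * t) \<cdot>\<^sub>v rot u = c \<cdot>\<^sub>v (t \<cdot>\<^sub>v rot u)" by (simp add: smult_smult_assoc)
      then show "Q ((c * t) \<cdot>\<^sub>v rot u) y = y \<bullet> (c \<cdot>\<^sub>v rot W)"
        using D(3)[of "t \<cdot>\<^sub>v rot u" y c] t(2)[OF y] y by (simp add: scalar_prod_smult_distrib[of _ 2])
    qed simp
    have "(\<forall>z\<in>line (rot W). dual_inner_product 2 Q z y = 0) \<longleftrightarrow> rot u \<bullet> y = 0" if y: "y \<in> carrier_vec 2" for y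
    proof -
      have "dual_inner_product 2 Q (c \<cdot>\<^sub>v rot W) y = c * t * (rot u \<bullet> y)" for c
        using dual_inner_product_riesz(2)[OF order_refl Q2 _ y, of "c \<cdot>\<^sub>v rot W"] y by (simp add: rz smult_scalar_prod_distrib[of _ 2])
      then have e: "(\<forall>z\<in>line (rot W). dual_inner_product 2 Q z y = 0) \<longleftrightarrow> (\<forall>c. c * t * (rot u \<bullet> y) = 0)" by auto
      show ?thesis unfolding e using t(1) by (auto dest: spec[of _ 1])
    qed
    then have "{y \<in> carrier_vec 2. \<forall>z\<in>line (rot W). dual_inner_product 2 Q z y = 0} = kernel (rot u)" unfolding kernel_def by blast
    then have 2: "orthogonal_map 2 (dual_inner_product 2 Q) (line (rot W)) = Some (kernel (rot u))"
      using line_subspace[OF rot_carrier, of W] unfolding orthogonal_map_def by presburger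
    have "rot u \<bullet> rot W = 1" using rot_pair(1)[OF u(1) W(1)] u(2) by simp
    then show ?thesis using 1 2 u(1,2) unfolding line_complement_def by (intro exI[of _ u]) simp
  qed
  have "\<exists>u. line_complement (orthogonal_map 2 (dual_inner_product 2 Q)) W u"
    if n2: "n = 2" and W: "W \<in> carrier_vec 2" "W \<noteq> 0\<^sub>v 2" for W
  proof -
    have r: "rot (- rot W) = W" using W by (intro vec_2_eqI) (auto simp: carrier_vecD[OF rot_carrier])
    have "- rot W \<noteq> 0\<^sub>v 2"
    proof
      assume "- rot W = 0\<^sub>v 2"
      then have "rot (0\<^sub>v 2) = W" using r by simp
      moreover have "rot (0\<^sub>v 2) = 0\<^sub>v 2" by (intro vec_2_eqI) auto
      ultimately show False using W by simp
    qed
    then show ?thesis using plane[OF n2, of "- rot W"] unfolding r by auto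
  qed
  then show ?thesis using zp zd dom plane unfolding dual_complements_def by blast
qed

subsection \<open>Rational cones in dimension at most two\<close>

lemma unit_dual_basis: "rat_dual_basis n (unit_vec n) (unit_vec n)"
  by unfold_locales auto

context rat_dual_basis
begin

text \<open>Steinitz exchange: the basis dual to the coordinates in which the j-th functional is
  replaced by f. The other basis vectors are corrected along \<open>v j\<close> so that f vanishes
  on them.\<close>

definition exchanged :: "nat \<Rightarrow> rat vec \<Rightarrow> nat \<Rightarrow> rat vec" where
  "exchanged j f i = (if i = j then (1 / (f \<bullet> v j)) \<cdot>\<^sub>v v j else v i - ((f \<bullet> v i) / (f \<bullet> v j)) \<cdot>\<^sub>v v j)"

lemma exchange:
  assumes f: "f \<in> carrier_vec n" and j: "j < n" "f \<bullet> v j \<noteq> 0"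
  shows "rat_dual_basis n (exchanged j f) (w(j := f))"
proof
  fix i k assume i: "i < n" and k: "k < n"
  have fm: "f \<bullet> (v k - c \<cdot>\<^sub>v v j) = f \<bullet> v k - c * (f \<bullet> v j)" for c
    using f j k by (simp add: scalar_prod_minus_distrib[of _ n] scalar_prod_smult_distrib[of _ n])
  have fs: "f \<bullet> (c \<cdot>\<^sub>v v j) = c * (f \<bullet> v j)" for c
    using f j by (simp add: scalar_prod_smult_distrib[of _ n])
  show "(w(j := f)) i \<bullet> exchanged j f k = (if i = k then 1 else 0)"
    using i k j fm fs by (auto simp: exchanged_def coord_minus coord_smult pairing)
qed (use f j in \<open>auto simp: exchanged_def\<close>)

lemma rescale:
  assumes "\<And>i. i < n \<Longrightarrow> c i > 0"
  shows "rat_dual_basis n (\<lambda>i. c i \<cdot>\<^sub>v v i) (\<lambda>i. (1 / c i) \<cdot>\<^sub>v w i)"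
    and "coord_cone n (\<lambda>i. (1 / c i) \<cdot>\<^sub>v w i) I J = coord_cone n w I J"
proof -
  have sm: "((1 / c i) \<cdot>\<^sub>v w i) \<bullet> x = (1 / c i) * (w i \<bullet> x)" if "i < n" "x \<in> carrier_vec n" for i x
    using that by (simp add: smult_scalar_prod_distrib[of _ n])
  show "rat_dual_basis n (\<lambda>i. c i \<cdot>\<^sub>v v i) (\<lambda>i. (1 / c i) \<cdot>\<^sub>v w i)"
  proof
    fix i j assume ij: "i < n" "j < n"
    show "((1 / c i) \<cdot>\<^sub>v w i) \<bullet> (c j \<cdot>\<^sub>v v j) = (if i = j then 1 else 0)"
      using ij sm[of i "c j \<cdot>\<^sub>v v j"] assms[of i] by (cases "i = j") (simp_all add: coord_smult pairing)
  qed auto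
  have eq: "((1 / c i) \<cdot>\<^sub>v w i) \<bullet> x = 0 \<longleftrightarrow> w i \<bullet> x = 0" "0 \<le> ((1 / c i) \<cdot>\<^sub>v w i) \<bullet> x \<longleftrightarrow> 0 \<le> w i \<bullet> x"
    if "i < n" "x \<in> carrier_vec n" for i x
    unfolding sm[OF that] using assms[OF that(1)] by (auto simp: zero_le_divide_iff)
  then show "coord_cone n (\<lambda>i. (1 / c i) \<cdot>\<^sub>v w i) I J = coord_cone n w I J"
    unfolding coord_cone_def by (intro Collect_cong conj_cong refl all_cong imp_cong) (simp_all only: eq)
qed

lemma primitive_rescale:
  obtains c where "\<And>i. i < n \<Longrightarrow> c i > 0" "\<And>i. i < n \<Longrightarrow> primitive_vec n (c i \<cdot>\<^sub>v v i)"
proof -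
  have "\<exists>c. i < n \<longrightarrow> c > 0 \<and> primitive_vec n (c \<cdot>\<^sub>v v i)" for i
  proof (cases "i < n")
    case True
    show ?thesis by (rule primitive_multiple[OF v_carrier[OF True] nonzero(1)[OF True]]) blast
  qed simp
  then have "\<forall>i. \<exists>c. i < n \<longrightarrow> c > 0 \<and> primitive_vec n (c \<cdot>\<^sub>v v i)" by blast
  from choice[OF this] obtain c where "\<forall>i. i < n \<longrightarrow> c i > 0 \<and> primitive_vec n (c i \<cdot>\<^sub>v v i)" by blast
  then show thesis using that by blast
qed

text \<open>If f is nonzero on a free direction, it becomes the coordinate of that direction, which
  is then no longer free. Otherwise f is determined on the cone by its values at the edges: if all
  are nonnegative, f is redundant, and if none is positive, it cuts out a face. Mixed signs require
  two edges, hence dimension 2 with J empty; there f replaces the coordinate of an edge where it is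
  positive, and the lost inequality follows from the other two.\<close>

lemma halfspace_cone:
  assumes n: "n \<le> 2" and f: "f \<in> carrier_vec n" and I: "J \<subseteq> I" "I \<subseteq> {..<n}"
  shows "\<exists>v' w' I' J'. rat_dual_basis n v' w' \<and> J' \<subseteq> I' \<and> I' \<subseteq> {..<n} \<and>
    {x \<in> coord_cone n w I J. 0 \<le> f \<bullet> x} = coord_cone n w' I' J'"
proof -
  have self: "rat_dual_basis n v w" by unfold_locales
  have fx: "f \<bullet> x = (\<Sum>i<n. (w i \<bullet> x) * (f \<bullet> v i))" if "x \<in> carrier_vec n" for x
    by (rule pair_expand[OF that f])
  consider j where "j \<in> J" "f \<bullet> v j \<noteq> 0"
    | "\<And>j. j \<in> J \<Longrightarrow> f \<bullet> v j = 0" "\<And>i. i \<in> I - J \<Longrightarrow> 0 \<le> f \<bullet> v i"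
    | "\<And>j. j \<in> J \<Longrightarrow> f \<bullet> v j = 0" "\<And>i. i \<in> I - J \<Longrightarrow> f \<bullet> v i \<le> 0"
    | i k where "i \<in> I - J" "k \<in> I - J" "f \<bullet> v i > 0" "f \<bullet> v k < 0"
    by (metis not_le)
  then show ?thesis
  proof cases
    case (1 j)
    have j: "j < n" "j \<in> I" using 1 I by auto
    have "{x \<in> coord_cone n w I J. 0 \<le> f \<bullet> x} = coord_cone n (w(j := f)) I (J - {j})"
      using 1 I j by (auto simp: coord_cone_def)
    moreover have "J - {j} \<subseteq> I" using I by blast
    ultimately show ?thesis using exchange[OF f j(1) 1(2)] I(2) by blast
  next
    case 2
    have "0 \<le> f \<bullet> x" if x: "x \<in> coord_cone n w I J" for x
    proof -
      have xc: "x \<in> carrier_vec n" using x by (simp add: coord_cone_def)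
      have "0 \<le> (w i \<bullet> x) * (f \<bullet> v i)" if i: "i \<in> {..<n}" for i
      proof -
        consider "i \<notin> I" | "i \<in> J" | "i \<in> I - J" by blast
        then show ?thesis by cases (use x i 2 in \<open>auto simp: coord_cone_def\<close>)
      qed
      then show ?thesis unfolding fx[OF xc] by (rule sum_nonneg)
    qed
    then have "{x \<in> coord_cone n w I J. 0 \<le> f \<bullet> x} = coord_cone n w I J" by blast
    then show ?thesis using self I by blast
  next
    case 3
    define I' where "I' = {i \<in> I. f \<bullet> v i = 0}"
    have I': "J \<subseteq> I'" "I' \<subseteq> I" using 3 I by (auto simp: I'_def)
    have term0: "(w i \<bullet> x) * (f \<bullet> v i) \<le> 0" if x: "x \<in> coord_cone n w I J" and i: "i \<in> {..<n}" for x i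
    proof -
      consider "i \<notin> I" | "i \<in> J" | "i \<in> I - J" by blast
      then show ?thesis by cases (use x i 3 in \<open>auto simp: coord_cone_def mult_nonneg_nonpos\<close>)
    qed
    have "{x \<in> coord_cone n w I J. 0 \<le> f \<bullet> x} = coord_cone n w I' J"
    proof (intro equalityI subsetI)
      fix x assume "x \<in> {x \<in> coord_cone n w I J. 0 \<le> f \<bullet> x}"
      then have x: "x \<in> coord_cone n w I J" "0 \<le> f \<bullet> x" by auto
      have xc: "x \<in> carrier_vec n" using x by (simp add: coord_cone_def)
      have "(\<Sum>i<n. (w i \<bullet> x) * (f \<bullet> v i)) \<le> 0" using term0[OF x(1)] by (rule sum_nonpos)
      then have "(\<Sum>i<n. (w i \<bullet> x) * (f \<bullet> v i)) = 0" using x(2) fx[OF xc] by simp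
      then have z: "(w i \<bullet> x) * (f \<bullet> v i) = 0" if "i < n" for i
        using sum_nonneg_eq_0_iff[of "{..<n}" "\<lambda>i. - ((w i \<bullet> x) * (f \<bullet> v i))"] term0[OF x(1)] that by (simp add: sum_negf)
      have "w i \<bullet> x = 0" if "i < n" "i \<notin> I'" for i
        using z[OF that(1)] that x(1) by (cases "i \<in> I") (auto simp: I'_def coord_cone_def)
      then show "x \<in> coord_cone n w I' J" using x(1) I' by (auto simp: coord_cone_def)
    next
      fix x assume x: "x \<in> coord_cone n w I' J"
      then have xc: "x \<in> carrier_vec n" by (simp add: coord_cone_def)
      have "(w i \<bullet> x) * (f \<bullet> v i) = 0" if "i \<in> {..<n}" for i
        using x that by (cases "i \<in> I'") (auto simp: I'_def coord_cone_def)
      then have "f \<bullet> x = 0" unfolding fx[OF xc] by (rule sum.neutral[OF ballI])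
      moreover have "x \<in> coord_cone n w I J"
        unfolding coord_cone_def
      proof (intro CollectI conjI allI impI)
        fix i assume "i < n"
        { assume "i \<notin> I" then show "w i \<bullet> x = 0" using x I' \<open>i < n\<close> by (auto simp: coord_cone_def) }
        { assume "i \<in> I - J" then show "0 \<le> w i \<bullet> x" using x \<open>i < n\<close> by (cases "i \<in> I'") (auto simp: coord_cone_def) }
      qed (rule xc)
      ultimately show "x \<in> {x \<in> coord_cone n w I J. 0 \<le> f \<bullet> x}" by simp
    qed
    then show ?thesis using self I I' by (metis order_trans)
  next
    case (4 i k)
    have ik: "i < n" "k < n" "i \<noteq> k" using 4 I by auto
    then have n2: "n = 2" using n by linarith
    have all: "l = i \<or> l = k" if "l < n" for l using that ik unfolding n2 by linarith
    have IJ: "I = {i, k}" "J = {}" using 4 I all by auto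
    have fik: "f \<bullet> x = (w i \<bullet> x) * (f \<bullet> v i) + (w k \<bullet> x) * (f \<bullet> v k)" if "x \<in> carrier_vec n" for x
    proof -
      have "{..<n} = {i, k}" using all ik by auto
      then show ?thesis unfolding fx[OF that] using ik(3) by simp
    qed
    have "{x \<in> coord_cone n w I J. 0 \<le> f \<bullet> x} = coord_cone n (w(i := f)) I J"
    proof (intro equalityI subsetI)
      fix x assume "x \<in> {x \<in> coord_cone n w I J. 0 \<le> f \<bullet> x}"
      then show "x \<in> coord_cone n (w(i := f)) I J" using ik unfolding IJ by (auto simp: coord_cone_def)
    next
      fix x assume "x \<in> coord_cone n (w(i := f)) I J"
      then have x: "x \<in> carrier_vec n" "0 \<le> f \<bullet> x" "0 \<le> w k \<bullet> x" using ik unfolding IJ by (auto simp: coord_cone_def)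
      have "(w k \<bullet> x) * (f \<bullet> v k) \<le> 0" using x(3) 4(4) by (simp add: mult_nonneg_nonpos)
      then have "0 \<le> (w i \<bullet> x) * (f \<bullet> v i)" using x(2) fik[OF x(1)] by linarith
      then have "0 \<le> w i \<bullet> x" using 4(3) by (simp add: zero_le_mult_iff)
      then show "x \<in> {x \<in> coord_cone n w I J. 0 \<le> f \<bullet> x}" using x all unfolding IJ coord_cone_def by auto
    qed
    moreover have "rat_dual_basis n (exchanged i f) (w(i := f))" by (rule exchange[OF f ik(1)]) (use 4 in simp)
    ultimately show ?thesis using I by blast
  qed
qed

end

text \<open>The inequalities are imposed one at a time, starting from the whole space with all
  coordinates free; in dimension at most 2 each of them keeps the cone in coordinate form, though in
  a new basis.\<close>

lemma polyhedral_cone_coord_cone: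
  assumes n: "n \<le> 2" and K: "polyhedral_cone n K"
  obtains v w I J where "rat_dual_basis n v w" "J \<subseteq> I" "I \<subseteq> {..<n}" "K = coord_cone n w I J"
proof -
  obtain k A where A: "A \<in> carrier_mat k n" "K = {x \<in> carrier_vec n. A *\<^sub>v x \<le> 0\<^sub>v k}"
    using K unfolding polyhedral_cone_def by blast
  have rows: "\<exists>v w I J. rat_dual_basis n v w \<and> J \<subseteq> I \<and> I \<subseteq> {..<n} \<and> {x \<in> carrier_vec n. \<forall>i<m. row A i \<bullet> x \<le> 0} = coord_cone n w I J"
    if "m \<le> k" for m using that
  proof (induction m)
    case 0
    show ?case using unit_dual_basis[of n] coord_space_full[of n "unit_vec n :: nat \<Rightarrow> rat vec"]
      by (intro exI[of _ "unit_vec n"] exI[of _ "{..<n}"]) simp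
  next
    case (Suc m)
    then obtain v w I J where IH: "rat_dual_basis n v w" "J \<subseteq> I" "I \<subseteq> {..<n}"
      "{x \<in> carrier_vec n. \<forall>i<m. row A i \<bullet> x \<le> 0} = coord_cone n w I J" by auto
    have r: "row A m \<in> carrier_vec n" using A Suc by auto
    have "{x \<in> carrier_vec n. \<forall>i<Suc m. row A i \<bullet> x \<le> 0} = {x \<in> coord_cone n w I J. 0 \<le> (- row A m) \<bullet> x}"
      unfolding IH(4)[symmetric] using neg_scalar_prod(1)[OF r] by (auto simp: less_Suc_eq)
    then show ?case using rat_dual_basis.halfspace_cone[OF IH(1) n _ IH(2,3), of "- row A m"] r by simp
  qed
  obtain v w I J where *: "rat_dual_basis n v w" "J \<subseteq> I" "I \<subseteq> {..<n}"
    "{x \<in> carrier_vec n. \<forall>i<k. row A i \<bullet> x \<le> 0} = coord_cone n w I J" using rows[OF order_refl] by auto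
  have "A *\<^sub>v x \<le> 0\<^sub>v k \<longleftrightarrow> (\<forall>i<k. row A i \<bullet> x \<le> 0)" for x
    using carrier_matD(1)[OF A(1)] by (simp add: less_eq_vec_def)
  then have "K = {x \<in> carrier_vec n. \<forall>i<k. row A i \<bullet> x \<le> 0}" unfolding A(2) by (simp only:)
  then have "K = coord_cone n w I J" using *(4) by (rule trans)
  then show thesis by (rule that[OF *(1-3)])
qed

lemma primitive_basis_swap: "rat_dual_basis 2 v w \<Longrightarrow> rat_dual_basis 2 (\<lambda>i. v (1 - i)) (\<lambda>i. w (1 - i))"
proof -
  assume "rat_dual_basis 2 v w"
  then interpret rat_dual_basis 2 v w .
  have "1 - i < 2" "1 - i = 1 - j \<longleftrightarrow> i = j" if "i < 2" "j < 2" for i j :: nat using that by auto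
  then show ?thesis by unfold_locales (auto simp: pairing)
qed

text \<open>The determinant of the edges is a nonzero integer, because the edges are integral and
  independent. Exchanging them makes it positive without changing the cone.\<close>

lemma pointed_plane_cone:
  assumes D: "rat_dual_basis 2 v w" and prim: "\<And>i. i < 2 \<Longrightarrow> primitive_vec 2 (v i)"
  shows "\<exists>v' w' Q. primitive_plane v' w' Q \<and> coord_cone 2 w' {0, 1} {} = coord_cone 2 w {0, 1} {}" (is ?thesis)
proof -
  have nz: "a 0 $ 0 * a 1 $ 1 - a 0 $ 1 * a 1 $ 0 \<noteq> 0" if ab: "rat_dual_basis 2 a b" for a b
  proof
    interpret D: rat_dual_basis 2 a b by fact
    interpret D': rat_dual_basis 2 b a by (rule D.swap_rat)
    assume "a 0 $ 0 * a 1 $ 1 - a 0 $ 1 * a 1 $ 0 = 0"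
    then have "a i \<bullet> rot (a 1) = 0" if "i < 2" for i
      using that D.v_carrier[of 0] D.v_carrier[of 1] by (auto simp: less_2_cases_iff One_nat_def[symmetric] scalar_prod_2 algebra_simps)
    then have "rot (a 1) = 0\<^sub>v 2" using D.v_carrier by (intro D'.coords_eqI) auto
    then show False using rot_nonzero[OF D.v_carrier D.nonzero(1)] by simp
  qed
  have pos: ?thesis if ab: "rat_dual_basis 2 a b" "\<And>i. i < 2 \<Longrightarrow> primitive_vec 2 (a i)"
    "a 0 $ 0 * a 1 $ 1 - a 0 $ 1 * a 1 $ 0 > 0" "coord_cone 2 b {0, 1} {} = coord_cone 2 w {0, 1} {}" for a b
  proof -
    have "a 0 $ 0 * a 1 $ 1 - a 0 $ 1 * a 1 $ 0 \<in> \<int>"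
      using primitive_vecD(1)[OF ab(2)[of 0]] primitive_vecD(1)[OF ab(2)[of 1]] by (auto simp: int_lattice_2)
    then obtain z :: int where z: "a 0 $ 0 * a 1 $ 1 - a 0 $ 1 * a 1 $ 0 = of_int z" by (auto elim: Ints_cases)
    have z0: "z > 0" using ab(3) unfolding z by simp
    have "primitive_plane a b (nat z)"
      using ab(1,2) z z0 by (simp add: primitive_plane_def primitive_plane_axioms_def)
    then show ?thesis using ab(4) by blast
  qed
  have sw: "coord_cone 2 (\<lambda>i. w (1 - i)) {0, 1} {} = coord_cone 2 w {0, 1} {}"
    unfolding lessThan_2[symmetric] by (auto simp: coord_cone_def less_2_cases_iff One_nat_def)
  show ?thesis
  proof (cases "v 0 $ 0 * v 1 $ 1 - v 0 $ 1 * v 1 $ 0 > 0")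
    case True
    then show ?thesis using pos[OF D prim] by simp
  next
    case False
    then have "v 1 $ 0 * v 0 $ 1 - v 1 $ 1 * v 0 $ 0 > 0" using nz[OF D] by (simp add: algebra_simps)
    then show ?thesis using pos[OF primitive_basis_swap[OF D] _ _ sw] prim by simp
  qed
qed

subsection \<open>The duality theorem\<close>

lemma kernel_perp_line:
  assumes "x \<in> carrier_vec 2" "x \<noteq> 0\<^sub>v 2" "y \<in> carrier_vec 2" "y \<noteq> 0\<^sub>v 2" "x \<bullet> y = 0"
  shows "line y = line (rot x)"
proof -
  have "y \<in> kernel x" using assms by (simp add: kernel_def)
  then obtain c where c: "y = c \<cdot>\<^sub>v rot x" unfolding kernel_line[OF assms(1,2)] by blast
  have "c \<noteq> 0"
  proof
    assume "c = 0"
    then have "y = 0\<^sub>v 2" unfolding c by (intro eq_vecI) (auto simp: carrier_vecD[OF rot_carrier])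
    then show False using assms(4) by simp
  qed
  then show ?thesis unfolding c by (rule line_smult)
qed

text \<open>Genericity of the dual cone asks that the spans of the faces of the original cone lie in
  the domain of \<open>\<Psi>\<^sub>d\<close>, whereas the hypothesis places the annihilators of
  these spans in the domain of \<Psi>. For lines in the plane a span is the rotation of its
  annihilator, to which \<open>dual_complements\<close> applies.\<close>

lemma dual_generic:
  assumes n: "n \<le> 2" and D: "rat_dual_basis n v w" and I: "J \<subseteq> I" "I \<subseteq> {..<n}"
    and dc: "dual_complements n \<Psi> \<Psi>\<^sub>d" and gen: "generic_cone n \<Psi> (coord_cone n w I J)"
  shows "generic_cone n \<Psi>\<^sub>d (coord_cone n v ({..<n} - J) ({..<n} - I))"
proof -
  interpret D: rat_dual_basis n v w by fact
  interpret D': rat_dual_basis n w v by (rule D.swap_rat)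
  have key: "coord_space n w I' \<in> dom \<Psi>\<^sub>d" if I': "J \<subseteq> I'" "I' \<subseteq> I" for I'
  proof -
    have dom: "coord_space n v ({..<n} - I') \<in> dom \<Psi>" using gen D.generic_coord_cone_iff[OF I] I' by blast
    consider "I' = {}" | "I' = {..<n}" | i where "n = 2" "i < 2" "I' = {i}"
    proof -
      consider "n = 0" | "n = 1" | "n = 2" using n by linarith
      then show ?thesis
      proof cases
        case 3
        then have "I' \<subseteq> {..<2}" using I I' by auto
        then show ?thesis using subset_lessThan_2[of I'] that(1,2) that(3)[of 0] that(3)[of 1] unfolding 3 lessThan_2 by auto
      qed (use I I' that(1,2) subset_lessThan_1[of I'] in auto)
    qed
    then show ?thesis
    proof cases
      case 1
      then show ?thesis using dc by (auto simp: D.coord_space_empty dual_complements_def)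
    next
      case 2
      then show ?thesis using dc by (simp add: coord_space_full dual_complements_def)
    next
      case (3 i)
      define j where "j = 1 - i"
      have "i \<noteq> j" unfolding j_def by presburger
      then have j: "j < n" "i < n" "i \<noteq> j" using 3 by (auto simp: j_def)
      have "{..<n} - I' = {j}" unfolding 3(1,3) lessThan_2 using 3(2) by (auto simp: j_def less_2_cases_iff One_nat_def[symmetric])
      then have line: "line (w j) \<in> dom \<Psi>" using dom D'.coord_space_singleton[OF j(1)] by simp
      have wj: "w j \<in> carrier_vec 2" "w j \<noteq> 0\<^sub>v 2" "v i \<in> carrier_vec 2" "v i \<noteq> 0\<^sub>v 2"
        using D.nonzero(2)[OF j(1)] D.nonzero(1)[OF j(2)] D.w_carrier[OF j(1)] D.v_carrier[OF j(2)] 3(1) by auto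
      have "w j \<bullet> v i = 0" using D.pairing[of j i] j by simp
      then have "line (v i) = line (rot (w j))" by (rule kernel_perp_line[OF wj])
      moreover have "line (rot (w j)) \<in> dom \<Psi>\<^sub>d"
        using dc 3(1) wj(1,2) line unfolding dual_complements_def line_complement_def by blast
      ultimately show ?thesis unfolding 3(3) D.coord_space_singleton[OF j(2)] by simp
    qed
  qed
  have "coord_space n w ({..<n} - I'') \<in> dom \<Psi>\<^sub>d" if "{..<n} - I \<subseteq> I''" "I'' \<subseteq> {..<n} - J" for I''
    by (rule key) (use that I in auto)
  then show ?thesis
    by (subst D'.generic_coord_cone_iff) (use I in auto)
qed

lemma plane_cone_duality:
  assumes P: "primitive_plane v w Q" and dc: "dual_complements 2 \<Psi> \<Psi>\<^sub>d"
    and gen: "generic_cone 2 \<Psi> (coord_cone 2 w {0, 1} {})"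
    and \<nu>: "IS0_interpolator 2 \<Psi> \<nu>" and \<mu>: "SI_interpolator 2 \<Psi>\<^sub>d \<mu>"
  shows "\<exists>a. has_value 2 (\<nu> (coord_cone 2 w {0, 1} {})) (0\<^sub>v 2) a \<and> has_value 2 (\<mu> (coord_cone 2 v {0, 1} {})) (0\<^sub>v 2) a"
proof -
  interpret P: primitive_plane v w Q by fact
  interpret D: primitive_plane P.dual_edge P.dual_coord Q by (rule P.dual_plane)
  interpret W: rat_dual_basis 2 w v by (rule P.swap_rat)
  have base: "rat_dual_basis 2 v w" by unfold_locales
  have c0: "\<Psi> {0\<^sub>v 2} = Some (carrier_vec 2)" "\<Psi>\<^sub>d {0\<^sub>v 2} = Some (carrier_vec 2)" using dc by (auto simp: dual_complements_def)
  have cone': "coord_cone 2 P.dual_coord {0, 1} {} = coord_cone 2 v {0, 1} {}"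
    using W.rescale(2)[of "\<lambda>_. of_nat Q"] P.Q_pos by simp
  have gen': "generic_cone 2 \<Psi>\<^sub>d (coord_cone 2 P.dual_coord {0, 1} {})"
    using dual_generic[OF _ base _ _ dc gen] unfolding cone' lessThan_2 by simp
  have ex: "\<exists>u. line_complement \<Psi> (P.dual_edge i) u \<and> line_complement \<Psi>\<^sub>d (rot (P.dual_edge i)) (rot u)" if i: "i < 2" for i
  proof -
    have Wi: "P.dual_edge i \<in> carrier_vec 2" "P.dual_edge i \<noteq> 0\<^sub>v 2" using i D.v_carrier[OF i] D.nonzero(1)[OF i] by auto
    have "coord_space 2 v ({0, 1} - {1 - i}) \<in> dom \<Psi>"
      using gen P.generic_coord_cone_iff[of "{}" "{0, 1}" \<Psi>] i unfolding lessThan_2 by (auto simp: less_2_cases_iff One_nat_def[symmetric])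
    moreover have "{0, 1} - {1 - i} = {i}" using i by (auto simp: less_2_cases_iff One_nat_def[symmetric])
    ultimately have "line (w i) \<in> dom \<Psi>" using W.coord_space_singleton[OF i] by simp
    then have "line (P.dual_edge i) \<in> dom \<Psi>" using line_smult[of "of_nat Q" "w i"] P.Q_pos by simp
    then show ?thesis using dc Wi unfolding dual_complements_def by blast
  qed
  obtain u0 where u0: "line_complement \<Psi> (P.dual_edge 0) u0" "line_complement \<Psi>\<^sub>d (rot (P.dual_edge 0)) (rot u0)"
    using ex[of 0] by auto
  obtain u1 where u1: "line_complement \<Psi> (P.dual_edge 1) u1" "line_complement \<Psi>\<^sub>d (rot (P.dual_edge 1)) (rot u1)"
    using ex[of 1] by auto
  have uc: "u0 \<in> carrier_vec 2" "u1 \<in> carrier_vec 2" using u0 u1 by (auto simp: line_complement_def)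
  have vc: "v 0 \<in> carrier_vec 2" "v 1 \<in> carrier_vec 2" by auto
  \<comment> \<open>The half-plane along edge i is defined by the other dual edge, so the indices
    are crossed: u 0 is normalized at dual edge 1.\<close>
  define u where "u = (\<lambda>i :: nat. if i = 0 then u1 else u0)"
  \<comment> \<open>Rotation sends dual edge 0 to v 1 but dual edge 1 to - v 0, hence the sign in
    the second case.\<close>
  define u' where "u' = (\<lambda>i :: nat. if i = 0 then rot u0 else - rot u1)"
  have edges: "rot (P.dual_edge 0) = v 1" "rot (P.dual_edge 1) = - v 0"
    unfolding P.dual_rot using vc by (auto intro!: vec_2_eqI simp: carrier_vecD[OF rot_carrier] carrier_vecD[OF vc(1)])
  have two: "i = 0 \<or> i = 1" if "i < 2" for i :: nat using that by auto
  have scale: "of_nat Q \<cdot>\<^sub>v P.dual_coord i = v i" for i using P.Q_pos by (simp add: smult_smult_assoc)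

  have \<nu>val: "has_value 2 (\<nu> (coord_cone 2 w {0, 1} {})) (0\<^sub>v 2)
     ((if False then 1 else - 1) * (\<Sum>b\<in>P.box False {0, 1}. (of_rat (w 0 \<bullet> b) - 1/2) * (of_rat (w 1 \<bullet> b) - 1/2))
      + (of_rat (w 0 \<bullet> u 0) + of_rat (w 1 \<bullet> u 1)) * deriv (rho False) 0 + (if False then 0 else 1/2))"
  proof (rule IS.plane_cone[OF P _ c0(1) gen])
    show "compatible_interpolator lattice_cone IS0_identity 2 \<Psi> \<nu>" using \<nu> by (simp add: IS0_interpolator_def)
    fix i :: nat assume i: "i < 2"
    show "u i \<in> carrier_vec 2" using uc by (simp add: u_def)
    show "u i \<bullet> P.dual_edge (1 - i) = 1" "\<Psi> (line (P.dual_edge (1 - i))) = Some {y \<in> carrier_vec 2. u i \<bullet> y = 0}"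
      using two[OF i] u0(1) u1(1) unfolding line_complement_def kernel_def u_def by auto
  qed
  have \<mu>val: "has_value 2 (\<mu> (coord_cone 2 P.dual_coord {0, 1} {})) (0\<^sub>v 2)
     ((if True then 1 else - 1) * (\<Sum>b\<in>D.box True {0, 1}. (of_rat (P.dual_coord 0 \<bullet> b) - 1/2) * (of_rat (P.dual_coord 1 \<bullet> b) - 1/2))
      + (of_rat (P.dual_coord 0 \<bullet> u' 0) + of_rat (P.dual_coord 1 \<bullet> u' 1)) * deriv (rho True) 0 + (if True then 0 else 1/2))"
  proof (rule SI.plane_cone[OF P.dual_plane _ c0(2) gen'])
    show "compatible_interpolator affine_cone SI_identity 2 \<Psi>\<^sub>d \<mu>" using \<mu> by (simp add: SI_interpolator_def)
    fix i :: nat assume i: "i < 2"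
    show "u' i \<in> carrier_vec 2" by (simp add: u'_def)
    have "line_complement \<Psi>\<^sub>d (v (1 - i)) (u' i)"
    proof (cases "i = 0")
      case True
      then show ?thesis using u0(2) unfolding edges u'_def by simp
    next
      case False
      have "line_complement \<Psi>\<^sub>d ((- 1) \<cdot>\<^sub>v (- v 0)) ((1 / - 1) \<cdot>\<^sub>v rot u1)"
        by (rule line_complement_smult) (use u1(2) vc in \<open>auto simp: edges\<close>)
      moreover have "(- 1) \<cdot>\<^sub>v (- v 0) = v 0" "(1 / - 1) \<cdot>\<^sub>v rot u1 = - rot u1" by (auto intro!: eq_vecI)
      moreover have "i = 1" using two[OF i] False by simp
      ultimately show ?thesis by (simp add: u'_def)
    qed
    then show "u' i \<bullet> (of_nat Q \<cdot>\<^sub>v P.dual_coord (1 - i)) = 1"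
      "\<Psi>\<^sub>d (line (of_nat Q \<cdot>\<^sub>v P.dual_coord (1 - i))) = Some {y \<in> carrier_vec 2. u' i \<bullet> y = 0}"
      unfolding scale line_complement_def kernel_def by auto
  qed
  \<comment> \<open>Moving the rotation across the pairing changes the sign, so the two complement
    maps contribute opposite amounts.\<close>
  have slope: "P.dual_coord 0 \<bullet> u' 0 + P.dual_coord 1 \<bullet> u' 1 = - (w 0 \<bullet> u 0 + w 1 \<bullet> u 1)"
  proof -
    have h1: "of_nat Q * (w 0 \<bullet> u1) = - (rot (v 1) \<bullet> u1)"
      using arg_cong[OF P.dual_rot(1), of "\<lambda>x. x \<bullet> u1"] uc by (simp add: neg_scalar_prod[of _ 2])
    have h2: "of_nat Q * (w 1 \<bullet> u0) = rot (v 0) \<bullet> u0"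
      using arg_cong[OF P.dual_rot(2), of "\<lambda>x. x \<bullet> u0"] uc by simp
    have h3: "of_nat Q * (P.dual_coord 0 \<bullet> rot u0) = - (rot (v 0) \<bullet> u0)"
      using rot_pair(2)[OF vc(1) uc(1)] vc P.Q_pos by (simp add: smult_scalar_prod_distrib[of _ 2])
    have h4: "of_nat Q * (P.dual_coord 1 \<bullet> (- rot u1)) = rot (v 1) \<bullet> u1"
      using rot_pair(2)[OF vc(2) uc(2)] vc P.Q_pos by (simp add: smult_scalar_prod_distrib[of _ 2] neg_scalar_prod[of _ 2])
    have "of_nat Q * ((P.dual_coord 0 \<bullet> rot u0 + P.dual_coord 1 \<bullet> (- rot u1)) + (w 0 \<bullet> u1 + w 1 \<bullet> u0)) = 0"
      unfolding distrib_left h1 h2 h3 h4 by simp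
    then have "(P.dual_coord 0 \<bullet> rot u0 + P.dual_coord 1 \<bullet> (- rot u1)) + (w 0 \<bullet> u1 + w 1 \<bullet> u0) = 0"
      using P.Q_pos by (simp only: mult_eq_0_iff of_nat_eq_0_iff) simp
    then show ?thesis unfolding u_def u'_def by (simp add: eq_neg_iff_add_eq_0)
  qed
  define A B where "A = (\<Sum>b\<in>P.box False {0, 1}. (w 0 \<bullet> b - 1/2) * (w 1 \<bullet> b - 1/2))"
    and "B = (\<Sum>b\<in>D.box True {0, 1}. (P.dual_coord 0 \<bullet> b - 1/2) * (P.dual_coord 1 \<bullet> b - 1/2))"
  have "A + B = 1/2" unfolding A_def B_def by (rule P.box_duality)
  \<comment> \<open>The 1/2 obtained from the two boxes is the constant 1/2 in the formula for
    \<nu>, which the formula for \<mu> does not have.\<close>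
  then have AB: "of_rat B = 1/2 - (of_rat A :: complex)" by (metis add_diff_cancel_left' of_rat_diff of_rat_divide of_rat_1 of_rat_numeral_eq)
  have cA: "(\<Sum>b\<in>P.box False {0, 1}. (of_rat (w 0 \<bullet> b) - 1/2) * (of_rat (w 1 \<bullet> b) - 1/2)) = (of_rat A :: complex)"
    "(\<Sum>b\<in>D.box True {0, 1}. (of_rat (P.dual_coord 0 \<bullet> b) - 1/2) * (of_rat (P.dual_coord 1 \<bullet> b) - 1/2)) = (of_rat B :: complex)"
    by (simp_all add: A_def B_def of_rat_sum of_rat_mult of_rat_diff of_rat_divide)
  have slope': "of_rat (P.dual_coord 0 \<bullet> u' 0) + of_rat (P.dual_coord 1 \<bullet> u' 1) = - (of_rat (w 0 \<bullet> u 0) + of_rat (w 1 \<bullet> u 1) :: complex)"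
    using arg_cong[OF slope, of "of_rat :: rat \<Rightarrow> complex"] by (simp only: of_rat_add of_rat_minus)
  show ?thesis
    using \<nu>val \<mu>val unfolding cA AB slope' deriv_rho cone' by (intro exI conjI) (simp_all add: algebra_simps)
qed

theorem theorem8:
  fixes n :: nat and K :: "rat vec set" and \<Psi> \<Psi>\<^sub>d :: complement_map and \<mu> \<nu> :: interpolator
  assumes "n \<le> 2"
    and "polyhedral_cone n K"
    and "(\<exists>Q. inner_product n Q \<and> \<Psi> = orthogonal_map n Q \<and>
              \<Psi>\<^sub>d = orthogonal_map n (dual_inner_product n Q)) \<or>
         (\<exists>L. complete_flag n L \<and> \<Psi> = flag_map n L \<and> \<Psi>\<^sub>d = flag_map n (dual_flag n L))"
    and "generic_cone n \<Psi> K"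
    and "IS0_interpolator n \<Psi> \<nu>"
    and "SI_interpolator n \<Psi>\<^sub>d \<mu>"
  shows "mero_analytic_at n (\<nu> K) (0\<^sub>v n) \<and>
         mero_analytic_at n (\<mu> (dual_cone n K)) (0\<^sub>v n) \<and>
         mero_value n (\<nu> K) (0\<^sub>v n) = mero_value n (\<mu> (dual_cone n K)) (0\<^sub>v n)"
proof -
  have dc: "dual_complements n \<Psi> \<Psi>\<^sub>d"
    using assms(3) orthogonal_dual_complements[OF assms(1)] flag_dual_complements by blast
  have c0: "\<Psi> {0\<^sub>v n} = Some (carrier_vec n)" "\<Psi>\<^sub>d {0\<^sub>v n} = Some (carrier_vec n)" using dc by (auto simp: dual_complements_def)
  have lines: "\<exists>u. line_complement \<Psi> W u" if "n = 2" "W \<in> carrier_vec 2" "W \<noteq> 0\<^sub>v 2" "line W \<in> dom \<Psi>" for W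
    using that dc unfolding dual_complements_def by blast
  have lines': "\<exists>u. line_complement \<Psi>\<^sub>d W u" if "n = 2" "W \<in> carrier_vec 2" "W \<noteq> 0\<^sub>v 2" "line W \<in> dom \<Psi>\<^sub>d" for W
    using that dc unfolding dual_complements_def by blast
  obtain v0 w0 I J where D0: "rat_dual_basis n v0 w0" and I: "J \<subseteq> I" "I \<subseteq> {..<n}" and K0: "K = coord_cone n w0 I J"
    by (rule polyhedral_cone_coord_cone[OF assms(1,2)])
  interpret D0: rat_dual_basis n v0 w0 by fact
  \<comment> \<open>Positive rescaling of a dual basis changes neither the cone nor its faces, and
    makes the edges primitive as the formulas for rays require.\<close>
  obtain c where c: "\<And>i. i < n \<Longrightarrow> c i > 0" "\<And>i. i < n \<Longrightarrow> primitive_vec n (c i \<cdot>\<^sub>v v0 i)" by (rule D0.primitive_rescale) blast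
  define v w where "v = (\<lambda>i. c i \<cdot>\<^sub>v v0 i)" and "w = (\<lambda>i. (1 / c i) \<cdot>\<^sub>v w0 i)"
  have D: "rat_dual_basis n v w" and K: "K = coord_cone n w I J"
    using D0.rescale[of c] c(1) unfolding v_def w_def K0 by auto
  have prim: "primitive_vec n (v i)" if "i < n" for i using c(2)[OF that] by (simp add: v_def)
  interpret D: rat_dual_basis n v w by fact
  have "\<exists>a. has_value n (\<nu> K) (0\<^sub>v n) a \<and> has_value n (\<mu> (dual_cone n K)) (0\<^sub>v n) a"
  proof (cases "n = 2 \<and> I = {0, 1} \<and> J = {}")
    case True
    then have D2: "rat_dual_basis 2 v w" and prim2: "\<And>i. i < 2 \<Longrightarrow> primitive_vec 2 (v i)" using D prim by auto
    obtain v' w' Q where P: "primitive_plane v' w' Q" "coord_cone 2 w' {0, 1} {} = coord_cone 2 w {0, 1} {}"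
      using pointed_plane_cone[OF D2 prim2] by blast
    interpret P: primitive_plane v' w' Q by fact
    have K': "K = coord_cone 2 w' {0, 1} {}" using K True P(2) by simp
    have "dual_cone 2 K = coord_cone 2 v' {0, 1} {}"
      unfolding K' using P.dual_coord_cone[of "{}" "{0, 1}"] unfolding lessThan_2 by simp
    then show ?thesis
      using plane_cone_duality[OF P(1), of \<Psi> \<Psi>\<^sub>d \<nu> \<mu>] dc assms(4-6) True K' by simp
  next
    case False
    interpret D': rat_dual_basis n w v by (rule D.swap_rat)
    define I' J' where "I' = {..<n} - J" and "J' = {..<n} - I"
    have I': "J' \<subseteq> I'" "I' \<subseteq> {..<n}" using I by (auto simp: I'_def J'_def)
    have gen: "generic_cone n \<Psi> (coord_cone n w I J)" using assms(4) K by simp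
    have gen': "generic_cone n \<Psi>\<^sub>d (coord_cone n v I' J')"
      unfolding I'_def J'_def by (rule dual_generic[OF assms(1) D I dc gen])
    \<comment> \<open>The edges of the dual cone are taken from the family w, which is rescaled on
      its own because primitivity of the \<open>v i\<close> does not pass to the
      \<open>w i\<close>.\<close>
    obtain d where d: "\<And>i. i < n \<Longrightarrow> d i > 0" "\<And>i. i < n \<Longrightarrow> primitive_vec n (d i \<cdot>\<^sub>v w i)" by (rule D'.primitive_rescale) blast
    have E: "rat_dual_basis n (\<lambda>i. d i \<cdot>\<^sub>v w i) (\<lambda>i. (1 / d i) \<cdot>\<^sub>v v i)"
      "coord_cone n (\<lambda>i. (1 / d i) \<cdot>\<^sub>v v i) I' J' = coord_cone n v I' J'"
      using D'.rescale[of d] d(1) by auto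
    \<comment> \<open>Complementing both index sets shows that the dual of a cone is pointed of
      dimension 2 only if the cone itself is.\<close>
    have excl: "\<not> (n = 2 \<and> I' = {0, 1} \<and> J' = {})" using False I unfolding I'_def J'_def by (auto simp: lessThan_2)
    have eq: "I' = J' \<longleftrightarrow> I = J" using I unfolding I'_def J'_def by blast
    have \<nu>: "has_value n (\<nu> (coord_cone n w I J)) (0\<^sub>v n) (if I = J then 1 else 1/2)"
      by (rule IS.low_dimensional_value[OF assms(1) D I prim _ c0(1) gen lines False])
         (use assms(5) in \<open>auto simp: IS0_interpolator_def\<close>)
    have "has_value n (\<mu> (coord_cone n (\<lambda>i. (1 / d i) \<cdot>\<^sub>v v i) I' J')) (0\<^sub>v n) (if I' = J' then 1 else 1/2)"
      by (rule SI.low_dimensional_value[OF assms(1) E(1) I' d(2) _ c0(2) _ lines' excl])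
         (use assms(6) gen' in \<open>auto simp: SI_interpolator_def E(2)\<close>)
    then have "has_value n (\<mu> (coord_cone n v I' J')) (0\<^sub>v n) (if I = J then 1 else 1/2)" unfolding E(2) eq .
    then have "has_value n (\<mu> (dual_cone n K)) (0\<^sub>v n) (if I = J then 1 else 1/2)"
      unfolding K D.dual_coord_cone[OF I] I'_def J'_def .
    then show ?thesis using \<nu> K by blast
  qed
  then obtain a where a: "has_value n (\<nu> K) (0\<^sub>v n) a" "has_value n (\<mu> (dual_cone n K)) (0\<^sub>v n) a" by blast
  then show ?thesis
    using mero_value_eq[OF a(1)] mero_value_eq[OF a(2)] by (auto simp: mero_analytic_at_def)
qed

end
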